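(* Assume that $(M,d,\mu,L)$ satisfies $(H)$ and that $(M,d,\mu)$ satisfies the volume doubling property: there is $C>0$ with $V(x,2r)\le C\,V(x,r)$ for all $x\in M$, $r>0$. Let $v:M\times\mathbb{R}_+\to\mathbb{R}_+$ satisfy $(A)$, $(D_v)$, $(RD_v)$, and $v\ge\epsilon V$ for some $\epsilon>0$. Then the upper bound $(DUE^v)$ is equivalent to the relative Faber-Krahn inequality $(FK^v)$.
   Context: $B(x,r)$ denotes the open ball of the metric $d$, and $V(x,r):=\mu(B(x,r))$, assumed finite and positive for all $x\in M,r>0$. $(H)$: $(M,d,\mu)$ is a locally compact, separable and complete metric space endowed with a Borel measure $\mu$ which is finite on compact sets and strictly positive on non-empty open sets; $L$ is a non-negative self-adjoint operator on $L^2(M,\mu)$ whose associated quadratic form $\mathcal{E}$, $\mathcal{E}(f)=\|L^{1/2}f\|_2^2$ with domain $\mathcal{F}$, is a strongly local and regular Dirichlet form, with energy measure $d\Gamma$ (so $\mathcal{E}(f,g)=\int_M d\Gamma(f,g)$ for $f,g\in\mathcal{F}$); and for every $x\in M$ the function $d_x(y):=d(x,y)$ belongs to $\mathcal{F}_{loc}$ (the functions that coincide locally with elements of $\mathcal F$) and satisfies $d\Gamma(d_x,d_x)\le d\mu$. Conditions on $v$ (write $v_r(x)=v(x,r)$): - $(A)$: $v(x,r)$ is measurable in $x$, a.e. finite and positive, and non-decreasing in $r$ for a.e. fixed $x$. - $(D_v)$: there is $C>0$ with $v(x,2r)\le C\,v(x,r)$ for all $r>0$ and $\mu$-a.e. $x$.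 - $(RD_v)$ (reverse doubling): there exist $\kappa'_v,c>0$ such that for any $r\ge s>0$ and $x,y\in M$ with $d(x,y)<r+s$, $c\left(\frac rs\right)^{\kappa'_v}\le \frac{v_r(y)}{v_s(x)}$. $(DUE^v)$: $(e^{-tL})_{t>0}$ has a measurable kernel $p_t$, and there exist $C,c>0$ such that $|p_t(x,y)|\le C\left(v(x,c\sqrt t)\,v(y,c\sqrt t)\right)^{-1/2}$ for all $t>0$ and $\mu$-a.e. $x,y\in M$. For an open set $\Omega\subset M$, $\mathcal{F}_c(\Omega)$ is the set of functions in $\mathcal{F}$ compactly supported in $\Omega$ and $\lambda_1(\Omega):=\inf\{\mathcal{E}(f)/\|f\|_2^2:\ f\in\mathcal{F}_c(\Omega),\ f\ne0\}$. $(FK^v)$: there exist $\alpha,c>0$ such that for any ball $B(x,r)\subset M$ and any (non-empty) relatively compact open set $\Omega\subset B(x,r)$, $\lambda_1(\Omega)\ge \dfrac{c}{r^2}\left(\dfrac{v_r(x)}{\mu(\Omega)}\right)^\alpha$. *)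

theory Defs
  imports "HOL-Analysis.Analysis"
begin

section \<open>The real space $L^2(\mu)$\<close>

text \<open>Elements of $L^2(\mu)$ are represented by functions; equality in $L^2(\mu)$ is equality
  almost everywhere.\<close>

definition L2 :: "'a measure \<Rightarrow> ('a \<Rightarrow> real) set" where
  "L2 \<mu> = {f \<in> borel_measurable \<mu>. integrable \<mu> (\<lambda>x. (f x)\<^sup>2)}"

definition l2_inner :: "'a measure \<Rightarrow> ('a \<Rightarrow> real) \<Rightarrow> ('a \<Rightarrow> real) \<Rightarrow> real" where
  "l2_inner \<mu> f g = (\<integral>x. f x * g x \<partial>\<mu>)"

definition l2_norm :: "'a measure \<Rightarrow> ('a \<Rightarrow> real) \<Rightarrow> real" where
  "l2_norm \<mu> f = sqrt (\<integral>x. (f x)\<^sup>2 \<partial>\<mu>)"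

definition l2_dense :: "'a measure \<Rightarrow> ('a \<Rightarrow> real) set \<Rightarrow> bool" where
  "l2_dense \<mu> D \<longleftrightarrow>
     D \<subseteq> L2 \<mu> \<and> (\<forall>f\<in>L2 \<mu>. \<forall>e>0. \<exists>g\<in>D. l2_norm \<mu> (\<lambda>x. f x - g x) < e)"


section \<open>Self-adjoint operators, square roots and generated semigroups\<close>

text \<open>An unbounded operator is given by its graph, a relation on $L^2(\mu)$. The adjoint of a densely
  defined relation is automatically linear, single-valued up to null sets and invariant under
  modification on null sets, so these properties need not be required of a self-adjoint
  operator.\<close>

definition l2_adjoint :: "'a measure \<Rightarrow> ('a \<Rightarrow> real) rel \<Rightarrow> ('a \<Rightarrow> real) rel" where
  "l2_adjoint \<mu> A =
     {(g, h). g \<in> L2 \<mu> \<and> h \<in> L2 \<mu> \<and> (\<forall>(f, k)\<in>A. l2_inner \<mu> k g = l2_inner \<mu> f h)}"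

definition self_adjoint :: "'a measure \<Rightarrow> ('a \<Rightarrow> real) rel \<Rightarrow> bool" where
  "self_adjoint \<mu> A \<longleftrightarrow> A \<subseteq> L2 \<mu> \<times> L2 \<mu> \<and> l2_dense \<mu> (Domain A) \<and> l2_adjoint \<mu> A = A"

definition nonneg_self_adjoint :: "'a measure \<Rightarrow> ('a \<Rightarrow> real) rel \<Rightarrow> bool" where
  "nonneg_self_adjoint \<mu> A \<longleftrightarrow> self_adjoint \<mu> A \<and> (\<forall>(f, g)\<in>A. 0 \<le> l2_inner \<mu> g f)"

definition op_sqrt :: "'a measure \<Rightarrow> ('a \<Rightarrow> real) rel \<Rightarrow> ('a \<Rightarrow> real) rel" where
  "op_sqrt \<mu> L = (THE S. nonneg_self_adjoint \<mu> S \<and> S O S = L)"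

definition op_app :: "('a \<Rightarrow> real) rel \<Rightarrow> ('a \<Rightarrow> real) \<Rightarrow> 'a \<Rightarrow> real" where
  "op_app A f = (SOME g. (f, g) \<in> A)"

definition C0_semigroup :: "'a measure \<Rightarrow> (real \<Rightarrow> ('a \<Rightarrow> real) \<Rightarrow> 'a \<Rightarrow> real) \<Rightarrow> bool" where
  "C0_semigroup \<mu> T \<longleftrightarrow>
     (\<forall>t\<ge>0. \<forall>f\<in>L2 \<mu>. T t f \<in> L2 \<mu>) \<and>
     (\<forall>t\<ge>0. \<forall>f\<in>L2 \<mu>. \<forall>g\<in>L2 \<mu>. \<forall>a b.
        AE x in \<mu>. T t (\<lambda>y. a * f y + b * g y) x = a * T t f x + b * T t g x) \<and>
     (\<forall>t\<ge>0. \<exists>K. \<forall>f\<in>L2 \<mu>. l2_norm \<mu> (T t f) \<le> K * l2_norm \<mu> f) \<and>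
     (\<forall>f\<in>L2 \<mu>. AE x in \<mu>. T 0 f x = f x) \<and>
     (\<forall>s\<ge>0. \<forall>t\<ge>0. \<forall>f\<in>L2 \<mu>. AE x in \<mu>. T (s + t) f x = T s (T t f) x) \<and>
     (\<forall>f\<in>L2 \<mu>. ((\<lambda>t. l2_norm \<mu> (\<lambda>x. T t f x - f x)) \<longlongrightarrow> 0) (at_right 0))"

definition generator ::
    "'a measure \<Rightarrow> (real \<Rightarrow> ('a \<Rightarrow> real) \<Rightarrow> 'a \<Rightarrow> real) \<Rightarrow> ('a \<Rightarrow> real) rel" where
  "generator \<mu> T =
     {(f, g). f \<in> L2 \<mu> \<and> g \<in> L2 \<mu> \<and>
        ((\<lambda>t. l2_norm \<mu> (\<lambda>x. (T t f x - f x) / t - g x)) \<longlongrightarrow> 0) (at_right 0)}"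

text \<open>\<open>heat_semigroup \<mu> L t\<close> is $e^{-tL}$, the semigroup generated by $-L$; it is unique up to the
  choice of representatives of its values.\<close>

definition heat_semigroup ::
    "'a measure \<Rightarrow> ('a \<Rightarrow> real) rel \<Rightarrow> real \<Rightarrow> ('a \<Rightarrow> real) \<Rightarrow> 'a \<Rightarrow> real" where
  "heat_semigroup \<mu> L =
     (SOME T. C0_semigroup \<mu> T \<and> generator \<mu> T = {(f, \<lambda>x. - g x) | f g. (f, g) \<in> L})"


section \<open>The quadratic form of an operator\<close>

definition form_dom :: "'a measure \<Rightarrow> ('a \<Rightarrow> real) rel \<Rightarrow> ('a \<Rightarrow> real) set" where
  "form_dom \<mu> L = Domain (op_sqrt \<mu> L)"

definition form ::
    "'a measure \<Rightarrow> ('a \<Rightarrow> real) rel \<Rightarrow> ('a \<Rightarrow> real) \<Rightarrow> ('a \<Rightarrow> real) \<Rightarrow> real" where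
  "form \<mu> L f g = l2_inner \<mu> (op_app (op_sqrt \<mu> L) f) (op_app (op_sqrt \<mu> L) g)"

definition quad_form :: "'a measure \<Rightarrow> ('a \<Rightarrow> real) rel \<Rightarrow> ('a \<Rightarrow> real) \<Rightarrow> real" where
  "quad_form \<mu> L f = (l2_norm \<mu> (op_app (op_sqrt \<mu> L) f))\<^sup>2"


section \<open>Dirichlet forms\<close>

text \<open>Here \<open>D\<close> is the domain of the form \<open>E\<close>.\<close>

definition form_norm2 ::
    "'a measure \<Rightarrow> (('a \<Rightarrow> real) \<Rightarrow> ('a \<Rightarrow> real) \<Rightarrow> real) \<Rightarrow> ('a \<Rightarrow> real) \<Rightarrow> real" where
  "form_norm2 \<mu> E f = E f f + (l2_norm \<mu> f)\<^sup>2"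

definition closed_symmetric_form ::
    "'a measure \<Rightarrow> ('a \<Rightarrow> real) set \<Rightarrow> (('a \<Rightarrow> real) \<Rightarrow> ('a \<Rightarrow> real) \<Rightarrow> real) \<Rightarrow> bool" where
  "closed_symmetric_form \<mu> D E \<longleftrightarrow>
     l2_dense \<mu> D \<and>
     (\<forall>f\<in>D. \<forall>g\<in>borel_measurable \<mu>. (AE x in \<mu>. f x = g x) \<longrightarrow> g \<in> D \<and> (\<forall>h\<in>D. E g h = E f h)) \<and>
     (\<forall>f\<in>D. \<forall>g\<in>D. \<forall>a b. (\<lambda>x. a * f x + b * g x) \<in> D \<and>
        (\<forall>h\<in>D. E (\<lambda>x. a * f x + b * g x) h = a * E f h + b * E g h)) \<and>
     (\<forall>f\<in>D. \<forall>g\<in>D. E f g = E g f) \<and>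
     (\<forall>f\<in>D. 0 \<le> E f f) \<and>
     (\<forall>u. (\<forall>n. u n \<in> D) \<and>
        (\<forall>e>0. \<exists>N. \<forall>m\<ge>N. \<forall>n\<ge>N. form_norm2 \<mu> E (\<lambda>x. u m x - u n x) < e) \<longrightarrow>
        (\<exists>f\<in>D. (\<lambda>n::nat. form_norm2 \<mu> E (\<lambda>x. u n x - f x)) \<longlonglongrightarrow> 0))"

definition dirichlet_form ::
    "'a measure \<Rightarrow> ('a \<Rightarrow> real) set \<Rightarrow> (('a \<Rightarrow> real) \<Rightarrow> ('a \<Rightarrow> real) \<Rightarrow> real) \<Rightarrow> bool" where
  "dirichlet_form \<mu> D E \<longleftrightarrow>
     closed_symmetric_form \<mu> D E \<and>
     (\<forall>f\<in>D. (\<lambda>x. min 1 (max 0 (f x))) \<in> D \<and>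
        E (\<lambda>x. min 1 (max 0 (f x))) (\<lambda>x. min 1 (max 0 (f x))) \<le> E f f)"

definition Cc :: "('a::topological_space \<Rightarrow> real) set" where
  "Cc = {\<phi>. continuous_on UNIV \<phi> \<and> compact (closure {x. \<phi> x \<noteq> 0})}"

definition regular_form ::
    "'a::topological_space measure \<Rightarrow> ('a \<Rightarrow> real) set \<Rightarrow>
     (('a \<Rightarrow> real) \<Rightarrow> ('a \<Rightarrow> real) \<Rightarrow> real) \<Rightarrow> bool" where
  "regular_form \<mu> D E \<longleftrightarrow>
     (\<forall>f\<in>D. \<forall>e>0. \<exists>\<phi>\<in>D \<inter> Cc. form_norm2 \<mu> E (\<lambda>x. f x - \<phi> x) < e) \<and>
     (\<forall>\<psi>\<in>Cc. \<forall>e>0. \<exists>\<phi>\<in>D \<inter> Cc. \<forall>x. \<bar>\<psi> x - \<phi> x\<bar> < e)"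

text \<open>The support of (the measure with density) \<open>f\<close>: the complement of the largest open set on which
  \<open>f\<close> vanishes almost everywhere.\<close>

definition ess_support :: "'a::topological_space measure \<Rightarrow> ('a \<Rightarrow> real) \<Rightarrow> 'a set" where
  "ess_support \<mu> f = - \<Union> {U. open U \<and> (AE x in \<mu>. x \<in> U \<longrightarrow> f x = 0)}"

definition strongly_local_form ::
    "'a::topological_space measure \<Rightarrow> ('a \<Rightarrow> real) set \<Rightarrow>
     (('a \<Rightarrow> real) \<Rightarrow> ('a \<Rightarrow> real) \<Rightarrow> real) \<Rightarrow> bool" where
  "strongly_local_form \<mu> D E \<longleftrightarrow>
     (\<forall>f\<in>D. \<forall>g\<in>D. compact (ess_support \<mu> f) \<and> compact (ess_support \<mu> g) \<and>
        (\<exists>U a. open U \<and> ess_support \<mu> f \<subseteq> U \<and> (AE x in \<mu>. x \<in> U \<longrightarrow> g x = a)) \<longrightarrow>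
        E f g = 0)"


section \<open>Energy measures\<close>

definition truncate :: "nat \<Rightarrow> ('a \<Rightarrow> real) \<Rightarrow> 'a \<Rightarrow> real" where
  "truncate n f x = max (- real n) (min (real n) (f x))"

text \<open>The energy measure $\Gamma(f,f)$ is determined for bounded \<open>f\<close> in the domain by
  $\int \varphi \, d\Gamma(f,f) = \mathcal{E}(\varphi f, f) - \frac{1}{2} \mathcal{E}(f^2, \varphi)$
  for all \<open>\<phi>\<close> in the domain that are continuous with compact support, and for general \<open>f\<close> by
  truncation. With this normalisation its total mass is $\mathcal{E}(f,f)$ when the form is strongly
  local.\<close>

definition energy_measure ::
    "'a::topological_space measure \<Rightarrow> ('a \<Rightarrow> real) set \<Rightarrow>
     (('a \<Rightarrow> real) \<Rightarrow> ('a \<Rightarrow> real) \<Rightarrow> real) \<Rightarrow> ('a \<Rightarrow> real) \<Rightarrow> 'a measure" where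
  "energy_measure \<mu> D E f =
     (THE \<Gamma>. sets \<Gamma> = sets borel \<and> finite_measure \<Gamma> \<and>
        (\<forall>\<phi>\<in>D \<inter> Cc.
           (\<lambda>n. E (\<lambda>x. \<phi> x * truncate n f x) (truncate n f)
                  - E (\<lambda>x. (truncate n f x)\<^sup>2) \<phi> / 2) \<longlonglongrightarrow> (\<integral>x. \<phi> x \<partial>\<Gamma>)))"

definition rel_compact_open :: "'a::topological_space set \<Rightarrow> bool" where
  "rel_compact_open U \<longleftrightarrow> open U \<and> compact (closure U)"

definition form_dom_loc ::
    "'a::topological_space measure \<Rightarrow> ('a \<Rightarrow> real) set \<Rightarrow> ('a \<Rightarrow> real) set" where
  "form_dom_loc \<mu> D =
     {u \<in> borel_measurable \<mu>.
        \<forall>U. rel_compact_open U \<longrightarrow> (\<exists>f\<in>D. AE x in \<mu>. x \<in> U \<longrightarrow> u x = f x)}"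

text \<open>The energy measure of a function that is only locally in the domain, obtained by patching.\<close>

definition energy_measure_loc ::
    "'a::topological_space measure \<Rightarrow> ('a \<Rightarrow> real) set \<Rightarrow>
     (('a \<Rightarrow> real) \<Rightarrow> ('a \<Rightarrow> real) \<Rightarrow> real) \<Rightarrow> ('a \<Rightarrow> real) \<Rightarrow> 'a measure" where
  "energy_measure_loc \<mu> D E u =
     (THE \<Gamma>. sets \<Gamma> = sets borel \<and>
        (\<forall>U. \<forall>f\<in>D. rel_compact_open U \<and> (AE x in \<mu>. x \<in> U \<longrightarrow> u x = f x) \<longrightarrow>
           (\<forall>A\<in>sets borel. A \<subseteq> U \<longrightarrow> emeasure \<Gamma> A = emeasure (energy_measure \<mu> D E f) A)))"


section \<open>The standing hypotheses on the space and the operator\<close>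

text \<open>The metric space is the whole type: completeness and separability are part of the class
  \<^class>\<open>polish_space\<close>, and the metric is \<^const>\<open>dist\<close>.\<close>

definition hypothesis_H :: "'a::polish_space measure \<Rightarrow> ('a \<Rightarrow> real) rel \<Rightarrow> bool" where
  "hypothesis_H \<mu> L \<longleftrightarrow>
     locally compact (UNIV :: 'a set) \<and>
     sets \<mu> = sets borel \<and>
     (\<forall>K. compact K \<longrightarrow> emeasure \<mu> K < \<infinity>) \<and>
     (\<forall>U. open U \<and> U \<noteq> {} \<longrightarrow> 0 < emeasure \<mu> U) \<and>
     nonneg_self_adjoint \<mu> L \<and>
     dirichlet_form \<mu> (form_dom \<mu> L) (form \<mu> L) \<and>
     strongly_local_form \<mu> (form_dom \<mu> L) (form \<mu> L) \<and>
     regular_form \<mu> (form_dom \<mu> L) (form \<mu> L) \<and>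
     (\<forall>x. dist x \<in> form_dom_loc \<mu> (form_dom \<mu> L) \<and>
        (\<forall>A\<in>sets \<mu>.
           emeasure (energy_measure_loc \<mu> (form_dom \<mu> L) (form \<mu> L) (dist x)) A \<le> emeasure \<mu> A))"

definition vol :: "'a::metric_space measure \<Rightarrow> 'a \<Rightarrow> real \<Rightarrow> real" where
  "vol \<mu> x r = measure \<mu> (ball x r)"

definition volume_doubling :: "'a::metric_space measure \<Rightarrow> bool" where
  "volume_doubling \<mu> \<longleftrightarrow> (\<exists>C>0. \<forall>x. \<forall>r>0. vol \<mu> x (2 * r) \<le> C * vol \<mu> x r)"


section \<open>Conditions on the function $v$\<close>

definition cond_A :: "'a measure \<Rightarrow> ('a \<Rightarrow> real \<Rightarrow> real) \<Rightarrow> bool" where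
  "cond_A \<mu> v \<longleftrightarrow>
     (\<forall>r>0. (\<lambda>x. v x r) \<in> borel_measurable \<mu>) \<and>
     (\<forall>r>0. AE x in \<mu>. 0 < v x r) \<and>
     (AE x in \<mu>. mono_on {0<..} (v x))"

definition cond_D :: "'a measure \<Rightarrow> ('a \<Rightarrow> real \<Rightarrow> real) \<Rightarrow> bool" where
  "cond_D \<mu> v \<longleftrightarrow> (\<exists>C>0. \<forall>r>0. AE x in \<mu>. v x (2 * r) \<le> C * v x r)"

definition cond_RD :: "('a::metric_space \<Rightarrow> real \<Rightarrow> real) \<Rightarrow> bool" where
  "cond_RD v \<longleftrightarrow>
     (\<exists>\<kappa>>0. \<exists>c>0. \<forall>r s x y. 0 < s \<and> s \<le> r \<and> dist x y < r + s \<longrightarrow>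
        c * (r / s) powr \<kappa> \<le> v y r / v x s)"


section \<open>Heat kernel upper bounds and relative Faber-Krahn inequalities\<close>

text \<open>Integrability is required explicitly because the Bochner integral of a non-integrable function
  is 0.\<close>

definition heat_kernel ::
    "'a measure \<Rightarrow> ('a \<Rightarrow> real) rel \<Rightarrow> (real \<Rightarrow> 'a \<Rightarrow> 'a \<Rightarrow> real) \<Rightarrow> bool" where
  "heat_kernel \<mu> L p \<longleftrightarrow>
     (\<forall>t>0. (\<lambda>(x, y). p t x y) \<in> borel_measurable (\<mu> \<Otimes>\<^sub>M \<mu>) \<and>
        (\<forall>f\<in>L2 \<mu>. AE x in \<mu>.
           integrable \<mu> (\<lambda>y. p t x y * f y) \<and>
           heat_semigroup \<mu> L t f x = (\<integral>y. p t x y * f y \<partial>\<mu>)))"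

definition DUE :: "'a measure \<Rightarrow> ('a \<Rightarrow> real) rel \<Rightarrow> ('a \<Rightarrow> real \<Rightarrow> real) \<Rightarrow> bool" where
  "DUE \<mu> L v \<longleftrightarrow>
     (\<exists>p. heat_kernel \<mu> L p \<and>
        (\<exists>C>0. \<exists>c>0. \<forall>t>0. AE x in \<mu>. AE y in \<mu>.
           \<bar>p t x y\<bar> \<le> C * (v x (c * sqrt t) * v y (c * sqrt t)) powr (- 1 / 2)))"

definition form_dom_c ::
    "'a::topological_space measure \<Rightarrow> ('a \<Rightarrow> real) rel \<Rightarrow> 'a set \<Rightarrow> ('a \<Rightarrow> real) set" where
  "form_dom_c \<mu> L U =
     {f \<in> form_dom \<mu> L. compact (ess_support \<mu> f) \<and> ess_support \<mu> f \<subseteq> U}"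

definition lambda1 :: "'a::topological_space measure \<Rightarrow> ('a \<Rightarrow> real) rel \<Rightarrow> 'a set \<Rightarrow> ereal" where
  "lambda1 \<mu> L U =
     (INF f\<in>{f \<in> form_dom_c \<mu> L U. \<not> (AE x in \<mu>. f x = 0)}.
        ereal (quad_form \<mu> L f / (l2_norm \<mu> f)\<^sup>2))"

definition FK ::
    "'a::metric_space measure \<Rightarrow> ('a \<Rightarrow> real) rel \<Rightarrow> ('a \<Rightarrow> real \<Rightarrow> real) \<Rightarrow> bool" where
  "FK \<mu> L v \<longleftrightarrow>
     (\<exists>\<alpha>>0. \<exists>c>0. \<forall>x. \<forall>r>0. \<forall>U. rel_compact_open U \<and> U \<noteq> {} \<and> U \<subseteq> ball x r \<longrightarrow>
        ereal (c / r\<^sup>2 * (v x r / measure \<mu> U) powr \<alpha>) \<le> lambda1 \<mu> L U)"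

end

(* A semigroup generated by L is unique, so it is the one given by the continuous functional calculus
 of the bounded operator 1/(1+L); this also identifies the form E with the limit of
 <f - P_t f, f>/t. The Markov property of P_t gives pointwise inequalities for its would-be kernel,
 from which the energy measure is recovered by the Riesz theorem, and strong locality shows that
 cutoffs of slope b built from the distance have energy measure at most b^2 mu.

 From Faber-Krahn to the heat kernel: Faber-Krahn on superlevel sets gives a Nash inequality with
 an additive term on each ball. Applied to cutoffs of P_t f, with the tails controlled by
 Caccioppoli inequalities for cutoffs of slope growing like 2^k, it gives differential inequalities
 for the L^2 norm, hence a local L^1 -> L^2 bound on P_t. By duality, P_(t/2) is represented at almost
 every x by a square integrable function, and the kernel is the sum of the products of their
 coordinates in an orthonormal basis.

 From the heat kernel to Faber-Krahn: |f|^2 - <P_t f, f> <= t E(f), and the kernel bound together with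
 Cauchy-Schwarz gives <P_t f, f> <= C mu(U) |f|^2 / v on functions supported in U. Doubling and
 reverse doubling let one choose t so that the right-hand side is at most |f|^2 / 2. *)

theory Submission
 imports Defs "HOL-Computational_Algebra.Polynomial"
begin

section \<open>Bounded functional calculus in a Hilbert space\<close>

text \<open>Statements about L reduce to scalar inequalities for continuous functions on [0,1],
  because \<open>A\<close> = 1/(1+L) has its form between 0 and 1: e^(-tL) becomes exp (-t (1/a -
  1)), which decays so fast at a = 0 that it absorbs the singular factors 1/a and 1/sqrt a. Before
  the kernel exists, integrals against it are estimated through finite sums of products a(x) b(y);
  the whole calculus of the form rests on these. The obstacle in the heat kernel bound is that the
  tail outside one cutoff is controlled only by the tail outside a narrower one, with a constant of
  order 4^k. The resulting infinite system closes because up to times of order 4^(-k) the integrated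
  coefficient is small, while at later times the power bound that is being proved suffices by
  itself. Time scales as r^2 and slopes as 2^k / r, so constants do not depend on r, and the decay
  exponent is q = 1 / \<alpha>. In the converse direction \<alpha> is log_D 4: halving a radius
  costs a doubling constant D and gains a factor 4.\<close>

lemma parallelogram_law:
 fixes x y :: "'h::real_inner"
 shows "(norm (x + y))^2 + (norm (x - y))^2 = 2 * (norm x)^2 + 2 * (norm y)^2"
 by (simp add: power2_norm_eq_inner inner_diff inner_add algebra_simps)

lemma inner_eq_zero_of_dense:
 fixes z :: "'h::real_inner"
 assumes "closure D = UNIV" "!!d. d \<in> D ==> inner d z = 0"
 shows "z = 0"
proof -
 have "closed {d. inner d z = 0}"
  by (intro closed_Collect_eq continuous_intros)
 moreover have "D \<subseteq> {d. inner d z = 0}" using assms by auto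
 ultimately have "closure D \<subseteq> {d. inner d z = 0}" by (simp add: closure_minimal)
 then have "inner z z = 0" using assms(1) by blast
 then show ?thesis by simp
qed

lemma quadratic_nonneg_imp_zero:
 fixes b c :: real
 assumes "!!s. 0 \<le> s^2 * c - 2 * s * b"
 shows "b = 0"
proof (rule ccontr)
 assume b: "b \<noteq> 0"
 \<comment> \<open>The minimiser of the quadratic after \<open>c\<close> is enlarged to |c| + 1, so
   that the division is safe.\<close>
 define s where "s = b / (\<bar>c\<bar> + 1)"
 have "s^2 * c - 2 * s * b \<le> s^2 * (\<bar>c\<bar> + 1) - 2 * s * b"
  by (simp add: mult_left_mono)
 also have "s^2 * (\<bar>c\<bar> + 1) = s * b"
  by (simp add: s_def power2_eq_square)
 also have "s * b - 2 * s * b = - (b^2 / (\<bar>c\<bar> + 1))"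
  by (simp add: s_def power2_eq_square)
 also have "\<dots> < 0"
  using b by (simp add: add_nonneg_pos)
 finally show False using assms[of s] by simp
qed

text \<open>A minimising sequence for the distance is Cauchy: by the parallelogram law the midpoint
  of two almost optimal points far apart would beat the infimum. Orthogonality is the first
  variation along each direction of \<open>V\<close>.\<close>

lemma hilbert_projection:
 fixes V :: "'h::{real_inner,banach} set"
 assumes clo: "closed V" and sub: "subspace V"
 obtains y where "y \<in> V" "!!v. v \<in> V ==> inner (x - y) v = 0"
proof -
 define d where "d = (INF v\<in>V. (norm (x - v))^2)"
 have ne: "V \<noteq> {}" using sub subspace_0 by auto
 have bdd: "bdd_below ((%v. (norm (x - v))^2) ` V)"
  by (rule bdd_belowI[of _ 0]) auto
 have dle: "d \<le> (norm (x - v))^2" if "v \<in> V" for v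
  unfolding d_def using that bdd by (rule cINF_lower[rotated])
 have "\<exists>v\<in>V. (norm (x - v))^2 < d + 1 / (real n + 1)" for n
  using cINF_less_iff[OF ne bdd, of "d + 1 / (real n + 1)"] by (simp add: d_def add_pos_nonneg)
 then obtain v where v: "!!n. v n \<in> V" "!!n. (norm (x - v n))^2 < d + 1 / (real n + 1)"
  by metis
 have diff: "(norm (v n - v m))^2 \<le> 2 / (real n + 1) + 2 / (real m + 1)" for n m
 proof -
  have mid: "(1/2) *\<^sub>R (v n + v m) \<in> V"
   using sub v by (simp add: subspace_add subspace_mul)
  have e1: "(x - v m) + (x - v n) = 2 *\<^sub>R (x - (1/2) *\<^sub>R (v n + v m))"
   by (simp add: algebra_simps scaleR_2)
  have e2: "(x - v m) - (x - v n) = v n - v m" by simp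
  have "4 * (norm (x - (1/2) *\<^sub>R (v n + v m)))^2 + (norm (v n - v m))^2
    = 2 * (norm (x - v m))^2 + 2 * (norm (x - v n))^2"
   using parallelogram_law[of "x - v m" "x - v n"] unfolding e1 e2
   by (simp add: power_mult_distrib)
  with dle[OF mid] v(2)[of n] v(2)[of m] show ?thesis by linarith
 qed
 have "Cauchy v"
 proof (rule metric_CauchyI)
  fix e :: real assume e: "0 < e"
  obtain N where N: "4 / e^2 < real N" using reals_Archimedean2 by blast
  show "\<exists>M. \<forall>m\<ge>M. \<forall>n\<ge>M. dist (v m) (v n) < e"
  proof (intro exI allI impI)
   fix m n assume mn: "N \<le> m" "N \<le> n"
   have e2: "0 < e^2" using e by simp
   then have "0 < real N" using N by (smt (verit) divide_pos_pos)
   have a: "2 / (real m + 1) \<le> 2 / (real N + 1)" "2 / (real n + 1) \<le> 2 / (real N + 1)"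
    using mn by (auto intro!: divide_left_mono)
   have "4 / (real N + 1) < e^2"
   proof -
    have "4 < real N * e^2" using N e2 by (simp add: field_simps)
    then have "4 < e^2 * (real N + 1)" 
    proof -
     have "e^2 * (real N + 1) = real N * e^2 + e^2" by (simp add: algebra_simps)
     then show ?thesis using e2 \<open>4 < real N * e^2\<close> by linarith
    qed
    then show ?thesis by (simp add: divide_less_eq)
   qed
   then have "(norm (v m - v n))^2 < e^2"
    using diff[of m n] a by linarith
   then show "dist (v m) (v n) < e"
    using e by (simp add: dist_norm power_less_imp_less_base)
  qed
 qed
 then obtain y where y: "v \<longlonglongrightarrow> y" by (auto simp: Cauchy_convergent_iff convergent_def)
 have yV: "y \<in> V" using clo y v(1) closed_sequentially by blast
 have "(%n. d + 1 / (real n + 1)) \<longlonglongrightarrow> d + 0"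
  by (intro tendsto_intros LIMSEQ_inverse_real_of_nat_add_minus_mult) (use LIMSEQ_inverse_real_of_nat in \<open>simp add: inverse_eq_divide add.commute\<close>)
 moreover have "(%n. (norm (x - v n))^2) \<longlonglongrightarrow> (norm (x - y))^2"
  using y by (intro tendsto_intros)
 ultimately have yd: "(norm (x - y))^2 \<le> d + 0"
  by (intro LIMSEQ_le) (use v(2) less_imp_le in blast)+
 have "inner (x - y) w = 0" if w: "w \<in> V" for w
 proof (rule quadratic_nonneg_imp_zero)
  fix s :: real
  have "y + s *\<^sub>R w \<in> V" using sub yV w by (simp add: subspace_add subspace_mul)
  then have "(norm (x - y))^2 \<le> (norm ((x - y) - s *\<^sub>R w))^2"
   using dle yd by (smt (verit) diff_diff_eq)
  then show "0 \<le> s^2 * (norm w)^2 - 2 * s * inner (x - y) w"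
   unfolding power2_norm_eq_inner by (simp add: inner_diff inner_add algebra_simps power2_eq_square inner_commute)
 qed
 with yV show thesis by (rule that)
qed

lemma closed_subspace_eq_UNIV:
 fixes V :: "'h::{real_inner,banach} set"
 assumes "closed V" "subspace V" "!!z. (!!v. v \<in> V ==> inner z v = 0) ==> z = 0"
 shows "V = UNIV"
proof -
 have "x \<in> V" for x
 proof -
  obtain y where y: "y \<in> V" "!!v. v \<in> V ==> inner (x - y) v = 0"
   using hilbert_projection[OF assms(1,2)] by metis
  then have "x - y = 0" using assms(3)[of "x - y"] by blast
  with y show "x \<in> V" by simp
 qed
 then show ?thesis by auto
qed

text \<open>A three-epsilon argument. The bound on \<open>T t\<close> is required only eventually
  along the filter; applied to functionals the lemma also yields weak convergence.\<close>

lemma tendsto_of_dense: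
 fixes T :: "'b => 'h::real_normed_vector => 'k::real_normed_vector"
 assumes lin: "!!t. linear (T t)" and lin0: "linear S"
  and bd: "eventually (%t. \<forall>x. norm (T t x) \<le> M * norm x) F" and bd0: "!!x. norm (S x) \<le> M * norm x"
  and dense: "closure D = UNIV" and conv: "!!x. x \<in> D ==> ((%t. T t x) \<longlongrightarrow> S x) F"
 shows "((%t. T t x) \<longlongrightarrow> S x) F"
proof (rule tendstoI)
 fix e :: real assume e: "0 < e"
 define K where "K = \<bar>M\<bar> + 1"
 have K: "K > 0" "M \<le> K" by (auto simp: K_def)
 have "x \<in> closure D" using dense by simp
 then obtain y where y: "y \<in> D" "dist y x < e / (3 * K)"
  using e K by (meson closure_approachable divide_pos_pos mult_pos_pos zero_less_numeral)
 have ev: "eventually (%t. dist (T t y) (S y) < e / 3) F"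
  using conv[OF y(1)] e by (auto dest!: tendstoD[where e="e/3"])
 show "eventually (%t. dist (T t x) (S x) < e) F"
  using ev bd
 proof eventually_elim
  case (elim t)
  have d: "norm (x - y) < e / (3 * K)" using y by (simp add: dist_norm norm_minus_commute)
  have b1: "norm (T t (x - y)) \<le> K * norm (x - y)"
   using elim(2) K(2) by (meson mult_right_mono norm_ge_zero order_trans)
  have b2: "norm (S (x - y)) \<le> K * norm (x - y)"
   using bd0 K(2) by (meson mult_right_mono norm_ge_zero order_trans)
  have b3: "K * norm (x - y) < e / 3"
   using d K by (simp add: field_simps)
  have eq: "T t x - S x = T t (x - y) + (T t y - S y) - S (x - y)"
   by (simp add: linear_diff[OF lin] linear_diff[OF lin0])
  have "norm (T t x - S x) \<le> norm (T t (x - y)) + norm (T t y - S y) + norm (S (x - y))"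
   unfolding eq by (meson norm_triangle_ineq norm_triangle_ineq4 order_trans add_right_mono)
  also have "\<dots> < e"
   using b1 b2 b3 elim(1) by (simp add: dist_norm)
  finally show ?case by (simp add: dist_norm)
 qed
qed

text \<open>The quotient of falling factorials k(k-1)...(k-m+1) / (n(n-1)...(n-m+1)): these are the
  Bernstein coefficients of x^m in degree n. For k < m a factor 0 occurs.\<close>

fun bcoeff :: "nat => nat => nat => real" where
 "bcoeff n 0 k = 1"
| "bcoeff n (Suc m) k = real k / real n * bcoeff (n - 1) m (k - 1)"

text \<open>One factor x at a time is taken out by the absorption identity (k+1) C(n+1,k+1) = (n+1)
  C(n,k).\<close>

lemma power_eq_sum_bcoeff:
 "m \<le> n ==> (\<Sum>k\<le>n. bcoeff n m k * real (n choose k) * x ^ k * (1 - x) ^ (n - k)) = (x::real) ^ m"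
proof (induction m arbitrary: n)
 case 0
 show ?case using binomial_ring[of x "1 - x" n] by (simp add: mult.assoc)
next
 case (Suc m)
 then obtain n' where n: "n = Suc n'" by (cases n) auto
 have *: "real (Suc k) / real (Suc n') * real (Suc n' choose Suc k) = real (n' choose k)" for k
 proof -
  have "real (Suc k) * real (Suc n' choose Suc k) = real (Suc n') * real (n' choose k)"
   using Suc_times_binomial_eq[of n' k] by (metis mult.commute of_nat_mult)
  then show ?thesis by (simp add: field_simps del: of_nat_Suc binomial_Suc_Suc)
 qed
 have "(\<Sum>k\<le>n. bcoeff n (Suc m) k * real (n choose k) * x ^ k * (1 - x) ^ (n - k))
   = (\<Sum>k\<le>n'. bcoeff n' m k * (real (Suc k) / real (Suc n') * real (Suc n' choose Suc k)) * x ^ Suc k * (1 - x) ^ (n' - k))"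
  unfolding n by (subst sum.atMost_Suc_shift) (simp add: mult_ac del: binomial_Suc_Suc)
 also have "\<dots> = x * (\<Sum>k\<le>n'. bcoeff n' m k * real (n' choose k) * x ^ k * (1 - x) ^ (n' - k))"
  unfolding * by (simp add: sum_distrib_left mult_ac)
 also have "\<dots> = x * x ^ m" using Suc n by simp
 finally show ?case by simp
qed

text \<open>Each factor (k-i)/(n-i) differs from k/n by O(1/n) uniformly in k, so the coefficients
  of x^m approach its values at the nodes k/n.\<close>

lemma bcoeff_tendsto:
 "e > 0 ==> \<exists>N. \<forall>n\<ge>N. \<forall>k\<le>n. \<bar>bcoeff n m k - (real k / real n) ^ m\<bar> < e"
proof (induction m arbitrary: e)
 case 0
 then show ?case by simp
next
 case (Suc m)
 obtain N where N: "!!n k. n \<ge> N ==> k \<le> n ==> \<bar>bcoeff n m k - (real k / real n) ^ m\<bar> < e / 2"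
  using Suc.IH[of "e/2"] Suc.prems by auto
 obtain N2 where N2: "2 * real m / e < real N2" using reals_Archimedean2 by blast
 show ?case
 proof (intro exI allI impI)
  fix n k assume n: "n \<ge> max (N + 1) (max N2 2)" and k: "k \<le> n"
  have n2: "n \<ge> 2" "real n > 1" using n by auto
  show "\<bar>bcoeff n (Suc m) k - (real k / real n) ^ Suc m\<bar> < e"
  proof (cases k)
   case 0 then show ?thesis using Suc.prems by simp
  next
   case (Suc j)
   define q where "q = real k / real n"
   define q' where "q' = real (k - 1) / real (n - 1)"
   have q: "0 \<le> q" "q \<le> 1" using k n2 by (auto simp: q_def)
   have q': "0 \<le> q'" "q' \<le> 1" using k n2 by (auto simp: q'_def)
   have r: "real (k - 1) = real k - 1" "real (n - 1) = real n - 1" using Suc n2 by auto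
   have "q - q' = (real n - real k) / (real n * (real n - 1))"
    using n2 unfolding q_def q'_def r by (simp add: field_simps)
   moreover have "(real n - real k) / (real n * (real n - 1)) \<le> 1 / real n"
   proof -
    have "real n - real k \<le> real n - 1" using Suc by simp
    then have "(real n - real k) / (real n * (real n - 1)) \<le> (real n - 1) / (real n * (real n - 1))"
     using n2 by (intro divide_right_mono) auto
    also have "\<dots> = 1 / real n" using n2 by simp
    finally show ?thesis .
   qed
   moreover have "0 \<le> (real n - real k) / (real n * (real n - 1))"
    using n2 k by auto
   ultimately have qq: "\<bar>q' - q\<bar> \<le> 1 / real n" by auto
   have "\<bar>q' ^ m - q ^ m\<bar> \<le> real m * \<bar>q' - q\<bar>"
    using norm_power_diff[of q' q m] q q' by simp
   also have "\<dots> \<le> real m / real n"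
    using mult_left_mono[OF qq, of "real m"] by simp
   also have "\<dots> < e / 2"
   proof -
    have "real N2 \<le> real n" using n by simp
    then have "2 * real m / e < real n" using N2 by linarith
    then show ?thesis using Suc.prems n2 by (simp add: field_simps)
   qed
   finally have a: "\<bar>q' ^ m - q ^ m\<bar> < e / 2" .
   have b: "\<bar>bcoeff (n - 1) m (k - 1) - q' ^ m\<bar> < e / 2"
    unfolding q'_def using n k by (intro N) auto
   have "bcoeff n (Suc m) k - (real k / real n) ^ Suc m
     = q * (bcoeff (n - 1) m (k - 1) - q ^ m)"
    by (simp add: q_def algebra_simps)
   then have "\<bar>bcoeff n (Suc m) k - (real k / real n) ^ Suc m\<bar> = q * \<bar>bcoeff (n - 1) m (k - 1) - q ^ m\<bar>"
    using q by (simp add: abs_mult)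
   also have "\<dots> \<le> 1 * \<bar>bcoeff (n - 1) m (k - 1) - q ^ m\<bar>"
    using q by (intro mult_right_mono) auto
   also have "\<dots> < e" using a b unfolding mult_1 by linarith
   finally show ?thesis .
  qed
 qed
qed

section \<open>Polynomials in a symmetric operator between 0 and 1\<close>

locale pos_contraction =
 fixes A :: "'h::{real_inner,banach} => 'h"
 assumes bounded_linear_A: "bounded_linear A"
  and sym_A: "inner (A x) y = inner x (A y)"
  and pos_A: "0 \<le> inner (A x) x"
  and le_A: "inner (A x) x \<le> inner x x"
begin

lemma linear_A: "linear A"
 using bounded_linear_A by (rule bounded_linear.linear)

lemmas A_simps = linear_add[OF linear_A] linear_diff[OF linear_A] linear_scale[OF linear_A] linear_0[OF linear_A]

definition opoly :: "real poly => 'h => 'h" where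
 "opoly p = fold_coeffs (%a f x. a *\<^sub>R x + A (f x)) p (%x. 0)"

lemma opoly_0 [simp]: "opoly 0 x = 0"
 by (simp add: opoly_def)

lemma opoly_pCons [simp]: "opoly (pCons a p) x = a *\<^sub>R x + A (opoly p x)"
 by (cases "p = 0 \<and> a = 0") (auto simp: opoly_def A_simps)

lemma opoly_add: "opoly (p + q) x = opoly p x + opoly q x"
 by (induction p q rule: poly_induct2) (auto simp: A_simps algebra_simps)

lemma opoly_smult: "opoly (smult c p) x = c *\<^sub>R opoly p x"
 by (induction p) (auto simp: A_simps algebra_simps)

lemma opoly_diff: "opoly (p - q) x = opoly p x - opoly q x"
 using opoly_add[of "p - q" q x] by simp

lemma opoly_sum: "opoly (\<Sum>i\<in>I. p i) x = (\<Sum>i\<in>I. opoly (p i) x)"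
 by (induction I rule: infinite_finite_induct) (auto simp: opoly_add)

lemma linear_opoly: "linear (opoly p)"
proof (induction p)
 case 0
 show ?case by (rule linearI) auto
next
 case (pCons a p)
 show ?case
  by (rule linearI) (auto simp: A_simps linear_add[OF pCons.IH] linear_scale[OF pCons.IH] algebra_simps)
qed

lemma opoly_mult: "opoly (p * q) x = opoly p (opoly q x)"
 by (induction p) (auto simp: opoly_add opoly_smult)

lemma opoly_1 [simp]: "opoly 1 x = x"
 by (simp add: one_pCons A_simps)

lemma opoly_commute_with:
 assumes "linear T" "!!x. T (A x) = A (T x)"
 shows "T (opoly p x) = opoly p (T x)"
 by (induction p) (auto simp: assms linear_0[OF assms(1)] linear_add[OF assms(1)] linear_scale[OF assms(1)])

lemma opoly_sym: "inner (opoly p x) y = inner x (opoly p y)"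
proof (induction p arbitrary: x y)
 case (pCons a p)
 have "A (opoly p y) = opoly p (A y)"
  by (rule opoly_commute_with) (auto simp: linear_A)
 then show ?case by (simp add: inner_add sym_A pCons)
qed auto

lemma opoly_sandwich: "inner (opoly (q * (r * r)) x) x = inner (opoly q (opoly r x)) (opoly r x)"
proof -
 have "q * (r * r) = r * (q * r)" by (simp add: ac_simps)
 then show ?thesis by (simp only: opoly_mult) (simp add: opoly_sym)
qed

text \<open>Sandwiching removes squares, so according to the parities of the exponents only 1, A,
  1-A and A(1-A) have to be treated.\<close>

lemma opoly_bernstein_nonneg: "0 \<le> inner (opoly ([:0, 1:] ^ k * [:1, -1:] ^ l) x) x"
proof -
 define a b where "a = [:0, 1::real:]" and "b = [:1, -1::real:]"
 have A: "0 \<le> inner (opoly a w) w" for w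
  using pos_A by (simp add: a_def A_simps)
 have B: "0 \<le> inner (opoly b w) w" for w
  using le_A[of w] by (simp add: b_def A_simps inner_diff_left inner_add linear_neg[OF linear_A])
 have AB: "0 \<le> inner (opoly (a * b) w) w" for w
 proof -
  \<comment> \<open>A(1-A) = (1-A) A (1-A) + A (1-A) A is a sum of two sandwiched nonnegative
    operators.\<close>
  have "a * b = a * (b * b) + b * (a * a)" by (simp add: a_def b_def)
  then have "inner (opoly (a * b) w) w
    = inner (opoly (a * (b * b)) w) w + inner (opoly (b * (a * a)) w) w"
   by (metis opoly_add inner_add_left)
  then show ?thesis using A B by (simp add: opoly_sandwich)
 qed
 obtain i where i: "k = 2 * i \<or> k = 2 * i + 1" by (metis oddE evenE)
 obtain j where j: "l = 2 * j \<or> l = 2 * j + 1" by (metis oddE evenE)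
 define r where "r = a ^ i * b ^ j"
 have "a ^ k * b ^ l = 1 * (r * r) \<or> a ^ k * b ^ l = a * (r * r) \<or> a ^ k * b ^ l = b * (r * r)
   \<or> a ^ k * b ^ l = (a * b) * (r * r)"
  using i j unfolding r_def by (elim disjE) (simp_all add: power_add power_mult power2_eq_square power_mult_distrib ac_simps)
 moreover have "0 \<le> inner (opoly (1 * (r * r)) x) x" "0 \<le> inner (opoly (a * (r * r)) x) x"
  "0 \<le> inner (opoly (b * (r * r)) x) x" "0 \<le> inner (opoly ((a * b) * (r * r)) x) x"
  by (simp_all only: opoly_sandwich A B AB opoly_1 inner_ge_zero)
 ultimately show ?thesis unfolding a_def b_def by metis
qed

text \<open>Expanding a polynomial in the Bernstein basis of large degree turns nonnegativity on
 \<open>[0,1]\<close> into almost nonnegative coefficients.\<close>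

lemma opoly_nonneg:
 assumes p: "!!a. 0 \<le> a ==> a \<le> 1 ==> 0 \<le> poly p a"
 shows "0 \<le> inner (opoly p x) x"
proof (rule field_le_epsilon)
 fix e :: real assume e: "0 < e"
 define B where "B n k = smult (real (n choose k)) ([:0, 1:] ^ k * [:1, -1:] ^ (n - k))" for n k :: nat
 define w where "w n k = inner (opoly (B n k) x) x" for n k
 have w0: "0 \<le> w n k" for n k
  unfolding w_def B_def opoly_smult using opoly_bernstein_nonneg by simp
 have polyB: "poly (B n k) y = real (n choose k) * y ^ k * (1 - y) ^ (n - k)" for n k y
  by (simp add: B_def poly_power mult_ac)
 have rep: "p = (\<Sum>k\<le>n. smult (\<Sum>m\<le>degree p. coeff p m * bcoeff n m k) (B n k))" if n: "degree p \<le> n" for n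
 proof (rule poly_eq_poly_eq_iff[THEN iffD1], rule ext)
  fix y
  have "poly (\<Sum>k\<le>n. smult (\<Sum>m\<le>degree p. coeff p m * bcoeff n m k) (B n k)) y
   = (\<Sum>k\<le>n. \<Sum>m\<le>degree p. coeff p m * (bcoeff n m k * real (n choose k) * y ^ k * (1 - y) ^ (n - k)))"
   by (simp add: poly_sum polyB sum_distrib_left sum_distrib_right mult_ac)
  also have "\<dots> = (\<Sum>m\<le>degree p. coeff p m * (\<Sum>k\<le>n. bcoeff n m k * real (n choose k) * y ^ k * (1 - y) ^ (n - k)))"
   by (subst sum.swap) (simp add: sum_distrib_left)
  also have "\<dots> = (\<Sum>m\<le>degree p. coeff p m * y ^ m)"
   using n by (intro sum.cong) (auto simp: power_eq_sum_bcoeff)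
  also have "\<dots> = poly p y" by (simp add: poly_altdef)
  finally show "poly p y = poly (\<Sum>k\<le>n. smult (\<Sum>m\<le>degree p. coeff p m * bcoeff n m k) (B n k)) y" by simp
 qed
 define K where "K = (\<Sum>m\<le>degree p. \<bar>coeff p m\<bar>)"
 \<comment> \<open>The Bernstein coefficients will be at least -K d and the weights sum to <x, x>;
   this choice keeps the total error K d <x, x> at most \<open>e\<close>.\<close>
 define d where "d = e / ((K + 1) * (inner x x + 1))"
 have K0: "0 \<le> K" by (auto simp: K_def intro: sum_nonneg)
 have d: "d > 0" using e K0 by (auto simp: d_def intro!: divide_pos_pos mult_pos_pos add_nonneg_pos)
 obtain N where N: "!!m n k. n \<ge> N m ==> k \<le> n ==> \<bar>bcoeff n m k - (real k / real n) ^ m\<bar> < d"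
  using bcoeff_tendsto[OF d] by metis
 define n where "n = Max (insert (degree p + 1) (N ` {..degree p}))"
 have n: "degree p + 1 \<le> n" "!!m. m \<le> degree p ==> N m \<le> n"
  unfolding n_def by (rule Max_ge; auto)+
 have dn: "degree p \<le> n" and n0: "n > 0" using n by auto
 have lower: "- (K * d) \<le> (\<Sum>m\<le>degree p. coeff p m * bcoeff n m k)" if k: "k \<le> n" for k
 proof -
  have "(\<Sum>m\<le>degree p. coeff p m * bcoeff n m k) - poly p (real k / real n)
   = (\<Sum>m\<le>degree p. coeff p m * (bcoeff n m k - (real k / real n) ^ m))"
   by (simp add: poly_altdef sum_subtractf algebra_simps)
  also have "\<bar>\<dots>\<bar> \<le> (\<Sum>m\<le>degree p. \<bar>coeff p m\<bar> * d)"
  proof (intro order_trans[OF sum_abs] sum_mono)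
   fix m assume "m \<in> {..degree p}"
   then have "\<bar>bcoeff n m k - (real k / real n) ^ m\<bar> \<le> d"
    using N[of m n k] n k by force
   then show "\<bar>coeff p m * (bcoeff n m k - (real k / real n) ^ m)\<bar> \<le> \<bar>coeff p m\<bar> * d"
    by (simp add: abs_mult mult_left_mono)
  qed
  also have "\<dots> = K * d" by (simp add: K_def sum_distrib_right)
  finally have "\<bar>(\<Sum>m\<le>degree p. coeff p m * bcoeff n m k) - poly p (real k / real n)\<bar> \<le> K * d" .
  moreover have "0 \<le> poly p (real k / real n)" using k n0 by (intro p) auto
  ultimately show ?thesis by linarith
 qed
 have tot: "(\<Sum>k\<le>n. w n k) = inner x x"
 proof -
  have "(\<Sum>k\<le>n. B n k) = 1"
  proof (rule poly_eq_poly_eq_iff[THEN iffD1], rule ext)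
   fix y show "poly (\<Sum>k\<le>n. B n k) y = poly 1 y"
    using power_eq_sum_bcoeff[of 0 n y] by (simp add: poly_sum polyB)
  qed
  then have "opoly (\<Sum>k\<le>n. B n k) x = x" by simp
  then show ?thesis unfolding w_def opoly_sum by (simp flip: inner_sum_left)
 qed
 have "inner (opoly p x) x = (\<Sum>k\<le>n. (\<Sum>m\<le>degree p. coeff p m * bcoeff n m k) * w n k)"
  by (subst rep[OF dn]) (simp add: opoly_sum opoly_smult inner_sum_left w_def)
 also have "\<dots> \<ge> (\<Sum>k\<le>n. - (K * d) * w n k)"
  using lower w0 by (intro sum_mono mult_right_mono) auto
 finally have "- (K * d) * inner x x \<le> inner (opoly p x) x"
  unfolding sum_distrib_left[symmetric] tot .
 moreover have "K * d * inner x x \<le> e"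
 proof -
  have "K * inner x x \<le> (K + 1) * (inner x x + 1)"
   using K0 by (intro mult_mono) auto
  then have "K * inner x x * e \<le> (K + 1) * (inner x x + 1) * e"
   using e by (intro mult_right_mono) auto
  moreover have "0 < (K + 1) * (inner x x + 1)"
   using K0 by (auto intro!: mult_pos_pos add_nonneg_pos)
  ultimately show ?thesis unfolding d_def by (simp add: field_simps)
 qed
 ultimately show "0 \<le> inner (opoly p x) x + e" by simp
qed

text \<open>Nonnegativity of M^2 - p^2 on [0,1], applied to x, reads |p(A) x|^2 <= M^2
  |x|^2.\<close>

lemma norm_opoly_le:
 assumes p: "!!a. 0 \<le> a ==> a \<le> 1 ==> \<bar>poly p a\<bar> \<le> M"
 shows "norm (opoly p x) \<le> M * norm x"
proof -
 have M: "0 \<le> M" using p[of 0] by simp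
 have "0 \<le> inner (opoly ([:M^2:] - p * p) x) x"
 proof (rule opoly_nonneg)
  fix a :: real assume "0 \<le> a" "a \<le> 1"
  then have "(poly p a)^2 \<le> M^2" using p M by (simp add: abs_le_square_iff[symmetric])
  then show "0 \<le> poly ([:M^2:] - p * p) a" by (simp add: power2_eq_square)
 qed
 also have "inner (opoly ([:M^2:] - p * p) x) x = (M * norm x)^2 - (norm (opoly p x))^2"
  by (simp add: opoly_diff opoly_mult A_simps inner_diff opoly_sym power_mult_distrib power2_norm_eq_inner)
 finally have "(norm (opoly p x))^2 \<le> (M * norm x)^2" by simp
 then show ?thesis by (rule power2_le_imp_le) (use M in simp)
qed

section \<open>Continuous functional calculus\<close>

definition bern :: "(real => real) => nat => real poly" where
 "bern f n = (\<Sum>k\<le>n. smult (f (real k / real n) * real (n choose k)) ([:0, 1:] ^ k * [:1, -1:] ^ (n - k)))"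

lemma poly_bern: "poly (bern f n) a = (\<Sum>k\<le>n. f (real k / real n) * Bernstein n k a)"
 by (simp add: bern_def poly_sum poly_power Bernstein_def mult_ac)

lemma uniform_limit_bern:
 "continuous_on {0..1} f ==> uniform_limit {0..1} (%n. poly (bern f n)) f sequentially"
 unfolding uniform_limit_sequentially_iff poly_bern dist_real_def
 using Bernstein_Weierstrass[of f] by (metis abs_minus_commute)

definition fc :: "(real => real) => 'h => 'h" where
 "fc f x = lim (%n. opoly (bern f n) x)"

text \<open>Two approximating sequences have operators that are eventually close, so the limit does
  not depend on the polynomials chosen. The algebraic rules below may therefore use whatever
  approximants are convenient, for instance products of Bernstein polynomials.\<close>

lemma fc_limit:
 assumes f: "continuous_on {0..1} f" and p: "uniform_limit {0..1} (%n. poly (p n)) f sequentially"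
 shows "(%n. opoly (p n) x) \<longlonglongrightarrow> fc f x"
proof -
 have key: "\<exists>N. \<forall>m\<ge>N. \<forall>n\<ge>N. norm (opoly (p m) x - opoly (q n) x) < e"
  if p: "uniform_limit {0..1} (%n. poly (p n)) f sequentially"
   and q: "uniform_limit {0..1} (%n. poly (q n)) f sequentially" and e: "0 < e" for p q e
 proof -
  define d where "d = e / (2 * (norm x + 1))"
  have d: "d > 0" using e by (auto simp: d_def intro!: divide_pos_pos add_nonneg_pos)
  obtain N1 where N1: "!!n a. n \<ge> N1 ==> a \<in> {0..1} ==> dist (poly (p n) a) (f a) < d / 2"
   using p d unfolding uniform_limit_sequentially_iff by (meson half_gt_zero)
  obtain N2 where N2: "!!n a. n \<ge> N2 ==> a \<in> {0..1} ==> dist (poly (q n) a) (f a) < d / 2"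
   using q d unfolding uniform_limit_sequentially_iff by (meson half_gt_zero)
  show ?thesis
  proof (intro exI allI impI)
   fix m n assume mn: "max N1 N2 \<le> m" "max N1 N2 \<le> n"
   have "norm (opoly (p m - q n) x) \<le> d * norm x"
   proof (rule norm_opoly_le)
    fix a :: real assume a: "0 \<le> a" "a \<le> 1"
    show "\<bar>poly (p m - q n) a\<bar> \<le> d"
     using N1[of m a] N2[of n a] mn a unfolding dist_real_def poly_diff
     by (simp add: abs_if split: if_splits)
   qed
   also have "\<dots> < e"
   proof -
    have "d * norm x \<le> d * (norm x + 1)" using d by simp
    also have "\<dots> = e / 2"
     using norm_ge_zero[of x] unfolding d_def by (simp add: field_simps add_nonneg_eq_0_iff)
    also have "\<dots> < e" using e by simp
    finally show ?thesis .
   qed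
   finally show "norm (opoly (p m) x - opoly (q n) x) < e" by (simp add: opoly_diff)
  qed
 qed
 have b: "uniform_limit {0..1} (%n. poly (bern f n)) f sequentially"
  using f by (rule uniform_limit_bern)
 have "Cauchy (%n. opoly (bern f n) x)"
  using key[OF b b] by (intro metric_CauchyI) (simp add: dist_norm)
 then have lb: "(%n. opoly (bern f n) x) \<longlonglongrightarrow> fc f x"
  unfolding fc_def by (simp add: Cauchy_convergent_iff convergent_LIMSEQ_iff)
 have "(%n. opoly (p n) x - opoly (bern f n) x) \<longlonglongrightarrow> 0"
  unfolding LIMSEQ_iff using key[OF p b] by (metis diff_zero)
 from tendsto_add[OF this lb] show ?thesis by simp
qed

lemma fc_poly: "fc (poly p) x = opoly p x"
proof -
 have "(%n. opoly p x) \<longlonglongrightarrow> fc (poly p) x"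
  by (rule fc_limit) (auto intro!: continuous_intros uniform_limit_const)
 then show ?thesis by (simp add: LIMSEQ_const_iff)
qed

lemma fc_bern_limit:
 "continuous_on {0..1} f ==> (%n. opoly (bern f n) x) \<longlonglongrightarrow> fc f x"
 by (intro fc_limit uniform_limit_bern)

lemma fc_cong:
 assumes "!!a. 0 \<le> a ==> a \<le> 1 ==> f a = g a"
 shows "fc f x = fc g x"
proof -
 have "bern f n = bern g n" for n
 proof -
  have "f (real k / real n) = g (real k / real n)" if "k \<in> {..n}" for k
   using that by (intro assms divide_nonneg_nonneg) (auto simp: divide_le_eq_1)
  then show ?thesis unfolding bern_def by (intro sum.cong) auto
 qed
 then show ?thesis by (simp add: fc_def)
qed

lemma fc_add:
 assumes "continuous_on {0..1} f" "continuous_on {0..1} g"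
 shows "fc (%a. f a + g a) x = fc f x + fc g x"
proof -
 have "(%n. opoly (bern f n + bern g n) x) \<longlonglongrightarrow> fc (%a. f a + g a) x"
  using assms by (intro fc_limit) (auto intro!: continuous_intros uniform_limit_add uniform_limit_bern simp del: fun_Compl_def simp: poly_add[abs_def])
 moreover have "(%n. opoly (bern f n + bern g n) x) \<longlonglongrightarrow> fc f x + fc g x"
  unfolding opoly_add using assms by (intro tendsto_intros fc_bern_limit)
 ultimately show ?thesis by (rule LIMSEQ_unique)
qed

lemma fc_scale:
 assumes "continuous_on {0..1} f"
 shows "fc (%a. c * f a) x = c *\<^sub>R fc f x"
proof -
 have "(%n. opoly (smult c (bern f n)) x) \<longlonglongrightarrow> fc (%a. c * f a) x"
 proof (rule fc_limit)
  show "continuous_on {0..1} (%a. c * f a)" using assms by (intro continuous_intros)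
  show "uniform_limit {0..1} (%n. poly (smult c (bern f n))) (%a. c * f a) sequentially"
   using bounded_linear.uniform_limit[OF bounded_linear_mult_right uniform_limit_bern[OF assms], of c]
   by (simp add: poly_smult[abs_def])
 qed
 moreover have "(%n. opoly (smult c (bern f n)) x) \<longlonglongrightarrow> c *\<^sub>R fc f x"
  unfolding opoly_smult using assms by (intro tendsto_intros fc_bern_limit)
 ultimately show ?thesis by (rule LIMSEQ_unique)
qed

lemma fc_diff:
 assumes "continuous_on {0..1} f" "continuous_on {0..1} g"
 shows "fc (%a. f a - g a) x = fc f x - fc g x"
proof -
 have "fc (%a. f a + (-1) * g a) x = fc f x + fc (%a. (-1) * g a) x"
  using assms by (intro fc_add continuous_intros)
 also have "fc (%a. (-1) * g a) x = (-1) *\<^sub>R fc g x"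
  using assms by (intro fc_scale)
 finally show ?thesis by simp
qed

lemma linear_fc:
 assumes "continuous_on {0..1} f"
 shows "linear (fc f)"
proof (rule linearI)
 fix x y c
 have "(%n. opoly (bern f n) x + opoly (bern f n) y) \<longlonglongrightarrow> fc f x + fc f y"
  using assms by (intro tendsto_intros fc_bern_limit)
 moreover have "(%n. opoly (bern f n) (x + y)) \<longlonglongrightarrow> fc f (x + y)"
  using assms by (intro fc_bern_limit)
 ultimately show "fc f (x + y) = fc f x + fc f y"
  by (simp add: linear_add[OF linear_opoly] LIMSEQ_unique)
 have "(%n. c *\<^sub>R opoly (bern f n) x) \<longlonglongrightarrow> c *\<^sub>R fc f x"
  using assms by (intro tendsto_intros fc_bern_limit)
 moreover have "(%n. opoly (bern f n) (c *\<^sub>R x)) \<longlonglongrightarrow> fc f (c *\<^sub>R x)"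
  using assms by (intro fc_bern_limit)
 ultimately show "fc f (c *\<^sub>R x) = c *\<^sub>R fc f x"
  by (simp add: linear_scale[OF linear_opoly] LIMSEQ_unique)
qed

text \<open>The Bernstein basis is a partition of unity, so the approximants obey a sup bound of
  \<open>f\<close> for every n and not merely in the limit; \<open>fc_mult\<close> relies on this
  uniformity.\<close>

lemma norm_bern_le:
 assumes M: "!!a. 0 \<le> a ==> a \<le> 1 ==> \<bar>f a\<bar> \<le> M"
 shows "norm (opoly (bern f n) x) \<le> M * norm x"
proof (rule norm_opoly_le)
 fix a :: real assume a: "0 \<le> a" "a \<le> 1"
 have "\<bar>poly (bern f n) a\<bar> \<le> (\<Sum>k\<le>n. \<bar>f (real k / real n) * Bernstein n k a\<bar>)"
  unfolding poly_bern by (rule sum_abs)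
 also have "\<dots> \<le> (\<Sum>k\<le>n. M * Bernstein n k a)"
 proof (rule sum_mono)
  fix k assume "k \<in> {..n}"
  then have "\<bar>f (real k / real n)\<bar> \<le> M" by (intro M) (auto simp: divide_le_eq_1)
  then show "\<bar>f (real k / real n) * Bernstein n k a\<bar> \<le> M * Bernstein n k a"
   using Bernstein_nonneg[OF a] by (simp add: abs_mult mult_right_mono)
 qed
 also have "\<dots> = M" by (simp flip: sum_distrib_left)
 finally show "\<bar>poly (bern f n) a\<bar> \<le> M" .
qed

lemma norm_fc_le:
 assumes "continuous_on {0..1} f" and M: "!!a. 0 \<le> a ==> a \<le> 1 ==> \<bar>f a\<bar> \<le> M"
 shows "norm (fc f x) \<le> M * norm x"
proof -
 have "(%n. norm (opoly (bern f n) x)) \<longlonglongrightarrow> norm (fc f x)"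
  using assms by (intro tendsto_intros fc_bern_limit)
 moreover have "norm (opoly (bern f n) x) \<le> M * norm x" for n
  by (rule norm_bern_le) (rule M)
 ultimately show ?thesis by (intro LIMSEQ_le_const2) auto
qed

lemma bounded_on_unit:
 assumes "continuous_on {0..1} (f :: real => real)"
 obtains M where "!!a. 0 \<le> a ==> a \<le> 1 ==> \<bar>f a\<bar> \<le> M"
proof -
 have "compact (f ` {0..1})" using assms by (intro compact_continuous_image) auto
 then have "bounded (f ` {0..1})" by (rule compact_imp_bounded)
 then obtain M where "\<forall>y\<in>f ` {0..1}. \<bar>y\<bar> \<le> M" unfolding bounded_real ..
 then show thesis by (intro that[of M]) auto
qed

lemma bounded_linear_fc:
 assumes "continuous_on {0..1} f"
 shows "bounded_linear (fc f)"
proof -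
 obtain M where "!!a. 0 \<le> a ==> a \<le> 1 ==> \<bar>f a\<bar> \<le> M"
  using bounded_on_unit[OF assms] by blast
 then have "norm (fc f x) \<le> norm x * M" for x
  using norm_fc_le[OF assms, of M x] by (simp add: mult.commute)
 then show ?thesis
  using linear_fc[OF assms] by (auto simp: bounded_linear_def bounded_linear_axioms_def)
qed

lemma fc_sym:
 assumes "continuous_on {0..1} f"
 shows "inner (fc f x) y = inner x (fc f y)"
proof -
 have "(%n. inner (opoly (bern f n) x) y) \<longlonglongrightarrow> inner (fc f x) y"
  using assms by (intro tendsto_intros fc_bern_limit)
 moreover have "(%n. inner x (opoly (bern f n) y)) \<longlonglongrightarrow> inner x (fc f y)"
  using assms by (intro tendsto_intros fc_bern_limit)
 ultimately show ?thesis by (simp add: opoly_sym LIMSEQ_unique)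
qed

lemma fc_mult:
 assumes f: "continuous_on {0..1} f" and g: "continuous_on {0..1} g"
 shows "fc (%a. f a * g a) x = fc f (fc g x)"
proof -
 have bd: "bounded (h ` {0..1})" if "continuous_on {0..1} h" for h :: "real => real"
  using that by (intro compact_imp_bounded compact_continuous_image) auto
 have "(%n. opoly (bern f n * bern g n) x) \<longlonglongrightarrow> fc (%a. f a * g a) x"
 proof (rule fc_limit)
  show "uniform_limit {0..1} (%n. poly (bern f n * bern g n)) (%a. f a * g a) sequentially"
   unfolding poly_mult using f g
   by (intro uniform_lim_mult uniform_limit_bern bd)
 qed (use f g in \<open>intro continuous_intros\<close>)
 moreover have "(%n. opoly (bern f n * bern g n) x) \<longlonglongrightarrow> fc f (fc g x)"
 proof -
  obtain M where M: "!!a. 0 \<le> a ==> a \<le> 1 ==> \<bar>f a\<bar> \<le> M"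
   using bounded_on_unit[OF f] by blast
  have "(%n. norm (opoly (bern g n) x - fc g x)) \<longlonglongrightarrow> norm (fc g x - fc g x)"
   using g by (intro tendsto_intros fc_bern_limit)
  then have z: "(%n. M * norm (opoly (bern g n) x - fc g x)) \<longlonglongrightarrow> 0"
   by (intro tendsto_mult_right_zero) simp
  have "(%n. opoly (bern f n) (opoly (bern g n) x - fc g x)) \<longlonglongrightarrow> 0"
   by (rule Lim_null_comparison[OF _ z]) (rule eventuallyI, rule norm_bern_le, rule M)
  from tendsto_add[OF this fc_bern_limit[OF f, of "fc g x"]]
  show ?thesis by (simp add: opoly_mult linear_diff[OF linear_opoly])
 qed
 ultimately show ?thesis by (rule LIMSEQ_unique)
qed

end

section \<open>Nonnegative self-adjoint relations\<close>

definition hadj :: "('h::real_inner \<times> 'h) set => ('h \<times> 'h) set" where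
 "hadj R = {(g, h). \<forall>(f, k)\<in>R. inner k g = inner f h}"

definition nonneg_sa :: "('h::real_inner \<times> 'h) set => bool" where
 "nonneg_sa R \<longleftrightarrow> closure (Domain R) = UNIV \<and> hadj R = R \<and> (\<forall>(f, g)\<in>R. 0 \<le> inner g f)"

lemma hadjD: "(g, h) \<in> hadj R ==> (f, k) \<in> R ==> inner k g = inner f h"
 by (auto simp: hadj_def)

lemma hadjI: "(!!f k. (f, k) \<in> R ==> inner k g = inner f h) ==> (g, h) \<in> hadj R"
 by (auto simp: hadj_def)

lemma hadj_antimono: "R \<subseteq> S ==> hadj S \<subseteq> hadj R"
 by (auto simp: hadj_def)

lemma subspace_hadj: "subspace (hadj R)"
 unfolding subspace_def by (auto simp: hadj_def inner_add_right zero_prod_def split_beta)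

lemma closed_hadj: "closed (hadj R)"
proof -
 have "hadj R = (\<Inter>p\<in>R. {q. inner (snd p) (fst q) = inner (fst p) (snd q)})"
  by (fastforce simp: hadj_def)
 moreover have "closed {q. inner (snd p) (fst q) = inner (fst p) (snd q)}" for p :: "'a \<times> 'a"
  by (intro closed_Collect_eq continuous_intros)
 ultimately show ?thesis by auto
qed

lemma dense_of_orthogonal:
 fixes V :: "'h::{real_inner,banach} set"
 assumes V: "subspace V" and orth: "!!z. (!!v. v \<in> V ==> inner z v = 0) ==> z = 0"
 shows "closure V = UNIV"
proof (rule closed_subspace_eq_UNIV)
 show "subspace (closure V)"
  unfolding subspace_def
 proof (intro conjI ballI allI)
  show "0 \<in> closure V" using V closure_subset by (auto simp: subspace_def)
  fix x y c assume xy: "x \<in> closure V" "y \<in> closure V"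
  then obtain u w where uw: "!!n. u n \<in> V" "u \<longlonglongrightarrow> x" "!!n. w n \<in> V" "w \<longlonglongrightarrow> y"
   unfolding closure_sequential by auto
  have "(%n. u n + w n) \<longlonglongrightarrow> x + y" "(%n. c *\<^sub>R u n) \<longlonglongrightarrow> c *\<^sub>R x"
   using uw by (auto intro!: tendsto_intros)
  moreover have "u n + w n \<in> V" "c *\<^sub>R u n \<in> V" for n using uw V by (auto simp: subspace_def)
  ultimately show "x + y \<in> closure V" "c *\<^sub>R x \<in> closure V"
   unfolding closure_sequential by (auto intro: exI[of _ "%n. u n + w n"] exI[of _ "%n. c *\<^sub>R u n"])
 qed
 show "z = 0" if "!!v. v \<in> closure V ==> inner z v = 0" for z
  using that closure_subset by (intro orth) blast
qed simp

text \<open>Nonnegativity gives |f|^2 + |g|^2 <= |f + g|^2 on the graph, so the sum map has closed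
  range. A vector z orthogonal to the range satisfies L z = -z by self-adjointness, and
  nonnegativity forces z = 0. Hence 1 + L is onto with inverse \<open>A\<close>, and the parameter h
  = f + g replaces the unbounded relation by a bounded operator.\<close>

lemma nonneg_sa_resolvent:
 fixes L :: "('h::{real_inner,banach} \<times> 'h) set"
 assumes L: "nonneg_sa L"
 obtains A where "pos_contraction A" "!!x. A x = 0 ==> x = 0" "L = range (%h. (A h, h - A h))"
proof -
 have dense: "closure (Domain L) = UNIV" and adj: "hadj L = L"
  and nn: "!!f g. (f, g) \<in> L ==> 0 \<le> inner g f"
  using L by (auto simp: nonneg_sa_def)
 have sub: "subspace L" and clo: "closed L" using subspace_hadj[of L] closed_hadj[of L] adj by auto
 have L_sym: "inner k g = inner f h" if "(f, k) \<in> L" "(g, h) \<in> L" for f k g h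
  using hadjD[of g h L f k] adj that by auto
 have le: "(norm f)^2 + (norm g)^2 \<le> (norm (f + g))^2" if "(f, g) \<in> L" for f g
  using nn[OF that] unfolding power2_norm_eq_inner by (simp add: inner_add inner_commute)
 define add :: "'h \<times> 'h => 'h" where "add p = fst p + snd p" for p
 have lin: "linear add" by (rule linearI) (auto simp: add_def algebra_simps)
 have le': "norm p \<le> norm (add p)" if "p \<in> L" for p
  using le[of "fst p" "snd p"] that unfolding add_def norm_prod_def by (simp add: real_le_lsqrt)
 have "add ` L = UNIV"
 proof (rule closed_subspace_eq_UNIV)
  show "subspace (add ` L)" using lin sub by (rule linear_subspace_image)
  show "closed (add ` L)"
   unfolding closed_sequential_limits
  proof (intro allI impI, elim conjE)
   fix x l assume x: "\<forall>n. x n \<in> add ` L" and xl: "x \<longlonglongrightarrow> l"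
   have "\<forall>n. \<exists>q. q \<in> L \<and> x n = add q" using x unfolding image_iff by blast
   from choice[OF this] obtain p where p: "!!n. p n \<in> L" "!!n. x n = add (p n)" by blast
   have "Cauchy x" using xl LIMSEQ_imp_Cauchy by blast
   have "Cauchy p"
   proof (rule metric_CauchyI)
    fix e :: real assume "0 < e"
    then obtain M where M: "!!m n. m \<ge> M ==> n \<ge> M ==> dist (x m) (x n) < e"
     using \<open>Cauchy x\<close> by (meson metric_CauchyD)
    have "dist (p m) (p n) < e" if "m \<ge> M" "n \<ge> M" for m n
    proof -
     have "norm (p m - p n) \<le> norm (add (p m - p n))"
      using p sub by (intro le') (simp add: subspace_diff)
     also have "\<dots> = dist (x m) (x n)" by (simp add: p(2) dist_norm linear_diff[OF lin])
     finally show ?thesis using M[OF that] by (simp add: dist_norm)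
    qed
    then show "\<exists>M. \<forall>m\<ge>M. \<forall>n\<ge>M. dist (p m) (p n) < e" by blast
   qed
   then obtain q where q: "p \<longlonglongrightarrow> q" by (auto simp: Cauchy_convergent_iff convergent_def)
   have "q \<in> L" using clo p(1) q closed_sequentially by blast
   moreover have "(%n. add (p n)) \<longlonglongrightarrow> add q" unfolding add_def using q by (intro tendsto_intros)
   then have "add q = l" using xl LIMSEQ_unique unfolding p(2)[symmetric] by blast
   ultimately show "l \<in> add ` L" by auto
  qed
  fix z assume z: "!!v. v \<in> add ` L ==> inner z v = 0"
  have "(z, - z) \<in> hadj L"
  proof (rule hadjI)
   fix f k assume "(f, k) \<in> L"
   then have "add (f, k) \<in> add ` L" by (rule imageI)
   from z[OF this] have "inner z (f + k) = 0" by (simp add: add_def)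
   then show "inner k z = inner f (- z)" by (simp add: inner_add_right inner_commute)
  qed
  then have "(z, - z) \<in> L" using adj by simp
  from nn[OF this] have "inner z z \<le> 0" by simp
  then have "inner z z = 0" using inner_ge_zero[of z] by linarith
  then show "z = 0" by simp
 qed
 then have "\<exists>f. (f, h - f) \<in> L" for h
 proof -
  have "h \<in> add ` L" using \<open>add ` L = UNIV\<close> by simp
  then obtain p where "p \<in> L" "h = add p" by blast
  then have "(fst p, h - fst p) \<in> L" by (simp add: add_def)
  then show ?thesis ..
 qed
 then obtain A where A: "!!h. (A h, h - A h) \<in> L" by metis
 have uniq: "A (f + g) = f" if "(f, g) \<in> L" for f g
 proof -
  have "(f - A (f + g), g - (f + g - A (f + g))) \<in> L"
   using subspace_diff[OF sub that A[of "f + g"]] by simp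
  then have "(f - A (f + g), - (f - A (f + g))) \<in> L" by (simp add: algebra_simps)
  from nn[OF this] have "inner (f - A (f + g)) (f - A (f + g)) \<le> 0"
   unfolding inner_minus_left by simp
  then have "f - A (f + g) = 0" using inner_ge_zero[of "f - A (f + g)"] inner_eq_zero_iff by fastforce
  then show ?thesis by simp
 qed
 have Aadd: "A (x + y) = A x + A y" for x y
 proof -
  have "(A x + A y, (x - A x) + (y - A y)) \<in> L"
   using subspace_add[OF sub A[of x] A[of y]] by simp
  from uniq[OF this] show ?thesis by (simp add: algebra_simps)
 qed
 have Ascale: "A (c *\<^sub>R x) = c *\<^sub>R A x" for c x
 proof -
  have "(c *\<^sub>R A x, c *\<^sub>R (x - A x)) \<in> L"
   using subspace_scale[OF sub A[of x], of c] by simp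
  from uniq[OF this] show ?thesis by (simp add: algebra_simps)
 qed
 have Asym: "inner (A x) y = inner x (A y)" for x y
  using L_sym[OF A[of x] A[of y]] by (simp add: inner_diff inner_commute)
 have Apos: "(norm (A x))^2 \<le> inner (A x) x" for x
  using nn[OF A[of x]] unfolding power2_norm_eq_inner by (simp add: inner_diff inner_commute)
 have Anorm: "norm (A x) \<le> norm x" for x
  using le'[OF A[of x]] norm_fst_le[of "A x" "x - A x"] unfolding add_def by simp
 have "pos_contraction A"
 proof (rule pos_contraction.intro)
  show "bounded_linear A"
   by (rule bounded_linear_intro[of _ 1]) (auto simp: Aadd Ascale Anorm)
  show "inner (A x) y = inner x (A y)" for x y by (rule Asym)
  show "0 \<le> inner (A x) x" for x using Apos[of x] by (meson order_trans zero_le_power2)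
  show "inner (A x) x \<le> inner x x" for x
  proof -
   have "inner (A x) x \<le> norm (A x) * norm x" by (rule norm_cauchy_schwarz)
   also have "\<dots> \<le> norm x * norm x" using Anorm by (intro mult_right_mono) auto
   finally show ?thesis by (simp add: dot_square_norm power2_eq_square)
  qed
 qed
 moreover have "x = 0" if "A x = 0" for x
 proof (rule inner_eq_zero_of_dense[OF dense])
  fix d assume "d \<in> Domain L"
  then obtain k where k: "(d, k) \<in> L" by auto
  have "(0, x) \<in> L" using A[of x] that by simp
  from L_sym[OF k this] show "inner d x = 0" by simp
 qed
 moreover have "L = range (%h. (A h, h - A h))"
 proof (intro equalityI subsetI)
  fix p assume "p \<in> L"
  then have "p = (A (fst p + snd p), (fst p + snd p) - A (fst p + snd p))"
   using uniq[of "fst p" "snd p"] by simp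
  then show "p \<in> range (%h. (A h, h - A h))" by blast
 qed (use A in auto)
 ultimately show thesis by (rule that)
qed

subsection \<open>The square root\<close>

context pos_contraction
begin

lemma fc_1: "fc (%a. 1) x = x"
proof -
 have "fc (%a. 1) x = fc (poly 1) x" by (rule fc_cong) simp
 then show ?thesis by (simp add: fc_poly)
qed

lemma fc_id: "fc (%a. a) x = A x"
proof -
 have "fc (%a. a) x = fc (poly [:0, 1:]) x" by (rule fc_cong) simp
 then show ?thesis by (simp add: fc_poly A_simps)
qed

lemma fc_commute:
 "continuous_on {0..1} f ==> continuous_on {0..1} g ==> fc f (fc g x) = fc g (fc f x)"
 using fc_mult[of f g x] fc_mult[of g f x] by (simp add: mult.commute)

lemma fc_mult_eq:
 assumes "continuous_on {0..1} f" "continuous_on {0..1} g"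
  and "!!a. 0 \<le> a ==> a \<le> 1 ==> f a * g a = h a"
 shows "fc f (fc g x) = fc h x"
 using fc_mult[OF assms(1,2), of x] fc_cong[of "%a. f a * g a" h x] assms(3) by simp

lemma fc_nonneg:
 assumes "continuous_on {0..1} f" "!!a. 0 \<le> a ==> a \<le> 1 ==> 0 \<le> f a"
 shows "0 \<le> inner (fc f x) x"
proof -
 have c: "continuous_on {0..1} (%a. sqrt (f a))" using assms(1) by (intro continuous_intros)
 have "fc (%a. sqrt (f a)) (fc (%a. sqrt (f a)) x) = fc f x"
  using assms by (intro fc_mult_eq c) auto
 then show ?thesis using fc_sym[OF c, of "fc (%a. sqrt (f a)) x" x] by (metis inner_ge_zero)
qed

lemma fc_mono:
 assumes "continuous_on {0..1} f" "continuous_on {0..1} g"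
  and "!!a. 0 \<le> a ==> a \<le> 1 ==> f a \<le> g a"
 shows "inner (fc f x) x \<le> inner (fc g x) x"
proof -
 have "0 \<le> inner (fc (%a. g a - f a) x) x"
  using assms by (intro fc_nonneg continuous_intros) auto
 then show ?thesis using fc_diff[OF assms(2,1)] by (simp add: inner_diff)
qed

lemma fc_commute_with:
 assumes "bounded_linear T" "!!x. T (A x) = A (T x)" "continuous_on {0..1} f"
 shows "T (fc f x) = fc f (T x)"
proof -
 have "(%n. T (opoly (bern f n) x)) \<longlonglongrightarrow> T (fc f x)"
  using assms(3) by (intro bounded_linear.tendsto[OF assms(1)] fc_bern_limit)
 moreover have "T (opoly p x) = opoly p (T x)" for p
  using assms by (intro opoly_commute_with bounded_linear.linear)
 ultimately have "(%n. opoly (bern f n) (T x)) \<longlonglongrightarrow> T (fc f x)" by simp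
 then show ?thesis using fc_bern_limit[OF assms(3), of "T x"] by (rule LIMSEQ_unique)
qed

text \<open>For y = R x - Q x commutation gives (R + Q) y = R^2 x - Q^2 x = 0, so both nonnegative
  forms vanish at y. A symmetric operator with nonnegative form kills every vector where its form
  vanishes, and |y|^2 = <x, R y - Q y>.\<close>

lemma positive_root_unique:
 assumes R: "bounded_linear R" "!!x y. inner (R x) y = inner x (R y)" "!!x. 0 \<le> inner (R x) x"
  and Q: "linear Q" "!!x y. inner (Q x) y = inner x (Q y)" "!!x. 0 \<le> inner (Q x) x"
  and comm: "!!x. R (Q x) = Q (R x)" and sq: "!!x. R (R x) = Q (Q x)"
 shows "R x = Q x"
proof -
 have cs: "T y = 0" if T: "linear T" "!!x y. inner (T x) y = inner x (T y)" "!!x. 0 \<le> inner (T x) x"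
  and y: "inner (T y) y = 0" for T :: "'a => 'a" and y
 proof -
  have "inner (T y) (T y) = 0"
  proof (rule quadratic_nonneg_imp_zero)
   fix s :: real
   have "0 \<le> inner (T (y - s *\<^sub>R T y)) (y - s *\<^sub>R T y)" by (rule T(3))
   also have "\<dots> = s^2 * inner (T (T y)) (T y) - 2 * s * inner (T y) (T y)"
    using y by (simp add: linear_diff[OF T(1)] linear_scale[OF T(1)] inner_diff T(2) power2_eq_square algebra_simps)
   finally show "0 \<le> s^2 * inner (T (T y)) (T y) - 2 * s * inner (T y) (T y)" .
  qed
  then show ?thesis by simp
 qed
 define y where "y = R x - Q x"
 note Rl = bounded_linear.linear[OF R(1)]
 have "R y + Q y = 0"
  by (simp add: y_def linear_diff[OF Rl] linear_diff[OF Q(1)] comm sq)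
 then have "inner (R y) y + inner (Q y) y = 0" by (metis inner_add_left inner_zero_left)
 then have "inner (R y) y = 0" "inner (Q y) y = 0" using R(3)[of y] Q(3)[of y] by auto
 then have "R y = 0" "Q y = 0"
  by - (rule cs[OF Rl], rule R, rule R, assumption, rule cs[OF Q(1)], rule Q, rule Q, assumption)
 then have "inner y y = 0"
 proof -
  have "inner y y = inner (R x) y - inner (Q x) y" by (simp add: y_def inner_diff)
  also have "\<dots> = inner x (R y) - inner x (Q y)" unfolding R(2) Q(2) ..
  finally show ?thesis using \<open>R y = 0\<close> \<open>Q y = 0\<close> by simp
 qed
 then show ?thesis by (simp add: y_def)
qed

end

locale injective_pos_contraction = pos_contraction +
 assumes inj_A: "A x = 0 ==> x = 0"
begin

text \<open>In terms of L: \<open>C\<close> = (1 + L)^(-1/2) and \<open>B\<close> = L^(1/2) (1 +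
  L)^(-1/2), both bounded, with C^2 + B^2 = 1. \<open>Srel\<close> is the graph of L^(1/2),
  parametrised by h with f = C h.\<close>

definition C :: "'a => 'a" where "C = fc sqrt"
definition B :: "'a => 'a" where "B = fc (%a. sqrt (1 - a))"
definition Lrel :: "('a \<times> 'a) set" where "Lrel = range (%h. (A h, h - A h))"
definition Srel :: "('a \<times> 'a) set" where "Srel = range (%h. (C h, B h))"

lemma cont_sqrt: "continuous_on {0..1} sqrt" and cont_sqrt1: "continuous_on {0..1} (%a::real. sqrt (1 - a))"
 by (intro continuous_intros)+

lemma CC: "C (C x) = A x"
proof -
 have "C (C x) = fc (%a. a) x"
  unfolding C_def by (rule fc_mult_eq[OF cont_sqrt cont_sqrt]) simp
 then show ?thesis by (simp only: fc_id)
qed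

lemma BB: "B (B x) = x - A x"
proof -
 have "B (B x) = fc (%a. 1 - a) x"
  unfolding B_def by (rule fc_mult_eq[OF cont_sqrt1 cont_sqrt1]) simp
 also have "\<dots> = x - A x"
  using fc_diff[of "%a. 1" "%a. a"] by (simp add: fc_1 fc_id continuous_on_id)
 finally show ?thesis .
qed

lemma BC: "B (C x) = C (B x)"
 unfolding B_def C_def by (rule fc_commute[OF cont_sqrt1 cont_sqrt])

lemma bounded_linear_C: "bounded_linear C" and bounded_linear_B: "bounded_linear B"
 unfolding B_def C_def by (intro bounded_linear_fc cont_sqrt cont_sqrt1)+

lemmas linear_C = bounded_linear.linear[OF bounded_linear_C]
lemmas linear_B = bounded_linear.linear[OF bounded_linear_B]
lemmas C_simps = linear_add[OF linear_C] linear_diff[OF linear_C] linear_scale[OF linear_C] linear_0[OF linear_C]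
lemmas B_simps = linear_add[OF linear_B] linear_diff[OF linear_B] linear_scale[OF linear_B] linear_0[OF linear_B]

lemma C_sym: "inner (C x) y = inner x (C y)" and B_sym: "inner (B x) y = inner x (B y)"
 unfolding B_def C_def by (intro fc_sym cont_sqrt cont_sqrt1)+

lemma C_inj: "C x = 0 ==> x = 0"
proof -
 assume "C x = 0"
 then have "C (C x) = 0" by (simp only: C_simps)
 then show "x = 0" unfolding CC by (rule inj_A)
qed

lemma C_eq_iff: "C x = C y \<longleftrightarrow> x = y"
proof
 assume "C x = C y"
 then have "C (x - y) = 0" by (simp only: C_simps) simp
 then have "x - y = 0" by (rule C_inj)
 then show "x = y" by simp
qed simp

text \<open>Composition and adjoint of the root thereby become identities between bounded operators.
  Since C^2 + B^2 = 1, the parameter of a pair (f, g) is recovered as C f + B g.\<close>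

lemma Srel_iff: "(f, g) \<in> Srel \<longleftrightarrow> B f = C g"
proof
 show "(f, g) \<in> Srel ==> B f = C g" unfolding Srel_def using BC by blast
 assume *: "B f = C g"
 have "C (C f + B g) = f"
 proof -
  have "C (C f + B g) = A f + B (C g)" by (simp add: C_simps CC BC)
  also have "\<dots> = A f + B (B f)" by (simp add: *)
  finally show ?thesis by (simp add: BB)
 qed
 moreover have "B (C f + B g) = g"
 proof -
  have "B (C f + B g) = C (B f) + (g - A g)" by (simp add: B_simps BB BC)
  also have "\<dots> = C (C g) + (g - A g)" by (simp add: *)
  finally show ?thesis by (simp add: CC)
 qed
 ultimately show "(f, g) \<in> Srel"
  unfolding Srel_def by (intro image_eqI[of _ _ "C f + B g"]) simp_all
qed

lemma dense_range_C: "closure (range C) = UNIV"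
proof (rule dense_of_orthogonal)
 show "subspace (range C)" using linear_C by (simp add: linear_subspace_image)
 fix z assume z: "!!v. v \<in> range C ==> inner z v = 0"
 have "inner (C z) (C z) = inner z (C (C z))" by (rule C_sym)
 then show "z = 0" using z[of "C (C z)"] by - (rule C_inj, simp)
qed

lemma dense_range_A: "closure (range A) = UNIV"
proof (rule dense_of_orthogonal)
 show "subspace (range A)" using linear_A by (simp add: linear_subspace_image)
 fix z assume z: "!!v. v \<in> range A ==> inner z v = 0"
 have "inner (A z) (A z) = inner z (A (A z))" by (rule sym_A)
 then show "z = 0" using z[of "A (A z)"] by - (rule inj_A, simp)
qed

text \<open>By symmetry of \<open>B\<close> and \<open>C\<close> the adjoint condition, tested on
  all parameters h, reads B g = C k.\<close>

lemma hadj_Srel: "hadj Srel = Srel"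
proof -
 have "(g, k) \<in> hadj Srel \<longleftrightarrow> B g = C k" for g k
 proof -
  have "(g, k) \<in> hadj Srel \<longleftrightarrow> (\<forall>h. inner h (B g) = inner h (C k))"
   by (auto simp: hadj_def Srel_def B_sym C_sym)
  also have "\<dots> \<longleftrightarrow> B g = C k" by (metis vector_eq_rdot inner_commute)
  finally show ?thesis .
 qed
 then show ?thesis using Srel_iff by auto
qed

lemma nonneg_sa_Srel: "nonneg_sa Srel"
proof -
 have "Domain Srel = range C" by (auto simp: Srel_def)
 moreover have "0 \<le> inner (B h) (C h)" for h
 proof -
  have "C (B h) = fc (%a. sqrt a * sqrt (1 - a)) h"
   unfolding B_def C_def by (intro fc_mult[symmetric] cont_sqrt cont_sqrt1)
  also have "0 \<le> inner \<dots> h"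
   by (intro fc_nonneg continuous_intros) auto
  finally show ?thesis by (simp add: C_sym[of "B h" h])
 qed
 ultimately show ?thesis
  unfolding nonneg_sa_def using dense_range_C hadj_Srel by (auto simp: Srel_def)
qed

lemma Srel_square: "Srel O Srel = Lrel"
proof (intro equalityI subrelI)
 fix f k assume "(f, k) \<in> Srel O Srel"
 then obtain h k' where h: "f = C h" "k = B k'" "B h = C k'"
  by (auto simp: Srel_def)
 then obtain m where "h = C m" "k' = B m"
  using Srel_iff[of h k'] by (auto simp: Srel_def)
 then show "(f, k) \<in> Lrel" using h by (auto simp: Lrel_def CC BB)
next
 fix f k assume "(f, k) \<in> Lrel"
 then obtain m where m: "f = A m" "k = m - A m" by (auto simp: Lrel_def)
 have "(C (C m), B (C m)) \<in> Srel" "(C (B m), B (B m)) \<in> Srel" by (auto simp: Srel_def)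
 then show "(f, k) \<in> Srel O Srel" using m by (auto simp: CC BB BC)
qed

text \<open>Any root \<open>S\<close> yields a bounded positive root \<open>S A\<close> of \<open>A (1 - A)\<close> commuting with \<open>A\<close>, and such
 a root is unique; hence \<open>S\<close> and \<open>Srel\<close> agree on the common core \<open>range A\<close>.\<close>

lemma sqrt_unique:
 assumes S: "nonneg_sa S" and SS: "S O S = Lrel"
 shows "S = Srel"
proof -
 have adj: "hadj S = S" and nn: "!!f g. (f, g) \<in> S ==> 0 \<le> inner g f"
  using S by (auto simp: nonneg_sa_def)
 have sub: "subspace S" using subspace_hadj[of S] adj by auto
 have sym: "inner k g = inner f h" if "(f, k) \<in> S" "(g, h) \<in> S" for f k g h
  using hadjD[of g h S f k] adj that by auto
 have uniq: "g = g'" if "(f, g) \<in> S" "(f, g') \<in> S" for f g g'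
 proof -
  have d: "(0, g - g') \<in> S" using subspace_diff[OF sub that] by simp
  have "g - g' = 0"
  proof (rule inner_eq_zero_of_dense)
   show "closure (Domain S) = UNIV" using S by (simp add: nonneg_sa_def)
   show "inner d (g - g') = 0" if "d \<in> Domain S" for d
    using that sym[OF _ \<open>(0, g - g') \<in> S\<close>] by auto
  qed
  then show ?thesis by simp
 qed
 have "\<exists>q. (A h, q) \<in> S \<and> (q, h - A h) \<in> S" for h
 proof -
  have "(A h, h - A h) \<in> S O S" unfolding SS Lrel_def by blast
  then show ?thesis by auto
 qed
 then obtain Q where Q: "!!h. (A h, Q h) \<in> S" "!!h. (Q h, h - A h) \<in> S" by metis
 have Qadd: "Q (x + y) = Q x + Q y" for x y
  using subspace_add[OF sub Q(1)[of x] Q(1)[of y]] Q(1)[of "x + y"] uniq by (simp add: A_simps)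
 have Qscale: "Q (c *\<^sub>R x) = c *\<^sub>R Q x" for c x
  using subspace_scale[OF sub Q(1)[of x], of c] Q(1)[of "c *\<^sub>R x"] uniq by (simp add: A_simps)
 have linQ: "linear Q" by (rule linearI) (auto simp: Qadd Qscale)
 have symQ: "inner (Q x) y = inner x (Q y)" for x y
 proof -
  have "inner (x - A x) (Q y) = inner (Q x) (y - A y)" by (rule sym[OF Q(2) Q(2)])
  moreover have "inner (Q x) (A y) = inner (A x) (Q y)" by (rule sym[OF Q(1) Q(1)])
  ultimately show ?thesis by (simp add: inner_diff)
 qed
 have posQ: "0 \<le> inner (Q x) x" for x
  using nn[OF Q(1)[of x]] nn[OF Q(2)[of x]] by (simp add: inner_diff inner_commute)
 \<comment> \<open>Subtracting (A f, Q f) from (f, g) leaves (f - A f, g - Q f) in \<open>S\<close>;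
   preceded by (Q f, f - A f) it is a pair of L, and \<open>A\<close> inverts 1 + L.\<close>
 have key: "Q f = A g" if "(f, g) \<in> S" for f g
 proof -
  have "(f - A f, g - Q f) \<in> S" using subspace_diff[OF sub that Q(1)[of f]] by simp
  with Q(2)[of f] have "(Q f, g - Q f) \<in> Lrel" unfolding SS[symmetric] by auto
  then obtain h where "Q f = A h" "g - Q f = h - A h" by (auto simp: Lrel_def)
  then show ?thesis by (simp add: algebra_simps)
 qed
 have QA: "Q (A x) = A (Q x)" for x by (rule key[OF Q(1)])
 have QQ: "Q (Q x) = A (x - A x)" for x by (rule key[OF Q(2)])
 have bQ: "bounded_linear Q"
 proof (rule bounded_linear_intro[of _ 1])
  fix x
  have "inner (Q x) (Q x) = inner (A (x - A x)) x" using QQ by (simp add: symQ inner_commute)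
  also have "\<dots> = inner (A x) x - inner (A x) (A x)"
   by (simp add: A_simps inner_diff sym_A)
  also have "\<dots> \<le> inner x x" using le_A[of x] inner_ge_zero[of "A x"] by linarith
  finally show "norm (Q x) \<le> norm x * 1" by (simp add: norm_le)
 qed (simp_all add: Qadd Qscale)
 define R where "R x = B (C x)" for x
 have R: "R = fc (%a. sqrt (1 - a) * sqrt a)"
  unfolding R_def B_def C_def by (intro ext fc_mult[symmetric] cont_sqrt cont_sqrt1)
 have contR: "continuous_on {0..1} (%a::real. sqrt (1 - a) * sqrt a)" by (intro continuous_intros)
 have RQ: "R x = Q x" for x
 proof (rule positive_root_unique[where R = R and Q = Q])
  show "bounded_linear R" unfolding R by (rule bounded_linear_fc[OF contR])
  show "inner (R x) y = inner x (R y)" for x y unfolding R by (rule fc_sym[OF contR])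
  show "0 \<le> inner (R x) x" for x unfolding R by (rule fc_nonneg[OF contR]) auto
  show "R (Q x) = Q (R x)" for x
   unfolding R by (rule fc_commute_with[OF bQ _ contR, symmetric]) (rule QA)
  show "R (R x) = Q (Q x)" for x
  proof -
   have "R (R x) = C (C (B (B x)))" by (simp add: R_def BC)
   then show ?thesis by (simp add: CC BB QQ)
  qed
 qed (rule linQ, rule symQ, rule posQ)
 have "S \<subseteq> Srel"
 proof (rule subrelI)
  fix f g assume fg: "(f, g) \<in> S"
  have "C (B f) = C (C g)" using key[OF fg] RQ[of f] by (simp add: R_def BC CC)
  then show "(f, g) \<in> Srel" by (simp add: C_eq_iff Srel_iff)
 qed
 \<comment> \<open>One inclusion is enough: taking adjoints reverses it, and both relations are
   their own adjoints.\<close>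
 moreover from hadj_antimono[OF this] have "Srel \<subseteq> S" using adj hadj_Srel by simp
 ultimately show ?thesis by auto
qed

end

section \<open>Strongly continuous semigroups\<close>

text \<open>By Baire's theorem one of the closed sets on which all \<open>T n\<close> are bounded by
  m contains a ball; differences of its points give a bound near 0.\<close>

lemma uniform_boundedness:
 fixes T :: "nat => 'h::banach => 'k::real_normed_vector"
 assumes bl: "!!n. bounded_linear (T n)" and bd: "!!x. bounded (range (%n. T n x))"
 obtains M where "!!n x. norm (T n x) \<le> M * norm x"
proof -
 define F where "F m = {x. \<forall>n. norm (T n x) \<le> real m}" for m
 have closed: "closed (F m)" for m
 proof -
  have "F m = (\<Inter>n. {x. norm (T n x) \<le> real m})" by (auto simp: F_def)
  moreover have "closed {x. norm (T n x) \<le> real m}" for n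
   by (intro closed_Collect_le continuous_intros linear_continuous_on bl)
  ultimately show ?thesis by auto
 qed
 have cover: "\<exists>m. x \<in> F m" for x
 proof -
  obtain b where b: "!!n. norm (T n x) \<le> b" using bd[of x] by (auto simp: bounded_iff)
  obtain m :: nat where "b \<le> real m" using real_arch_simple by blast
  then have "x \<in> F m" using b by (auto simp: F_def intro: order_trans)
  then show ?thesis ..
 qed
 have "\<exists>m. interior (F m) \<noteq> {}"
 proof (rule ccontr)
  assume "\<not> ?thesis"
  then have dense: "closure (- F m) = UNIV" for m by (simp add: closure_complement)
  have "Met_TC.mtopology closure_of \<Inter>(range (%m. - F m)) = (UNIV :: 'h set)"
  proof (rule Met_TC.metric_Baire_category)
   show "Met_TC.mcomplete TYPE('h)" by (simp add: complete_UNIV)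
   fix S assume "S \<in> range (%m. - F m)"
   then obtain m where "S = - F m" by auto
   then show "openin Met_TC.mtopology S \<and> Met_TC.mtopology closure_of S = UNIV"
    using dense by (simp add: open_Compl[OF closed])
  qed simp
  moreover have "\<Inter>(range (%m. - F m)) = {}" using cover by auto
  ultimately show False by simp
 qed
 then obtain m x0 where "x0 \<in> interior (F m)" by auto
 then obtain e where e: "e > 0" "cball x0 e \<subseteq> F m" by (metis mem_interior_cball)
 have "norm (T n x) \<le> (2 * real m / e) * norm x" for n x
 proof (cases "x = 0")
  case True then show ?thesis by (simp add: linear_0[OF bounded_linear.linear[OF bl]])
 next
  case False
  define y where "y = (e / norm x) *\<^sub>R x"
  have "x0 + y \<in> F m" "x0 \<in> F m" using e False by (auto simp: y_def dist_norm subset_iff)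
  then have *: "norm (T n (x0 + y)) \<le> real m" "norm (T n x0) \<le> real m" by (auto simp: F_def)
  note lin = bounded_linear.linear[OF bl, of n]
  have "T n y = T n (x0 + y) - T n x0" by (simp add: linear_add[OF lin])
  then have "norm (T n y) \<le> 2 * real m" using * norm_triangle_ineq4[of "T n (x0 + y)" "T n x0"] by simp
  moreover have "norm (T n y) = e / norm x * norm (T n x)"
   using e by (simp add: y_def linear_scale[OF lin])
  ultimately show ?thesis using e False by (simp add: field_simps)
 qed
 then show thesis by (rule that)
qed

locale c0_semigroup =
 fixes T :: "real => 'h::banach => 'h"
 assumes bounded_linear_T: "t \<ge> 0 ==> bounded_linear (T t)"
  and T_0: "T 0 x = x"
  and T_add: "s \<ge> 0 ==> t \<ge> 0 ==> T (s + t) x = T s (T t x)"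
  and T_tendsto: "((%t. T t x) \<longlongrightarrow> x) (at_right 0)"
begin

lemma linear_T: "t \<ge> 0 ==> linear (T t)"
 by (intro bounded_linear.linear bounded_linear_T)

text \<open>Otherwise there are times t_n <= 1/(n+1) at which the norm exceeds n+1, although T t_n
  converges strongly to the identity; this contradicts uniform boundedness.\<close>

lemma bounded_near_0: "\<exists>d>0. \<exists>M. \<forall>t\<in>{0..d}. \<forall>x. norm (T t x) \<le> M * norm x"
proof (rule ccontr)
 assume neg: "\<not> ?thesis"
 have "\<exists>t x. 0 \<le> t \<and> t \<le> 1 / real (Suc n) \<and> real (Suc n) * norm x < norm (T t x)" for n
 proof -
  have "1 / real (Suc n) > 0" by simp
  with neg have "\<not> (\<forall>t\<in>{0..1 / real (Suc n)}. \<forall>x. norm (T t x) \<le> real (Suc n) * norm x)" by blast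
  then show ?thesis by (auto simp: not_le)
 qed
 then obtain t x where tx: "!!n. 0 \<le> t n" "!!n. t n \<le> 1 / real (Suc n)"
   "!!n. real (Suc n) * norm (x n) < norm (T (t n) (x n))" by metis
 have "t n \<noteq> 0" for n
 proof
  assume "t n = 0"
  then have "real (Suc n) * norm (x n) < norm (x n)" using tx(3)[of n] by (simp add: T_0)
  moreover have "1 * norm (x n) \<le> real (Suc n) * norm (x n)" by (intro mult_right_mono) auto
  ultimately show False by simp
 qed
 then have tpos: "t n > 0" for n using tx(1)[of n] by (simp add: less_le)
 have "t \<longlonglongrightarrow> 0"
  by (rule tendsto_sandwich[of "%_. 0" _ _ "%n. 1 / real (Suc n)"])
   (use tx LIMSEQ_inverse_real_of_nat in \<open>auto simp: inverse_eq_divide\<close>)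
 then have f: "filterlim t (at_right 0) sequentially"
  using tpos by (auto simp: filterlim_at less_imp_neq[symmetric] intro!: always_eventually)
 have conv: "(%n. T (t n) y) \<longlonglongrightarrow> y" for y
  using filterlim_compose[OF T_tendsto f] by simp
 obtain M where M: "!!n y. norm (T (t n) y) \<le> M * norm y"
 proof (rule uniform_boundedness[of "%n. T (t n)"])
  show "bounded_linear (T (t n))" for n using tx(1) by (rule bounded_linear_T)
  show "bounded (range (%n. T (t n) y))" for y
   using conv by (rule convergent_imp_bounded)
 qed blast
 obtain n :: nat where n: "M < real n" using reals_Archimedean2 by blast
 have "real (Suc n) * norm (x n) < M * norm (x n)" using tx(3)[of n] M[of n "x n"] by linarith
 moreover have "M * norm (x n) \<le> real (Suc n) * norm (x n)" using n by (intro mult_right_mono) auto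
 ultimately show False by simp
qed

lemma bounded_on_interval:
 obtains M where "M > 0" "!!s x. 0 \<le> s ==> s \<le> t ==> norm (T s x) \<le> M * norm x"
proof -
 obtain d M0 where d: "d > 0" and M0: "!!s x. 0 \<le> s ==> s \<le> d ==> norm (T s x) \<le> M0 * norm x"
  using bounded_near_0 by (metis atLeastAtMost_iff)
 define M where "M = max M0 1"
 have M1: "M \<ge> 1" and M: "norm (T s x) \<le> M * norm x" if "0 \<le> s" "s \<le> d" for s x
  using M0[OF that, of x] mult_right_mono[of M0 M "norm x"] unfolding M_def by auto
 have M1: "M \<ge> 1" by (simp add: M_def)
 have step: "norm (T s x) \<le> M ^ Suc n * norm x" if "0 \<le> s" "s \<le> real (Suc n) * d" for n s x
  using that
 proof (induction n arbitrary: s x)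
  case 0 then show ?case using M[of s x] by simp
 next
  case (Suc n)
  show ?case
  proof (cases "s \<le> d")
   case True
   have "M * norm x \<le> M ^ Suc (Suc n) * norm x"
    using power_increasing[of 1 "Suc (Suc n)" M] M1 by (intro mult_right_mono) simp_all
   then show ?thesis using M[OF Suc.prems(1) True, of x] by linarith
  next
   case False
   have "T s x = T (s - d) (T d x)" using T_add[of "s - d" d x] False d by simp
   also have "norm \<dots> \<le> M ^ Suc n * norm (T d x)"
    using Suc.prems False by (intro Suc.IH) (auto simp: algebra_simps)
   also have "\<dots> \<le> M ^ Suc n * (M * norm x)"
    using M[of d x] d M1 by (intro mult_left_mono) auto
   finally show ?thesis by (simp add: mult_ac)
  qed
 qed
 obtain n :: nat where n: "t / d \<le> real n" using real_arch_simple by blast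
 then have "t \<le> real n * d" using d by (simp add: divide_le_eq)
 also have "\<dots> \<le> real (Suc n) * d" using d by (intro mult_right_mono) auto
 finally have t: "t \<le> real (Suc n) * d" .
 show thesis
 proof (rule that)
  show "0 < M ^ Suc n" using M1 by (intro zero_less_power) simp
  show "norm (T s x) \<le> M ^ Suc n * norm x" if "0 \<le> s" "s \<le> t" for s x
   using that t by (intro step) auto
 qed
qed

lemma filterlim_dist_at: "filterlim (%y. \<bar>y - s\<bar>) (at_right 0) (at (s::real) within S)"
proof -
 have "((%y. \<bar>y - s\<bar>) \<longlongrightarrow> \<bar>s - s\<bar>) (at s within S)" by (intro tendsto_intros)
 then show ?thesis by (auto simp: filterlim_at eventually_at_filter)
qed

lemma continuous_on_T: "continuous_on {0..} (%s. T s x)"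
 unfolding continuous_on_def
proof
 fix s :: real assume s: "s \<in> {0..}"
 obtain M where M: "M > 0" "!!r x. 0 \<le> r ==> r \<le> s + 1 ==> norm (T r x) \<le> M * norm x"
  using bounded_on_interval[of "s + 1"] by metis
 have ev: "eventually (%y. y \<in> {0..} \<and> y < s + 1) (at s within {0..})"
  unfolding eventually_at by (auto intro!: exI[of _ 1] simp: dist_real_def)
 have "((%y. T y x - T s x) \<longlongrightarrow> 0) (at s within {0..})"
 proof (rule Lim_null_comparison)
  show "eventually (%y. norm (T y x - T s x) \<le> M * norm (T \<bar>y - s\<bar> x - x)) (at s within {0..})"
   using ev
  proof eventually_elim
   case (elim y)
   show ?case
   proof (cases "s \<le> y")
    case True
    have "T y x - T s x = T s (T \<bar>y - s\<bar> x - x)"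
     using T_add[of s "y - s" x] True s by (simp add: linear_diff[OF linear_T])
    then show ?thesis using M(2)[of s] s by simp
   next
    case False
    have "T y x - T s x = - T y (T \<bar>y - s\<bar> x - x)"
     using T_add[of y "s - y" x] False elim by (simp add: linear_diff[OF linear_T])
    then show ?thesis using M(2)[of y] elim by simp
   qed
  qed
  have "((%y. norm (T \<bar>y - s\<bar> x - x)) \<longlongrightarrow> norm (x - x)) (at s within {0..})"
   by (intro tendsto_intros filterlim_compose[OF T_tendsto filterlim_dist_at])
  then show "((%y. M * norm (T \<bar>y - s\<bar> x - x)) \<longlongrightarrow> 0) (at s within {0..})"
   by (intro tendsto_mult_right_zero) simp
 qed
 then show "((%s. T s x) \<longlongrightarrow> T s x) (at s within {0..})"
  by (rule LIM_zero_cancel)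
qed

text \<open>The generator provides only a right derivative at 0. The increments on both sides of s
  are written as T, at the smaller of the two times, applied to a difference quotient with step |y -
  s|; local boundedness and strong continuity then give the two-sided derivative.\<close>

lemma has_vector_derivative_T:
 assumes q: "((%t. (1 / t) *\<^sub>R (T t f - f)) \<longlongrightarrow> g) (at_right 0)" and s: "s > 0"
 shows "((%s. T s f) has_vector_derivative T s g) (at s)"
proof -
 obtain M where M: "M > 0" "!!r x. 0 \<le> r ==> r \<le> s + 1 ==> norm (T r x) \<le> M * norm x"
  using bounded_on_interval[of "s + 1"] by metis
 define Q where "Q t = (1 / t) *\<^sub>R (T t f - f)" for t
 have cont: "((%s. T s g) \<longlongrightarrow> T s g) (at s)"
  using continuous_on_T[of g] s unfolding continuous_on_def
  by (metis (no_types, lifting) at_within_interior atLeast_iff greaterThan_iff interior_real_atLeast less_imp_le)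
 have mint: "((%y. min y s) \<longlongrightarrow> min s s) (at s)" by (intro tendsto_intros)
 have contm: "((%y. T (min y s) g) \<longlongrightarrow> T s g) (at s)"
 proof (rule Lim_transform_bound[OF _ LIM_zero[OF cont], THEN LIM_zero_cancel])
  show "eventually (%y. norm (T (min y s) g - T s g) \<le> norm (T y g - T s g)) (at s)"
   by (rule always_eventually) (auto simp: min_def)
 qed
 have ev: "eventually (%y. 0 < y \<and> y < s + 1 \<and> y \<noteq> s) (at s)"
  unfolding eventually_at using s by (intro exI[of _ "min 1 s"]) (auto simp: dist_real_def abs_if split: if_splits)
 have "((%y. norm (T y f - T s f - (y - s) *\<^sub>R T s g) / norm (y - s)) \<longlongrightarrow> 0) (at s)"
 proof (rule Lim_null_comparison)
  show "eventually (%y. norm (norm (T y f - T s f - (y - s) *\<^sub>R T s g) / norm (y - s))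
    \<le> M * norm (Q \<bar>y - s\<bar> - g) + norm (T (min y s) g - T s g)) (at s)"
   using ev
  proof eventually_elim
   case (elim y)
   define m where "m = min y s"
   have m: "0 \<le> m" "m \<le> s + 1" using elim s by (auto simp: m_def)
   have "T y f - T s f = (y - s) *\<^sub>R T m (Q \<bar>y - s\<bar>)"
   proof (cases "s \<le> y")
    case True
    then have "T y f = T s (T (y - s) f)" using T_add[of s "y - s" f] s by simp
    then show ?thesis using True elim s
     by (simp add: m_def Q_def linear_scale[OF linear_T] linear_diff[OF linear_T])
   next
    case False
    then have *: "T s f = T y (T (s - y) f)" using T_add[of y "s - y" f] elim by simp
    have c: "(y - s) / (s - y) = - 1" using elim by (simp add: field_simps)
    have mm: "m = y" "\<bar>y - s\<bar> = s - y" using False by (auto simp: m_def)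
    show ?thesis using False elim unfolding mm *
     by (simp add: c Q_def linear_scale[OF linear_T] linear_diff[OF linear_T])
   qed
   then have "T y f - T s f - (y - s) *\<^sub>R T s g = (y - s) *\<^sub>R (T m (Q \<bar>y - s\<bar>) - T s g)"
    by (simp add: algebra_simps)
   then have "norm (T y f - T s f - (y - s) *\<^sub>R T s g) / norm (y - s) = norm (T m (Q \<bar>y - s\<bar>) - T s g)"
    using elim by simp
   also have "T m (Q \<bar>y - s\<bar>) - T s g = T m (Q \<bar>y - s\<bar> - g) + (T m g - T s g)"
    using m by (simp add: linear_diff[OF linear_T])
   also have "norm \<dots> \<le> norm (T m (Q \<bar>y - s\<bar> - g)) + norm (T m g - T s g)" by (rule norm_triangle_ineq)
   also have "\<dots> \<le> M * norm (Q \<bar>y - s\<bar> - g) + norm (T m g - T s g)" using M(2)[OF m] by simp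
   finally show ?case by (simp add: m_def)
  qed
  have "((%y. Q \<bar>y - s\<bar>) \<longlongrightarrow> g) (at s)"
   using filterlim_compose[OF q filterlim_dist_at[of s UNIV]] unfolding Q_def .
  then have "((%y. M * norm (Q \<bar>y - s\<bar> - g) + norm (T (min y s) g - T s g)) \<longlongrightarrow> M * norm (g - g) + norm (T s g - T s g)) (at s)"
   by (intro tendsto_intros contm)
  then show "((%y. M * norm (Q \<bar>y - s\<bar> - g) + norm (T (min y s) g - T s g)) \<longlongrightarrow> 0) (at s)" by simp
 qed
 then show ?thesis
  unfolding has_vector_derivative_def has_derivative_iff_norm
  by (simp add: bounded_linear_scaleR_left)
qed

end

text \<open>The difference of two trajectories with the same initial value has nonincreasing norm, since
 the common generator is dissipative.\<close>

lemma c0_semigroup_unique: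
 fixes T U :: "real => 'h::{real_inner,banach} => 'h"
 assumes "c0_semigroup T" "c0_semigroup U" and L: "nonneg_sa L"
  and genT: "!!f g. ((%t. (1 / t) *\<^sub>R (T t f - f)) \<longlongrightarrow> g) (at_right 0) \<longleftrightarrow> (f, - g) \<in> L"
  and genU: "!!f g. ((%t. (1 / t) *\<^sub>R (U t f - f)) \<longlongrightarrow> g) (at_right 0) \<longleftrightarrow> (f, - g) \<in> L"
  and t: "t \<ge> 0"
 shows "T t x = U t x"
proof -
 interpret T: c0_semigroup T by fact
 interpret U: c0_semigroup U by fact
 have sub: "subspace L" using L subspace_hadj[of L] by (simp add: nonneg_sa_def)
 \<comment> \<open>The domain is invariant because \<open>V s\<close> commutes with the difference
   quotients.\<close>
 have inv: "(V s f, V s g) \<in> L" if "c0_semigroup V" "s \<ge> 0" "(f, g) \<in> L"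
  and gen: "!!f g. ((%t. (1 / t) *\<^sub>R (V t f - f)) \<longlongrightarrow> g) (at_right 0) \<longleftrightarrow> (f, - g) \<in> L" for V s f g
 proof -
  interpret V: c0_semigroup V by fact
  have "((%t. V s ((1 / t) *\<^sub>R (V t f - f))) \<longlongrightarrow> V s (- g)) (at_right 0)"
   using that(2,3) gen by (intro bounded_linear.tendsto[OF V.bounded_linear_T]) auto
  moreover have "eventually (%t. V s ((1 / t) *\<^sub>R (V t f - f)) = (1 / t) *\<^sub>R (V t (V s f) - V s f)) (at_right 0)"
   unfolding eventually_at_filter
  proof (intro always_eventually allI impI)
   fix t :: real assume "t \<in> {0<..}"
   then have "V s (V t f) = V t (V s f)"
    using that(2) V.T_add[of s t f] V.T_add[of t s f] by (simp add: add.commute)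
   then show "V s ((1 / t) *\<^sub>R (V t f - f)) = (1 / t) *\<^sub>R (V t (V s f) - V s f)"
    using that(2) by (simp add: linear_scale[OF V.linear_T] linear_diff[OF V.linear_T])
  qed
  ultimately have "((%t. (1 / t) *\<^sub>R (V t (V s f) - V s f)) \<longlongrightarrow> V s (- g)) (at_right 0)"
   by (rule Lim_transform_eventually)
  then show ?thesis using gen that(2) by (simp add: linear_neg[OF V.linear_T])
 qed
 have eq: "T t f = U t f" if fg: "(f, g) \<in> L" for f g
 proof -
  define w where "w s = T s f - U s f" for s
  define k where "k s = T s g - U s g" for s
  have wk: "(w s, k s) \<in> L" if "s \<ge> 0" for s
   using subspace_diff[OF sub inv[OF assms(1) that fg genT] inv[OF assms(2) that fg genU]]
   by (simp add: w_def k_def)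
  have der: "(w has_vector_derivative - k s) (at s)" if "s > 0" for s
  proof -
   have "(w has_vector_derivative (T s (- g) - U s (- g))) (at s)"
    unfolding w_def using fg genT genU that
    by (intro has_vector_derivative_diff T.has_vector_derivative_T U.has_vector_derivative_T) auto
   then show ?thesis using that by (simp add: k_def linear_neg[OF T.linear_T] linear_neg[OF U.linear_T])
  qed
  have "inner (w t) (w t) \<le> inner (w 0) (w 0)"
  proof (rule DERIV_nonpos_imp_decreasing_open[OF t])
   have c: "continuous_on {0..t} (%s. T s f)" "continuous_on {0..t} (%s. U s f)"
    using T.continuous_on_T U.continuous_on_T continuous_on_subset by (metis Icc_subset_Ici_iff order_refl)+
   show "continuous_on {0..t} (%s. inner (w s) (w s))"
    unfolding w_def by (intro continuous_intros c)
   fix s :: real assume s: "0 < s" "s < t"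
   have "((%s. inner (w s) (w s)) has_derivative (%h. inner (w s) (h *\<^sub>R (- k s)) + inner (h *\<^sub>R (- k s)) (w s))) (at s)"
    using der[OF s(1)] unfolding has_vector_derivative_def by (intro has_derivative_inner)
   then have "((%s. inner (w s) (w s)) has_real_derivative - 2 * inner (k s) (w s)) (at s)"
    unfolding has_field_derivative_def by (rule has_derivative_eq_rhs) (auto simp: inner_commute)
   moreover have "- 2 * inner (k s) (w s) \<le> 0" using L wk[of s] s by (auto simp: nonneg_sa_def)
   ultimately show "\<exists>y. ((%s. inner (w s) (w s)) has_real_derivative y) (at s) \<and> y \<le> 0" by blast
  qed
  also have "w 0 = 0" by (simp add: w_def T.T_0 U.T_0)
  finally have "inner (w t) (w t) = 0" using inner_ge_zero[of "w t"] by simp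
  then show ?thesis by (simp add: w_def)
 qed
 have "closed {y. T t y = U t y}"
  using t by (intro closed_Collect_eq linear_continuous_on T.bounded_linear_T U.bounded_linear_T)
 moreover have "Domain L \<subseteq> {y. T t y = U t y}" using eq by auto
 ultimately have "closure (Domain L) \<subseteq> {y. T t y = U t y}" by (simp add: closure_minimal)
 then show ?thesis using L unfolding nonneg_sa_def by blast
qed

section \<open>The heat semigroup and its quadratic form\<close>

lemma continuous_on_unit_interval_from_bound:
 fixes f :: "real => real"
 assumes c: "continuous_on {0<..1} f" and b: "!!a. 0 < a ==> a \<le> 1 ==> \<bar>f a\<bar> \<le> K * a" and z: "f 0 = 0"
 shows "continuous_on {0..1} f"
 unfolding continuous_on_eq_continuous_within
proof
 fix a :: real assume a: "a \<in> {0..1}"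
 show "continuous (at a within {0..1}) f"
 proof (cases "a = 0")
  case True
  have "(f \<longlongrightarrow> 0) (at 0 within {0..1})"
  proof (rule Lim_null_comparison)
   show "eventually (%x. norm (f x) \<le> K * x) (at 0 within {0..1})"
    unfolding eventually_at_filter by (rule always_eventually) (use b in auto)
   have "((%x. K * x) \<longlongrightarrow> K * 0) (at 0 within {0..1})" by (intro tendsto_intros)
   then show "((%x. K * x) \<longlongrightarrow> 0) (at 0 within {0..1})" by simp
  qed
  then show ?thesis using True z by (simp add: continuous_within)
 next
  case False
  then have "at a within {0..1} = at a within {0<..1}"
   by (intro at_within_nhd[of a "{0<..}"]) (use a in auto)
  then show ?thesis using c a False by (simp add: continuous_on_eq_continuous_within)
 qed
qed

text \<open>With \<open>a = 1 / (1 + %)\<close>, \<open>psi t a\<close> is \<open>exp (- t %)\<close>.\<close>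

definition psi :: "real => real => real" where
 "psi t a = (if a \<le> 0 then 0 else exp (- t * (1 / a - 1)))"

lemma psi_nonneg: "0 \<le> psi t a"
 by (simp add: psi_def)

lemma psi_le_1: "0 \<le> t ==> a \<le> 1 ==> psi t a \<le> 1"
 by (auto simp: psi_def mult_nonneg_nonneg)

lemma psi_mult: "psi s a * psi t a = psi (s + t) a"
 by (auto simp: psi_def exp_add[symmetric] algebra_simps)

lemma psi_antimono: "s \<le> t ==> a \<le> 1 ==> psi t a \<le> psi s a"
 by (auto simp: psi_def mult_right_mono)

text \<open>Quadratic decay at a = 0, from exp u >= u^2 / 2, is what lets psi t a / a and psi t a /
  sqrt a extend continuously to [0,1].\<close>

lemma psi_le_square:
 assumes t: "t > 0" and a: "0 < a" "a \<le> 1"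
 shows "psi t a \<le> (2 * exp t / t^2) * a^2"
proof -
 have "0 \<le> t / a" using t a by simp
 then have "(t / a)^2 / 2 \<le> exp (t / a)"
  using exp_lower_Taylor_quadratic[of "t / a"] by linarith
 then have "exp (- (t / a)) \<le> 2 / (t / a)^2"
  using t a by (simp add: exp_minus inverse_eq_divide field_simps)
 then have "exp t * exp (- (t / a)) \<le> exp t * (2 / (t / a)^2)" by (intro mult_left_mono) auto
 moreover have "psi t a = exp t * exp (- (t / a))"
  using a by (simp add: psi_def exp_add[symmetric] algebra_simps)
 ultimately show ?thesis by (simp add: power_divide mult.commute mult.left_commute)
qed

lemma continuous_on_mult_psi:
 assumes t: "t > 0" and g: "continuous_on {0<..1} g"
  and b: "!!a. 0 < a ==> a \<le> 1 ==> \<bar>g a\<bar> \<le> 1 / a"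
 shows "continuous_on {0..1} (%a. g a * psi t a)"
proof (rule continuous_on_unit_interval_from_bound[where K = "2 * exp t / t^2"])
 have "continuous_on {0<..1} (%a. g a * exp (- t * (1 / a - 1)))"
  by (intro continuous_intros g) auto
 then show "continuous_on {0<..1} (%a. g a * psi t a)"
  by (rule continuous_on_eq) (auto simp: psi_def)
 fix a :: real assume a: "0 < a" "a \<le> 1"
 have "\<bar>g a * psi t a\<bar> \<le> (1 / a) * ((2 * exp t / t^2) * a^2)"
  unfolding abs_mult using a b[OF a] psi_le_square[OF t a] psi_nonneg[of t a]
  by (intro mult_mono) auto
 also have "\<dots> = 2 * exp t / t^2 * a" using a by (simp add: power2_eq_square)
 finally show "\<bar>g a * psi t a\<bar> \<le> 2 * exp t / t^2 * a" .
qed (simp add: psi_def)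

lemma continuous_on_psi: "t > 0 ==> continuous_on {0..1} (psi t)"
 using continuous_on_mult_psi[of t "%_. 1"] by simp

text \<open>With x = t (1/a - 1) one has a x = t (1 - a). The claims are 0 <= 1 - e^(-x) <= x
  multiplied by a, and x - (1 - e^(-x)) <= x^2 multiplied by a^2; these factors compensate the
  growth of x near a = 0.\<close>

lemma mult_one_minus_psi:
 assumes t: "t > 0" and a: "0 \<le> a" "a \<le> 1"
 shows "0 \<le> a * (1 - psi t a)" "a * (1 - psi t a) \<le> t * (1 - a)"
  "a * (t * (1 - a) - a * (1 - psi t a)) \<le> t^2"
proof -
 show "0 \<le> a * (1 - psi t a)" using a psi_le_1[of t a] t by simp
 define x where "x = t * (1 / a - 1)"
 have *: "a * (1 - psi t a) \<le> t * (1 - a) \<and> a * (t * (1 - a) - a * (1 - psi t a)) \<le> t^2"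
 proof (cases "a = 0")
  case True then show ?thesis using t by simp
 next
  case False
  have x: "0 \<le> x" unfolding x_def using False a t by (intro mult_nonneg_nonneg) (auto simp: field_simps)
  have x: "0 \<le> x" "a * x = t * (1 - a)" "psi t a = exp (- x)"
   using x False a t by (auto simp: psi_def x_def right_diff_distrib)
  have e1: "1 - exp (- x) \<le> x" using exp_ge_add_one_self[of "- x"] by simp
  have e2: "x - (1 - exp (- x)) \<le> x^2"
  proof -
   have "exp (- x) * (1 + x) \<le> exp (- x) * exp x" using exp_ge_add_one_self[of x] by (intro mult_left_mono) auto
   also have "\<dots> = 1" by (simp flip: exp_add)
   finally have "exp (- x) \<le> 1 / (1 + x)" using x by (simp add: field_simps)
   also have "\<dots> \<le> 1 - x + x^2" using x by (simp add: field_simps power2_eq_square)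
   finally show ?thesis by simp
  qed
  have "a * (1 - exp (- x)) \<le> a * x" using e1 a by (intro mult_left_mono)
  moreover have "a * (t * (1 - a) - a * (1 - psi t a)) \<le> t^2"
  proof -
   have "a * (t * (1 - a) - a * (1 - psi t a)) = a^2 * (x - (1 - exp (- x)))"
    by (simp add: x flip: x(2)) (simp add: power2_eq_square algebra_simps)
   also have "\<dots> \<le> a^2 * x^2" using e2 by (intro mult_left_mono) auto
   also have "\<dots> = (t * (1 - a))^2" by (simp add: x(2) flip: power_mult_distrib)
   also have "\<dots> \<le> t^2" using a t by (intro power_mono) (auto simp: mult_le_cancel_left1)
   finally show ?thesis .
  qed
  ultimately show ?thesis by (simp add: x)
 qed
 then show "a * (1 - psi t a) \<le> t * (1 - a)" "a * (t * (1 - a) - a * (1 - psi t a)) \<le> t^2" by auto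
qed


context injective_pos_contraction
begin

text \<open>\<open>psi 0\<close> jumps at 0 and has no continuous calculus, hence the separate case.
  Giving nonpositive times the identity keeps contraction and symmetry true for every t.\<close>

definition P :: "real => 'a => 'a" where "P t x = (if t > 0 then fc (psi t) x else x)"

lemma bounded_linear_P: "bounded_linear (P t)"
 unfolding P_def by (cases "t > 0") (auto intro: bounded_linear_fc continuous_on_psi bounded_linear_ident)

lemma linear_P: "linear (P t)"
 by (rule bounded_linear.linear[OF bounded_linear_P])

lemmas P_simps = linear_add[OF linear_P] linear_diff[OF linear_P] linear_scale[OF linear_P] linear_0[OF linear_P]

lemma norm_P_le: "norm (P t x) \<le> norm x"
proof (cases "t > 0")
 case True
 then have "norm (fc (psi t) x) \<le> 1 * norm x"
  by (intro norm_fc_le continuous_on_psi) (auto simp: abs_le_iff psi_le_1 order_trans[OF _ psi_nonneg])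
 then show ?thesis using True by (simp add: P_def)
qed (simp add: P_def)

lemma P_sym: "inner (P t x) y = inner x (P t y)"
 by (cases "t > 0") (auto simp: P_def fc_sym continuous_on_psi)

lemma P_add: "s \<ge> 0 ==> t \<ge> 0 ==> P (s + t) x = P s (P t x)"
 using fc_mult[OF continuous_on_psi continuous_on_psi, of s t x]
 by (cases "s = 0"; cases "t = 0") (auto simp: P_def psi_mult)

lemma fc_mult_A: "continuous_on {0..1} f ==> fc f (A x) = fc (%a. f a * a) x"
 by (simp add: fc_mult continuous_on_id fc_id)

text \<open>On \<open>range A\<close> the difference quotient converges in operator norm by the second-order bound; it is
 bounded everywhere, so it converges strongly.\<close>

lemma quotient_tendsto_A:
 "((%t. (1 / t) *\<^sub>R (P t (A x) - A x)) \<longlongrightarrow> - (x - A x)) (at_right 0)"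
proof -
 define g where "g t a = (1 / t) * (a * (1 - psi t a))" for t a
 have cg: "continuous_on {0..1} (g t)" if "t > 0" for t
  unfolding g_def using that by (intro continuous_intros continuous_on_psi)
 have g: "0 \<le> g t a" "g t a \<le> 1 - a" "\<bar>(g t a - (1 - a)) * a\<bar> \<le> t"
  if "t > 0" "0 \<le> a" "a \<le> 1" for t a
 proof -
  note m = mult_one_minus_psi[OF that]
  show "0 \<le> g t a" using m that by (simp add: g_def)
  show le: "g t a \<le> 1 - a" using m that by (simp add: g_def field_simps)
  have "a * ((1 - a) - g t a) = (1 / t) * (a * (t * (1 - a) - a * (1 - psi t a)))"
   using that by (simp add: g_def right_diff_distrib)
  also have "\<dots> \<le> (1 / t) * t^2" using m(3) that by (intro mult_left_mono) auto
  also have "\<dots> = t" using that by (simp add: power2_eq_square)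
  finally have "a * ((1 - a) - g t a) \<le> t" .
  moreover have "0 \<le> a * ((1 - a) - g t a)" using le that by simp
  moreover have "\<bar>(g t a - (1 - a)) * a\<bar> = a * ((1 - a) - g t a)"
   using le that by (simp add: abs_mult mult.commute)
  ultimately show "\<bar>(g t a - (1 - a)) * a\<bar> \<le> t" by simp
 qed
 have rep: "(1 / t) *\<^sub>R (P t (A x) - A x) = - fc (g t) x" if "t > 0" for t x
 proof -
  have c: "continuous_on {0..1} (%a. a * (1 - psi t a))"
   "continuous_on {0..1} (%a. psi t a * a)" "continuous_on {0..1} (%a::real. a)"
   using that by (auto intro!: continuous_intros continuous_on_psi)
  have "fc (g t) x = (1 / t) *\<^sub>R fc (%a. a * (1 - psi t a)) x"
   unfolding g_def by (rule fc_scale[OF c(1)])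
  also have "fc (%a. a * (1 - psi t a)) x = fc (%a. a - psi t a * a) x"
   by (rule fc_cong) (simp add: algebra_simps)
  also have "\<dots> = A x - P t (A x)"
   using fc_diff[OF c(3) c(2), of x] that by (simp add: fc_id P_def fc_mult_A continuous_on_psi)
  finally show ?thesis by (simp add: algebra_simps)
 qed
 have "((%t. if t > 0 then fc (g t) x else 0) \<longlongrightarrow> x - A x) (at_right 0)"
 proof (rule tendsto_of_dense[where D = "range A" and M = 1 and S = "%x. x - A x"
    and T = "%t x. if t > 0 then fc (g t) x else 0"])
  show "linear (%x. if t > 0 then fc (g t) x else 0)" for t
   using linear_fc[OF cg, of t] by (cases "t > 0") (auto simp: linear_iff)
  show "linear (%x. x - A x)"
   by (intro linear_compose_sub linear_ident linear_A)
  show "eventually (%t. \<forall>x. norm (if t > 0 then fc (g t) x else 0) \<le> 1 * norm x) (at_right 0)"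
  proof (intro always_eventually allI)
   fix t x
   show "norm (if t > 0 then fc (g t) x else 0) \<le> 1 * norm x"
   proof (cases "t > 0")
    case True
    have "norm (fc (g t) x) \<le> 1 * norm x"
    proof (rule norm_fc_le[OF cg[OF True]])
     fix a :: real assume a: "0 \<le> a" "a \<le> 1"
     show "\<bar>g t a\<bar> \<le> 1" using g(1,2)[OF True a] a by linarith
    qed
    then show ?thesis using True by simp
   qed simp
  qed
  show "norm (x - A x) \<le> 1 * norm x" for x
  proof -
   have "norm (fc (%a. 1 - a) x) \<le> 1 * norm x"
    by (rule norm_fc_le) (auto intro!: continuous_intros)
   moreover have "fc (%a. 1 - a) x = x - A x"
    using fc_diff[of "%a. 1" "%a. a"] by (simp add: fc_1 fc_id continuous_on_id)
   ultimately show ?thesis by simp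
  qed
  show "closure (range A) = UNIV" by (rule dense_range_A)
  fix y assume "y \<in> range A"
  then obtain z where y: "y = A z" by auto
  have "((%t. fc (g t) y - (y - A y)) \<longlongrightarrow> 0) (at_right 0)"
  proof (rule Lim_null_comparison)
   show "eventually (%t. norm (fc (g t) y - (y - A y)) \<le> t * norm z) (at_right 0)"
    unfolding eventually_at_filter
   proof (intro always_eventually allI impI)
    fix t :: real assume "t \<in> {0<..}"
    then have t: "t > 0" by simp
    have c: "continuous_on {0..1} (%a. g t a - (1 - a))" "continuous_on {0..1} (%a::real. 1 - a)"
     by (auto intro!: continuous_intros cg[OF t])
    have "fc (g t) y - (y - A y) = fc (%a. g t a - (1 - a)) y"
     using fc_diff[OF cg[OF t] c(2), of y] fc_diff[of "%a. 1" "%a. a" y]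
     by (simp add: fc_1 fc_id continuous_on_id)
    also have "\<dots> = fc (%a. (g t a - (1 - a)) * a) z" unfolding y by (rule fc_mult_A[OF c(1)])
    also have "norm \<dots> \<le> t * norm z"
     by (intro norm_fc_le continuous_intros c g(3)[OF t])
    finally show "norm (fc (g t) y - (y - A y)) \<le> t * norm z" .
   qed
   have "((%t. t * norm z) \<longlongrightarrow> 0 * norm z) (at_right 0)" by (intro tendsto_intros)
   then show "((%t. t * norm z) \<longlongrightarrow> 0) (at_right 0)" by simp
  qed
  then have "((%t. fc (g t) y) \<longlongrightarrow> y - A y) (at_right 0)" by (rule LIM_zero_cancel)
  then show "((%t. if t > 0 then fc (g t) y else 0) \<longlongrightarrow> y - A y) (at_right 0)"
   by (rule Lim_transform_eventually) (auto simp: eventually_at_filter)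
 qed
 then have "((%t. - (if t > 0 then fc (g t) x else 0)) \<longlongrightarrow> - (x - A x)) (at_right 0)"
  by (rule tendsto_minus)
 then show ?thesis
  by (rule Lim_transform_eventually) (auto simp: eventually_at_filter rep)
qed

lemma c0_semigroup_P: "c0_semigroup P"
proof (rule c0_semigroup.intro)
 show "bounded_linear (P t)" for t by (rule bounded_linear_P)
 show "P 0 x = x" for x by (simp add: P_def)
 show "P (s + t) x = P s (P t x)" if "s \<ge> 0" "t \<ge> 0" for s t x using that by (rule P_add)
 show "((%t. P t x) \<longlongrightarrow> x) (at_right 0)" for x
 proof (rule tendsto_of_dense[where D = "range A" and M = 1 and T = P and S = "%x. x"])
  show "linear (P t)" for t by (rule linear_P)
  show "linear (%x::'a. x)" by (rule linear_ident)
  show "eventually (%t. \<forall>x. norm (P t x) \<le> 1 * norm x) (at_right 0)"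
   by (simp add: norm_P_le)
  show "closure (range A) = UNIV" by (rule dense_range_A)
  fix y assume "y \<in> range A"
  then obtain z where y: "y = A z" by auto
  have "((%t. t *\<^sub>R ((1 / t) *\<^sub>R (P t (A z) - A z)) + A z) \<longlongrightarrow> 0 *\<^sub>R (- (z - A z)) + A z) (at_right 0)"
   by (intro tendsto_intros quotient_tendsto_A)
  then have "((%t. t *\<^sub>R ((1 / t) *\<^sub>R (P t (A z) - A z)) + A z) \<longlongrightarrow> y) (at_right 0)"
   by (simp add: y)
  then show "((%t. P t y) \<longlongrightarrow> y) (at_right 0)"
   by (rule Lim_transform_eventually) (auto simp: eventually_at_filter y)
 qed simp
qed

sublocale P: c0_semigroup P by (rule c0_semigroup_P)

lemma hadj_Lrel: "hadj Lrel = Lrel"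
proof (intro equalityI subrelI)
 fix g k assume gk: "(g, k) \<in> hadj Lrel"
 have "inner h (g - A g) = inner h (A k)" for h
  using hadjD[OF gk, of "A h" "h - A h"] by (simp add: Lrel_def inner_diff sym_A)
 then have "g - A g = A k" by (metis vector_eq_rdot inner_commute)
 then have "g = A (g + k)" by (simp add: A_simps algebra_simps)
 moreover have "k = (g + k) - A (g + k)" using calculation by (simp add: algebra_simps)
 ultimately show "(g, k) \<in> Lrel" unfolding Lrel_def by (intro image_eqI[of _ _ "g + k"]) auto
next
 fix g k assume "(g, k) \<in> Lrel"
 then show "(g, k) \<in> hadj Lrel" by (auto simp: Lrel_def hadj_def inner_diff sym_A A_simps)
qed

text \<open>From the limit to the relation, maximality is used: symmetry of \<open>P\<close> puts
  the limiting pair into the adjoint of \<open>Lrel\<close>, which is \<open>Lrel\<close>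
  itself.\<close>

lemma generator_P: "((%t. (1 / t) *\<^sub>R (P t f - f)) \<longlongrightarrow> g) (at_right 0) \<longleftrightarrow> (f, - g) \<in> Lrel"
proof
 assume "(f, - g) \<in> Lrel"
 then obtain z where "f = A z" "- g = z - A z" by (auto simp: Lrel_def)
 then show "((%t. (1 / t) *\<^sub>R (P t f - f)) \<longlongrightarrow> g) (at_right 0)"
  using quotient_tendsto_A[of z] by (metis add.inverse_inverse)
next
 assume lim: "((%t. (1 / t) *\<^sub>R (P t f - f)) \<longlongrightarrow> g) (at_right 0)"
 have "(f, - g) \<in> hadj Lrel"
 proof (rule hadjI)
  fix u w assume "(u, w) \<in> Lrel"
  then obtain z where z: "u = A z" "w = z - A z" by (auto simp: Lrel_def)
  have "((%t. inner ((1 / t) *\<^sub>R (P t f - f)) u) \<longlongrightarrow> inner g u) (at_right 0)"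
   by (intro tendsto_intros lim)
  moreover have "((%t. inner f ((1 / t) *\<^sub>R (P t u - u))) \<longlongrightarrow> inner f (- w)) (at_right 0)"
   unfolding z by (intro tendsto_intros quotient_tendsto_A)
  moreover have "(%t. inner ((1 / t) *\<^sub>R (P t f - f)) u) = (%t. inner f ((1 / t) *\<^sub>R (P t u - u)))"
   by (simp add: inner_diff P_sym fun_eq_iff)
  ultimately have "inner g u = inner f (- w)"
   by (simp only:) (rule tendsto_unique[of "at_right (0::real)"], auto)
  then show "inner w f = inner u (- g)" by (simp add: inner_commute)
 qed
 then show "(f, - g) \<in> Lrel" by (simp add: hadj_Lrel)
qed

lemma nonneg_sa_Lrel: "nonneg_sa Lrel"
proof -
 have "Domain Lrel = range A" by (auto simp: Lrel_def)
 moreover have "0 \<le> inner (h - A h) (A h)" for h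
 proof -
  have "inner (h - A h) (A h) = inner (B (B h)) (C (C h))" by (simp only: BB CC)
  also have "\<dots> = inner (C (B (B h))) (C h)" by (simp only: C_sym)
  also have "C (B (B h)) = B (B (C h))" by (simp only: BC)
  also have "inner (B (B (C h))) (C h) = inner (B (C h)) (B (C h))" by (rule B_sym)
  finally show ?thesis by simp
 qed
 ultimately show ?thesis
  unfolding nonneg_sa_def using dense_range_A hadj_Lrel by (auto simp: Lrel_def)
qed

lemma semigroup_eq_P:
 assumes "c0_semigroup T"
  and "!!f g. ((%t. (1 / t) *\<^sub>R (T t f - f)) \<longlongrightarrow> g) (at_right 0) \<longleftrightarrow> (f, - g) \<in> Lrel" and "t \<ge> 0"
 shows "T t x = P t x"
 by (rule c0_semigroup_unique[OF assms(1) c0_semigroup_P nonneg_sa_Lrel assms(2) generator_P assms(3)])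

subsection \<open>The quadratic form\<close>

text \<open>\<open>D\<close> is the domain of L^(1/2), and B C^(-1) is L^(1/2), so \<open>E\<close>
  is the form of L; the norm of \<open>Ci f\<close> is the form norm. \<open>Et t\<close> is the
  bounded approximating form <f - P_t f, g> / t.\<close>

definition D :: "'a set" where "D = range C"
definition Ci :: "'a => 'a" where "Ci = inv C"
definition E :: "'a => 'a => real" where "E f g = inner (B (Ci f)) (B (Ci g))"
definition Et :: "real => 'a => 'a => real" where "Et t f g = (inner f g - inner (P t f) g) / t"

lemma Ci_C [simp]: "Ci (C h) = h"
 unfolding Ci_def by (rule inv_f_f) (auto simp: inj_def C_eq_iff)

lemma C_Ci [simp]: "f \<in> D ==> C (Ci f) = f"
 by (auto simp: D_def)

lemma C_in_D [simp]: "C h \<in> D"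
 by (simp add: D_def)

lemma subspace_D: "subspace D"
 unfolding D_def using linear_C by (simp add: linear_subspace_image)

lemma D_add [simp]: "f \<in> D ==> g \<in> D ==> f + g \<in> D"
 and D_diff [simp]: "f \<in> D ==> g \<in> D ==> f - g \<in> D"
 and D_scale [simp]: "f \<in> D ==> c *\<^sub>R f \<in> D"
 and D_0 [simp]: "0 \<in> D"
 using subspace_D by (auto simp: subspace_add subspace_diff subspace_scale subspace_0)

lemma Ci_add: "f \<in> D ==> g \<in> D ==> Ci (f + g) = Ci f + Ci g"
 and Ci_diff: "f \<in> D ==> g \<in> D ==> Ci (f - g) = Ci f - Ci g"
 and Ci_scale: "f \<in> D ==> Ci (c *\<^sub>R f) = c *\<^sub>R Ci f"
 by (auto simp: D_def C_simps(1)[symmetric] C_simps(2)[symmetric] C_simps(3)[symmetric])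

lemma E_sym: "E f g = E g f"
 by (simp add: E_def inner_commute)

lemma E_add: "f \<in> D ==> g \<in> D ==> E (f + g) h = E f h + E g h"
 and E_diff: "f \<in> D ==> g \<in> D ==> E (f - g) h = E f h - E g h"
 and E_scale: "f \<in> D ==> E (c *\<^sub>R f) h = c * E f h"
 by (simp_all add: E_def Ci_add Ci_diff Ci_scale B_simps inner_add inner_diff)

lemma E_add_right: "f \<in> D ==> g \<in> D ==> E h (f + g) = E h f + E h g"
 and E_diff_right: "f \<in> D ==> g \<in> D ==> E h (f - g) = E h f - E h g"
 and E_scale_right: "f \<in> D ==> E h (c *\<^sub>R f) = c * E h f"
 using E_add E_diff E_scale E_sym by simp_all

lemma E_nonneg: "0 \<le> E f f"
 by (simp add: E_def)

lemma E_C: "E (C h) (C k) = inner h k - inner (C h) (C k)"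
 by (simp add: E_def B_sym BB C_sym CC inner_diff inner_commute)

lemma form_inner: "f \<in> D ==> g \<in> D ==> E f g + inner f g = inner (Ci f) (Ci g)"
 using E_C[of "Ci f" "Ci g"] by simp

lemma form_norm: "f \<in> D ==> E f f + (norm f)^2 = (norm (Ci f))^2"
 using form_inner[of f f] by (simp add: power2_norm_eq_inner)

lemma E_Cauchy_Schwarz: "(E f g)^2 \<le> E f f * E g g"
 unfolding E_def by (rule Cauchy_Schwarz_ineq)

text \<open>Moving one root \<open>C\<close> across the inner product turns the approximating form
  on \<open>D\<close> into a difference quotient on the range of \<open>A\<close>, where the limit
  is known.\<close>

lemma Et_C: "t > 0 ==> Et t (C h) (C k) = - inner ((1 / t) *\<^sub>R (P t (A h) - A h)) k"
proof -
 assume t: "t > 0"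
 have "C (P t (C h)) = P t (A h)"
  using t fc_commute[OF cont_sqrt continuous_on_psi[OF t], of "C h"] by (simp add: P_def C_def flip: CC)
 then have "inner (P t (C h)) (C k) = inner (P t (A h)) k" by (simp flip: C_sym)
 moreover have "inner (C h) (C k) = inner (A h) k" by (simp flip: C_sym CC)
 ultimately show ?thesis by (simp add: Et_def inner_diff diff_divide_distrib)
qed

lemma Et_tendsto:
 assumes "f \<in> D" "g \<in> D"
 shows "((%t. Et t f g) \<longlongrightarrow> E f g) (at_right 0)"
proof -
 obtain h k where hk: "f = C h" "g = C k" using assms by (auto simp: D_def)
 have "((%t. - inner ((1 / t) *\<^sub>R (P t (A h) - A h)) k) \<longlongrightarrow> - inner (- (h - A h)) k) (at_right 0)"
  by (intro tendsto_intros quotient_tendsto_A)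
 moreover have "- inner (- (h - A h)) k = E f g"
  by (simp add: hk E_C inner_diff C_sym CC inner_commute[of k] sym_A)
 ultimately have "((%t. - inner ((1 / t) *\<^sub>R (P t (A h) - A h)) k) \<longlongrightarrow> E f g) (at_right 0)" by simp
 then show ?thesis
  by (rule Lim_transform_eventually) (auto simp: eventually_at_filter hk Et_C)
qed

text \<open>In the parameter h this is the scalar inequality a (1 - psi t a) <= t (1 - a).\<close>

lemma Et_le_E:
 assumes t: "t > 0" and f: "f \<in> D"
 shows "Et t f f \<le> E f f"
proof -
 obtain h where h: "f = C h" using f by (auto simp: D_def)
 have c: "continuous_on {0..1} (%a. a - psi t a * a)" "continuous_on {0..1} (%a. psi t a * a)"
  using t by (auto intro!: continuous_intros continuous_on_psi)
 have c2: "continuous_on {0..1} (%a. t * (1 - a))" "continuous_on {0..1} (%a::real. 1 - a)"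
  by (intro continuous_intros)+
 have "inner (fc (%a. a - psi t a * a) h) h \<le> inner (fc (%a. t * (1 - a)) h) h"
  using mult_one_minus_psi(2)[OF t] by (intro fc_mono c c2) (simp add: algebra_simps)
 also have "fc (%a. t * (1 - a)) h = t *\<^sub>R (h - A h)"
  using fc_scale[OF c2(2), of t h] fc_diff[of "%a. 1" "%a. a" h] by (simp add: fc_1 fc_id continuous_on_id)
 also have "fc (%a. a - psi t a * a) h = A h - P t (A h)"
  using fc_diff[OF continuous_on_id c(2), of h] t by (simp add: fc_id P_def fc_mult_A continuous_on_psi)
 finally have "inner (A h - P t (A h)) h \<le> t * inner (h - A h) h" by simp
 moreover have "inner (h - A h) h = E f f" by (simp add: h E_C inner_diff C_sym CC sym_A)
 ultimately have "inner (A h - P t (A h)) h / t \<le> E f f" using t by (simp add: divide_le_eq mult.commute)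
 moreover have "Et t f f = inner (A h - P t (A h)) h / t"
  using Et_C[OF t, of h h] by (simp add: h inner_diff diff_divide_distrib)
 ultimately show ?thesis by simp
qed

lemma square_diff_le_diff_squares: "0 \<le> y ==> y \<le> x ==> (x - y)\<^sup>2 \<le> x^2 - (y::real)^2"
proof -
 assume "0 \<le> y" "y \<le> x"
 then have "y * y \<le> x * y" by (intro mult_right_mono)
 then show ?thesis by (simp add: power2_eq_square algebra_simps)
qed

text \<open>The functions \<open>P s f\<close> are Cauchy in the form norm as \<open>s\<close> tends to 0, because their form norms are
 bounded and increasing.\<close>

lemma in_D_of_Et_bounded:
 assumes bd: "!!t. t > 0 ==> Et t f f \<le> M"
 shows "f \<in> D" "E f f \<le> M"
proof -
 \<comment> \<open>\<open>k s\<close> will be the preimage of P_s f under \<open>C\<close>, so its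
   norm is the form norm of P_s f.\<close>
 define F where "F s a = (1 / sqrt a) * psi s a" for s a
 define k where "k s = fc (F s) f" for s
 have cF: "continuous_on {0..1} (F s)" if "s > 0" for s
  unfolding F_def
 proof (rule continuous_on_mult_psi[OF that])
  show "continuous_on {0<..1} (%a. 1 / sqrt a)" by (intro continuous_intros) auto
  fix a :: real assume a: "0 < a" "a \<le> 1"
  have "sqrt a * sqrt a \<le> sqrt a * 1" using a by (intro mult_left_mono) auto
  then have "a \<le> sqrt a" using a by simp
  then show "\<bar>1 / sqrt a\<bar> \<le> 1 / a" using a by (simp add: frac_le)
 qed
 have Ck: "C (k s) = P s f" if "s > 0" for s
 proof -
  have "C (k s) = fc (psi s) f"
   unfolding C_def k_def by (intro fc_mult_eq cont_sqrt cF that) (auto simp: F_def psi_def)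
  then show ?thesis using that by (simp add: P_def)
 qed
 have Bk: "inner (B (k s)) (B (k s)) \<le> M" if s: "s > 0" for s
 proof -
  have "B (B (k s)) = fc (%a. 1 - a) (k s)"
   using fc_diff[of "%a. 1" "%a. a" "k s"] by (simp add: BB fc_1 fc_id continuous_on_id)
  also have "\<dots> = fc (%a. (1 - a) * F s a) f"
   unfolding k_def by (rule fc_mult[symmetric]) (auto intro!: continuous_intros cF[OF s])
  finally have "inner (B (k s)) (B (k s)) = inner (fc (F s) (fc (%a. (1 - a) * F s a) f)) f"
   using fc_sym[OF cF[OF s], of "fc (%a. (1 - a) * F s a) f" f] by (simp add: B_sym k_def inner_commute)
  also have "fc (F s) (fc (%a. (1 - a) * F s a) f) = fc (%a. F s a * ((1 - a) * F s a)) f"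
   by (rule fc_mult[symmetric]) (auto intro!: continuous_intros cF[OF s])
  also have "inner \<dots> f \<le> inner (fc (%a. (1 / (2 * s)) * (1 - psi (2 * s) a)) f) f"
  proof (rule fc_mono)
   show "continuous_on {0..1} (%a. F s a * ((1 - a) * F s a))" by (intro continuous_intros cF[OF s])
   show "continuous_on {0..1} (%a. (1 / (2 * s)) * (1 - psi (2 * s) a))"
    using s by (intro continuous_intros continuous_on_psi) auto
   fix a :: real assume a: "0 \<le> a" "a \<le> 1"
   \<comment> \<open>With x = 2 s (1/a - 1) this is x e^(-x) <= 1 - e^(-x). It bounds the energy of
     P_s f by the approximating form at time 2 s.\<close>
   show "F s a * ((1 - a) * F s a) \<le> (1 / (2 * s)) * (1 - psi (2 * s) a)"
   proof (cases "a = 0")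
    case True then show ?thesis using s by (simp add: F_def psi_def)
   next
    case False
    then have a0: "a > 0" using a by simp
    define x where "x = 2 * s * (1 / a - 1)"
    have p: "psi (2 * s) a = exp (- x)" using a0 by (simp add: psi_def x_def)
    have "exp (- x) * (1 + x) \<le> exp (- x) * exp x" using exp_ge_add_one_self[of x] by (intro mult_left_mono) auto
    also have "\<dots> = 1" by (simp flip: exp_add)
    finally have xe: "x * exp (- x) \<le> 1 - exp (- x)" by (simp add: algebra_simps)
    have "F s a * ((1 - a) * F s a) = ((1 - a) / a) * (psi s a * psi s a)"
     using a0 by (simp add: F_def field_simps real_sqrt_mult_self)
    also have "\<dots> = (1 / (2 * s)) * (x * exp (- x))"
     using a0 s by (simp add: psi_mult p[symmetric]) (simp add: x_def field_simps)
    also have "\<dots> \<le> (1 / (2 * s)) * (1 - exp (- x))" using xe s by (intro mult_left_mono) auto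
    finally show ?thesis by (simp add: p)
   qed
  qed
  also have "fc (%a. (1 / (2 * s)) * (1 - psi (2 * s) a)) f = (1 / (2 * s)) *\<^sub>R (f - P (2 * s) f)"
   using s fc_scale[of "%a. 1 - psi (2 * s) a" "1 / (2 * s)" f] fc_diff[of "%a. 1" "psi (2 * s)" f]
   by (simp add: fc_1 P_def continuous_on_psi continuous_on_diff)
  also have "inner \<dots> f = Et (2 * s) f f" by (simp add: Et_def inner_diff)
  also have "\<dots> \<le> M" using s by (intro bd) simp
  finally show ?thesis .
 qed
 define N where "N s = (norm (k s))^2" for s
 have Nb: "N s \<le> M + (norm f)^2" if "s > 0" for s
 proof -
  have "N s = inner (B (k s)) (B (k s)) + (norm (C (k s)))^2"
   by (simp add: N_def power2_norm_eq_inner B_sym BB C_sym CC inner_diff)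
  also have "norm (C (k s)) \<le> norm f" using that by (simp add: Ck norm_P_le)
  then have "(norm (C (k s)))^2 \<le> (norm f)^2" by (intro power_mono) auto
  finally show ?thesis using Bk[OF that] by linarith
 qed
 have fcsq: "(norm (fc G f))^2 = inner (fc (%a. (G a)^2) f) f" if "continuous_on {0..1} G" for G
  using fc_mult[OF that that, of f] fc_sym[OF that, of "fc G f" f]
  unfolding power2_norm_eq_inner by (simp add: power2_eq_square)
 \<comment> \<open>\<open>F s\<close> decreases in s, and (x - y)^2 <= x^2 - y^2 for 0 <= y <= x;
   convergence of the monotone bounded numbers \<open>N\<close> then makes \<open>k\<close>
   Cauchy.\<close>
 have diff: "(norm (k s - k r))^2 \<le> N s - N r" if "0 < s" "s \<le> r" for s r
 proof -
  have r: "0 < r" using that by simp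
  note c = cF[OF that(1)] cF[OF r]
  have "k s - k r = fc (%a. F s a - F r a) f"
   unfolding k_def using fc_diff[OF c] by simp
  then have "(norm (k s - k r))^2 = inner (fc (%a. (F s a - F r a)^2) f) f"
   using fcsq[of "%a. F s a - F r a"] c by (simp add: continuous_on_diff)
  also have "\<dots> \<le> inner (fc (%a. (F s a)^2 - (F r a)^2) f) f"
  proof (rule fc_mono)
   fix a :: real assume a: "0 \<le> a" "a \<le> 1"
   show "(F s a - F r a)^2 \<le> (F s a)^2 - (F r a)^2"
   proof (rule square_diff_le_diff_squares)
    show "0 \<le> F r a" using a psi_nonneg[of r a] by (simp add: F_def)
    show "F r a \<le> F s a" unfolding F_def
     using a psi_antimono[OF that(2)] by (intro mult_left_mono) auto
   qed
  qed (intro continuous_intros c)+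
  also have "\<dots> = N s - N r"
   using fc_diff[of "%a. (F s a)^2" "%a. (F r a)^2" f] fcsq[OF c(1)] fcsq[OF c(2)] c
   by (simp add: N_def k_def inner_diff continuous_on_power)
  finally show ?thesis .
 qed
 define s where "s n = 1 / real (Suc n)" for n
 have s0: "s n > 0" for n by (simp add: s_def)
 have smono: "s n \<le> s m" if "m \<le> n" for m n using that by (simp add: s_def frac_le)
 have "convergent (%n. N (s n))"
 proof (rule Bseq_mono_convergent)
  show "Bseq (%n. N (s n))"
   by (rule BseqI'[of _ "M + (norm f)^2"]) (use Nb[OF s0] in \<open>simp add: N_def\<close>)
  show "\<forall>m n. m \<le> n \<longrightarrow> N (s m) \<le> N (s n)"
   using diff[OF s0 smono] by (smt (verit) zero_le_power2)
 qed
 then have cauchyN: "Cauchy (%n. N (s n))" by (rule convergent_Cauchy)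
 have "Cauchy (%n. k (s n))"
 proof (rule metric_CauchyI)
  fix e :: real assume e: "0 < e"
  then have "e^2 > 0" by simp
  then obtain n0 where n0: "!!m n. m \<ge> n0 ==> n \<ge> n0 ==> dist (N (s m)) (N (s n)) < e^2"
   using cauchyN by (meson metric_CauchyD)
  have *: "dist (k (s n)) (k (s m)) < e" if "m \<ge> n0" "m \<le> n" for m n
  proof -
   have "(norm (k (s n) - k (s m)))^2 \<le> N (s n) - N (s m)" by (rule diff[OF s0 smono[OF that(2)]])
   also have "\<dots> < e^2" using n0[of n m] that by (auto simp: dist_real_def)
   finally show ?thesis using e by (simp add: dist_norm power_less_imp_less_base)
  qed
  show "\<exists>M. \<forall>m\<ge>M. \<forall>n\<ge>M. dist (k (s m)) (k (s n)) < e"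
  proof (intro exI allI impI)
   fix m n assume "n0 \<le> m" "n0 \<le> n"
   then show "dist (k (s m)) (k (s n)) < e"
    using *[of m n] *[of n m] by (cases "m \<le> n") (auto simp: dist_commute)
  qed
 qed
 then obtain l where l: "(%n. k (s n)) \<longlonglongrightarrow> l" by (auto simp: Cauchy_convergent_iff convergent_def)
 have "(%n. C (k (s n))) \<longlonglongrightarrow> C l" by (rule bounded_linear.tendsto[OF bounded_linear_C l])
 moreover have "(%n. C (k (s n))) \<longlonglongrightarrow> f"
 proof -
  have "filterlim s (at_right 0) sequentially"
   unfolding filterlim_at using s0 LIMSEQ_inverse_real_of_nat
   by (auto simp: s_def[abs_def] inverse_eq_divide intro!: always_eventually)
  from filterlim_compose[OF P.T_tendsto this] show ?thesis by (simp add: Ck[OF s0])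
 qed
 ultimately have fl: "f = C l" using LIMSEQ_unique by blast
 then show "f \<in> D" by simp
 have "(%n. inner (B (k (s n))) (B (k (s n)))) \<longlonglongrightarrow> inner (B l) (B l)"
  by (intro tendsto_intros bounded_linear.tendsto[OF bounded_linear_B l])
 then have "inner (B l) (B l) \<le> M" by (rule LIMSEQ_le_const2) (use Bk[OF s0] in blast)
 then show "E f f \<le> M" by (simp add: fl E_def)
qed

text \<open>The approximating forms are continuous in norm, which gives lower semicontinuity of
  \<open>E\<close>. The vectors Ci (f n) are bounded, and tested on the dense range of
  \<open>C\<close> they converge because symmetry of \<open>C\<close> removes \<open>Ci\<close>;
  hence they converge weakly.\<close>

lemma form_limit:
 assumes fD: "!!n. f n \<in> D" and bd: "!!n. E (f n) (f n) \<le> M" and lim: "f \<longlonglongrightarrow> g"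
 shows "g \<in> D" "E g g \<le> M" "h \<in> D ==> (%n. E (f n) h) \<longlonglongrightarrow> E g h"
proof -
 have "Et t g g \<le> M" if "t > 0" for t
 proof -
  have "(%n. Et t (f n) (f n)) \<longlonglongrightarrow> Et t g g"
   unfolding Et_def using that
   by (intro tendsto_intros bounded_linear.tendsto[OF bounded_linear_P] lim) auto
  moreover have "Et t (f n) (f n) \<le> M" for n using Et_le_E[OF that fD[of n]] bd[of n] by linarith
  ultimately show ?thesis by (intro LIMSEQ_le_const2) auto
 qed
 then show gD: "g \<in> D" and "E g g \<le> M" using in_D_of_Et_bounded[of g M] by blast+
 have nb: "bounded (range f)" using lim by (rule convergent_imp_bounded)
 then obtain b where b: "!!n. norm (f n) \<le> b" by (auto simp: bounded_iff)
 define K where "K = sqrt (M + b^2) + norm (Ci g)"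
 have K: "norm (Ci (f n)) \<le> K" for n
 proof -
  have "(norm (Ci (f n)))^2 = E (f n) (f n) + (norm (f n))^2" using form_norm[OF fD[of n]] by simp
  also have "\<dots> \<le> M + b^2" using bd[of n] b[of n] by (intro add_mono power_mono) auto
  finally have "norm (Ci (f n)) \<le> sqrt (M + b^2)" by (rule real_le_rsqrt)
  then show ?thesis using norm_ge_zero[of "Ci g"] unfolding K_def by linarith
 qed
 have K2: "norm (Ci g) \<le> K"
 proof -
  have "0 \<le> M" using bd[of 0] E_nonneg[of "f 0"] by linarith
  then show ?thesis unfolding K_def by simp
 qed
 have "(%n. inner (Ci (f n)) y) \<longlonglongrightarrow> inner (Ci g) y" for y
 proof (rule tendsto_of_dense[where D = "range C" and M = K and T = "%n. inner (Ci (f n))" and S = "inner (Ci g)"])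
  show "linear (inner (Ci (f n)))" for n by (rule linearI) (auto simp: inner_add)
  show "linear (inner (Ci g))" by (rule linearI) (auto simp: inner_add)
  show "eventually (%n. \<forall>x. norm (inner (Ci (f n)) x) \<le> K * norm x) sequentially"
  proof (intro always_eventually allI)
   fix n x
   have "\<bar>inner (Ci (f n)) x\<bar> \<le> norm (Ci (f n)) * norm x" by (rule Cauchy_Schwarz_ineq2)
   also have "\<dots> \<le> K * norm x" using K by (intro mult_right_mono) auto
   finally show "norm (inner (Ci (f n)) x) \<le> K * norm x" by simp
  qed
  show "norm (inner (Ci g) x) \<le> K * norm x" for x
  proof -
   have "\<bar>inner (Ci g) x\<bar> \<le> norm (Ci g) * norm x" by (rule Cauchy_Schwarz_ineq2)
   also have "\<dots> \<le> K * norm x" using K2 by (intro mult_right_mono) auto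
   finally show ?thesis by simp
  qed
  fix x assume "x \<in> range C"
  then obtain z where z: "x = C z" by auto
  have "(%n. inner (f n) z) \<longlonglongrightarrow> inner g z" by (intro tendsto_intros lim)
  moreover have "inner (Ci (f n)) x = inner (f n) z" for n
   using C_sym[of "Ci (f n)" z] fD[of n] by (simp add: z)
  moreover have "inner (Ci g) x = inner g z" using C_sym[of "Ci g" z] gD by (simp add: z)
  ultimately show "(%n. inner (Ci (f n)) x) \<longlonglongrightarrow> inner (Ci g) x" by simp
 qed (rule dense_range_C)
 note weak = this
 assume h: "h \<in> D"
 have "(%n. inner (Ci (f n)) (Ci h) - inner (f n) h) \<longlonglongrightarrow> inner (Ci g) (Ci h) - inner g h"
  by (intro tendsto_intros weak lim)
 moreover have "inner (Ci (f n)) (Ci h) - inner (f n) h = E (f n) h" for n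
  using form_inner[OF fD h, of n] by simp
 moreover have "inner (Ci g) (Ci h) - inner g h = E g h" using form_inner[OF gD h] by simp
 ultimately show "(%n. E (f n) h) \<longlonglongrightarrow> E g h" by simp
qed

lemma
 assumes t: "t > 0"
 shows P_in_D: "P t f \<in> D"
  and has_derivative_P: "\<exists>w. ((%s. P s f) has_vector_derivative - w) (at t) \<and> (\<forall>g\<in>D. inner w g = E (P t f) g)"
proof -
 define s where "s = t / 2"
 have s: "s > 0" "t - s = s" using t by (auto simp: s_def)
 \<comment> \<open>psi s a / a is continuous, so P_s f lies in the range of \<open>A\<close>, the
   domain of L. Half of the time is spent on this regularisation, the other half on
   differentiating.\<close>
 define z where "z = fc (%a. (1 / a) * psi s a) f"
 have c: "continuous_on {0..1} (%a. (1 / a) * psi s a)"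
  by (rule continuous_on_mult_psi[OF s(1)]) (auto intro!: continuous_intros)
 have Az: "A z = P s f"
  unfolding z_def using s fc_mult_eq[OF continuous_on_id c, of "psi s" f]
  by (simp add: P_def fc_id) (simp add: psi_def)
 define y where "y = P s z"
 have PA: "P s (A x) = A (P s x)" for x
  using fc_commute[OF continuous_on_psi[OF s(1)] continuous_on_id, of x] s by (simp add: P_def fc_id)
 have Ptf: "P t f = A y"
  using P_add[of s s f] s Az PA[of z] by (simp add: y_def s_def)
 then show "P t f \<in> D" by (simp add: D_def flip: CC)
 have d: "((%r. P r (A z)) has_vector_derivative P s (- (z - A z))) (at s)"
  by (rule P.has_vector_derivative_T[OF quotient_tendsto_A s(1)])
 have "((%r. P (r - s) (A z)) has_vector_derivative P s (- (z - A z))) (at t)"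
 proof -
  have "((%r. r - s) has_vector_derivative 1) (at t)" by (auto intro!: derivative_eq_intros)
  from vector_diff_chain_at[OF this, of "%r. P r (A z)"] d show ?thesis
   by (simp add: s(2) o_def)
 qed
 then have "((%r. P r f) has_vector_derivative P s (- (z - A z))) (at t)"
 proof (rule has_vector_derivative_transform_within_open[where S = "{s<..}"])
  show "t \<in> {s<..}" using t by (simp add: s_def)
  fix r assume "r \<in> {s<..}"
  then show "P (r - s) (A z) = P r f" using P_add[of "r - s" s f] s by (simp add: Az)
 qed simp
 moreover have "P s (- (z - A z)) = - (y - A y)"
  by (simp add: y_def P_simps linear_neg[OF linear_P] PA)
 moreover have "inner (y - A y) g = E (P t f) g" if "g \<in> D" for g
 proof -
  obtain m where m: "g = C m" using \<open>g \<in> D\<close> unfolding D_def by blast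
  have "E (P t f) g = inner (C y) m - inner (C (C y)) (C m)"
   unfolding Ptf m using E_C[of "C y" m] by (simp add: CC)
  then show ?thesis by (simp add: m inner_diff C_sym CC)
 qed
 ultimately show "\<exists>w. ((%s. P s f) has_vector_derivative - w) (at t) \<and> (\<forall>g\<in>D. inner w g = E (P t f) g)"
  by (intro exI[of _ "y - A y"]) auto
qed

end

section \<open>The Hilbert space $L^2$\<close>

lemma L2_iff: "f \<in> L2 M \<longleftrightarrow> f \<in> borel_measurable M \<and> integrable M (%x. (f x)^2)"
 by (simp add: L2_def)

lemma L2_measurable [measurable_dest]: "f \<in> L2 M ==> f \<in> borel_measurable M"
 by (simp add: L2_iff)

lemma L2_integrable_square: "f \<in> L2 M ==> integrable M (%x. (f x)^2)"
 by (simp add: L2_iff)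

lemma L2_integrable_mult:
 assumes "f \<in> L2 M" "g \<in> L2 M"
 shows "integrable M (%x. f x * g x)"
proof (rule Bochner_Integration.integrable_bound)
 show "integrable M (%x. (f x)^2 + (g x)^2)"
  using assms by (intro Bochner_Integration.integrable_add L2_integrable_square)
 show "(%x. f x * g x) \<in> borel_measurable M" using assms by (auto simp: L2_iff)
 have "\<bar>f x * g x\<bar> \<le> (f x)^2 + (g x)^2" for x
 proof -
  have "2 * (\<bar>f x\<bar> * \<bar>g x\<bar>) \<le> (f x)^2 + (g x)^2"
   using sum_squares_bound[of "\<bar>f x\<bar>" "\<bar>g x\<bar>"] by simp
  moreover have "0 \<le> \<bar>f x\<bar> * \<bar>g x\<bar>" by simp
  ultimately show ?thesis unfolding abs_mult by linarith
 qed
 then show "AE x in M. norm (f x * g x) \<le> norm ((f x)^2 + (g x)^2)" by simp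
qed

lemma L2_add: "f \<in> L2 M ==> g \<in> L2 M ==> (%x. f x + g x) \<in> L2 M"
proof -
 assume fg: "f \<in> L2 M" "g \<in> L2 M"
 have "integrable M (%x. (f x)^2 + (g x)^2 + 2 * (f x * g x))"
  using fg by (intro Bochner_Integration.integrable_add L2_integrable_square integrable_mult_right L2_integrable_mult)
 then show ?thesis using fg by (auto simp: L2_iff power2_sum mult.assoc)
qed

lemma L2_scale: "f \<in> L2 M ==> (%x. c * f x) \<in> L2 M"
 by (auto simp: L2_iff power_mult_distrib)

lemma L2_uminus: "f \<in> L2 M ==> (%x. - f x) \<in> L2 M"
 using L2_scale[of f M "-1"] by simp

lemma L2_diff: "f \<in> L2 M ==> g \<in> L2 M ==> (%x. f x - g x) \<in> L2 M"
 using L2_add[OF _ L2_uminus, of f M g] by simp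

lemma L2_0: "(%x. 0) \<in> L2 M"
 by (simp add: L2_iff)

lemma L2_bound:
 assumes "g \<in> L2 M" "f \<in> borel_measurable M" "AE x in M. \<bar>f x\<bar> \<le> \<bar>g x\<bar>"
 shows "f \<in> L2 M"
proof -
 have "integrable M (%x. (f x)^2)"
 proof (rule Bochner_Integration.integrable_bound[OF L2_integrable_square[OF assms(1)]])
  show "AE x in M. norm ((f x)^2) \<le> norm ((g x)^2)"
   using assms(3) by eventually_elim (simp add: abs_le_square_iff)
 qed (use assms in auto)
 then show ?thesis using assms by (simp add: L2_iff)
qed

lemma L2_cong_AE:
 assumes "f \<in> L2 M" "g \<in> borel_measurable M" "AE x in M. f x = g x"
 shows "g \<in> L2 M"
 by (rule L2_bound[OF assms(1,2)]) (use assms(3) in eventually_elim, simp)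

lemma l2_norm_0_iff:
 assumes "f \<in> L2 M"
 shows "(LINT x|M. (f x)^2) = 0 \<longleftrightarrow> (AE x in M. f x = 0)"
 using integral_nonneg_eq_0_iff_AE[OF L2_integrable_square[OF assms]] by simp

lemma nn_integral_square: "f \<in> L2 M ==> (\<integral>\<^sup>+x. ennreal ((f x)^2) \<partial>M) = ennreal (LINT x|M. (f x)^2)"
 by (rule nn_integral_eq_integral) (auto simp: L2_iff)

lemma L2_complete:
 fixes f :: "nat => 'a => real"
 assumes fL: "!!n. f n \<in> L2 M"
  and cauchy: "!!e. e > 0 ==> \<exists>N. \<forall>m\<ge>N. \<forall>n\<ge>N. (LINT x|M. (f m x - f n x)^2) < e"
 shows "\<exists>g\<in>L2 M. (%n. \<integral>x. (f n x - g x)^2 \<partial>M) \<longlonglongrightarrow> 0"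
proof -
 have [measurable]: "f n \<in> borel_measurable M" for n using fL[of n] by (simp add: L2_iff)
 have "\<forall>k. \<exists>N. \<forall>m\<ge>N. \<forall>n\<ge>N. (LINT x|M. (f m x - f n x)^2) < (1/4) ^ k"
  using cauchy by simp
 from choice[OF this] obtain N where
  N: "!!k m n. N k \<le> m ==> N k \<le> n ==> (LINT x|M. (f m x - f n x)^2) < (1/4) ^ k" by blast
 \<comment> \<open>The sum makes \<open>r\<close> strictly increasing while keeping r k >= N
   k.\<close>
 define r where "r k = k + (\<Sum>i\<le>k. N i)" for k
 have r1: "N k \<le> r k" for k unfolding r_def by (rule trans_le_add2, rule member_le_sum) auto
 have r2: "r k \<le> r (Suc k)" for k by (simp add: r_def)
 define u where "u k = f (r k)" for k
 have [measurable]: "u k \<in> borel_measurable M" for k by (simp add: u_def)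
 \<comment> \<open>The squared norms of the increments are at most 4^(-k), so the sum of 2^k (d k)^2
   still has finite integral. Where that sum is finite, |d k| is at most a constant times 2^(-k/2),
   and the increments are summable.\<close>
 define d where "d k x = u (Suc k) x - u k x" for k x
 have [measurable]: "d k \<in> borel_measurable M" for k unfolding d_def[abs_def] by measurable
 have dL: "d k \<in> L2 M" for k
  unfolding d_def u_def by (intro L2_diff fL)
 have di: "(LINT x|M. (d k x)^2) \<le> (1/4) ^ k" for k
  using N[of k "r (Suc k)" "r k"] r1[of k] r2[of k] by (simp add: d_def u_def)
 have "(\<integral>\<^sup>+x. (\<Sum>k. ennreal (2 ^ k * (d k x)^2)) \<partial>M) = (\<Sum>k. \<integral>\<^sup>+x. ennreal (2 ^ k * (d k x)^2) \<partial>M)"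
  by (rule nn_integral_suminf) simp
 also have "\<dots> \<le> (\<Sum>k. ennreal ((1/2) ^ k))"
 proof (rule suminf_le)
  fix k
  have "(\<integral>\<^sup>+x. ennreal (2 ^ k * (d k x)^2) \<partial>M) = ennreal (2 ^ k) * (\<integral>\<^sup>+x. ennreal ((d k x)^2) \<partial>M)"
   by (subst nn_integral_cmult[symmetric]) (auto simp: ennreal_mult)
  also have "\<dots> = ennreal (2 ^ k * (LINT x|M. (d k x)^2))"
   by (simp add: nn_integral_square[OF dL] ennreal_mult)
  also have "\<dots> \<le> ennreal (2 ^ k * (1/4) ^ k)"
   using di[of k] by (intro ennreal_leI mult_left_mono) auto
  also have "2 ^ k * (1/4) ^ k = (1/2::real) ^ k"
   by (simp flip: power_mult_distrib)
  finally show "(\<integral>\<^sup>+x. ennreal (2 ^ k * (d k x)^2) \<partial>M) \<le> ennreal ((1/2) ^ k)" .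
 qed auto
 also have "\<dots> = ennreal (\<Sum>k. (1/2) ^ k)"
  by (rule suminf_ennreal2) (simp_all add: summable_geometric)
 also have "\<dots> < \<infinity>" by simp
 finally have "(\<integral>\<^sup>+x. (\<Sum>k. ennreal (2 ^ k * (d k x)^2)) \<partial>M) \<noteq> \<infinity>" by simp
 then have fin: "AE x in M. (\<Sum>k. ennreal (2 ^ k * (d k x)^2)) \<noteq> \<infinity>"
  by (intro nn_integral_PInf_AE) auto
 have conv: "convergent (%k. u k x)" if x: "(\<Sum>k. ennreal (2 ^ k * (d k x)^2)) \<noteq> \<infinity>" for x
 proof -
  define S where "S = enn2real (\<Sum>k. ennreal (2 ^ k * (d k x)^2))"
  have "(\<Sum>k. ennreal (2 ^ k * (d k x)^2)) < top" using x unfolding less_top[symmetric] infinity_ennreal_def .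
  from ennreal_enn2real[OF this] have S: "(\<Sum>k. ennreal (2 ^ k * (d k x)^2)) = ennreal S" unfolding S_def ..
  have S0: "0 \<le> S" unfolding S_def by (rule enn2real_nonneg)
  have b: "norm (d k x) \<le> sqrt S * (1 / sqrt 2) ^ k" for k
  proof -
   have "ennreal (2 ^ k * (d k x)^2) \<le> (\<Sum>k. ennreal (2 ^ k * (d k x)^2))"
   proof -
    have "(\<Sum>i\<in>{k}. ennreal (2 ^ i * (d i x)^2)) \<le> (\<Sum>k. ennreal (2 ^ k * (d k x)^2))"
     by (rule sum_le_suminf) (rule summableI, rule finite.insertI, rule finite.emptyI, rule zero_le)
    then show ?thesis by (simp only: sum.insert[OF finite.emptyI] sum.empty empty_iff not_False_eq_True add_0_right)
   qed
   then have "2 ^ k * (d k x)^2 \<le> S" unfolding S using S0 by (simp only: ennreal_le_iff)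
   then have "sqrt (2 ^ k * (d k x)^2) \<le> sqrt S" by simp
   then have "sqrt 2 ^ k * \<bar>d k x\<bar> \<le> sqrt S"
    unfolding real_sqrt_mult real_sqrt_abs by (simp only: real_sqrt_power)
   then show ?thesis by (simp add: power_one_over field_simps)
  qed
  have "summable (%k. sqrt S * (1 / sqrt 2) ^ k)"
   by (intro summable_mult summable_geometric) simp
  then have "summable (%k. d k x)"
   by (rule summable_comparison_test'[of _ 0]) (rule b)
  then have "convergent (%n. \<Sum>k<n. d k x)" by (simp add: summable_iff_convergent)
  moreover have "(\<Sum>k<n. d k x) = u n x - u 0 x" for n
   unfolding d_def using sum_lessThan_telescope[of "%k. u k x" n] by simp
  ultimately have "convergent (%n. (u n x - u 0 x) + u 0 x)"
   by (intro convergent_add convergent_const) simp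
  then show ?thesis by simp
 qed
 define g where "g x = lim (%k. u k x)" for x
 have [measurable]: "g \<in> borel_measurable M" unfolding g_def by measurable
 have lim: "AE x in M. (%k. u k x) \<longlonglongrightarrow> g x"
  using fin by eventually_elim (use conv in \<open>auto simp: g_def convergent_LIMSEQ_iff\<close>)
 have close: "\<exists>N. \<forall>m\<ge>N. (\<integral>\<^sup>+x. ennreal ((f m x - g x)^2) \<partial>M) \<le> ennreal e" if e: "e > 0" for e
 proof -
  obtain N where N: "!!m n. m \<ge> N ==> n \<ge> N ==> (LINT x|M. (f m x - f n x)^2) < e"
   using cauchy[OF e] by blast
  have "(\<integral>\<^sup>+x. ennreal ((f m x - g x)^2) \<partial>M) \<le> ennreal e" if m: "m \<ge> N" for m
  proof -
   have "AE x in M. ennreal ((f m x - g x)^2) = liminf (%k. ennreal ((f m x - u k x)^2))"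
    using lim
   proof eventually_elim
    case (elim x)
    have "(%k. ennreal ((f m x - u k x)^2)) \<longlonglongrightarrow> ennreal ((f m x - g x)^2)"
     by (intro tendsto_intros tendsto_ennrealI elim)
    then show ?case by (rule lim_imp_Liminf[OF sequentially_bot, symmetric])
   qed
   then have "(\<integral>\<^sup>+x. ennreal ((f m x - g x)^2) \<partial>M) = (\<integral>\<^sup>+x. liminf (%k. ennreal ((f m x - u k x)^2)) \<partial>M)"
    by (rule nn_integral_cong_AE)
   also have "\<dots> \<le> liminf (%k. \<integral>\<^sup>+x. ennreal ((f m x - u k x)^2) \<partial>M)"
    by (rule nn_integral_liminf) simp
   also have "\<dots> \<le> ennreal e"
   proof (rule Liminf_le)
    show "eventually (%k. (\<integral>\<^sup>+x. ennreal ((f m x - u k x)^2) \<partial>M) \<le> ennreal e) sequentially"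
     unfolding eventually_sequentially
    proof (intro exI allI impI)
     fix k assume "N \<le> k"
     then have "N \<le> r k" by (simp add: r_def)
     from N[OF m this] show "(\<integral>\<^sup>+x. ennreal ((f m x - u k x)^2) \<partial>M) \<le> ennreal e"
      unfolding u_def using nn_integral_square[OF L2_diff[OF fL fL], of m "r k"] by (simp add: ennreal_leI)
    qed
   qed simp
   finally show ?thesis .
  qed
  then show ?thesis by blast
 qed
 have diffL: "(%x. f m x - g x) \<in> L2 M" if "(\<integral>\<^sup>+x. ennreal ((f m x - g x)^2) \<partial>M) \<le> ennreal e" for m e
  unfolding L2_iff using le_less_trans[OF that ennreal_less_top]
  by (auto intro!: integrableI_bounded)
 obtain N1 where "!!m. m \<ge> N1 ==> (\<integral>\<^sup>+x. ennreal ((f m x - g x)^2) \<partial>M) \<le> ennreal 1"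
  using close[of 1] by auto
 then have "(%x. f N1 x - g x) \<in> L2 M" using diffL by blast
 from L2_diff[OF fL[of N1] this] have gL: "g \<in> L2 M" by simp
 have dL: "(%x. f n x - g x) \<in> L2 M" for n by (intro L2_diff fL gL)
 have "(%n. \<integral>x. (f n x - g x)^2 \<partial>M) \<longlonglongrightarrow> 0"
  unfolding LIMSEQ_iff
 proof (intro allI impI)
  fix e :: real assume e: "0 < e"
  obtain N where N: "!!m. m \<ge> N ==> (\<integral>\<^sup>+x. ennreal ((f m x - g x)^2) \<partial>M) \<le> ennreal (e / 2)"
   using close[of "e / 2"] e by auto
  have "norm ((LINT x|M. (f n x - g x)^2) - 0) < e" if "n \<ge> N" for n
  proof -
   have "ennreal (LINT x|M. (f n x - g x)^2) \<le> ennreal (e / 2)"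
    using N[OF \<open>n \<ge> N\<close>] nn_integral_square[OF dL[of n]] by simp
   then have "(LINT x|M. (f n x - g x)^2) \<le> e / 2" using e by (simp add: ennreal_le_iff)
   moreover have "0 \<le> (LINT x|M. (f n x - g x)^2)" by simp
   ultimately show ?thesis using e by simp
  qed
  then show "\<exists>no. \<forall>n\<ge>no. norm ((LINT x|M. (f n x - g x)^2) - 0) < e" by blast
 qed
 then show ?thesis using gL by blast
qed

text \<open>To have $L^2(\mu)$ available as a type, the measure is a constant: a counterexample to the
 theorem if there is one. Refuting that this constant is a counterexample proves the theorem.\<close>

definition standing_hypotheses ::
  "'a::polish_space measure => ('a => real) rel => ('a => real => real) => bool" where
 "standing_hypotheses \<mu> L v \<longleftrightarrow> hypothesis_H \<mu> L \<and>
  (\<forall>x. \<forall>r>0. 0 < emeasure \<mu> (ball x r) \<and> emeasure \<mu> (ball x r) < \<infinity>) \<and>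
  volume_doubling \<mu> \<and> cond_A \<mu> v \<and> cond_D \<mu> v \<and> cond_RD v \<and>
  (\<forall>x. \<forall>r>0. 0 \<le> v x r) \<and> (\<exists>\<epsilon>>0. \<forall>x. \<forall>r>0. \<epsilon> * vol \<mu> x r \<le> v x r)"

definition mu0 :: "'a::polish_space measure" where
 "mu0 = (SOME \<mu>. \<exists>L v. standing_hypotheses \<mu> L v \<and> \<not> (DUE \<mu> L v \<longleftrightarrow> FK \<mu> L v))"

quotient_type (overloaded) 'a l2 = "'a::polish_space => real" / partial:
 "%f g. f \<in> L2 mu0 \<and> g \<in> L2 mu0 \<and> (AE x in mu0. f x = g x)"
proof (rule part_equivpI)
 show "\<exists>x. x \<in> L2 mu0 \<and> x \<in> L2 mu0 \<and> (AE xa in mu0. x xa = x xa)" using L2_0 by auto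
 show "symp (%f g. f \<in> L2 mu0 \<and> g \<in> L2 mu0 \<and> (AE x in mu0. f x = g x))"
  by (auto intro!: sympI simp: eq_commute)
 show "transp (%f g. f \<in> L2 mu0 \<and> g \<in> L2 mu0 \<and> (AE x in mu0. f x = g x))"
  by (auto intro!: transpI elim: eventually_elim2)
qed

definition cls :: "('a::polish_space => real) => 'a l2" where "cls = abs_l2"
definition rep :: "'a::polish_space l2 => 'a => real" where "rep = rep_l2"

lemma rep_L2: "rep h \<in> L2 mu0"
 using Quotient_rep_reflp[OF Quotient_l2, of h] by (simp add: rep_def)

lemma cls_rep [simp]: "cls (rep h) = h"
 by (simp add: cls_def rep_def Quotient_abs_rep[OF Quotient_l2])

lemma cls_eq_iff:
 "f \<in> L2 mu0 ==> g \<in> L2 mu0 ==> cls f = cls g \<longleftrightarrow> (AE x in mu0. f x = g x)"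
 using Quotient_rel[OF Quotient_l2, of f g] by (auto simp: cls_def)

lemma rep_cls: "f \<in> L2 mu0 ==> AE x in mu0. rep (cls f) x = f x"
 using cls_eq_iff[OF rep_L2, of f "cls f"] by simp

lemma rep_eqI: "(AE x in mu0. rep h x = rep k x) ==> h = k"
 using cls_eq_iff[OF rep_L2 rep_L2, of h k] by simp

instantiation l2 :: (polish_space) real_vector
begin

definition zero_l2 :: "'a l2" where "zero_l2 = cls (%x. 0)"
definition plus_l2 :: "'a l2 => 'a l2 => 'a l2" where "plus_l2 h k = cls (%x. rep h x + rep k x)"
definition minus_l2 :: "'a l2 => 'a l2 => 'a l2" where "minus_l2 h k = cls (%x. rep h x - rep k x)"
definition uminus_l2 :: "'a l2 => 'a l2" where "uminus_l2 h = cls (%x. - rep h x)"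
definition scaleR_l2 :: "real => 'a l2 => 'a l2" where "scaleR_l2 c h = cls (%x. c * rep h x)"
lemma rep_ops_AE:
 "AE x in mu0. rep (h + k) x = rep h x + rep k x"
 "AE x in mu0. rep (h - k) x = rep h x - rep k x"
 "AE x in mu0. rep (- h) x = - rep h x"
 "AE x in mu0. rep (c *\<^sub>R h) x = c * rep h x"
 "AE x in mu0. rep (0 :: 'a l2) x = 0"
 unfolding plus_l2_def minus_l2_def uminus_l2_def scaleR_l2_def zero_l2_def
 by (intro rep_cls L2_add L2_diff L2_uminus L2_scale L2_0 rep_L2)+

instance
proof
 fix a b c :: "'a l2" and r s :: real
 show "a + b + c = a + (b + c)"
  by (rule rep_eqI) (use rep_ops_AE(1)[of "a + b" c] rep_ops_AE(1)[of a b] rep_ops_AE(1)[of a "b + c"] rep_ops_AE(1)[of b c] in \<open>eventually_elim, simp\<close>)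
 show "a + b = b + a"
  by (rule rep_eqI) (use rep_ops_AE(1)[of a b] rep_ops_AE(1)[of b a] in \<open>eventually_elim, simp\<close>)
 show "0 + a = a"
  by (rule rep_eqI) (use rep_ops_AE(1)[of 0 a] rep_ops_AE(5) in \<open>eventually_elim, simp\<close>)
 show "- a + a = 0"
  by (rule rep_eqI) (use rep_ops_AE(1)[of "- a" a] rep_ops_AE(3)[of a] rep_ops_AE(5) in \<open>eventually_elim, simp\<close>)
 show "a - b = a + - b"
  by (rule rep_eqI) (use rep_ops_AE(1)[of a "- b"] rep_ops_AE(3)[of b] rep_ops_AE(2)[of a b] in \<open>eventually_elim, simp\<close>)
 show "r *\<^sub>R (a + b) = r *\<^sub>R a + r *\<^sub>R b"
  by (rule rep_eqI) (use rep_ops_AE(1)[of a b] rep_ops_AE(4)[of r "a + b"] rep_ops_AE(4)[of r a] rep_ops_AE(4)[of r b]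
   rep_ops_AE(1)[of "r *\<^sub>R a" "r *\<^sub>R b"] in \<open>eventually_elim, simp add: algebra_simps\<close>)
 show "(r + s) *\<^sub>R a = r *\<^sub>R a + s *\<^sub>R a"
  by (rule rep_eqI) (use rep_ops_AE(4)[of "r + s" a] rep_ops_AE(4)[of r a] rep_ops_AE(4)[of s a]
   rep_ops_AE(1)[of "r *\<^sub>R a" "s *\<^sub>R a"] in \<open>eventually_elim, simp add: algebra_simps\<close>)
 show "r *\<^sub>R s *\<^sub>R a = (r * s) *\<^sub>R a"
  by (rule rep_eqI) (use rep_ops_AE(4)[of "r * s" a] rep_ops_AE(4)[of r "s *\<^sub>R a"] rep_ops_AE(4)[of s a] in \<open>eventually_elim, simp add: algebra_simps\<close>)
 show "1 *\<^sub>R a = a"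
  by (rule rep_eqI) (use rep_ops_AE(4)[of 1 a] in \<open>eventually_elim, simp\<close>)
qed

end

instantiation l2 :: (polish_space) real_inner
begin

definition inner_l2 :: "'a l2 => 'a l2 => real" where "inner_l2 h k = l2_inner mu0 (rep h) (rep k)"
definition norm_l2 :: "'a l2 => real" where "norm_l2 h = sqrt (inner h h)"
definition dist_l2 :: "'a l2 => 'a l2 => real" where "dist_l2 h k = norm (h - k)"
definition sgn_l2 :: "'a l2 => 'a l2" where "sgn_l2 h = h /\<^sub>R norm h"
definition uniformity_l2 :: "('a l2 \<times> 'a l2) filter" where
 "uniformity_l2 = (INF e\<in>{0<..}. principal {(x, y). dist x y < e})"
definition open_l2 :: "'a l2 set => bool" where
 "open_l2 U = (\<forall>x\<in>U. eventually (%(x', y). x' = x \<longrightarrow> y \<in> U) uniformity)"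

lemma inner_l2_cong:
 "(AE x in mu0. rep h x = f x) ==> f \<in> borel_measurable mu0 ==> inner h k = l2_inner mu0 f (rep k)"
 unfolding inner_l2_def l2_inner_def using rep_L2[of h] rep_L2[of k]
 by (intro integral_cong_AE) (auto simp: L2_iff)

instance
proof
 fix a b c :: "'a l2" and r :: real
 show "dist a b = norm (a - b)" by (simp add: dist_l2_def)
 show "sgn a = a /\<^sub>R norm a" by (simp add: sgn_l2_def)
 show "uniformity = (INF e\<in>{0<..}. principal {(x :: 'a l2, y). dist x y < e})"
  by (simp add: uniformity_l2_def)
 show "open U = (\<forall>x\<in>U. eventually (%(x', y). x' = x \<longrightarrow> y \<in> U) uniformity)" for U :: "'a l2 set"
  by (simp add: open_l2_def)
 show "inner a b = inner b a" by (simp add: inner_l2_def l2_inner_def mult.commute)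
 show "inner (a + b) c = inner a c + inner b c"
 proof -
  have "inner (a + b) c = l2_inner mu0 (%x. rep a x + rep b x) (rep c)"
   using rep_L2[of a] rep_L2[of b] by (intro inner_l2_cong rep_ops_AE) (auto simp: L2_iff)
  also have "\<dots> = inner a c + inner b c"
   unfolding inner_l2_def l2_inner_def distrib_right
   by (intro Bochner_Integration.integral_add L2_integrable_mult rep_L2)
  finally show ?thesis .
 qed
 show "inner (r *\<^sub>R a) b = r * inner a b"
 proof -
  have "inner (r *\<^sub>R a) b = l2_inner mu0 (%x. r * rep a x) (rep b)"
   using rep_L2[of a] by (intro inner_l2_cong rep_ops_AE) (auto simp: L2_iff)
  also have "\<dots> = r * inner a b"
   unfolding inner_l2_def l2_inner_def mult.assoc by simp
  finally show ?thesis .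
 qed
 show "0 \<le> inner a a" by (simp add: inner_l2_def l2_inner_def)
 show "inner a a = 0 \<longleftrightarrow> a = 0"
 proof -
  have "inner a a = 0 \<longleftrightarrow> (AE x in mu0. rep a x = 0)"
   using l2_norm_0_iff[OF rep_L2, of a] by (simp add: inner_l2_def l2_inner_def power2_eq_square)
  also have "\<dots> \<longleftrightarrow> a = 0"
   using cls_eq_iff[OF rep_L2 L2_0, of a] by (simp add: zero_l2_def)
  finally show ?thesis .
 qed
 show "norm a = sqrt (inner a a)" by (simp add: norm_l2_def)
qed

end

lemma inner_cls:
 assumes "f \<in> L2 mu0" "g \<in> L2 mu0"
 shows "inner (cls f) (cls g) = l2_inner mu0 f g"
 unfolding inner_l2_def l2_inner_def
 using rep_cls[OF assms(1)] rep_cls[OF assms(2)] rep_L2[of "cls f"] rep_L2[of "cls g"] assms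
 by (intro integral_cong_AE) (auto simp: L2_iff)

lemma norm_cls: "f \<in> L2 mu0 ==> norm (cls f) = l2_norm mu0 f"
 by (simp add: norm_eq_sqrt_inner inner_cls l2_inner_def l2_norm_def power2_eq_square)

lemma norm_cls_square: "f \<in> L2 mu0 ==> (norm (cls f))\<^sup>2 = (LINT x|mu0. (f x)^2)"
 by (simp add: norm_cls l2_norm_def)

lemma cls_cong: "f \<in> L2 mu0 ==> g \<in> L2 mu0 ==> AE x in mu0. f x = g x ==> cls f = cls g"
 by (simp add: cls_eq_iff)

lemma cls_add: "f \<in> L2 mu0 ==> g \<in> L2 mu0 ==> cls (%x. f x + g x) = cls f + cls g"
 using rep_cls[of f] rep_cls[of g] unfolding plus_l2_def
 by (intro cls_cong L2_add rep_L2) auto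

lemma cls_diff: "f \<in> L2 mu0 ==> g \<in> L2 mu0 ==> cls (%x. f x - g x) = cls f - cls g"
 using rep_cls[of f] rep_cls[of g] unfolding minus_l2_def
 by (intro cls_cong L2_diff rep_L2) auto

lemma cls_scale:
 assumes "f \<in> L2 mu0"
 shows "cls (%x. c * f x) = c *\<^sub>R cls f"
proof -
 have "AE x in mu0. c * f x = c * rep (cls f) x" using rep_cls[OF assms] by eventually_elim simp
 then show ?thesis unfolding scaleR_l2_def by (intro cls_cong L2_scale rep_L2 assms)
qed

lemma cls_uminus: "f \<in> L2 mu0 ==> cls (%x. - f x) = - cls f"
 using cls_scale[of f "-1"] by simp

lemma cls_0: "cls (%x. 0) = 0"
 by (simp add: zero_l2_def)

instance l2 :: (polish_space) banach
proof
 fix X :: "nat => 'a l2" assume X: "Cauchy X"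
 have sq: "(LINT x|mu0. (rep (X m) x - f x)^2) = (norm (X m - cls f))^2" if "f \<in> L2 mu0" for m f
  using norm_cls_square[OF L2_diff[OF rep_L2 that], of "X m"] cls_diff[OF rep_L2 that, of "X m"] by simp
 have "\<exists>g\<in>L2 mu0. (%n. \<integral>x. (rep (X n) x - g x)^2 \<partial>mu0) \<longlonglongrightarrow> 0"
 proof (rule L2_complete[OF rep_L2])
  fix e :: real assume e: "e > 0"
  then have "sqrt e > 0" by simp
  then obtain N where N: "!!m n. m \<ge> N ==> n \<ge> N ==> dist (X m) (X n) < sqrt e"
   using X by (meson metric_CauchyD)
  have "(LINT x|mu0. (rep (X m) x - rep (X n) x)^2) < e" if "m \<ge> N" "n \<ge> N" for m n
  proof -
   have "(norm (X m - X n))^2 < (sqrt e)^2"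
    using N[OF that] by (intro power_strict_mono) (auto simp: dist_norm)
   then show ?thesis using e sq[OF rep_L2, of m "X n"] by simp
  qed
  then show "\<exists>N. \<forall>m\<ge>N. \<forall>n\<ge>N. (LINT x|mu0. (rep (X m) x - rep (X n) x)^2) < e" by blast
 qed
 then obtain g where g: "g \<in> L2 mu0" "(%n. (norm (X n - cls g))^2) \<longlonglongrightarrow> 0" by (auto simp: sq)
 from tendsto_real_sqrt[OF g(2)] have "(%n. norm (X n - cls g)) \<longlonglongrightarrow> 0" by simp
 then have "X \<longlonglongrightarrow> cls g" by (simp add: tendsto_norm_zero_iff LIM_zero_iff)
 then show "convergent X" by (auto simp: convergent_def)
qed

subsection \<open>Transport of relations\<close>

text \<open>\<open>pull\<close> yields relations between functions that are saturated under equality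
  almost everywhere; \<open>push\<close> passes to classes. Pushing a pull changes nothing, whereas
  pulling a push saturates.\<close>

definition pull :: "('a::polish_space l2 \<times> 'a l2) set => ('a => real) rel" where
 "pull S = {(f, g). f \<in> L2 mu0 \<and> g \<in> L2 mu0 \<and> (cls f, cls g) \<in> S}"

definition push :: "('a::polish_space => real) rel => ('a l2 \<times> 'a l2) set" where
 "push R = {(cls f, cls g) | f g. (f, g) \<in> R}"

lemma push_pull: "push (pull S) = S"
proof
 show "push (pull S) \<subseteq> S" by (auto simp: push_def pull_def)
 show "S \<subseteq> push (pull S)"
 proof (rule subrelI)
  fix h k assume "(h, k) \<in> S"
  then have "(rep h, rep k) \<in> pull S" by (simp add: pull_def rep_L2)
  then show "(h, k) \<in> push (pull S)" unfolding push_def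
   by (intro CollectI exI[of _ "rep h"] exI[of _ "rep k"]) simp
 qed
qed

text \<open>Inner products see only classes, so every adjoint is saturated. For this reason a
  self-adjoint relation is recovered from its push.\<close>

lemma l2_adjoint_eq_pull:
 assumes "R \<subseteq> L2 mu0 \<times> L2 mu0"
 shows "l2_adjoint mu0 R = pull (hadj (push R))"
proof -
 have "(g, h) \<in> l2_adjoint mu0 R \<longleftrightarrow> (g, h) \<in> pull (hadj (push R))" for g h
 proof (cases "g \<in> L2 mu0 \<and> h \<in> L2 mu0")
  case True
  have "(g, h) \<in> l2_adjoint mu0 R \<longleftrightarrow> (\<forall>(f, k)\<in>R. inner (cls k) (cls g) = inner (cls f) (cls h))"
   using True assms by (fastforce simp: l2_adjoint_def inner_cls)
  also have "\<dots> \<longleftrightarrow> (cls g, cls h) \<in> hadj (push R)"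
   by (fastforce simp: hadj_def push_def)
  finally show ?thesis using True by (simp add: pull_def)
 qed (auto simp: l2_adjoint_def pull_def)
 then show ?thesis by auto
qed

lemma pull_subset: "pull S \<subseteq> L2 mu0 \<times> L2 mu0"
 by (auto simp: pull_def)

lemma Domain_pull: "Domain (pull S) = {f \<in> L2 mu0. cls f \<in> Domain S}"
proof -
 have "f \<in> Domain (pull S)" if "f \<in> L2 mu0" "(cls f, k) \<in> S" for f k
  using that rep_L2[of k] by (intro DomainI[of _ "rep k"]) (simp add: pull_def)
 then show ?thesis by (auto simp: pull_def)
qed

lemma l2_dense_pull: "l2_dense mu0 (Domain (pull S)) \<longleftrightarrow> closure (Domain S) = UNIV"
proof -
 have nrm: "l2_norm mu0 (%x. f x - g x) = dist (cls g) (cls f)" if "f \<in> L2 mu0" "g \<in> L2 mu0" for f g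
  using that by (simp add: norm_cls[symmetric] L2_diff cls_diff dist_norm norm_minus_commute)
 have "l2_dense mu0 (Domain (pull S)) \<longleftrightarrow>
   (\<forall>f\<in>L2 mu0. \<forall>e>0. \<exists>g\<in>Domain (pull S). dist (cls g) (cls f) < e)"
 proof -
  have "(\<exists>g\<in>Domain (pull S). l2_norm mu0 (%x. f x - g x) < e) \<longleftrightarrow>
    (\<exists>g\<in>Domain (pull S). dist (cls g) (cls f) < e)" if "f \<in> L2 mu0" for f e
   using nrm[OF that] by (intro bex_cong refl) (auto simp: Domain_pull)
  then show ?thesis unfolding l2_dense_def by (auto simp: Domain_pull)
 qed
 also have "\<dots> \<longleftrightarrow> (\<forall>h. \<forall>e>0. \<exists>k\<in>Domain S. dist k h < e)"
 proof
  assume *: "\<forall>f\<in>L2 mu0. \<forall>e>0. \<exists>g\<in>Domain (pull S). dist (cls g) (cls f) < e"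
  show "\<forall>h. \<forall>e>0. \<exists>k\<in>Domain S. dist k h < e"
  proof (intro allI impI)
   fix h :: "'a l2" and e :: real assume "e > 0"
   then obtain g where "g \<in> Domain (pull S)" "dist (cls g) (cls (rep h)) < e"
    using * rep_L2 by meson
   then show "\<exists>k\<in>Domain S. dist k h < e" by (auto simp: Domain_pull)
  qed
 next
  assume *: "\<forall>h. \<forall>e>0. \<exists>k\<in>Domain S. dist k h < e"
  show "\<forall>f\<in>L2 mu0. \<forall>e>0. \<exists>g\<in>Domain (pull S). dist (cls g) (cls f) < e"
  proof (intro ballI allI impI)
   fix f :: "'a => real" and e :: real assume "e > 0"
   then obtain k where k: "k \<in> Domain S" "dist k (cls f) < e" using * by meson
   then have "rep k \<in> Domain (pull S)" by (simp add: Domain_pull rep_L2)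
   then show "\<exists>g\<in>Domain (pull S). dist (cls g) (cls f) < e" using k by (intro bexI[of _ "rep k"]) auto
  qed
 qed
 also have "\<dots> \<longleftrightarrow> closure (Domain S) = UNIV"
  by (auto simp: closure_approachable set_eq_iff)
 finally show ?thesis .
qed

lemma pull_inject: "pull S = pull S' \<longleftrightarrow> S = S'"
 by (metis push_pull)

lemma nonneg_self_adjoint_pull: "nonneg_self_adjoint mu0 (pull S) \<longleftrightarrow> nonneg_sa S"
proof -
 have adj: "l2_adjoint mu0 (pull S) = pull S \<longleftrightarrow> hadj S = S"
  by (simp add: l2_adjoint_eq_pull[OF pull_subset] push_pull pull_inject)
 have "(\<forall>(f, g)\<in>pull S. 0 \<le> l2_inner mu0 g f) \<longleftrightarrow> (\<forall>(f, g)\<in>push (pull S). 0 \<le> inner g f)"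
  by (fastforce simp: push_def pull_def inner_cls)
 then show ?thesis
  unfolding nonneg_self_adjoint_def self_adjoint_def nonneg_sa_def
  using pull_subset[of S] adj l2_dense_pull[of S] by (simp add: push_pull)
qed

lemma self_adjoint_eq_pull: "self_adjoint mu0 R ==> R = pull (push R)"
proof -
 assume R: "self_adjoint mu0 R"
 then have "R = pull (hadj (push R))" using l2_adjoint_eq_pull[of R] by (auto simp: self_adjoint_def)
 then show ?thesis by (metis push_pull)
qed

lemma pull_relcomp: "pull S O pull T = pull (S O T)"
proof (intro equalityI subrelI)
 fix f h assume "(f, h) \<in> pull (S O T)"
 then obtain k where k: "(cls f, k) \<in> S" "(k, cls h) \<in> T" "f \<in> L2 mu0" "h \<in> L2 mu0" by (auto simp: pull_def)
 then have "(f, rep k) \<in> pull S" "(rep k, h) \<in> pull T" by (auto simp: pull_def rep_L2)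
 then show "(f, h) \<in> pull S O pull T" by auto
qed (auto simp: pull_def)

section \<open>The semigroup and form of the operator\<close>

lemma l2_dominated_convergence:
 fixes f :: "nat => 'a::polish_space => real"
 assumes fm: "!!n. f n \<in> borel_measurable mu0" and g: "g \<in> L2 mu0"
  and h: "h \<in> borel_measurable mu0"
  and bd: "!!n. AE x in mu0. \<bar>f n x\<bar> \<le> \<bar>g x\<bar>" and lim: "AE x in mu0. (%n. f n x) \<longlonglongrightarrow> h x"
 shows "(%n. cls (f n)) \<longlonglongrightarrow> cls h"
proof -
 have fL: "f n \<in> L2 mu0" for n by (rule L2_bound[OF g fm bd])
 have "AE x in mu0. \<forall>n. \<bar>f n x\<bar> \<le> \<bar>g x\<bar>" using bd by (simp add: AE_all_countable)
 then have hb: "AE x in mu0. \<bar>h x\<bar> \<le> \<bar>g x\<bar>"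
  using lim
 proof eventually_elim
  case (elim x)
  have "(%n. \<bar>f n x\<bar>) \<longlonglongrightarrow> \<bar>h x\<bar>" using elim(2) by (rule tendsto_rabs)
  then show ?case by (rule LIMSEQ_le_const2) (use elim(1) in auto)
 qed
 have hL: "h \<in> L2 mu0" by (rule L2_bound[OF g h hb])
 have "(%n. \<integral>x. (f n x - h x)^2 \<partial>mu0) \<longlonglongrightarrow> (LINT x|(mu0 :: 'a measure). 0)"
 proof (rule integral_dominated_convergence[where w = "%x. 4 * (g x)^2" and f = "%x. 0" and s = "%n x. (f n x - h x)^2"])
  show "integrable mu0 (%x. 4 * (g x)^2)" using g by (simp add: L2_iff)
  show "AE x in mu0. (%n. (f n x - h x)^2) \<longlonglongrightarrow> 0"
   using lim
  proof eventually_elim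
   case (elim x)
   have "(%n. (f n x - h x)^2) \<longlonglongrightarrow> (h x - h x)^2" by (intro tendsto_intros elim)
   then show ?case by simp
  qed
  show "AE x in mu0. norm ((f n x - h x)^2) \<le> 4 * (g x)^2" for n
   using bd[of n] hb
  proof eventually_elim
   case (elim x)
   have "\<bar>f n x - h x\<bar> \<le> \<bar>2 * g x\<bar>" using elim by (simp add: abs_mult)
   then have "(f n x - h x)^2 \<le> (2 * g x)^2" by (simp only: abs_le_square_iff)
   then show ?case by (simp add: power_mult_distrib)
  qed
  show "(%x. (f n x - h x)^2) \<in> borel_measurable mu0" for n using fm[of n] h by measurable
 qed simp
 then have "(%n. (norm (cls (f n) - cls h))^2) \<longlonglongrightarrow> 0"
  by (simp add: norm_cls_square[OF L2_diff[OF fL hL]] flip: cls_diff[OF fL hL])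
 from tendsto_real_sqrt[OF this] have "(%n. norm (cls (f n) - cls h)) \<longlonglongrightarrow> 0" by simp
 then show ?thesis by (simp add: tendsto_norm_zero_iff LIM_zero_iff)
qed

lemma l2_norm_quotient:
 fixes f g k :: "'a::polish_space => real"
 assumes "f \<in> L2 mu0" "g \<in> L2 mu0" "k \<in> L2 mu0"
 shows "l2_norm mu0 (%x. (k x - f x) / t - g x) = norm ((1 / t) *\<^sub>R (cls k - cls f) - cls g)"
proof -
 note kf = L2_diff[OF assms(3,1)] and L = L2_scale[OF L2_diff[OF assms(3,1)], of "1 / t"]
 have "(%x. (k x - f x) / t - g x) \<in> L2 mu0" using L2_diff[OF L assms(2)] by simp
 moreover have "cls (%x. (k x - f x) / t - g x) = (1 / t) *\<^sub>R (cls k - cls f) - cls g"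
  using cls_diff[OF L assms(2)] cls_scale[OF kf, of "1 / t"] cls_diff[OF assms(3,1)] by simp
 ultimately show ?thesis by (metis norm_cls)
qed

locale heat_space =
 fixes L :: "('a::polish_space => real) rel"
 assumes H: "hypothesis_H mu0 L"
  and ball_measure: "!!x r. r > 0 ==> 0 < emeasure mu0 (ball (x::'a) r) \<and> emeasure mu0 (ball x r) < \<infinity>"
begin

lemma sets_mu0 [simp, measurable_cong]: "sets (mu0 :: 'a measure) = sets borel"
 using H by (simp add: hypothesis_H_def)

lemma space_mu0 [simp]: "space (mu0 :: 'a measure) = UNIV"
 using sets_eq_imp_space_eq[OF sets_mu0] by simp

lemma borel_measurable_mu0 [simp]: "borel_measurable (mu0 :: 'a measure) = borel_measurable borel"
 by (rule measurable_cong_sets) auto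

lemma nonneg_sa_push: "nonneg_sa (push L)" and pull_push_L: "pull (push L) = L"
proof -
 have "nonneg_self_adjoint mu0 L" using H by (simp add: hypothesis_H_def)
 moreover from this show "pull (push L) = L"
  by (intro self_adjoint_eq_pull[symmetric]) (simp add: nonneg_self_adjoint_def)
 ultimately show "nonneg_sa (push L)" using nonneg_self_adjoint_pull[of "push L"] by simp
qed

definition resolvent :: "'a l2 => 'a l2" where
 "resolvent = (SOME R. pos_contraction R \<and> (\<forall>x. R x = 0 \<longrightarrow> x = 0) \<and> push L = range (%h. (R h, h - R h)))"

lemma resolvent:
 "pos_contraction resolvent" "resolvent x = 0 ==> x = 0" "push L = range (%h. (resolvent h, h - resolvent h))"
proof -
 have "\<exists>R. pos_contraction R \<and> (\<forall>x. R x = 0 \<longrightarrow> x = 0) \<and> push L = range (%h. (R h, h - R h))"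
 proof (rule nonneg_sa_resolvent[OF nonneg_sa_push])
  fix R assume "pos_contraction R" "!!x. R x = 0 ==> x = 0" "push L = range (%h. (R h, h - R h))"
  then show ?thesis by (intro exI[of _ R] conjI allI impI)
 qed
 note * = someI_ex[OF this, folded resolvent_def]
 show "pos_contraction resolvent" by (rule conjunct1[OF *])
 show "resolvent x = 0 ==> x = 0" by (rule conjunct1[OF conjunct2[OF *], THEN spec, THEN mp])
 show "push L = range (%h. (resolvent h, h - resolvent h))" by (rule conjunct2[OF conjunct2[OF *]])
qed

sublocale H: injective_pos_contraction resolvent
 by (rule injective_pos_contraction.intro[OF resolvent(1)], rule injective_pos_contraction_axioms.intro, rule resolvent(2))

lemma push_L: "push L = H.Lrel"
 unfolding H.Lrel_def by (rule resolvent(3))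

lemma pull_Lrel: "pull H.Lrel = L"
 using pull_push_L unfolding push_L .

text \<open>The definite description is resolved by uniqueness in the Hilbert space: a candidate is
  self-adjoint, hence a pull, and its push is a nonnegative root of \<open>H.Lrel\<close>.\<close>

lemma op_sqrt_eq: "op_sqrt mu0 L = pull H.Srel"
 unfolding op_sqrt_def
proof (rule the_equality)
 show "nonneg_self_adjoint mu0 (pull H.Srel) \<and> pull H.Srel O pull H.Srel = L"
  using H.nonneg_sa_Srel by (simp add: nonneg_self_adjoint_pull pull_relcomp H.Srel_square pull_Lrel)
 fix S assume S: "nonneg_self_adjoint mu0 S \<and> S O S = L"
 then have eq: "pull (push S) = S" by (intro self_adjoint_eq_pull[symmetric]) (simp add: nonneg_self_adjoint_def)
 have "nonneg_sa (push S)" using S eq nonneg_self_adjoint_pull[of "push S"] by simp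
 moreover have "push S O push S = H.Lrel"
 proof -
  have "pull (push S O push S) = pull H.Lrel"
   using S eq pull_Lrel pull_relcomp[of "push S" "push S"] by simp
  then show ?thesis by (simp add: pull_inject)
 qed
 ultimately have "push S = H.Srel" by (rule H.sqrt_unique)
 then show "S = pull H.Srel" using eq by simp
qed

abbreviation FD :: "('a => real) set" where "FD \<equiv> form_dom mu0 L"
abbreviation EE :: "('a => real) => ('a => real) => real" where "EE \<equiv> form mu0 L"

lemma FD_iff: "f \<in> FD \<longleftrightarrow> f \<in> L2 mu0 \<and> cls f \<in> H.D"
proof -
 have "Domain H.Srel = H.D" by (auto simp: H.Srel_def H.D_def)
 then show ?thesis by (simp add: form_dom_def op_sqrt_eq Domain_pull)
qed

lemma FD_L2: "f \<in> FD ==> f \<in> L2 mu0" and FD_D: "f \<in> FD ==> cls f \<in> H.D"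
 by (auto simp: FD_iff)

lemma FD_measurable [measurable_dest]: "f \<in> FD ==> f \<in> borel_measurable borel"
 using L2_measurable[OF FD_L2] by simp

lemma op_app_sqrt:
 assumes "f \<in> FD"
 shows "op_app (op_sqrt mu0 L) f \<in> L2 mu0" "cls (op_app (op_sqrt mu0 L) f) = H.B (H.Ci (cls f))"
proof -
 have "f \<in> Domain (op_sqrt mu0 L)" using assms by (simp add: form_dom_def)
 then have "(f, op_app (op_sqrt mu0 L) f) \<in> op_sqrt mu0 L"
  unfolding op_app_def by (elim DomainE) (rule someI[of "%g. (f, g) \<in> op_sqrt mu0 L"])
 then have "op_app (op_sqrt mu0 L) f \<in> L2 mu0" "(cls f, cls (op_app (op_sqrt mu0 L) f)) \<in> H.Srel"
  by (auto simp: op_sqrt_eq pull_def)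
 then show "op_app (op_sqrt mu0 L) f \<in> L2 mu0" "cls (op_app (op_sqrt mu0 L) f) = H.B (H.Ci (cls f))"
  by (auto simp: H.Srel_def)
qed

lemma EE_eq: "f \<in> FD ==> g \<in> FD ==> EE f g = H.E (cls f) (cls g)"
 by (simp add: form_def H.E_def inner_cls[symmetric] op_app_sqrt)

lemma quad_form_eq: "f \<in> FD ==> quad_form mu0 L f = EE f f"
 by (simp add: quad_form_def EE_eq H.E_def norm_cls[symmetric] op_app_sqrt power2_norm_eq_inner[symmetric])

lemma form_norm2_eq: "f \<in> FD ==> form_norm2 mu0 EE f = H.E (cls f) (cls f) + (norm (cls f))^2"
 by (simp add: form_norm2_def EE_eq norm_cls FD_L2)

lemma heat_semigroup_spec:
 "C0_semigroup mu0 (heat_semigroup mu0 L) \<and> generator mu0 (heat_semigroup mu0 L) = {(f, %x. - g x) | f g. (f, g) \<in> L}"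
 unfolding heat_semigroup_def
proof (rule someI_ex[of "%T. C0_semigroup mu0 T \<and> generator mu0 T = {(f, %x. - g x) | f g. (f, g) \<in> L}"])
 define T where "T t f = rep (H.P t (cls f))" for t and f :: "'a => real"
 have TL: "T t f \<in> L2 mu0" for t f by (simp add: T_def rep_L2)
 have nrm: "l2_norm mu0 (%x. T t f x - f x) = norm (H.P t (cls f) - cls f)" if "f \<in> L2 mu0" for t f
  using that by (simp add: norm_cls[symmetric] L2_diff rep_L2 T_def cls_diff)
 have "C0_semigroup mu0 T"
  unfolding C0_semigroup_def
 proof (intro conjI allI ballI impI)
  show "T t f \<in> L2 mu0" for t f by (rule TL)
  fix t :: real and f g :: "'a => real" and a b :: real
  assume fg: "f \<in> L2 mu0" "g \<in> L2 mu0"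
  have "cls (T t (%y. a * f y + b * g y)) = cls (%x. a * T t f x + b * T t g x)"
   using fg TL[of t f] TL[of t g] by (simp add: T_def cls_add cls_scale L2_scale H.P_simps)
  then show "AE x in mu0. T t (%y. a * f y + b * g y) x = a * T t f x + b * T t g x"
   by (subst (asm) cls_eq_iff) (auto intro!: L2_add L2_scale TL)
 next
  show "\<exists>K. \<forall>f\<in>L2 mu0. l2_norm mu0 (T t f) \<le> K * l2_norm mu0 f" for t
   by (rule exI[of _ 1]) (simp add: T_def norm_cls[symmetric] rep_L2 H.norm_P_le)
  show "AE x in mu0. T 0 f x = f x" if "f \<in> L2 mu0" for f
   using rep_cls[OF that] by (simp add: T_def H.P_def)
  show "AE x in mu0. T (s + t) f x = T s (T t f) x" if "0 \<le> s" "0 \<le> t" for s t f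
   using that by (simp add: T_def H.P_add)
  show "((%t. l2_norm mu0 (%x. T t f x - f x)) \<longlongrightarrow> 0) (at_right 0)" if "f \<in> L2 mu0" for f
   unfolding nrm[OF that] using tendsto_norm[OF LIM_zero[OF H.P.T_tendsto[of "cls f"]]] by simp
 qed
 moreover have "generator mu0 T = {(f, %x. - g x) | f g. (f, g) \<in> L}"
 proof -
  have "(f, g) \<in> generator mu0 T \<longleftrightarrow> (f, %x. - g x) \<in> L" for f g
  proof (cases "f \<in> L2 mu0 \<and> g \<in> L2 mu0")
   case True
   have n: "l2_norm mu0 (%x. (T t f x - f x) / t - g x) = norm ((1 / t) *\<^sub>R (H.P t (cls f) - cls f) - cls g)" for t
    using True l2_norm_quotient[of f g "T t f" t] TL[of t f] by (simp add: T_def)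
   have "(f, g) \<in> generator mu0 T \<longleftrightarrow> ((%t. (1 / t) *\<^sub>R (H.P t (cls f) - cls f)) \<longlongrightarrow> cls g) (at_right 0)"
    using True by (simp add: generator_def n tendsto_norm_zero_iff LIM_zero_iff)
   also have "\<dots> \<longleftrightarrow> (f, %x. - g x) \<in> pull (push L)"
    unfolding H.generator_P push_L using True by (simp add: pull_def L2_uminus cls_uminus)
   finally show ?thesis unfolding pull_push_L .
  next
   case False
   have "(f, %x. - g x) \<notin> L"
   proof
    assume "(f, %x. - g x) \<in> L"
    then have "(f, %x. - g x) \<in> pull (push L)" unfolding pull_push_L .
    then have "f \<in> L2 mu0" "(%x. - g x) \<in> L2 mu0" by (auto simp: pull_def)
    with L2_uminus[OF this(2)] show False using False by simp
   qed
   then show ?thesis using False by (auto simp: generator_def)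
  qed
  moreover have "(f, g) \<in> {(f, %x. - g x) | f g. (f, g) \<in> L} \<longleftrightarrow> (f, %x. - g x) \<in> L" for f g
   by (auto intro!: exI[of _ "%x. - g x"])
  ultimately show ?thesis by auto
 qed
 ultimately show "\<exists>T. C0_semigroup mu0 T \<and> generator mu0 T = {(f, %x. - g x) | f g. (f, g) \<in> L}" by blast
qed

text \<open>The semigroup is only some choice of functions. Boundedness and linearity make it well
  defined on classes, where it is strongly continuous with generator -L, so uniqueness identifies it
  with \<open>H.P\<close>.\<close>

lemma
 assumes t: "t \<ge> 0" and f: "f \<in> L2 mu0"
 shows heat_L2: "heat_semigroup mu0 L t f \<in> L2 mu0"
  and heat_cls: "cls (heat_semigroup mu0 L t f) = H.P t (cls f)"
proof -
 define T where "T = heat_semigroup mu0 L"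
 have C0: "C0_semigroup mu0 T" and gen: "generator mu0 T = {(f, %x. - g x) | f g. (f, g) \<in> L}"
  using heat_semigroup_spec by (auto simp: T_def)
 have TL: "T t f \<in> L2 mu0" if "t \<ge> 0" "f \<in> L2 mu0" for t f
  using C0 that by (simp add: C0_semigroup_def)
 have Tlin: "cls (T t (%y. a * f y + b * g y)) = a *\<^sub>R cls (T t f) + b *\<^sub>R cls (T t g)"
  if "t \<ge> 0" "f \<in> L2 mu0" "g \<in> L2 mu0" for t f g a b
 proof -
  have "AE x in mu0. T t (%y. a * f y + b * g y) x = a * T t f x + b * T t g x"
   using C0 that unfolding C0_semigroup_def by blast
  then have "cls (T t (%y. a * f y + b * g y)) = cls (%x. a * T t f x + b * T t g x)"
   using that by (intro cls_cong TL L2_add L2_scale) auto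
  then show ?thesis using that by (simp add: cls_add cls_scale L2_scale TL)
 qed
 have Tb: "\<exists>K. \<forall>f\<in>L2 mu0. norm (cls (T t f)) \<le> K * norm (cls f)" if "t \<ge> 0" for t
 proof -
  obtain K where K: "!!f. f \<in> L2 mu0 ==> l2_norm mu0 (T t f) \<le> K * l2_norm mu0 f"
   using C0 \<open>t \<ge> 0\<close> unfolding C0_semigroup_def by meson
  show ?thesis
   by (rule exI[of _ K]) (use K TL[OF \<open>t \<ge> 0\<close>] in \<open>simp add: norm_cls\<close>)
 qed
 have cong: "cls (T t f) = cls (T t g)" if tt: "t \<ge> 0" and fg: "f \<in> L2 mu0" "g \<in> L2 mu0" "cls f = cls g" for t f g
 proof -
  obtain K where K: "!!f. f \<in> L2 mu0 ==> norm (cls (T t f)) \<le> K * norm (cls f)" using Tb[OF tt] by auto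
  have "cls (T t f) - cls (T t g) = cls (T t (%y. 1 * f y + (-1) * g y))"
   unfolding Tlin[OF tt fg(1,2)] by simp
  also have "norm \<dots> \<le> K * norm (cls (%y. 1 * f y + (-1) * g y))"
   using fg by (intro K L2_add L2_scale)
  also have "cls (%y. 1 * f y + (-1) * g y) = 0"
   using fg by (simp add: cls_diff)
  finally show ?thesis by simp
 qed
 define U where "U t h = cls (T t (rep h))" for t h
 have U: "U t (cls f) = cls (T t f)" if "t \<ge> 0" "f \<in> L2 mu0" for t f
  unfolding U_def using that by (intro cong) (auto simp: rep_L2)
 have c0U: "c0_semigroup U"
 proof (rule c0_semigroup.intro)
  fix t :: real assume t: "t \<ge> 0"
  obtain K where K: "!!f. f \<in> L2 mu0 ==> norm (cls (T t f)) \<le> K * norm (cls f)" using Tb[OF t] by auto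
  have comb: "U t (a *\<^sub>R h + b *\<^sub>R k) = a *\<^sub>R U t h + b *\<^sub>R U t k" for a b h k
  proof -
   have "a *\<^sub>R h + b *\<^sub>R k = cls (%y. a * rep h y + b * rep k y)"
    by (simp add: cls_add cls_scale L2_scale rep_L2)
   then show ?thesis
    using U[OF t, of "%y. a * rep h y + b * rep k y"] Tlin[OF t rep_L2 rep_L2, of a h b k]
    by (simp add: L2_add L2_scale rep_L2 U_def)
  qed
  show "bounded_linear (U t)"
  proof (rule bounded_linear_intro)
   show "U t (x + y) = U t x + U t y" for x y using comb[of 1 x 1 y] by simp
   show "U t (r *\<^sub>R x) = r *\<^sub>R U t x" for r x using comb[of r x 0 0] by simp
   show "norm (U t x) \<le> norm x * K" for x
    using K[OF rep_L2, of x] by (simp add: U_def mult.commute)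
  qed
 next
  show "U 0 x = x" for x
  proof -
   have "AE y in mu0. T 0 (rep x) y = rep x y" using C0 rep_L2[of x] by (simp add: C0_semigroup_def)
   then have "cls (T 0 (rep x)) = cls (rep x)" by (intro cls_cong TL rep_L2) auto
   then show ?thesis by (simp add: U_def)
  qed
  show "U (s + t) x = U s (U t x)" if "s \<ge> 0" "t \<ge> 0" for s t x
  proof -
   have "AE y in mu0. T (s + t) (rep x) y = T s (T t (rep x)) y"
    using C0 that rep_L2[of x] unfolding C0_semigroup_def by blast
   then have "cls (T (s + t) (rep x)) = cls (T s (T t (rep x)))"
    using that by (intro cls_cong TL rep_L2) auto
   then show ?thesis using U[of s "T t (rep x)"] that by (simp add: U_def[of "s + t"] U_def[of t] TL rep_L2)
  qed
  show "((%t. U t x) \<longlongrightarrow> x) (at_right 0)" for x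
  proof -
   have "((%t. l2_norm mu0 (%y. T t (rep x) y - rep x y)) \<longlongrightarrow> 0) (at_right 0)"
    using C0 rep_L2[of x] by (simp add: C0_semigroup_def)
   then have "((%t. norm (U t x - x)) \<longlongrightarrow> 0) (at_right 0)"
    by (rule Lim_transform_eventually)
     (auto simp: eventually_at_filter U_def norm_cls[symmetric] L2_diff TL rep_L2 cls_diff)
   then show ?thesis by (simp add: tendsto_norm_zero_iff LIM_zero_iff)
  qed
 qed
 have genU: "((%t. (1 / t) *\<^sub>R (U t f - f)) \<longlongrightarrow> g) (at_right 0) \<longleftrightarrow> (f, - g) \<in> H.Lrel" for f g
 proof -
  have n: "l2_norm mu0 (%x. (T t (rep f) x - rep f x) / t - rep g x) = norm ((1 / t) *\<^sub>R (U t f - f) - g)" if "t > 0" for t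
   using l2_norm_quotient[of "rep f" "rep g" "T t (rep f)" t] TL[of t "rep f"] \<open>t > 0\<close> by (simp add: U_def rep_L2)
  have "((%t. (1 / t) *\<^sub>R (U t f - f)) \<longlongrightarrow> g) (at_right 0) \<longleftrightarrow> ((%t. norm ((1 / t) *\<^sub>R (U t f - f) - g)) \<longlongrightarrow> 0) (at_right 0)"
   by (simp add: tendsto_norm_zero_iff LIM_zero_iff)
  also have "\<dots> \<longleftrightarrow> ((%t. l2_norm mu0 (%x. (T t (rep f) x - rep f x) / t - rep g x)) \<longlongrightarrow> 0) (at_right 0)"
   by (rule tendsto_cong) (auto simp: eventually_at_filter n)
  also have "\<dots> \<longleftrightarrow> (rep f, rep g) \<in> generator mu0 T"
   by (simp add: generator_def rep_L2)
  also have "\<dots> \<longleftrightarrow> (rep f, %x. - rep g x) \<in> L"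
   unfolding gen by (auto intro!: exI[of _ "%x. - rep g x"])
  also have "\<dots> \<longleftrightarrow> (rep f, %x. - rep g x) \<in> pull (push L)" unfolding pull_push_L ..
  also have "\<dots> \<longleftrightarrow> (f, - g) \<in> H.Lrel"
   by (simp add: pull_def push_L rep_L2 L2_uminus cls_uminus)
  finally show ?thesis .
 qed
 show "heat_semigroup mu0 L t f \<in> L2 mu0" using TL[OF t f] by (simp add: T_def)
 show "cls (heat_semigroup mu0 L t f) = H.P t (cls f)"
  using H.semigroup_eq_P[OF c0U genU t, of "cls f"] U[OF t f] by (simp add: T_def)
qed

subsection \<open>The Markov property\<close>

definition clip :: "real => real" where "clip a = min 1 (max 0 a)"

lemma clip_measurable [measurable]: "clip \<in> borel_measurable borel"
 unfolding clip_def[abs_def] by measurable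

lemma abs_clip_le: "\<bar>clip a\<bar> \<le> \<bar>a\<bar>"
 by (simp add: clip_def)

lemma L2_clip: "f \<in> L2 mu0 ==> (%x. clip (f x)) \<in> L2 mu0"
 using L2_measurable[of f mu0] by - (rule L2_bound[of f], auto simp: abs_clip_le)

lemma FD_clip: "f \<in> FD ==> (%x. clip (f x)) \<in> FD"
 and EE_clip: "f \<in> FD ==> EE (%x. clip (f x)) (%x. clip (f x)) \<le> EE f f"
 using H by (auto simp: hypothesis_H_def dirichlet_form_def clip_def)

definition clipH :: "'a l2 => 'a l2" where "clipH h = cls (%x. clip (rep h x))"

lemma clipH_cls: "f \<in> L2 mu0 ==> clipH (cls f) = cls (%x. clip (f x))"
 unfolding clipH_def by (intro cls_cong L2_clip rep_L2) (auto dest!: rep_cls elim: eventually_mono)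

lemma clipH_D: "h \<in> H.D ==> clipH h \<in> H.D" and E_clipH: "h \<in> H.D ==> H.E (clipH h) (clipH h) \<le> H.E h h"
proof -
 assume h: "h \<in> H.D"
 then have r: "rep h \<in> FD" by (simp add: FD_iff rep_L2)
 show "clipH h \<in> H.D" using FD_clip[OF r] unfolding clipH_def by (rule FD_D)
 show "H.E (clipH h) (clipH h) \<le> H.E h h"
  using EE_clip[OF r] EE_eq[OF r r] EE_eq[OF FD_clip[OF r] FD_clip[OF r]] by (simp add: clipH_def)
qed

lemma clip_cases: "a \<le> 0 ==> clip a = 0" "0 \<le> a ==> a \<le> 1 ==> clip a = a" "1 \<le> a ==> clip a = 1"
 by (auto simp: clip_def)

text \<open>All points of the ray that leaves the nearest point of [0,1] in the direction of
  \<open>a\<close> have that same nearest point.\<close>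

lemma clip_interpolate:
 assumes s: "s > 0"
 shows "clip (clip a + s * (a - clip a)) = clip a"
proof -
 consider "a \<le> 0" | "0 \<le> a" "a \<le> 1" | "1 \<le> a" by linarith
 then show ?thesis
 proof cases
  case 1
  then have "s * a \<le> 0" using s by (simp add: mult_nonneg_nonpos)
  then show ?thesis using 1 by (simp add: clip_cases)
 next
  case 3
  then have "0 \<le> s * (a - 1)" using s by (intro mult_nonneg_nonneg) auto
  then show ?thesis using 3 by (simp add: clip_cases)
 qed (simp add: clip_cases)
qed

text \<open>With k = h - clip h, the vector clip h + s k has the same clip as h, so contraction of
  the form under clipping gives 0 <= 2 E(clip h, k) + s E(k, k); then s tends to 0.\<close>

lemma E_minus_clipH_nonneg:
 assumes h: "h \<in> H.D"
 shows "0 \<le> H.E h (h - clipH h)"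
proof -
 define k where "k = h - clipH h"
 have kD: "k \<in> H.D" and cD: "clipH h \<in> H.D" using h clipH_D by (auto simp: k_def)
 have step: "0 \<le> 2 * H.E (clipH h) k + s * H.E k k" if s: "s > 0" for s
 proof -
  have "clipH (clipH h + s *\<^sub>R k) = clipH h"
  proof -
   have L: "(%x. clip (rep h x)) \<in> L2 mu0" by (intro L2_clip rep_L2)
   have "clipH h + s *\<^sub>R k = cls (%x. clip (rep h x) + s * (rep h x - clip (rep h x)))"
    using L rep_L2[of h] by (simp add: k_def clipH_def cls_add cls_scale cls_diff L2_scale L2_diff)
   then have "clipH (clipH h + s *\<^sub>R k) = cls (%x. clip (clip (rep h x) + s * (rep h x - clip (rep h x))))"
    using L rep_L2[of h] by (simp add: clipH_cls L2_add L2_scale L2_diff)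
   then show ?thesis by (simp add: clip_interpolate[OF s] clipH_def)
  qed
  then have "H.E (clipH h) (clipH h) \<le> H.E (clipH h + s *\<^sub>R k) (clipH h + s *\<^sub>R k)"
   using E_clipH[of "clipH h + s *\<^sub>R k"] kD cD by simp
  also have "\<dots> = H.E (clipH h) (clipH h) + s * (2 * H.E (clipH h) k + s * H.E k k)"
   using kD cD by (simp add: H.E_add H.E_add_right H.E_scale H.E_scale_right H.E_sym[of k "clipH h"] algebra_simps)
  finally have "0 \<le> s * (2 * H.E (clipH h) k + s * H.E k k)" by simp
  then show ?thesis using s by (simp add: zero_le_mult_iff)
 qed
 have "((%s. 2 * H.E (clipH h) k + s * H.E k k) \<longlongrightarrow> 2 * H.E (clipH h) k + 0 * H.E k k) (at_right 0)"
  by (intro tendsto_intros)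
 then have "0 \<le> 2 * H.E (clipH h) k + 0 * H.E k k"
  by (rule tendsto_lowerbound) (auto simp: eventually_at_filter step)
 moreover have "H.E h k = H.E (clipH h) k + H.E k k"
  using H.E_add[OF cD kD, of k] by (simp add: k_def)
 ultimately show ?thesis using H.E_nonneg[of k] by (simp add: k_def)
qed

text \<open>A second-order expansion of the squared distance to [0,1]. Its two sides are the
  variational inequality (x - clip x) (clip x - clip y) >= 0 of the projection, used once at each
  point.\<close>

lemma square_dist_clip_expansion: "\<bar>(b - clip b)^2 - (a - clip a)^2 - 2 * ((a - clip a) * (b - a))\<bar> \<le> (b - a)^2"
proof -
 define p q where "p = a - clip a" and "q = b - clip b"
 have mono: "0 \<le> (x - clip x) * (clip x - clip y)" for x y
 proof -
  consider "x \<le> 0" | "0 \<le> x" "x \<le> 1" | "1 \<le> x" by linarith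
  then show ?thesis
  proof cases
   case 1
   moreover have "0 \<le> clip y" by (simp add: clip_def)
   ultimately show ?thesis by (simp add: clip_cases mult_nonpos_nonneg)
  next
   case 3
   moreover have "clip y \<le> 1" by (simp add: clip_def)
   ultimately show ?thesis by (simp add: clip_cases)
  qed (simp add: clip_cases)
 qed
 have e1: "q^2 - p^2 - 2 * (p * (b - a)) = (q - p)^2 + 2 * (p * (clip a - clip b))"
  unfolding p_def q_def by (simp add: power2_eq_square algebra_simps)
 have e2: "(b - a)^2 - (q^2 - p^2 - 2 * (p * (b - a))) = (clip b - clip a)^2 + 2 * (q * (clip b - clip a))"
  unfolding p_def q_def by (simp add: power2_eq_square algebra_simps)
 have "0 \<le> q^2 - p^2 - 2 * (p * (b - a))" using e1 mono[of a b] by (simp add: p_def)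
 moreover have "0 \<le> (b - a)^2 - (q^2 - p^2 - 2 * (p * (b - a)))" using e2 mono[of b a] by (simp add: q_def)
 ultimately show ?thesis unfolding p_def q_def by linarith
qed

end

context heat_space
begin

text \<open>The squared distance to the convex set of functions with values in [0,1]; it is
  differentiable with gradient 2 (h - clip h), so it can be followed along the flow.\<close>

definition clip_defect :: "'a l2 => real" where "clip_defect h = (norm (h - clipH h))^2"

lemma clip_defect_expansion:
 "\<bar>clip_defect k - clip_defect h - 2 * inner (h - clipH h) (k - h)\<bar> \<le> (norm (k - h))^2"
proof -
 define f g where "f = rep h" and "g = rep k"
 have fg: "f \<in> L2 mu0" "g \<in> L2 mu0" by (simp_all add: f_def g_def rep_L2)
 define pf pg where "pf x = f x - clip (f x)" and "pg x = g x - clip (g x)" for x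
 define d where "d x = g x - f x" for x
 have L: "pf \<in> L2 mu0" "pg \<in> L2 mu0" "d \<in> L2 mu0"
  unfolding pf_def pg_def d_def using fg by (auto intro!: L2_diff L2_clip)
 have h: "h - clipH h = cls pf"
  unfolding pf_def clipH_def f_def using cls_diff[OF rep_L2 L2_clip[OF rep_L2], of h h] by simp
 have k: "k - clipH k = cls pg"
  unfolding pg_def clipH_def g_def using cls_diff[OF rep_L2 L2_clip[OF rep_L2], of k k] by simp
 have kh: "k - h = cls d"
  unfolding d_def f_def g_def using cls_diff[OF rep_L2 rep_L2, of k h] by simp
 have i: "integrable mu0 (%x. (pg x)^2)" "integrable mu0 (%x. (pf x)^2)" "integrable mu0 (%x. pf x * d x)"
  "integrable mu0 (%x. (d x)^2)"
  using L by (auto intro: L2_integrable_square L2_integrable_mult)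
 have "clip_defect k - clip_defect h - 2 * inner (h - clipH h) (k - h)
   = (LINT x|mu0. (pg x)^2 - (pf x)^2 - 2 * (pf x * d x))"
  unfolding clip_defect_def h k kh using L i
  by (simp add: norm_cls_square inner_cls l2_inner_def)
 also have "\<bar>\<dots>\<bar> \<le> (LINT x|mu0. \<bar>(pg x)^2 - (pf x)^2 - 2 * (pf x * d x)\<bar>)"
  by (rule integral_abs_bound)
 also have "\<dots> \<le> (LINT x|mu0. (d x)^2)"
 proof (rule integral_mono)
  show "integrable mu0 (%x. \<bar>(pg x)^2 - (pf x)^2 - 2 * (pf x * d x)\<bar>)"
   using i by (intro integrable_abs Bochner_Integration.integrable_diff integrable_mult_right)
  show "\<bar>(pg x)^2 - (pf x)^2 - 2 * (pf x * d x)\<bar> \<le> (d x)^2" for x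
   unfolding pf_def pg_def d_def by (rule square_dist_clip_expansion)
 qed (rule i)
 also have "\<dots> = (norm (k - h))^2" unfolding kh using L by (simp add: norm_cls_square)
 finally show ?thesis .
qed

lemma has_derivative_clip_defect:
 "(clip_defect has_derivative (%d. 2 * inner (h - clipH h) d)) (at h)"
 unfolding has_derivative_iff_norm
proof (intro conjI)
 show "bounded_linear (%d. 2 * inner (h - clipH h) d)"
  by (intro bounded_linear_const_mult bounded_linear_inner_right)
 show "((%k. norm (clip_defect k - clip_defect h - 2 * inner (h - clipH h) (k - h)) / norm (k - h)) \<longlongrightarrow> 0) (at h)"
 proof (rule Lim_null_comparison)
  show "eventually (%k. norm (norm (clip_defect k - clip_defect h - 2 * inner (h - clipH h) (k - h)) / norm (k - h)) \<le> norm (k - h)) (at h)"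
   unfolding eventually_at_filter
  proof (intro always_eventually allI impI)
   fix k assume "k \<noteq> h"
   then have "0 < norm (k - h)" by simp
   then show "norm (norm (clip_defect k - clip_defect h - 2 * inner (h - clipH h) (k - h)) / norm (k - h)) \<le> norm (k - h)"
    using clip_defect_expansion[of k h] by (simp add: divide_le_eq power2_eq_square)
  qed
  have "((%k. norm (k - h)) \<longlongrightarrow> norm (h - h)) (at h)" by (intro tendsto_intros)
  then show "((%k. norm (k - h)) \<longlongrightarrow> 0) (at h)" by simp
 qed
qed

text \<open>The distance to the unit clip is nonincreasing along the flow.\<close>

lemma clipH_P:
 assumes f: "f \<in> L2 mu0" and r: "AE x in mu0. 0 \<le> f x \<and> f x \<le> 1" and t: "t \<ge> 0"
 shows "clipH (H.P t (cls f)) = H.P t (cls f)"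
proof -
 define u where "u s = H.P s (cls f)" for s
 have "clip_defect (u t) \<le> clip_defect (u 0)"
 proof (rule DERIV_nonpos_imp_decreasing_open[OF t])
  have cu: "continuous_on {0..t} u"
   unfolding u_def using H.P.continuous_on_T by (rule continuous_on_subset) auto
  have cd: "continuous_on UNIV clip_defect"
   by (intro continuous_at_imp_continuous_on ballI has_derivative_continuous[OF has_derivative_clip_defect])
  show "continuous_on {0..t} (%s. clip_defect (u s))"
   by (rule continuous_on_compose2[OF cd cu]) auto
  fix s :: real assume s: "0 < s" "s < t"
  obtain w where w: "(u has_vector_derivative - w) (at s)" "!!g. g \<in> H.D ==> inner w g = H.E (u s) g"
   using H.has_derivative_P[OF s(1), of "cls f"] unfolding u_def by blast
  have uD: "u s \<in> H.D" unfolding u_def by (rule H.P_in_D[OF s(1)])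
  have "((%s. clip_defect (u s)) has_derivative (%y. 2 * inner (u s - clipH (u s)) (y *\<^sub>R (- w)))) (at s)"
   using has_derivative_compose[OF w(1)[unfolded has_vector_derivative_def] has_derivative_clip_defect] .
  then have "((%s. clip_defect (u s)) has_real_derivative (- 2 * inner w (u s - clipH (u s)))) (at s)"
   unfolding has_field_derivative_def by (rule has_derivative_eq_rhs) (auto simp: inner_commute)
  moreover have "0 \<le> inner w (u s - clipH (u s))"
   using w(2)[of "u s - clipH (u s)"] E_minus_clipH_nonneg[OF uD] uD clipH_D[OF uD] by simp
  ultimately show "\<exists>y. ((%s. clip_defect (u s)) has_real_derivative y) (at s) \<and> y \<le> 0" by fastforce
 qed
 also have "clip_defect (u 0) = 0"
 proof -
  have "AE x in mu0. clip (f x) = f x" using r by eventually_elim (simp add: clip_cases)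
  then have "cls (%x. clip (f x)) = cls f" by (intro cls_cong L2_clip f)
  then show ?thesis by (simp add: u_def H.P_def clip_defect_def clipH_cls[OF f])
 qed
 finally have "(norm (u t - clipH (u t)))^2 = 0" by (simp add: clip_defect_def)
 then show ?thesis by (simp add: u_def)
qed

abbreviation PP :: "real => ('a => real) => 'a => real" where "PP t f \<equiv> rep (H.P t (cls f))"

lemma P_unit_interval:
 assumes f: "f \<in> L2 mu0" and r: "AE x in mu0. 0 \<le> f x \<and> f x \<le> 1" and t: "t \<ge> 0"
 shows "AE x in mu0. 0 \<le> PP t f x \<and> PP t f x \<le> 1"
proof -
 have "cls (%x. clip (PP t f x)) = cls (PP t f)"
  using clipH_P[OF assms] by (simp add: clipH_def)
 then have "AE x in mu0. clip (PP t f x) = PP t f x"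
  by (simp only: cls_eq_iff[OF L2_clip[OF rep_L2] rep_L2])
 then show ?thesis
 proof eventually_elim
  case (elim x)
  have "0 \<le> clip (PP t f x)" "clip (PP t f x) \<le> 1" by (simp_all add: clip_def)
  then show ?case using elim by simp
 qed
qed

text \<open>The negative part of the limit is dominated pointwise by its distance to each
  nonnegative approximant.\<close>

lemma AE_nonneg_limit:
 assumes lim: "h \<longlonglongrightarrow> k" and nn: "!!n. AE x in mu0. 0 \<le> rep (h n) x"
 shows "AE x in mu0. 0 \<le> rep (k :: 'a l2) x"
proof -
 define m where "m x = max 0 (- rep k x)" for x
 have mL: "m \<in> L2 mu0"
  using L2_measurable[OF rep_L2[of k]] unfolding m_def by - (rule L2_bound[OF rep_L2[of k]], auto)
 have le: "norm (cls m) \<le> norm (h n - k)" for n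
 proof -
  have dL: "(%x. rep (h n) x - rep k x) \<in> L2 mu0" by (intro L2_diff rep_L2)
  have "(LINT x|mu0. (m x)^2) \<le> (LINT x|mu0. (rep (h n) x - rep k x)^2)"
  proof (rule integral_mono_AE[OF L2_integrable_square[OF mL] L2_integrable_square[OF dL]])
   show "AE x in mu0. (m x)^2 \<le> (rep (h n) x - rep k x)^2"
    using nn[of n]
   proof eventually_elim
    case (elim x)
    have "\<bar>m x\<bar> \<le> \<bar>rep (h n) x - rep k x\<bar>" using elim by (auto simp: m_def)
    then show ?case by (simp only: abs_le_square_iff)
   qed
  qed
  then have "(norm (cls m))^2 \<le> (norm (cls (%x. rep (h n) x - rep k x)))^2"
   by (simp only: norm_cls_square[OF mL] norm_cls_square[OF dL])
  then show ?thesis by (simp add: cls_diff rep_L2 power2_le_iff_abs_le)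
 qed
 have "(%n. norm (h n - k)) \<longlonglongrightarrow> norm (k - k)" by (intro tendsto_intros lim)
 then have "norm (cls m) \<le> norm (k - k)" by (rule LIMSEQ_le_const) (use le in blast)
 then have "cls m = cls (%x. 0)" by (simp add: cls_0)
 then have "AE x in mu0. m x = 0" by (simp add: cls_eq_iff mL L2_0)
 then show ?thesis by eventually_elim (auto simp: m_def)
qed

lemma P_nonneg:
 assumes f: "f \<in> L2 mu0" and nn: "AE x in mu0. 0 \<le> f x" and t: "t \<ge> 0"
 shows "AE x in mu0. 0 \<le> PP t f x"
proof -
 define g where "g n x = min (f x) (real (Suc n))" for n x
 have fm: "f \<in> borel_measurable mu0" using f by (rule L2_measurable)
 have gm: "g n \<in> borel_measurable mu0" for n
  unfolding g_def[abs_def] using fm by measurable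
 have gb: "AE x in mu0. \<bar>g n x\<bar> \<le> \<bar>f x\<bar>" for n
  using nn by eventually_elim (auto simp: g_def)
 have gL: "g n \<in> L2 mu0" for n by (rule L2_bound[OF f gm gb])
 have "(%n. cls (g n)) \<longlonglongrightarrow> cls f"
 proof (rule l2_dominated_convergence[OF gm f fm gb], rule AE_I2)
  fix x
  obtain N :: nat where N: "f x \<le> real N" using real_arch_simple by blast
  have "eventually (%n. g n x = f x) sequentially"
   unfolding eventually_sequentially using N by (intro exI[of _ N]) (auto simp: g_def)
  then show "(%n. g n x) \<longlonglongrightarrow> f x" by (rule tendsto_eventually)
 qed
 then have "(%n. H.P t (cls (g n))) \<longlonglongrightarrow> H.P t (cls f)"
  by (rule bounded_linear.tendsto[OF H.bounded_linear_P])
 then show ?thesis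
 proof (rule AE_nonneg_limit)
  fix n
  define c where "c = 1 / real (Suc n)"
  have c: "c > 0" "c * real (Suc n) = 1" by (simp_all add: c_def)
  have "AE x in mu0. 0 \<le> PP t (%x. c * g n x) x \<and> PP t (%x. c * g n x) x \<le> 1"
  proof (rule P_unit_interval[OF L2_scale[OF gL] _ t])
   show "AE x in mu0. 0 \<le> c * g n x \<and> c * g n x \<le> 1"
    using nn
   proof eventually_elim
    case (elim x)
    then have "0 \<le> g n x" "g n x \<le> real (Suc n)" by (auto simp: g_def)
    then have "c * g n x \<le> c * real (Suc n)" using c by (intro mult_left_mono) auto
    then show ?case using c \<open>0 \<le> g n x\<close> unfolding c(2) by simp
   qed
  qed
  moreover have "AE x in mu0. PP t (%x. c * g n x) x = c * PP t (g n) x"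
   unfolding cls_scale[OF gL] H.P_simps by (rule rep_ops_AE)
  ultimately show "AE x in mu0. 0 \<le> PP t (g n) x"
   by eventually_elim (use c in \<open>simp add: zero_le_mult_iff\<close>)
 qed
qed

text \<open>The negative part only helps, and the positive part is scaled by 1 / c into [0,1]; c = 0
  is separate because then the positive part is the zero class.\<close>

lemma P_le_const:
 assumes f: "f \<in> L2 mu0" and le: "AE x in mu0. f x \<le> c" and c: "0 \<le> c" and t: "t \<ge> 0"
 shows "AE x in mu0. PP t f x \<le> c"
proof -
 have fm: "f \<in> borel_measurable mu0" using f by (rule L2_measurable)
 define p m where "p x = max 0 (f x)" and "m x = max 0 (- f x)" for x
 have L: "p \<in> L2 mu0" "m \<in> L2 mu0"
  using fm by (auto intro!: L2_bound[OF f] simp: p_def[abs_def] m_def[abs_def])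
 have "(%x. p x - m x) = f" by (auto simp: p_def m_def)
 then have "cls f = cls p - cls m" using cls_diff[OF L] by simp
 then have 1: "AE x in mu0. PP t f x = PP t p x - PP t m x"
  by (simp add: H.P_simps rep_ops_AE)
 have 2: "AE x in mu0. 0 \<le> PP t m x" by (rule P_nonneg[OF L(2) _ t]) (simp add: m_def)
 have 3: "AE x in mu0. PP t p x \<le> c"
 proof (cases "c = 0")
  case True
  then have "cls p = cls (%x. 0)"
   using le by (intro cls_cong L L2_0) (auto elim!: eventually_mono simp: p_def)
  then have "PP t p = rep 0" by (simp add: cls_0 H.P_simps)
  moreover have "AE x in mu0. rep (0 :: 'a l2) x \<le> c" using rep_ops_AE(5) by eventually_elim (simp add: True)
  ultimately show ?thesis by simp
 next
  case False
  then have c0: "c > 0" using c by simp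
  have "AE x in mu0. 0 \<le> PP t (%x. (1 / c) * p x) x \<and> PP t (%x. (1 / c) * p x) x \<le> 1"
   using le c0 by (intro P_unit_interval L2_scale L t) (auto elim!: eventually_mono simp: p_def divide_le_eq)
  moreover have "AE x in mu0. PP t (%x. (1 / c) * p x) x = (1 / c) * PP t p x"
   unfolding cls_scale[OF L(1)] H.P_simps by (rule rep_ops_AE)
  ultimately show ?thesis by eventually_elim (use c0 in \<open>simp add: divide_le_eq\<close>)
 qed
 show ?thesis using 1 2 3 by eventually_elim simp
qed

lemma L2_indicator: "A \<in> sets borel ==> emeasure mu0 A < \<infinity> ==> (indicator A :: 'a => real) \<in> L2 mu0"
proof -
 assume A: "A \<in> sets borel" "emeasure mu0 A < \<infinity>"
 have "(%x. (indicator A x :: real)^2) = indicator A" by (auto simp: indicator_def)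
 then show ?thesis using A by (simp add: L2_iff)
qed

text \<open>Tested against indicators of growing balls, symmetry moves \<open>P\<close> onto the
  indicator, whose image is at most 1; monotone convergence removes the balls.\<close>

lemma P_integral_le:
 assumes c: "c \<in> L2 mu0" and nn: "AE x in mu0. 0 \<le> c x" and int: "integrable mu0 c" and t: "t \<ge> 0"
 shows "integrable mu0 (PP t c)" "(LINT x|mu0. PP t c x) \<le> (LINT x|mu0. c x)"
proof -
 fix x0 :: 'a
 define K where "K n = ball x0 (real (Suc n))" for n
 have K: "K n \<in> sets borel" "emeasure mu0 (K n) < \<infinity>" for n
  using ball_measure[of "real (Suc n)" x0] by (auto simp: K_def)
 define p where "p = PP t c"
 have pL: "p \<in> L2 mu0" by (simp add: p_def rep_L2)
 have [measurable]: "p \<in> borel_measurable borel" using L2_measurable[OF pL] by simp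
 have pn: "AE x in mu0. 0 \<le> p x" unfolding p_def by (rule P_nonneg[OF c nn t])
 have step: "(\<integral>\<^sup>+x. ennreal (p x * indicator (K n) x) \<partial>mu0) \<le> ennreal (LINT x|mu0. c x)" for n
 proof -
  have iL: "(indicator (K n) :: 'a => real) \<in> L2 mu0" using K by (rule L2_indicator)
  have "(\<integral>\<^sup>+x. ennreal (p x * indicator (K n) x) \<partial>mu0) = ennreal (LINT x|mu0. p x * indicator (K n) x)"
   by (rule nn_integral_eq_integral[OF L2_integrable_mult[OF pL iL]])
    (use pn in \<open>auto elim: eventually_mono\<close>)
  also have "(LINT x|mu0. p x * indicator (K n) x) = inner (cls p) (cls (indicator (K n)))"
   by (simp add: inner_cls pL iL l2_inner_def)
  also have "\<dots> = inner (cls c) (H.P t (cls (indicator (K n))))"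
   by (simp add: p_def H.P_sym)
  also have "\<dots> = (LINT x|mu0. c x * PP t (indicator (K n)) x)"
   using inner_cls[OF c rep_L2, of "H.P t (cls (indicator (K n)))"] by (simp add: l2_inner_def)
  also have "\<dots> \<le> (LINT x|mu0. c x)"
  proof (rule integral_mono_AE[OF L2_integrable_mult[OF c rep_L2] int])
   have "AE x in mu0. PP t (indicator (K n)) x \<le> 1"
    by (rule P_le_const[OF iL _ _ t]) (auto simp: indicator_def)
   then show "AE x in mu0. c x * PP t (indicator (K n)) x \<le> c x"
    using nn by eventually_elim (simp add: mult_left_le)
  qed
  finally show ?thesis by (simp add: ennreal_leI)
 qed
 have "(\<integral>\<^sup>+x. ennreal (p x) \<partial>mu0) = (\<integral>\<^sup>+x. (SUP n. ennreal (p x * indicator (K n) x)) \<partial>mu0)"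
 proof (rule nn_integral_cong)
  fix x
  obtain N :: nat where N: "dist x0 x < real N" using reals_Archimedean2 by blast
  then have "x \<in> K N" by (simp add: K_def)
  then have "ennreal (p x) \<le> (SUP n. ennreal (p x * indicator (K n) x))"
   by (intro SUP_upper2[of N]) auto
  moreover have "(SUP n. ennreal (p x * indicator (K n) x)) \<le> ennreal (p x)"
   by (rule SUP_least) (auto simp: indicator_def)
  ultimately show "ennreal (p x) = (SUP n. ennreal (p x * indicator (K n) x))" by (rule antisym)
 qed
 also have "\<dots> = (SUP n. \<integral>\<^sup>+x. ennreal (p x * indicator (K n) x) \<partial>mu0)"
 proof (rule nn_integral_monotone_convergence_SUP)
  show "incseq (%n x. ennreal (p x * indicator (K n) x))"
  proof (rule incseq_SucI, rule le_funI)
   fix n x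
   have "K n \<subseteq> K (Suc n)" by (auto simp: K_def)
   then show "ennreal (p x * indicator (K n) x) \<le> ennreal (p x * indicator (K (Suc n)) x)"
    by (auto simp: indicator_def)
  qed
  show "(%x. ennreal (p x * indicator (K n) x)) \<in> borel_measurable mu0" for n
   using K(1)[of n] by measurable
 qed
 also have "\<dots> \<le> ennreal (LINT x|mu0. c x)" by (rule SUP_least) (rule step)
 finally have fin: "(\<integral>\<^sup>+x. ennreal (p x) \<partial>mu0) \<le> ennreal (LINT x|mu0. c x)" .
 show int_p: "integrable mu0 (PP t c)"
  unfolding p_def[symmetric] using pn le_less_trans[OF fin ennreal_less_top]
  by (intro integrableI_nonneg) auto
 have "ennreal (LINT x|mu0. p x) = (\<integral>\<^sup>+x. ennreal (p x) \<partial>mu0)"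
  using nn_integral_eq_integral[OF int_p] pn by (simp add: p_def)
 then have "ennreal (LINT x|mu0. p x) \<le> ennreal (LINT x|mu0. c x)" using fin by simp
 moreover have "0 \<le> (LINT x|mu0. c x)" using nn by (rule integral_nonneg_AE)
 ultimately show "(LINT x|mu0. PP t c x) \<le> (LINT x|mu0. c x)" unfolding p_def by (simp add: ennreal_le_iff)
qed

subsection \<open>Inequalities for the transition kernel without a kernel\<close>

lemma AE_L2_sum:
 fixes h :: "nat => 'a l2"
 shows "AE x in mu0. rep (\<Sum>k<n. s k *\<^sub>R h k) x = (\<Sum>k<n. s k * rep (h k) x)"
proof (induction n)
 case 0
 show ?case using rep_ops_AE(5) by simp
next
 case (Suc n)
 have 1: "AE x in mu0. rep ((\<Sum>k<n. s k *\<^sub>R h k) + s n *\<^sub>R h n) x = rep (\<Sum>k<n. s k *\<^sub>R h k) x + rep (s n *\<^sub>R h n) x"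
  by (rule rep_ops_AE)
 have 2: "AE x in mu0. rep (s n *\<^sub>R h n) x = s n * rep (h n) x" by (rule rep_ops_AE)
 show ?case using 1 2 Suc by eventually_elim simp
qed

text \<open>Freezing the second variable \<open>y\<close> gives, for almost every \<open>x\<close>, an inequality valid for a countable
 set of \<open>y\<close> whose values are dense; by continuity it holds for \<open>y = x\<close>.\<close>

lemma kernel_inequality_L2:
 fixes a b :: "nat => 'a => real"
 assumes aL: "!!k. a k \<in> L2 mu0" and bL: "!!k. b k \<in> L2 mu0"
  and cL: "c \<in> L2 mu0" and c: "!!x. 0 \<le> c x" "integrable mu0 c"
  and d: "!!x. 0 \<le> d x" "integrable mu0 d"
  and le: "!!x y. (\<Sum>k<n. a k x * b k y) \<le> c x + d y" and t: "t \<ge> 0"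
 shows "(\<Sum>k<n. inner (H.P t (cls (a k))) (cls (b k))) \<le> (LINT x|mu0. c x) + (LINT x|mu0. d x)"
proof -
 \<comment> \<open>A point of the sequence space carrying b_0 y, ..., b_(n-1) y and, from coordinate
   n on, d y. Separability of that space provides the countable dense set of such points.\<close>
 define \<beta> where "\<beta> y k = (if k < n then b k y else d y)" for y and k :: nat
 obtain S where S: "countable S" "S \<subseteq> range \<beta>" "range \<beta> \<subseteq> closure S"
  using separable[of "range \<beta>"] by metis
 define pa where "pa k = PP t (a k)" for k
 define pc where "pc = PP t c"
 have frozen: "AE x in mu0. (\<Sum>k<n. s k * pa k x) - pc x \<le> s n" if s: "s \<in> S" for s
 proof -
  obtain y where y: "s = \<beta> y" using S(2) s by auto
  have sumL: "(%x. \<Sum>k<m. s k * a k x) \<in> L2 mu0" and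
   clsum: "cls (%x. \<Sum>k<m. s k * a k x) = (\<Sum>k<m. s k *\<^sub>R cls (a k))" for m
  proof (induction m)
   case 0
   show "(%x. \<Sum>k<0. s k * a k x) \<in> L2 mu0" "cls (%x. \<Sum>k<0. s k * a k x) = (\<Sum>k<0. s k *\<^sub>R cls (a k))"
    by (simp_all add: L2_0 cls_0)
  next
   case (Suc m)
   show "(%x. \<Sum>k<Suc m. s k * a k x) \<in> L2 mu0"
    using L2_add[OF Suc(1) L2_scale[OF aL]] by simp
   show "cls (%x. \<Sum>k<Suc m. s k * a k x) = (\<Sum>k<Suc m. s k *\<^sub>R cls (a k))"
    using cls_add[OF Suc(1) L2_scale[OF aL], of "s m" m] Suc(2) by (simp add: cls_scale[OF aL])
  qed
  have 1: "AE x in mu0. PP t (%x. (\<Sum>k<n. s k * a k x) - c x) x \<le> s n"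
  proof (rule P_le_const[OF L2_diff[OF sumL cL] _ _ t])
   have "(\<Sum>k<n. s k * a k x) - c x \<le> s n" for x
   proof -
    have "(\<Sum>k<n. s k * a k x) = (\<Sum>k<n. a k x * b k y)"
     by (intro sum.cong) (auto simp: y \<beta>_def)
    then show ?thesis using le[of x y] by (simp add: y \<beta>_def)
   qed
   then show "AE x in mu0. (\<Sum>k<n. s k * a k x) - c x \<le> s n" by simp
   show "0 \<le> s n" using d by (simp add: y \<beta>_def)
  qed
  have 2: "H.P t (cls (%x. (\<Sum>k<n. s k * a k x) - c x)) = (\<Sum>k<n. s k *\<^sub>R H.P t (cls (a k))) - H.P t (cls c)"
   by (simp add: cls_diff[OF sumL cL] clsum H.P_simps linear_sum[OF H.linear_P])
  have 3: "AE x in mu0. rep ((\<Sum>k<n. s k *\<^sub>R H.P t (cls (a k))) - H.P t (cls c)) x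
    = rep (\<Sum>k<n. s k *\<^sub>R H.P t (cls (a k))) x - pc x"
   unfolding pc_def by (rule rep_ops_AE)
  have 4: "AE x in mu0. rep (\<Sum>k<n. s k *\<^sub>R H.P t (cls (a k))) x = (\<Sum>k<n. s k * pa k x)"
   unfolding pa_def by (rule AE_L2_sum)
  show ?thesis using 1[unfolded 2] 3 4 by eventually_elim simp
 qed
 have "AE x in mu0. \<forall>s\<in>S. (\<Sum>k<n. s k * pa k x) - pc x \<le> s n"
  using frozen S(1) by (simp add: AE_ball_countable)
 then have diag: "AE x in mu0. (\<Sum>k<n. b k x * pa k x) \<le> pc x + d x"
 proof eventually_elim
  case (elim x)
  have "closed {s :: nat => real. (\<Sum>k<n. s k * pa k x) - pc x \<le> s n}"
   by (intro closed_Collect_le continuous_intros continuous_on_product_coordinates)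
  then have "closure S \<subseteq> {s. (\<Sum>k<n. s k * pa k x) - pc x \<le> s n}"
   using elim by (intro closure_minimal) auto
  then have "(\<Sum>k<n. \<beta> x k * pa k x) - pc x \<le> \<beta> x n" using S(3) by blast
  moreover have "(\<Sum>k<n. \<beta> x k * pa k x) = (\<Sum>k<n. b k x * pa k x)"
   by (intro sum.cong) (auto simp: \<beta>_def)
  ultimately show ?case by (simp add: \<beta>_def)
 qed
 have ib: "integrable mu0 (%x. b k x * pa k x)" for k
  unfolding pa_def by (intro L2_integrable_mult bL rep_L2)
 have "(\<Sum>k<n. inner (H.P t (cls (a k))) (cls (b k))) = (\<Sum>k<n. \<integral>x. b k x * pa k x \<partial>mu0)"
 proof (rule sum.cong)
  fix k
  show "inner (H.P t (cls (a k))) (cls (b k)) = (LINT x|mu0. b k x * pa k x)"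
   using inner_cls[OF bL rep_L2, of k "H.P t (cls (a k))"] by (simp add: pa_def l2_inner_def inner_commute)
 qed simp
 also have "\<dots> = (LINT x|mu0. (\<Sum>k<n. b k x * pa k x))"
  using ib by (simp add: Bochner_Integration.integral_sum)
 also have "\<dots> \<le> (LINT x|mu0. pc x + d x)"
  using ib P_integral_le(1)[OF cL _ c(2) t] c(1) d(2) diag
  by (intro integral_mono_AE Bochner_Integration.integrable_add Bochner_Integration.integrable_sum) (auto simp: pc_def)
 also have "\<dots> = (LINT x|mu0. pc x) + (LINT x|mu0. d x)"
  using P_integral_le(1)[OF cL _ c(2) t] c(1) d(2) by (simp add: pc_def)
 also have "(LINT x|mu0. pc x) \<le> (LINT x|mu0. c x)"
  unfolding pc_def using c by (intro P_integral_le(2)[OF cL _ c(2) t]) auto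
 finally show ?thesis by simp
qed

lemma L2_restrict: "f \<in> L2 mu0 ==> A \<in> sets borel ==> (%x. indicator A x * f x) \<in> L2 (mu0 :: 'a measure)"
 using L2_measurable[of f mu0] by - (rule L2_bound[of f], auto simp: indicator_def)

text \<open>Restricting both variables to {c <= m} makes c square integrable; elsewhere the left
  side becomes 0 and the right side stays nonnegative. Then m grows.\<close>

lemma kernel_inequality:
 fixes a b :: "nat => 'a => real"
 assumes aL: "!!k. a k \<in> L2 mu0" and bL: "!!k. b k \<in> L2 mu0"
  and c: "!!x. 0 \<le> c x" "integrable mu0 c" and d: "!!x. 0 \<le> d x" "integrable mu0 d"
  and le: "!!x y. (\<Sum>k<n. a k x * b k y) \<le> c x + d y" and t: "t \<ge> 0"
 shows "(\<Sum>k<n. inner (H.P t (cls (a k))) (cls (b k))) \<le> (LINT x|mu0. c x) + (LINT x|mu0. d x)"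
proof -
 have cm: "c \<in> borel_measurable borel" using borel_measurable_integrable[OF c(2)] by simp
 define A where "A m = {x. c x \<le> real m}" for m
 have A: "A m \<in> sets borel" for m unfolding A_def using cm by simp
 define a' b' where "a' m k x = indicator (A m) x * a k x" and "b' m k x = indicator (A m) x * b k x" for m k x
 have L: "a' m k \<in> L2 mu0" "b' m k \<in> L2 mu0" for m k
  unfolding a'_def b'_def by (intro L2_restrict aL bL A)+
 have conv: "(%m. cls (%x. indicator (A m) x * f x)) \<longlonglongrightarrow> cls f" if f: "f \<in> L2 mu0" for f
 proof (rule l2_dominated_convergence[OF _ f])
  show "(%x. indicator (A m) x * f x) \<in> borel_measurable mu0" for m
   by (rule L2_measurable[OF L2_restrict[OF f A]])
  show "f \<in> borel_measurable mu0" by (rule L2_measurable[OF f])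
  show "AE x in mu0. \<bar>indicator (A m) x * f x\<bar> \<le> \<bar>f x\<bar>" for m by (auto simp: indicator_def)
  show "AE x in mu0. (%m. indicator (A m) x * f x) \<longlonglongrightarrow> f x"
  proof (rule AE_I2)
   fix x
   obtain N :: nat where N: "c x \<le> real N" using real_arch_simple by blast
   have "eventually (%m. indicator (A m) x * f x = f x) sequentially"
    unfolding eventually_sequentially using N by (intro exI[of _ N]) (auto simp: A_def)
   then show "(%m. indicator (A m) x * f x) \<longlonglongrightarrow> f x" by (rule tendsto_eventually)
  qed
 qed
 have bound: "(\<Sum>k<n. inner (H.P t (cls (a' m k))) (cls (b' m k))) \<le> (LINT x|mu0. c x) + (LINT x|mu0. d x)" for m
 proof -
  define c' d' where "c' x = indicator (A m) x * c x" and "d' x = indicator (A m) x * d x" for x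
  have ci: "integrable mu0 c'" "integrable mu0 d'"
   unfolding c'_def d'_def using integrable_real_mult_indicator[of "A m" mu0] A c d
   by (simp_all add: mult.commute)
  have c'L: "c' \<in> L2 mu0"
  proof -
   have "integrable mu0 (%x. (c' x)^2)"
   proof (rule Bochner_Integration.integrable_bound[of _ "%x. real m * c' x"])
    show "AE x in mu0. norm ((c' x)^2) \<le> norm (real m * c' x)"
     using c(1) by (intro AE_I2) (auto simp: c'_def A_def indicator_def power2_eq_square abs_mult intro!: mult_right_mono)
    show "(%x. (c' x)^2) \<in> borel_measurable mu0" unfolding c'_def using cm A by simp
   qed (use ci in simp)
   then show ?thesis using borel_measurable_integrable[OF ci(1)] by (simp add: L2_iff)
  qed
  have "(\<Sum>k<n. inner (H.P t (cls (a' m k))) (cls (b' m k))) \<le> (LINT x|mu0. c' x) + (LINT x|mu0. d' x)"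
  proof (rule kernel_inequality_L2[OF L c'L _ ci(1) _ ci(2) _ t])
   show "0 \<le> c' x" "0 \<le> d' x" for x using c d by (auto simp: c'_def d'_def)
   show "(\<Sum>k<n. a' m k x * b' m k y) \<le> c' x + d' y" for x y
   proof (cases "x \<in> A m \<and> y \<in> A m")
    case True then show ?thesis using le[of x y] by (simp add: a'_def b'_def c'_def d'_def)
   next
    case False
    then have "(\<Sum>k<n. a' m k x * b' m k y) = 0" by (intro sum.neutral) (auto simp: a'_def b'_def)
    then show ?thesis using c d by (simp add: c'_def d'_def)
   qed
  qed
  also have "(LINT x|mu0. c' x) \<le> (LINT x|mu0. c x)"
   using c by (intro integral_mono ci) (auto simp: c'_def indicator_def)
  also have "(LINT x|mu0. d' x) \<le> (LINT x|mu0. d x)"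
   using d by (intro integral_mono ci) (auto simp: d'_def indicator_def)
  finally show ?thesis by simp
 qed
 have "(%m. \<Sum>k<n. inner (H.P t (cls (a' m k))) (cls (b' m k))) \<longlonglongrightarrow> (\<Sum>k<n. inner (H.P t (cls (a k))) (cls (b k)))"
  unfolding a'_def b'_def
  by (intro tendsto_intros bounded_linear.tendsto[OF H.bounded_linear_P] conv aL bL)
 then show ?thesis by (rule LIMSEQ_le_const2) (use bound in blast)
qed

lemma kernel_inequality_list:
 assumes L: "!!a b. (a, b) \<in> set xs ==> a \<in> L2 mu0 \<and> b \<in> L2 mu0"
  and c: "!!x. 0 \<le> c x" "integrable mu0 c" and d: "!!x. 0 \<le> d x" "integrable mu0 d"
  and le: "!!x y. (\<Sum>(a, b)\<leftarrow>xs. a x * b y) \<le> c x + d y" and t: "t \<ge> 0"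
 shows "(\<Sum>(a, b)\<leftarrow>xs. inner (H.P t (cls a)) (cls b)) \<le> (LINT x|mu0. c x) + (LINT x|mu0. d x)"
proof -
 define a b where "a k = (if k < length xs then fst (xs ! k) else (%x. 0))"
  and "b k = (if k < length xs then snd (xs ! k) else (%x. 0))" for k
 have ab: "a k \<in> L2 mu0 \<and> b k \<in> L2 mu0" for k
  using L[of "fst (xs ! k)" "snd (xs ! k)"] L2_0 by (auto simp: a_def b_def)
 have "(\<Sum>(a, b)\<leftarrow>xs. inner (H.P t (cls a)) (cls b)) = (\<Sum>k<length xs. inner (H.P t (cls (a k))) (cls (b k)))"
  by (subst sum_list_sum_nth) (auto simp: a_def b_def atLeast0LessThan split_beta intro!: sum.cong)
 also have "\<dots> \<le> (LINT x|mu0. c x) + (LINT x|mu0. d x)"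
 proof (rule kernel_inequality[OF _ _ c d _ t])
  fix x y
  have "(\<Sum>k<length xs. a k x * b k y) = (\<Sum>(a, b)\<leftarrow>xs. a x * b y)"
   by (subst sum_list_sum_nth) (auto simp: a_def b_def atLeast0LessThan split_beta intro!: sum.cong)
  then show "(\<Sum>k<length xs. a k x * b k y) \<le> c x + d y" using le by simp
 qed (use ab in auto)
 finally show ?thesis .
qed


subsection \<open>Calculus of the form\<close>

definition ET :: "real => ('a => real) => ('a => real) => real" where
 "ET t f g = H.Et t (cls f) (cls g)"

lemma ET_tendsto: "f \<in> FD ==> g \<in> FD ==> ((%t. ET t f g) \<longlongrightarrow> EE f g) (at_right 0)"
 by (simp add: ET_def EE_eq H.Et_tendsto FD_D)

lemma ET_le_EE: "f \<in> FD ==> t > 0 ==> ET t f f \<le> EE f f"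
 by (simp add: ET_def EE_eq H.Et_le_E FD_D)

lemma in_FD_of_ET_bounded:
 assumes "f \<in> L2 mu0" "!!t. t > 0 ==> ET t f f \<le> M"
 shows "f \<in> FD" "EE f f \<le> M"
proof -
 have D: "cls f \<in> H.D" "H.E (cls f) (cls f) \<le> M"
  using H.in_D_of_Et_bounded[of "cls f" M] assms(2) by (auto simp: ET_def)
 then show "f \<in> FD" using assms by (simp add: FD_iff)
 then show "EE f f \<le> M" using D by (simp add: EE_eq)
qed

text \<open>The approximating forms are \<open>(1 / 2 t) \<integral>\<integral>(a x - a y) (b x - b y) p\<^sub>t(x, y) + \<integral>a b (1 - P\<^sub>t 1) / t\<close>, so
 inequalities between them need only be checked pointwise, off and on the diagonal.\<close>

lemma ET_inequality:
 assumes L: "!!c a b. (c, a, b) \<in> set xs ==> a \<in> L2 mu0 \<and> b \<in> L2 mu0"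
  and off: "!!x y. 0 \<le> (\<Sum>(c, a, b)\<leftarrow>xs. c * ((a x - a y) * (b x - b y)))"
  and diag: "!!x. 0 \<le> (\<Sum>(c, a, b)\<leftarrow>xs. c * (a x * b x))" and t: "t > 0"
 shows "0 \<le> (\<Sum>(c, a, b)\<leftarrow>xs. c * ET t a b)"
proof -
 define S where "S x = (\<Sum>(c, a, b)\<leftarrow>xs. c * (a x * b x))" for x
 \<comment> \<open>The mixed part of (a x - a y) (b x - b y) is a(x) b(y) + b(x) a(y); the remaining
   terms are collected in S x + S y.\<close>
 define ys where "ys = concat (map (%(c, a, b). [(%x. c * a x, b), (%x. c * b x, a)]) xs)"
 have sum_ys: "(\<Sum>(a, b)\<leftarrow>ys. F a b) = (\<Sum>(c, a, b)\<leftarrow>xs. F (%x. c * a x) b + F (%x. c * b x) a)" for F :: "_ => _ => real"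
  unfolding ys_def by (induction xs) auto
 have S: "integrable mu0 S \<and> (LINT x|mu0. S x) = (\<Sum>(c, a, b)\<leftarrow>xs. c * inner (cls a) (cls b))"
  unfolding S_def using L
 proof (induction xs)
  case (Cons z xs)
  obtain c a b where z: "z = (c, a, b)" by (cases z)
  have ab: "a \<in> L2 mu0" "b \<in> L2 mu0" using Cons.prems[of c a b] by (auto simp: z)
  have "integrable mu0 (%x. \<Sum>(c, a, b)\<leftarrow>xs. c * (a x * b x)) \<and>
   (LINT x|mu0. (\<Sum>(c, a, b)\<leftarrow>xs. c * (a x * b x))) = (\<Sum>(c, a, b)\<leftarrow>xs. c * inner (cls a) (cls b))"
   by (rule Cons.IH) (use Cons.prems in auto)
  then show ?case using L2_integrable_mult[OF ab] inner_cls[OF ab] by (simp add: z l2_inner_def)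
 qed simp
 have "(\<Sum>(a, b)\<leftarrow>ys. inner (H.P t (cls a)) (cls b)) \<le> (LINT x|mu0. S x) + (LINT x|mu0. S x)"
 proof (rule kernel_inequality_list)
  show "a \<in> L2 mu0 \<and> b \<in> L2 mu0" if "(a, b) \<in> set ys" for a b
   using that L by (auto simp: ys_def intro: L2_scale)
  show "(\<Sum>(a, b)\<leftarrow>ys. a x * b y) \<le> S x + S y" for x y
  proof -
   have "(\<Sum>(c, a, b)\<leftarrow>xs. c * ((a x - a y) * (b x - b y))) = S x + S y - (\<Sum>(a, b)\<leftarrow>ys. a x * b y)"
    unfolding sum_ys S_def by (induction xs) (auto simp: algebra_simps)
   then show ?thesis using off[of x y] by simp
  qed
 qed (use diag[folded S_def] S t in auto)
 also have "(\<Sum>(a, b)\<leftarrow>ys. inner (H.P t (cls a)) (cls b)) = 2 * (\<Sum>(c, a, b)\<leftarrow>xs. c * inner (H.P t (cls a)) (cls b))"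
  unfolding sum_ys using L
 proof (induction xs)
  case (Cons z xs)
  obtain c a b where z: "z = (c, a, b)" by (cases z)
  have ab: "a \<in> L2 mu0" "b \<in> L2 mu0" using Cons.prems[of c a b] by (auto simp: z)
  show ?case using Cons.IH[OF Cons.prems[OF list.set_intros(2)]] H.P_sym[of t "cls b" "cls a"] ab
   by (simp add: z cls_scale H.P_simps inner_commute)
 qed simp
 finally have "0 \<le> (LINT x|mu0. S x) - (\<Sum>(c, a, b)\<leftarrow>xs. c * inner (H.P t (cls a)) (cls b))" by simp
 also have "\<dots> = t * (\<Sum>(c, a, b)\<leftarrow>xs. c * ET t a b)"
  unfolding S[THEN conjunct2] ET_def H.Et_def using t
  by (induction xs) (auto simp: inner_diff_left algebra_simps diff_divide_distrib)
 finally show ?thesis using t by (simp add: zero_le_mult_iff)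
qed

text \<open>The limit t -> 0 of the preceding inequality. A triple in the list stands for a
  coefficient and the two arguments of the form.\<close>

lemma form_inequality:
 assumes D: "!!c a b. (c, a, b) \<in> set xs ==> a \<in> FD \<and> b \<in> FD"
  and "!!x y. 0 \<le> (\<Sum>(c, a, b)\<leftarrow>xs. c * ((a x - a y) * (b x - b y)))"
  and "!!x. 0 \<le> (\<Sum>(c, a, b)\<leftarrow>xs. c * (a x * b x))"
 shows "0 \<le> (\<Sum>(c, a, b)\<leftarrow>xs. c * EE a b)"
proof (rule tendsto_lowerbound)
 show "((%t. \<Sum>(c, a, b)\<leftarrow>xs. c * ET t a b) \<longlongrightarrow> (\<Sum>(c, a, b)\<leftarrow>xs. c * EE a b)) (at_right 0)"
  using D by (induction xs) (fastforce intro!: tendsto_intros ET_tendsto)+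
 have "0 \<le> (\<Sum>(c, a, b)\<leftarrow>xs. c * ET t a b)" if "t > 0" for t
  by (rule ET_inequality[OF _ assms(2,3) that]) (use D FD_L2 in blast)
 then show "\<forall>\<^sub>F t in at_right 0. 0 \<le> (\<Sum>(c, a, b)\<leftarrow>xs. c * ET t a b)" by (simp add: eventually_at_filter)
qed simp

lemma FD_add: "f \<in> FD ==> g \<in> FD ==> (%x. f x + g x) \<in> FD"
 and FD_diff: "f \<in> FD ==> g \<in> FD ==> (%x. f x - g x) \<in> FD"
 and FD_scale: "f \<in> FD ==> (%x. c * f x) \<in> FD"
 by (auto simp: FD_iff L2_add L2_diff L2_scale cls_add cls_diff cls_scale)

lemma FD_0: "(%x. 0) \<in> FD"
 by (simp add: FD_iff L2_0 cls_0)

lemma EE_add: "f \<in> FD ==> g \<in> FD ==> h \<in> FD ==> EE (%x. f x + g x) h = EE f h + EE g h"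
 and EE_diff: "f \<in> FD ==> g \<in> FD ==> h \<in> FD ==> EE (%x. f x - g x) h = EE f h - EE g h"
 and EE_scale: "f \<in> FD ==> h \<in> FD ==> EE (%x. c * f x) h = c * EE f h"
 by (simp_all add: EE_eq FD_add FD_diff FD_scale cls_add cls_diff cls_scale FD_L2 FD_D H.E_add H.E_diff H.E_scale)

lemma EE_sym: "f \<in> FD ==> g \<in> FD ==> EE f g = EE g f"
 by (simp add: EE_eq H.E_sym)

lemma EE_nonneg: "f \<in> FD ==> 0 \<le> EE f f"
 by (simp add: EE_eq H.E_nonneg)

lemma FD_cong: "f \<in> FD ==> g \<in> borel_measurable borel ==> AE x in mu0. f x = g x ==> g \<in> FD"
 using L2_cong_AE[of f mu0 g] cls_cong[of f g] by (auto simp: FD_iff)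

lemma EE_cong: "f \<in> FD ==> g \<in> FD ==> AE x in mu0. f x = g x ==> EE f h = EE g h"
 using cls_cong[of f g] by (simp add: form_def op_sqrt_eq op_app_def pull_def FD_L2)

lemma EE_Cauchy_Schwarz: "f \<in> FD ==> g \<in> FD ==> \<bar>EE f g\<bar> \<le> sqrt (EE f f) * sqrt (EE g g)"
 using H.E_Cauchy_Schwarz[of "cls f" "cls g"] real_sqrt_le_mono[of "(EE f g)^2" "EE f f * EE g g"]
 by (simp add: EE_eq real_sqrt_mult)

text \<open>Comparing the approximating forms pointwise bounds all those of \<open>g\<close> by the
  energy of \<open>f\<close>; this boundedness is what puts \<open>g\<close> into the
  domain.\<close>

lemma
 assumes f: "f \<in> FD" and g: "g \<in> borel_measurable borel"
  and le: "!!x. \<bar>g x\<bar> \<le> \<bar>f x\<bar>" and lip: "!!x y. \<bar>g x - g y\<bar> \<le> \<bar>f x - f y\<bar>"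
 shows FD_contraction: "g \<in> FD" and EE_contraction: "EE g g \<le> EE f f"
proof -
 have fL: "f \<in> L2 mu0" using f by (rule FD_L2)
 have gL: "g \<in> L2 mu0" by (rule L2_bound[OF fL]) (use g le in auto)
 have "ET t g g \<le> EE f f" if t: "t > 0" for t
 proof -
  have "0 \<le> (\<Sum>(c, a, b)\<leftarrow>[(1, f, f), (-1, g, g)]. c * ET t a b)"
   by (rule ET_inequality[OF _ _ _ t]) (use fL gL lip le in \<open>auto simp: abs_le_square_iff power2_eq_square[symmetric]\<close>)
  then show ?thesis using ET_le_EE[OF f t] by simp
 qed
 then show "g \<in> FD" "EE g g \<le> EE f f" using in_FD_of_ET_bounded[OF gL] by blast+
qed

text \<open>Bounded elements of the domain form an algebra, which gives the products in the energy
  integrals a meaning. The bound is asked for at every point, in keeping with the pointwise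
  hypotheses of the form inequalities.\<close>

definition FB :: "('a => real) set" where "FB = {f \<in> FD. \<exists>K. \<forall>x. \<bar>f x\<bar> \<le> K}"

lemma FB_FD: "f \<in> FB ==> f \<in> FD" and FB_L2: "f \<in> FB ==> f \<in> L2 mu0"
 by (auto simp: FB_def FD_L2)

lemma FB_bound: "f \<in> FB ==> (!!K. K \<ge> 0 ==> (!!x. \<bar>f x\<bar> \<le> K) ==> thesis) ==> thesis"
 unfolding FB_def by (smt (verit) abs_ge_zero mem_Collect_eq)

lemma FBI: "f \<in> FD ==> (!!x. \<bar>f x\<bar> \<le> K) ==> f \<in> FB"
 by (auto simp: FB_def)

lemma L2_mult_bounded:
 assumes f: "f \<in> L2 (mu0 :: 'a measure)" and g: "g \<in> borel_measurable borel" and b: "!!x. \<bar>g x\<bar> \<le> K"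
 shows "(%x. g x * f x) \<in> L2 mu0"
proof (rule L2_bound[OF L2_scale[OF f, of K]])
 show "(%x. g x * f x) \<in> borel_measurable mu0" using L2_measurable[OF f] g by simp
 show "AE x in mu0. \<bar>g x * f x\<bar> \<le> \<bar>K * f x\<bar>"
  unfolding abs_mult using b by (intro AE_I2 mult_right_mono) (auto intro: order_trans[OF _ abs_ge_self])
qed

lemma square_product_diff_le:
 fixes a b c d :: real
 shows "(a * b - c * d)^2 \<le> 2 * (c^2 * (b - d)^2) + 2 * (b^2 * (a - c)^2)"
 using sum_squares_bound[of "c * (b - d)" "b * (a - c)"] by (simp add: power2_eq_square algebra_simps)

lemma EE_mult_le:
 assumes f: "f \<in> FD" and g: "g \<in> FD" and F: "!!x. \<bar>f x\<bar> \<le> F" and G: "!!x. \<bar>g x\<bar> \<le> G"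
 shows "(%x. f x * g x) \<in> FD" "EE (%x. f x * g x) (%x. f x * g x) \<le> 2 * F^2 * EE g g + 2 * G^2 * EE f f"
proof -
 note fL = FD_L2[OF f] and gL = FD_L2[OF g]
 have pL: "(%x. f x * g x) \<in> L2 mu0"
  by (rule L2_mult_bounded[OF gL _ F]) (use L2_measurable[OF fL] in simp)
 have F2: "(f x)^2 \<le> F^2" and G2: "(g x)^2 \<le> G^2" for x
  using power_mono[OF F[of x], of 2] power_mono[OF G[of x], of 2] by simp_all
 have "ET t (%x. f x * g x) (%x. f x * g x) \<le> 2 * F^2 * EE g g + 2 * G^2 * EE f f" if t: "t > 0" for t
 proof -
  have "0 \<le> (\<Sum>(c, a, b)\<leftarrow>[(2 * F^2, g, g), (2 * G^2, f, f), (-1, %x. f x * g x, %x. f x * g x)]. c * ET t a b)"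
  proof (rule ET_inequality[OF _ _ _ t])
   show "0 \<le> (\<Sum>(c, a, b)\<leftarrow>[(2 * F^2, g, g), (2 * G^2, f, f), (-1, %x. f x * g x, %x. f x * g x)]. c * ((a x - a y) * (b x - b y)))" for x y
    using square_product_diff_le[of "f x" "g x" "f y" "g y"] mult_right_mono[OF F2[of y], of "(g x - g y)^2"]
     mult_right_mono[OF G2[of x], of "(f x - f y)^2"] by (simp add: power2_eq_square[symmetric])
   show "0 \<le> (\<Sum>(c, a, b)\<leftarrow>[(2 * F^2, g, g), (2 * G^2, f, f), (-1, %x. f x * g x, %x. f x * g x)]. c * (a x * b x))" for x
    using mult_right_mono[OF F2[of x], of "(g x)^2"] mult_nonneg_nonneg[of "G^2" "(f x)^2"] mult_nonneg_nonneg[of "F^2" "(g x)^2"]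
    by (simp add: power2_eq_square[symmetric] power_mult_distrib del: mult_nonneg_nonneg)
  qed (use fL gL pL in auto)
  moreover have "2 * F^2 * ET t g g + 2 * G^2 * ET t f f \<le> 2 * F^2 * EE g g + 2 * G^2 * EE f f"
   using ET_le_EE[OF f t] ET_le_EE[OF g t] by (intro add_mono mult_left_mono) auto
  ultimately show ?thesis by simp
 qed
 then show "(%x. f x * g x) \<in> FD" "EE (%x. f x * g x) (%x. f x * g x) \<le> 2 * F^2 * EE g g + 2 * G^2 * EE f f"
  using in_FD_of_ET_bounded[OF pL] by blast+
qed

lemma FB_mult: "f \<in> FB ==> g \<in> FB ==> (%x. f x * g x) \<in> FB"
proof -
 assume f: "f \<in> FB" and g: "g \<in> FB"
 obtain F where F: "F \<ge> 0" "!!x. \<bar>f x\<bar> \<le> F" using FB_bound[OF f] by metis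
 obtain G where G: "!!x. \<bar>g x\<bar> \<le> G" using FB_bound[OF g] by metis
 have b: "\<bar>f x * g x\<bar> \<le> F * G" for x
  unfolding abs_mult using F G by (intro mult_mono) auto
 show ?thesis by (rule FBI[OF EE_mult_le(1)[OF FB_FD[OF f] FB_FD[OF g] F(2) G] b])
qed

lemma FB_add: "f \<in> FB ==> g \<in> FB ==> (%x. f x + g x) \<in> FB"
 and FB_diff: "f \<in> FB ==> g \<in> FB ==> (%x. f x - g x) \<in> FB"
proof -
 assume f: "f \<in> FB" and g: "g \<in> FB"
 obtain F where F: "!!x. \<bar>f x\<bar> \<le> F" using FB_bound[OF f] by metis
 obtain G where G: "!!x. \<bar>g x\<bar> \<le> G" using FB_bound[OF g] by metis
 have b1: "\<bar>f x + g x\<bar> \<le> F + G" and b2: "\<bar>f x - g x\<bar> \<le> F + G" for x using F[of x] G[of x] by linarith+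
 show "(%x. f x + g x) \<in> FB" by (rule FBI[OF FD_add[OF FB_FD[OF f] FB_FD[OF g]] b1])
 show "(%x. f x - g x) \<in> FB" by (rule FBI[OF FD_diff[OF FB_FD[OF f] FB_FD[OF g]] b2])
qed

lemma FB_scale: "f \<in> FB ==> (%x. c * f x) \<in> FB"
proof -
 assume f: "f \<in> FB"
 obtain F where F: "!!x. \<bar>f x\<bar> \<le> F" using FB_bound[OF f] by metis
 have b: "\<bar>c * f x\<bar> \<le> \<bar>c\<bar> * F" for x unfolding abs_mult using F by (intro mult_left_mono) auto
 show ?thesis by (rule FBI[OF FD_scale[OF FB_FD[OF f]] b])
qed

text \<open>\<open>GG \<phi> f\<close> stands for \<open>\<integral>\<phi> d\<Gamma>(f,f)\<close>.\<close>

definition GG :: "('a => real) => ('a => real) => real" where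
 "GG \<phi> f = EE (%x. \<phi> x * f x) f - EE (%x. (f x)^2) \<phi> / 2"

lemma FB_square: "f \<in> FB ==> (%x. (f x)^2) \<in> FB"
 unfolding power2_eq_square by (intro FB_mult)

text \<open>For twice this expression the off-diagonal term is (\<phi> x + \<phi> y) (f x - f y)^2
  and the diagonal one \<phi> x (f x)^2. The comparisons that follow are read off the same two
  terms.\<close>

lemma GG_nonneg:
 assumes \<phi>: "\<phi> \<in> FB" and f: "f \<in> FB" and nn: "!!x. 0 \<le> \<phi> x"
 shows "0 \<le> GG \<phi> f"
proof -
 have "0 \<le> (\<phi> x + \<phi> y) * (f x - f y)^2" for x y using nn[of x] nn[of y] by simp
 then have "0 \<le> (\<Sum>(c, a, b)\<leftarrow>[(2, %x. \<phi> x * f x, f), (-1, %x. (f x)^2, \<phi>)]. c * EE a b)"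
  using \<phi> f nn by (intro form_inequality) (auto intro!: FB_FD FB_mult simp: power2_eq_square algebra_simps)
 then show ?thesis by (simp add: GG_def)
qed

lemma GG_contraction:
 assumes \<phi>: "\<phi> \<in> FB" and f: "f \<in> FB" and g: "g \<in> FB" and nn: "!!x. 0 \<le> \<phi> x"
  and le: "!!x. \<bar>g x\<bar> \<le> \<bar>f x\<bar>" and lip: "!!x y. \<bar>g x - g y\<bar> \<le> \<bar>f x - f y\<bar>"
 shows "GG \<phi> g \<le> GG \<phi> f"
proof -
 have "(\<phi> x + \<phi> y) * (g x - g y)^2 \<le> (\<phi> x + \<phi> y) * (f x - f y)^2" "\<phi> x * (g x)^2 \<le> \<phi> x * (f x)^2" for x y
  using lip[of x y] le[of x] nn[of x] nn[of y] by (auto simp: abs_le_square_iff intro!: mult_left_mono)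
 then have "0 \<le> (\<Sum>(c, a, b)\<leftarrow>[(2, %x. \<phi> x * f x, f), (-1, %x. (f x)^2, \<phi>), (-2, %x. \<phi> x * g x, g), (1, %x. (g x)^2, \<phi>)]. c * EE a b)"
  using \<phi> f g by (intro form_inequality) (auto intro!: FB_FD FB_mult simp: power2_eq_square algebra_simps)
 then show ?thesis by (simp add: GG_def)
qed

lemma GG_le:
 assumes \<phi>: "\<phi> \<in> FB" and f: "f \<in> FB" and nn: "!!x. 0 \<le> \<phi> x" and b: "!!x. \<phi> x \<le> K"
 shows "GG \<phi> f \<le> K * EE f f"
proof -
 have "(\<phi> x + \<phi> y) * (f x - f y)^2 \<le> (K + K) * (f x - f y)^2" "\<phi> x * (f x)^2 \<le> (K + K) * (f x)^2" for x y
  using b[of x] b[of y] nn[of x] by (intro mult_right_mono; simp)+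
 then have "0 \<le> (\<Sum>(c, a, b)\<leftarrow>[(2 * K, f, f), (-2, %x. \<phi> x * f x, f), (1, %x. (f x)^2, \<phi>)]. c * EE a b)"
  using \<phi> f by (intro form_inequality) (auto intro!: FB_FD FB_mult simp: power2_eq_square algebra_simps)
 then show ?thesis by (simp add: GG_def)
qed

text \<open>For a local form the first of these inequalities is an equality.\<close>

lemma
 assumes w: "w \<in> FB" and \<eta>: "\<eta> \<in> FB"
 shows EE_cutoff_le: "EE (%x. \<eta> x * w x) (%x. \<eta> x * w x) - EE w (%x. (\<eta> x)^2 * w x) \<le> GG (%x. (w x)^2) \<eta>"
  and EE_cutoff_bounded: "(!!x. \<bar>\<eta> x\<bar> \<le> 1) ==> EE (%x. \<eta> x * w x) (%x. \<eta> x * w x) \<le> 2 * EE w w + 2 * GG (%x. (w x)^2) \<eta>"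
proof -
 have "0 \<le> ((w x - w y) * (\<eta> x - \<eta> y))^2" "0 \<le> (w x * \<eta> x)^2" for x y by simp_all
 then have "0 \<le> (\<Sum>(c, a, b)\<leftarrow>[(2, %x. (w x)^2 * \<eta> x, \<eta>), (-1, %x. (\<eta> x)^2, %x. (w x)^2),
   (-2, %x. \<eta> x * w x, %x. \<eta> x * w x), (2, w, %x. (\<eta> x)^2 * w x)]. c * EE a b)"
  using w \<eta> by (intro form_inequality) (auto intro!: FB_FD FB_mult simp: power2_eq_square algebra_simps)
 then show "EE (%x. \<eta> x * w x) (%x. \<eta> x * w x) - EE w (%x. (\<eta> x)^2 * w x) \<le> GG (%x. (w x)^2) \<eta>" by (simp add: GG_def)
 assume X: "!!x. \<bar>\<eta> x\<bar> \<le> 1"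
 have "(\<eta> x * w x - \<eta> y * w y)^2 \<le> 2 * (w x - w y)^2 + 2 * ((w x)^2 * (\<eta> x - \<eta> y)^2)" for x y
  using square_product_diff_le[of "\<eta> x" "w x" "\<eta> y" "w y"] mult_right_mono[of "(\<eta> y)^2" 1 "(w x - w y)^2"] X[of y]
  by (simp add: abs_square_le_1)
 from this this[of y x for x y]
 have "(\<eta> x * w x - \<eta> y * w y)^2 \<le> 2 * (w x - w y)^2 + ((w x)^2 + (w y)^2) * (\<eta> x - \<eta> y)^2" for x y
  by (simp add: power2_commute distrib_right) (smt (verit) power2_commute)
 then have "0 \<le> (\<Sum>(c, a, b)\<leftarrow>[(2, w, w), (2, %x. (w x)^2 * \<eta> x, \<eta>), (-1, %x. (\<eta> x)^2, %x. (w x)^2),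
   (-1, %x. \<eta> x * w x, %x. \<eta> x * w x)]. c * EE a b)"
  using w \<eta> by (intro form_inequality) (auto intro!: FB_FD FB_mult simp: power2_eq_square algebra_simps)
 then show "EE (%x. \<eta> x * w x) (%x. \<eta> x * w x) \<le> 2 * EE w w + 2 * GG (%x. (w x)^2) \<eta>" by (simp add: GG_def)
qed

end

section \<open>Locality\<close>

locale doubling_heat_space = heat_space +
 assumes doubling: "volume_doubling (mu0 :: 'a measure)"
begin

lemma emeasure_ball_eq: "r > 0 ==> emeasure mu0 (ball (x::'a) r) = ennreal (vol mu0 x r)"
 using ball_measure[of r x] unfolding vol_def by (intro emeasure_eq_ennreal_measure) auto

lemma vol_pos: "r > 0 ==> 0 < vol mu0 (x::'a) r"
 using ball_measure[of r x] emeasure_ball_eq[of r x] by simp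

lemma emeasure_bounded_finite:
 assumes "bounded (A :: 'a set)"
 shows "emeasure mu0 A < \<infinity>"
proof (cases "A = {}")
 case False
 then obtain x where "x \<in> A" by auto
 obtain r where r: "A \<subseteq> cball x r" using bounded_subset_ballD[OF assms, of x] ball_subset_cball by blast
 have "A \<subseteq> ball x (\<bar>r\<bar> + 1)"
 proof
  fix y assume "y \<in> A"
  then have "dist x y \<le> r" using r by auto
  then show "y \<in> ball x (\<bar>r\<bar> + 1)" by simp
 qed
 then have "emeasure mu0 A \<le> emeasure mu0 (ball x (\<bar>r\<bar> + 1))" by (intro emeasure_mono) auto
 also have "\<dots> < \<infinity>" using ball_measure[of "\<bar>r\<bar> + 1" x] by simp
 finally show ?thesis .
qed simp

text \<open>Doubling bounds the number of disjoint balls of radius \<open>e / 2\<close> in a larger ball, so closed balls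
 are totally bounded.\<close>

lemma compact_cball: "compact (cball (x0::'a) R)"
proof (cases "R < 0")
 case False
 then have R: "R \<ge> 0" by simp
 obtain C where C: "C > 0" "!!x r. r > 0 ==> vol mu0 (x::'a) (2 * r) \<le> C * vol mu0 x r"
  using doubling by (auto simp: volume_doubling_def)
 have pow: "vol mu0 (x::'a) (2 ^ m * r) \<le> C ^ m * vol mu0 x r" if r: "r > 0" for x r m
 proof (induction m)
  case (Suc m)
  have "vol mu0 x (2 ^ Suc m * r) \<le> C * vol mu0 x (2 ^ m * r)"
   using C(2)[of "2 ^ m * r" x] r by (simp add: mult.assoc)
  also have "\<dots> \<le> C * (C ^ m * vol mu0 x r)" using Suc C(1) by (intro mult_left_mono) auto
  finally show ?case by (simp add: mult_ac)
 qed simp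
 have tb: "\<exists>k. finite k \<and> cball x0 R \<subseteq> (\<Union>x\<in>k. ball x e)" if e: "e > 0" for e
 proof (rule ccontr)
  assume no: "\<not> ?thesis"
  have "\<exists>F. finite F \<and> card F = N \<and> F \<subseteq> cball x0 R \<and> (\<forall>x\<in>F. \<forall>y\<in>F. x \<noteq> y \<longrightarrow> e \<le> dist x y)" for N
  proof (induction N)
   case (Suc N)
   then obtain F where F: "finite F" "card F = N" "F \<subseteq> cball x0 R" "\<forall>x\<in>F. \<forall>y\<in>F. x \<noteq> y \<longrightarrow> e \<le> dist x y" by (elim exE conjE)
   have "\<not> cball x0 R \<subseteq> (\<Union>x\<in>F. ball x e)" using no F(1) by metis
   then obtain y where y: "y \<in> cball x0 R" "y \<notin> (\<Union>x\<in>F. ball x e)" by (meson subsetI)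
   have yF: "e \<le> dist x y" if "x \<in> F" for x using y(2) that by (simp add: not_less)
   have "y \<notin> F" using yF[of y] e by auto
   show ?case
    by (rule exI[of _ "insert y F"]) (use F y \<open>y \<notin> F\<close> yF in \<open>auto simp: dist_commute\<close>)
  qed auto
  \<comment> \<open>After m doublings the ball of radius e/2 about any point of the separated set
    covers the ball of radius R + e about the centre, so the number of disjoint small balls is at
    most C^m.\<close>
  moreover obtain m :: nat where m: "(2 * R + 2 * e) / (e / 2) < 2 ^ m"
   using real_arch_pow[of 2] by auto
  moreover obtain N :: nat where N: "C ^ m < real N" using reals_Archimedean2 by blast
  ultimately obtain F where F: "finite F" "card F = N" "F \<subseteq> cball x0 R" "!!x y. x \<in> F ==> y \<in> F ==> x \<noteq> y ==> e \<le> dist x y" by metis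
  define V where "V = vol mu0 x0 (R + e)"
  have V: "V > 0" unfolding V_def using R e by (intro vol_pos) simp
  have m': "2 * R + 2 * e \<le> 2 ^ m * (e / 2)" using m e by (simp add: field_simps)
  have lower: "V \<le> C ^ m * vol mu0 x (e / 2)" if x: "x \<in> F" for x
  proof -
   have dx: "dist x0 x \<le> R" using F(3) x by auto
   have "ball x0 (R + e) \<subseteq> ball x (2 ^ m * (e / 2))"
   proof
    fix y assume "y \<in> ball x0 (R + e)"
    then have "dist x y < R + (R + e)" using dx dist_triangle[of x y x0] by (simp add: dist_commute)
    then show "y \<in> ball x (2 ^ m * (e / 2))" using m' e by simp
   qed
   then have "V \<le> vol mu0 x (2 ^ m * (e / 2))"
    unfolding V_def vol_def using emeasure_bounded_finite[of "ball x (2 ^ m * (e / 2))"]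
    by (intro measure_mono_fmeasurable) (auto simp: fmeasurable_def)
   also have "\<dots> \<le> C ^ m * vol mu0 x (e / 2)" using e by (intro pow) simp
   finally show ?thesis .
  qed
  have fm: "ball x (e / 2) \<in> fmeasurable mu0" for x :: 'a
   using emeasure_bounded_finite[of "ball x (e / 2)"] by (simp add: fmeasurable_def)
  have "real N * V \<le> (\<Sum>x\<in>F. C ^ m * vol mu0 x (e / 2))"
   using sum_mono[of F "%x. V"] lower F(2) by fastforce
  also have "\<dots> = C ^ m * (\<Sum>x\<in>F. measure mu0 (ball x (e / 2)))" by (simp add: sum_distrib_left vol_def)
  also have "(\<Sum>x\<in>F. measure mu0 (ball x (e / 2))) = measure mu0 (\<Union>x\<in>F. ball x (e / 2))"
  proof (rule measure_finite_Union[symmetric, OF F(1)])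
   show "disjoint_family_on (%x. ball x (e / 2)) F"
    unfolding disjoint_family_on_def
   proof (intro ballI impI)
    fix x y assume xy: "x \<in> F" "y \<in> F" "x \<noteq> y"
    show "ball x (e / 2) \<inter> ball y (e / 2) = {}"
    proof (rule ccontr)
     assume "ball x (e / 2) \<inter> ball y (e / 2) \<noteq> {}"
     then obtain z where "dist x z < e / 2" "dist y z < e / 2" by auto
     then have "dist x y < e" using dist_triangle2[of x y z] by linarith
     then show False using F(4)[OF xy] by simp
    qed
   qed
  qed (use emeasure_bounded_finite in \<open>auto simp: less_top[symmetric]\<close>)
  also have "C ^ m * \<dots> \<le> C ^ m * V"
  proof (rule mult_left_mono)
   have "(\<Union>x\<in>F. ball x (e / 2)) \<subseteq> ball x0 (R + e)"
   proof
    fix y assume "y \<in> (\<Union>x\<in>F. ball x (e / 2))"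
    then obtain x where x: "x \<in> F" "dist x y < e / 2" by auto
    then have "dist x0 y < R + e" using F(3) dist_triangle[of x0 y x] e by auto
    then show "y \<in> ball x0 (R + e)" by simp
   qed
   then show "measure mu0 (\<Union>x\<in>F. ball x (e / 2)) \<le> V"
    unfolding V_def vol_def using F(1) emeasure_bounded_finite[of "ball x0 (R + e)"]
    by (intro measure_mono_fmeasurable) (auto simp: fmeasurable_def intro!: sets.finite_UN)
  qed (use C in simp)
  finally have "real N \<le> C ^ m" using V by simp
  then show False using N by simp
 qed
 show ?thesis
  unfolding compact_eq_totally_bounded using tb by (simp add: complete_eq_closed)
qed simp

lemma compact_iff_closed_bounded: "compact (A :: 'a set) \<longleftrightarrow> closed A \<and> bounded A"
proof
 assume A: "closed A \<and> bounded A"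
 show "compact A"
 proof (cases "A = {}")
  case False
  then obtain x where "x \<in> A" by auto
  obtain r where r: "A \<subseteq> cball x r" using A bounded_subset_ballD[of A x] ball_subset_cball by blast
  have "compact (cball x r \<inter> A)" using A by (intro compact_Int_closed compact_cball) auto
  moreover have "cball x r \<inter> A = A" using r by auto
  ultimately show ?thesis by simp
 qed simp
qed (auto simp: compact_imp_closed compact_imp_bounded)

lemma rel_compact_openI: "open U ==> bounded (U :: 'a set) ==> rel_compact_open U"
 by (simp add: rel_compact_open_def compact_iff_closed_bounded bounded_closure)

abbreviation supp :: "('a => real) => 'a set" where "supp f \<equiv> closure {x. f x \<noteq> 0}"

definition CD :: "('a => real) set" where "CD = FD \<inter> Cc"

lemma CD_FD: "\<phi> \<in> CD ==> \<phi> \<in> FD" and CD_Cc: "\<phi> \<in> CD ==> \<phi> \<in> Cc"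
 by (auto simp: CD_def)

lemma CD_continuous: "\<phi> \<in> CD ==> continuous_on UNIV \<phi>" and CD_compact: "\<phi> \<in> CD ==> compact (supp \<phi>)"
 by (auto simp: CD_def Cc_def)

lemma supp_0: "x \<notin> supp f ==> f x = 0"
 using closure_subset[of "{x. f x \<noteq> 0}"] by auto

lemma CD_FB: "\<phi> \<in> CD ==> \<phi> \<in> FB"
proof -
 assume \<phi>: "\<phi> \<in> CD"
 have "compact (\<phi> ` supp \<phi>)"
  by (rule compact_continuous_image[OF continuous_on_subset[OF CD_continuous[OF \<phi>]] CD_compact[OF \<phi>]]) simp
 then have "bounded (\<phi> ` supp \<phi>)" by (rule compact_imp_bounded)
 then obtain K where K: "!!x. x \<in> supp \<phi> ==> \<bar>\<phi> x\<bar> \<le> K" by (auto simp: bounded_real)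
 have "\<bar>\<phi> x\<bar> \<le> max K 0" for x using K[of x] supp_0[of x \<phi>] by (cases "x \<in> supp \<phi>") (simp_all add: le_max_iff_disj)
 then show ?thesis by (rule FBI[OF CD_FD[OF \<phi>]])
qed

lemma CcI: "continuous_on UNIV f ==> compact K ==> (!!x. x \<notin> K ==> f x = 0) ==> f \<in> (Cc :: ('a => real) set)"
proof -
 assume f: "continuous_on UNIV f" "compact K" "!!x. x \<notin> K ==> f x = 0"
 have "supp f \<subseteq> K" using f by (intro closure_minimal) (auto intro: compact_imp_closed)
 then have "compact (supp f)" using compact_Int_closed[OF f(2), of "supp f"] by (simp add: Int_absorb1)
 then show ?thesis using f by (simp add: Cc_def)
qed

lemma CDI: "f \<in> FD ==> continuous_on UNIV f ==> compact K ==> (!!x. x \<notin> K ==> f x = 0) ==> f \<in> CD"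
 using CcI[of f K] by (auto simp: CD_def)

lemma CD_contraction:
 assumes \<phi>: "\<phi> \<in> CD" and T: "!!a b. \<bar>T a - T b\<bar> \<le> \<bar>a - b\<bar>" "T 0 = 0"
 shows "(%x. T (\<phi> x)) \<in> CD"
proof (rule CDI[OF _ _ CD_compact[OF \<phi>]])
 have cT: "continuous_on UNIV (T :: real => real)"
 proof (rule continuous_onI)
  fix a e :: real assume "e > 0"
  then show "\<exists>d>0. \<forall>b\<in>UNIV. dist b a < d \<longrightarrow> dist (T b) (T a) \<le> e"
   using T(1)[of _ a] by (intro exI[of _ e]) (auto simp: dist_real_def intro: order_trans[OF T(1)])
 qed
 then show c: "continuous_on UNIV (%x. T (\<phi> x))"
  by (rule continuous_on_compose2[OF _ CD_continuous[OF \<phi>]]) auto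
 show "(%x. T (\<phi> x)) \<in> FD"
 proof (rule FD_contraction[OF CD_FD[OF \<phi>] borel_measurable_continuous_onI[OF c]])
  show "\<bar>T (\<phi> x)\<bar> \<le> \<bar>\<phi> x\<bar>" for x using T(1)[of "\<phi> x" 0] T(2) by simp
 qed (rule T)
 show "T (\<phi> x) = 0" if "x \<notin> supp \<phi>" for x using supp_0[OF that] T by simp
qed

lemma CD_add: "f \<in> CD ==> g \<in> CD ==> (%x. f x + g x) \<in> CD"
 and CD_diff: "f \<in> CD ==> g \<in> CD ==> (%x. f x - g x) \<in> CD"
proof -
 assume fg: "f \<in> CD" "g \<in> CD"
 have K: "compact (supp f \<union> supp g)" using fg by (intro compact_Un CD_compact)
 show "(%x. f x + g x) \<in> CD"
  by (rule CDI[OF FD_add[OF fg[THEN CD_FD]] continuous_on_add[OF fg[THEN CD_continuous]] K]) (auto dest!: supp_0)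
 show "(%x. f x - g x) \<in> CD"
  by (rule CDI[OF FD_diff[OF fg[THEN CD_FD]] continuous_on_diff[OF fg[THEN CD_continuous]] K]) (auto dest!: supp_0)
qed

lemma CD_scale: "f \<in> CD ==> (%x. c * f x) \<in> CD"
 by (rule CDI[OF FD_scale[OF CD_FD] continuous_on_mult_left[OF CD_continuous] CD_compact]) (auto dest!: supp_0)

lemma CD_mult: "f \<in> CD ==> g \<in> CD ==> (%x. f x * g x) \<in> CD"
 by (rule CDI[OF FB_FD[OF FB_mult[OF CD_FB CD_FB]] continuous_on_mult[OF CD_continuous CD_continuous] CD_compact[of f]])
  (auto dest!: supp_0)

lemma abs_clip_diff: "\<bar>clip a - clip b\<bar> \<le> \<bar>a - b\<bar>"
 by (simp add: clip_def)

lemma regular1: "f \<in> FD ==> e > 0 ==> \<exists>\<phi>\<in>CD. form_norm2 mu0 EE (%x. f x - \<phi> x) < e"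
 using H by (simp add: hypothesis_H_def regular_form_def CD_def)

lemma regular2: "\<psi> \<in> Cc ==> e > 0 ==> \<exists>\<phi>\<in>CD. \<forall>x. \<bar>\<psi> x - \<phi> x\<bar> < e"
 using H by (simp add: hypothesis_H_def regular_form_def CD_def)

text \<open>Regularity gives only uniform approximants, which need not vanish or be constant
  anywhere. A plateau of height 3 is approximated within 1/2, lowered by 1 and clipped: the result
  is exactly 0 outside a compact part of \<open>U\<close> and exactly 1 near
  \<open>K\<close>.\<close>

lemma urysohn_CD:
 assumes K: "compact K" and U: "open U" "K \<subseteq> U"
 obtains h V where "h \<in> CD" "!!x. 0 \<le> h x" "!!x. h x \<le> 1" "supp h \<subseteq> U"
  "open V" "K \<subseteq> V" "!!x. x \<in> V ==> h x = 1"
proof (cases "K = {}")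
 case True
 have "(%x. 0) \<in> CD" by (rule CDI[OF FD_0, of "{}"]) auto
 then show thesis by (rule that[of _ "{}"]) (auto simp: True)
next
 case False
 obtain d where d: "d > 0" "!!x y. x \<in> K ==> y \<in> - U ==> d \<le> dist x y"
 proof -
  obtain e where "e > 0" "!!x. x \<in> K ==> \<exists>G\<in>{U}. ball x e \<subseteq> G"
   using Heine_Borel_lemma[OF K, of "{U}"] U by auto
  then show ?thesis by (intro that[of e]) (auto simp: subset_eq not_less[symmetric])
 qed
 define s where "s x = infdist x K" for x
 have cs: "continuous_on UNIV s" unfolding s_def by (intro continuous_intros)
 have bK: "bounded {x. s x \<le> d / 2}"
 proof -
  obtain k R where kR: "K \<subseteq> cball k R" using compact_imp_bounded[OF K] by (auto simp: bounded_subset_cball)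
  have "{x. s x \<le> d / 2} \<subseteq> cball k (R + d)"
  proof
   fix x assume "x \<in> {x. s x \<le> d / 2}"
   then have "infdist x K < d" using d by (simp add: s_def)
   then obtain y where y: "y \<in> K" "dist x y < d"
    using False cINF_less_iff[of K "dist x" d] by (auto simp: infdist_notempty)
   then have "dist k x \<le> R + d" using kR dist_triangle[of k x y] by (auto simp: dist_commute)
   then show "x \<in> cball k (R + d)" by simp
  qed
  then show ?thesis using bounded_cball bounded_subset by blast
 qed
 have closed: "closed {x. s x \<le> d / 2}" by (intro closed_Collect_le cs continuous_intros)
 have cK: "compact {x. s x \<le> d / 2}" using bK closed by (simp add: compact_iff_closed_bounded)
 have sU: "{x. s x \<le> d / 2} \<subseteq> U"
 proof
  fix x assume x: "x \<in> {x. s x \<le> d / 2}"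
  show "x \<in> U"
  proof (rule ccontr)
   assume "x \<notin> U"
   then have "d \<le> infdist x K"
    using d(2) False by (auto simp: infdist_notempty dist_commute intro!: cINF_greatest)
   then show False using x d by (simp add: s_def)
  qed
 qed
 define \<psi> where "\<psi> x = 3 * clip (2 - (4 / d) * s x)" for x
 have \<psi>0: "\<psi> x = 0" if "d / 2 \<le> s x" for x
 proof -
  have "2 \<le> (4 / d) * s x" using that d by (simp add: field_simps)
  then show ?thesis by (simp add: \<psi>_def clip_cases)
 qed
 have \<psi>1: "\<psi> x = 3" if "s x \<le> d / 4" for x
 proof -
  have "(4 / d) * s x \<le> 1" using that d by (simp add: field_simps)
  then show ?thesis by (simp add: \<psi>_def clip_cases)
 qed
 have "\<psi> \<in> Cc"
 proof (rule CcI[OF _ cK])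
  show "continuous_on UNIV \<psi>" unfolding \<psi>_def clip_def by (intro continuous_intros cs)
  show "\<psi> x = 0" if "x \<notin> {x. s x \<le> d / 2}" for x using that by (intro \<psi>0) simp
 qed
 then obtain \<phi> where \<phi>: "\<phi> \<in> CD" "!!x. \<bar>\<psi> x - \<phi> x\<bar> < 1 / 2" using regular2[of \<psi> "1/2"] by auto
 define h where "h x = clip (\<phi> x - 1)" for x
 have h0: "h x = 0" if "d / 2 \<le> s x" for x
  using \<phi>(2)[of x] \<psi>0[OF that] unfolding h_def by (intro clip_cases) (simp add: abs_if split: if_splits)
 have h1: "h x = 1" if "s x \<le> d / 4" for x
  using \<phi>(2)[of x] \<psi>1[OF that] unfolding h_def by (intro clip_cases) (simp add: abs_if split: if_splits)
 show thesis
 proof (rule that)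
  show "h \<in> CD" unfolding h_def
   by (rule CD_contraction[OF \<phi>(1), of "%a. clip (a - 1)"]) (use abs_clip_diff[of "_ - 1" "_ - 1"] in \<open>auto simp: clip_cases\<close>)
  show "0 \<le> h x" "h x \<le> 1" for x by (simp_all add: h_def clip_def)
  have "s x \<le> d / 2" if "h x \<noteq> 0" for x using h0[of x] that by (meson linear)
  then have "supp h \<subseteq> {x. s x \<le> d / 2}" by (intro closure_minimal closed) blast
  then show "supp h \<subseteq> U" using sU by simp
  show "open {x. s x < d / 4}" by (intro open_Collect_less cs continuous_intros)
  show "K \<subseteq> {x. s x < d / 4}" using d by (auto simp: s_def)
  show "h x = 1" if "x \<in> {x. s x < d / 4}" for x using h1[of x] that by simp
 qed
qed

lemma approx_CD:
 assumes f: "f \<in> FD"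
 shows "\<exists>\<phi>. (\<forall>n. \<phi> n \<in> CD) \<and> (%n. cls (\<phi> n)) \<longlonglongrightarrow> cls f \<and>
  (%n. EE (%x. \<phi> n x - f x) (%x. \<phi> n x - f x)) \<longlonglongrightarrow> 0"
proof -
 have "\<forall>n. \<exists>\<phi>. \<phi> \<in> CD \<and> form_norm2 mu0 EE (%x. f x - \<phi> x) < 1 / real (Suc n)"
  using regular1[OF f] by (meson of_nat_0_less_iff zero_less_Suc zero_less_divide_1_iff)
 from choice[OF this] obtain \<phi> where \<phi>: "!!n. \<phi> n \<in> CD" "!!n. form_norm2 mu0 EE (%x. f x - \<phi> n x) < 1 / real (Suc n)" by blast
 note \<phi>D = CD_FD[OF \<phi>(1)]
 have lim0: "(%n. 1 / real (Suc n)) \<longlonglongrightarrow> 0" using LIMSEQ_inverse_real_of_nat by (simp add: inverse_eq_divide)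
 have fn: "form_norm2 mu0 EE (%x. f x - \<phi> n x) = EE (%x. \<phi> n x - f x) (%x. \<phi> n x - f x) + (norm (cls (\<phi> n) - cls f))^2" for n
 proof -
  have D: "(%x. f x - \<phi> n x) \<in> FD" "(%x. \<phi> n x - f x) \<in> FD" by (intro FD_diff f \<phi>D)+
  have "cls (%x. f x - \<phi> n x) = - cls (%x. \<phi> n x - f x)"
   by (simp add: cls_diff FD_L2 f \<phi>D)
  moreover have "H.E (- h) (- h) = H.E h h" if "h \<in> H.D" for h
   using H.E_scale[OF that, of "-1"] H.E_scale_right[OF that, of _ "-1"] by simp
  ultimately show ?thesis
   using D by (simp add: form_norm2_eq EE_eq FD_D) (simp add: cls_diff FD_L2 f \<phi>D)
 qed
 have e: "EE (%x. \<phi> n x - f x) (%x. \<phi> n x - f x) \<le> 1 / real (Suc n)" "(norm (cls (\<phi> n) - cls f))^2 \<le> 1 / real (Suc n)"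
  and e0: "0 \<le> EE (%x. \<phi> n x - f x) (%x. \<phi> n x - f x)" for n
  using \<phi>(2)[of n] fn[of n] EE_nonneg[OF FD_diff[OF \<phi>D f], of n] zero_le_power2[of "norm (cls (\<phi> n) - cls f)"]
  by linarith+
 have "(%n. (norm (cls (\<phi> n) - cls f))^2) \<longlonglongrightarrow> 0"
  by (rule tendsto_sandwich[OF _ _ tendsto_const lim0]) (use e in auto)
 from tendsto_real_sqrt[OF this] have "(%n. norm (cls (\<phi> n) - cls f)) \<longlonglongrightarrow> 0" by simp
 then have 1: "(%n. cls (\<phi> n)) \<longlonglongrightarrow> cls f" by (simp add: tendsto_norm_zero_iff LIM_zero_iff)
 have 2: "(%n. EE (%x. \<phi> n x - f x) (%x. \<phi> n x - f x)) \<longlonglongrightarrow> 0"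
  by (rule tendsto_sandwich[OF _ _ tendsto_const lim0]) (use e e0 in auto)
 show ?thesis using \<phi>(1) 1 2 by blast
qed

lemma EE_sum_le: "f \<in> FD ==> g \<in> FD ==> EE (%x. f x + g x) (%x. f x + g x) \<le> 2 * EE f f + 2 * EE g g"
proof -
 assume f: "f \<in> FD" and g: "g \<in> FD"
 note D = FD_add[OF f g] FD_diff[OF f g]
 have "EE (%x. f x + g x) (%x. f x + g x) + EE (%x. f x - g x) (%x. f x - g x) = 2 * EE f f + 2 * EE g g"
  using f g D by (simp add: EE_add EE_diff EE_sym[of f "%x. f x + g x"] EE_sym[of g "%x. f x + g x"]
    EE_sym[of f "%x. f x - g x"] EE_sym[of g "%x. f x - g x"])
 then show ?thesis using EE_nonneg[OF D(2)] by linarith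
qed

lemma EE_uminus: "f \<in> FD ==> EE (%x. - f x) (%x. - f x) = EE f f"
 using EE_scale[of f "%x. - f x" "-1"] EE_scale[of f f "-1"] FD_scale[of f "-1"] EE_sym[of f "%x. - f x"] by simp

lemma EE_diff_le: "f \<in> FD ==> g \<in> FD ==> EE (%x. f x - g x) (%x. f x - g x) \<le> 2 * EE f f + 2 * EE g g"
 using EE_sum_le[of f "%x. - g x"] FD_scale[of g "-1"] EE_uminus[of g] by simp

lemma EE_weak_limit:
 assumes D: "!!n. f n \<in> FD" and b: "!!n. EE (f n) (f n) \<le> M" and lim: "(%n. cls (f n)) \<longlonglongrightarrow> cls g" and g: "g \<in> L2 mu0"
 shows "g \<in> FD" "EE g g \<le> M" "h \<in> FD ==> (%n. EE (f n) h) \<longlonglongrightarrow> EE g h"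
proof -
 have b': "H.E (cls (f n)) (cls (f n)) \<le> M" for n using b[of n] D[of n] by (simp add: EE_eq)
 note fl = H.form_limit[OF FD_D[OF D] b' lim]
 show gD: "g \<in> FD" using fl(1) g by (simp add: FD_iff)
 show "EE g g \<le> M" using fl(2) gD by (simp add: EE_eq)
 show "h \<in> FD ==> (%n. EE (f n) h) \<longlonglongrightarrow> EE g h" using fl(3)[OF FD_D] gD D by (simp add: EE_eq)
qed

lemma ess_support_compact:
 fixes h :: "'a => real"
 assumes "compact K" "!!x. x \<notin> K ==> h x = 0"
 shows "ess_support mu0 h \<subseteq> K \<and> compact (ess_support mu0 h)"
proof -
 have "- K \<in> {U. open U \<and> (AE x in mu0. x \<in> U \<longrightarrow> h x = 0)}"
  using assms compact_imp_closed[of K] by auto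
 then have "- K \<subseteq> \<Union>{U. open U \<and> (AE x in mu0. x \<in> U \<longrightarrow> h x = 0)}" by (rule Union_upper)
 then have sub: "ess_support mu0 h \<subseteq> K" unfolding ess_support_def by auto
 moreover have "closed (ess_support mu0 h)" unfolding ess_support_def by (intro closed_Compl open_Union) auto
 ultimately have "compact (ess_support mu0 h)"
  using compact_Int_closed[OF assms(1), of "ess_support mu0 h"] by (simp add: Int_absorb1)
 with sub show ?thesis by simp
qed

lemma strong_locality:
 assumes f: "f \<in> FD" and K: "compact K" "!!x. x \<notin> K ==> f x = 0"
  and g: "g \<in> FD" and K': "compact K'" "!!x. x \<notin> K' ==> g x = 0"
  and U: "open U" "K \<subseteq> U" "!!x. x \<in> U ==> g x = a"
 shows "EE f g = 0"
proof -
 have "strongly_local_form mu0 FD EE" using H by (simp add: hypothesis_H_def)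
 moreover have "compact (ess_support mu0 f)" "ess_support mu0 f \<subseteq> U" "compact (ess_support mu0 g)"
  using ess_support_compact[of K f, OF K] ess_support_compact[of K' g, OF K'] U(2) by blast+
 moreover have "AE x in mu0. x \<in> U \<longrightarrow> g x = a" using U(3) by simp
 ultimately show ?thesis using f g U(1) unfolding strongly_local_form_def by blast
qed

lemma FD_truncate_max: "f \<in> FD ==> M \<ge> 0 ==> (%x. max (- M) (min M (f x))) \<in> FD"
 and EE_truncate_max: "f \<in> FD ==> M \<ge> 0 ==> EE (%x. max (- M) (min M (f x))) (%x. max (- M) (min M (f x))) \<le> EE f f"
proof -
 assume f: "f \<in> FD" and M: "M \<ge> 0"
 have m: "(%x. max (- M) (min M (f x))) \<in> borel_measurable borel" using FD_measurable[OF f] by measurable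
 have 1: "\<bar>max (- M) (min M (f x))\<bar> \<le> \<bar>f x\<bar>" for x using M by (simp add: max_def min_def)
 have 2: "\<bar>max (- M) (min M (f x)) - max (- M) (min M (f y))\<bar> \<le> \<bar>f x - f y\<bar>" for x y
  by (simp add: max_def min_def)
 show "(%x. max (- M) (min M (f x))) \<in> FD" by (rule FD_contraction[OF f m 1 2])
 show "EE (%x. max (- M) (min M (f x))) (%x. max (- M) (min M (f x))) \<le> EE f f" by (rule EE_contraction[OF f m 1 2])
qed

text \<open>Strong locality for a second argument without compact support: approximate it by truncated
 continuous functions and multiply by \<open>1 - \<eta>\<close>.\<close>

lemma locality_bounded:
 assumes f: "f \<in> FD" and K: "compact K" "!!x. x \<notin> K ==> f x = 0"
  and h: "h \<in> FB" and U: "open U" "K \<subseteq> U" "!!x. x \<in> U ==> h x = 0"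
 shows "EE h f = 0"
proof -
 obtain \<eta> V where \<eta>: "\<eta> \<in> CD" "!!x. 0 \<le> \<eta> x" "!!x. \<eta> x \<le> 1" "supp \<eta> \<subseteq> U"
  and V: "open V" "K \<subseteq> V" "!!x. x \<in> V ==> \<eta> x = 1" by (rule urysohn_CD[OF K(1) U(1,2)]) metis
 obtain M where M: "M \<ge> 0" "!!x. \<bar>h x\<bar> \<le> M" using FB_bound[OF h] by metis
 obtain \<phi> where \<phi>: "!!n. \<phi> n \<in> CD" "(%n. cls (\<phi> n)) \<longlonglongrightarrow> cls h"
  "(%n. EE (%x. \<phi> n x - h x) (%x. \<phi> n x - h x)) \<longlonglongrightarrow> 0" using approx_CD[OF FB_FD[OF h]] by blast
 define T where "T a = max (- M) (min M a)" for a
 define g where "g n x = T (\<phi> n x) - T (\<phi> n x) * \<eta> x" for n x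
 have T: "T 0 = 0" "\<bar>T a - T b\<bar> \<le> \<bar>a - b\<bar>" "\<bar>T a\<bar> \<le> M" for a b
  using M(1) by (auto simp: T_def max_def min_def)
 have T\<phi>: "(%x. T (\<phi> n x)) \<in> CD" for n by (rule CD_contraction[OF \<phi>(1) T(2,1)])
 have gCD: "g n \<in> CD" for n unfolding g_def by (intro CD_diff CD_mult T\<phi> \<eta>)
 have E0: "EE (g n) f = 0" for n
 proof -
  have "EE f (g n) = 0"
   by (rule strong_locality[OF f K CD_FD[OF gCD] CD_compact[OF gCD] supp_0[of _ "g n"] V(1,2), where a = 0]) (simp_all add: g_def V)
  then show ?thesis using EE_sym[OF f CD_FD[OF gCD]] by simp
 qed
 have "Bseq (%n. EE (%x. \<phi> n x - h x) (%x. \<phi> n x - h x))"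
  using \<phi>(3) by (intro convergent_imp_Bseq) (auto simp: convergent_def)
 then obtain B where B: "!!n. \<bar>EE (%x. \<phi> n x - h x) (%x. \<phi> n x - h x)\<bar> \<le> B" by (auto simp: Bseq_def)
 define B1 where "B1 = 2 * B + 2 * EE h h"
 have B1: "EE (%x. T (\<phi> n x)) (%x. T (\<phi> n x)) \<le> B1" for n
 proof -
  have "EE (%x. T (\<phi> n x)) (%x. T (\<phi> n x)) \<le> EE (\<phi> n) (\<phi> n)"
   unfolding T_def by (rule EE_truncate_max[OF CD_FD[OF \<phi>(1)] M(1)])
  also have "\<dots> \<le> 2 * EE (%x. \<phi> n x - h x) (%x. \<phi> n x - h x) + 2 * EE h h"
   using EE_sum_le[OF FD_diff[OF CD_FD[OF \<phi>(1)] FB_FD[OF h]] FB_FD[OF h], of n] by simp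
  also have "\<dots> \<le> B1" using B[of n] by (simp add: B1_def)
  finally show ?thesis .
 qed
 \<comment> \<open>Truncation at the bound \<open>M\<close> of \<open>h\<close> keeps the energies
   of the products bounded; together with convergence in norm this suffices for the weak
   limit.\<close>
 have bound: "EE (g n) (g n) \<le> 2 * B1 + 2 * (2 * (M^2 * EE \<eta> \<eta>) + 2 * B1)" for n
 proof -
  have "EE (%x. T (\<phi> n x) * \<eta> x) (%x. T (\<phi> n x) * \<eta> x) \<le> 2 * M^2 * EE \<eta> \<eta> + 2 * 1^2 * EE (%x. T (\<phi> n x)) (%x. T (\<phi> n x))"
   by (rule EE_mult_le(2)[OF CD_FD[OF T\<phi>] CD_FD[OF \<eta>(1)] T(3)]) (use \<eta>(2,3) in auto)
  also have "\<dots> \<le> 2 * (M^2 * EE \<eta> \<eta>) + 2 * B1" using B1[of n] by simp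
  finally have a: "EE (%x. T (\<phi> n x) * \<eta> x) (%x. T (\<phi> n x) * \<eta> x) \<le> 2 * (M^2 * EE \<eta> \<eta>) + 2 * B1" .
  have b: "EE (g n) (g n) \<le> 2 * EE (%x. T (\<phi> n x)) (%x. T (\<phi> n x)) + 2 * EE (%x. T (\<phi> n x) * \<eta> x) (%x. T (\<phi> n x) * \<eta> x)"
   using EE_diff_le[OF CD_FD[OF T\<phi>] CD_FD[OF CD_mult[OF T\<phi> \<eta>(1)]], of n n] by (simp add: g_def[abs_def])
  show ?thesis by (rule order_trans[OF b add_mono]) (use a B1[of n] in simp_all)
 qed
 have lim: "(%n. cls (g n)) \<longlonglongrightarrow> cls h"
 proof -
  have le: "norm (cls (g n) - cls h) \<le> norm (cls (\<phi> n) - cls h)" for n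
  proof -
   have L: "(%x. g n x - h x) \<in> L2 mu0" "(%x. \<phi> n x - h x) \<in> L2 mu0"
    by (intro L2_diff FD_L2 CD_FD[OF gCD] CD_FD[OF \<phi>(1)] FB_FD[OF h])+
   have "(LINT x|mu0. (g n x - h x)^2) \<le> (LINT x|mu0. (\<phi> n x - h x)^2)"
   proof (rule integral_mono[OF L2_integrable_square[OF L(1)] L2_integrable_square[OF L(2)]])
    fix x
    have h\<eta>: "h x = h x * (1 - \<eta> x)"
     using U(3)[of x] \<eta>(4) supp_0[of x \<eta>] by (cases "x \<in> supp \<eta>") auto
    have "T (h x) = h x" using M(2)[of x] by (auto simp: T_def max_def min_def abs_le_iff)
    then have "g n x - h x = (T (\<phi> n x) - T (h x)) * (1 - \<eta> x)"
     using h\<eta> by (simp add: g_def algebra_simps)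
    also have "\<bar>\<dots>\<bar> \<le> \<bar>\<phi> n x - h x\<bar> * 1"
     unfolding abs_mult using T(2) \<eta>(2,3)[of x] by (intro mult_mono) auto
    finally show "(g n x - h x)^2 \<le> (\<phi> n x - h x)^2" by (simp add: abs_le_square_iff[symmetric])
   qed
   then have "(norm (cls (%x. g n x - h x)))^2 \<le> (norm (cls (%x. \<phi> n x - h x)))^2"
    by (simp only: norm_cls_square L)
   then have "norm (cls (%x. g n x - h x)) \<le> norm (cls (%x. \<phi> n x - h x))"
    by (rule power2_le_imp_le) simp
   then show ?thesis using gCD[of n] \<phi>(1)[of n] h by (simp add: cls_diff FD_L2 CD_FD FB_FD)
  qed
  have "(%n. norm (cls (\<phi> n) - cls h)) \<longlonglongrightarrow> norm (cls h - cls h)" by (intro tendsto_intros \<phi>)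
  then have z: "(%n. norm (cls (\<phi> n) - cls h)) \<longlonglongrightarrow> 0" by simp
  have "(%n. cls (g n) - cls h) \<longlonglongrightarrow> 0"
   by (rule Lim_null_comparison[OF _ z]) (simp add: le)
  then show ?thesis by (rule LIM_zero_cancel)
 qed
 have "(%n. EE (g n) f) \<longlonglongrightarrow> EE h f"
  by (rule EE_weak_limit(3)[OF CD_FD[OF gCD] bound lim FB_L2[OF h] f])
 then show ?thesis by (simp add: E0 LIMSEQ_const_iff)
qed

lemma locality_bounded_AE:
 assumes f: "f \<in> FD" and K: "compact K" "!!x. x \<notin> K ==> f x = 0"
  and h: "h \<in> FB" and U: "open U" "K \<subseteq> U" and h0: "AE x in mu0. x \<in> U \<longrightarrow> h x = 0"
 shows "EE h f = 0"
proof -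
 define h' where "h' x = (if x \<in> U then 0 else h x)" for x
 have [measurable]: "U \<in> sets borel" using U(1) by simp
 have m: "h' \<in> borel_measurable borel"
  unfolding h'_def using FD_measurable[OF FB_FD[OF h]] U(1) by measurable
 have eq: "AE x in mu0. h x = h' x" using h0 by eventually_elim (auto simp: h'_def)
 have h'D: "h' \<in> FD" by (rule FD_cong[OF FB_FD[OF h] m eq])
 obtain M where M: "M \<ge> 0" "!!x. \<bar>h x\<bar> \<le> M" using FB_bound[OF h] by metis
 have h'B: "h' \<in> FB" by (rule FBI[OF h'D, of M]) (use M in \<open>auto simp: h'_def\<close>)
 have "EE h' f = 0" by (rule locality_bounded[OF f K h'B U]) (simp_all add: h'_def)
 then show ?thesis using EE_cong[OF FB_FD[OF h] h'D eq] by simp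
qed

text \<open>The polarisation of \<open>GG\<close>: the integral of \<phi> against the mixed energy
  measure of f and g.\<close>

definition BB :: "('a => real) => ('a => real) => ('a => real) => real" where
 "BB \<phi> f g = (EE (%x. \<phi> x * f x) g + EE (%x. \<phi> x * g x) f - EE (%x. f x * g x) \<phi>) / 2"

lemma BB_self: "BB \<phi> f f = GG \<phi> f"
 by (simp add: BB_def GG_def power2_eq_square)

lemma BB_sym: "BB \<phi> f g = BB \<phi> g f"
 by (simp add: BB_def mult.commute)

lemma BB_add:
 assumes "\<phi> \<in> FB" "f \<in> FB" "g \<in> FB" "k \<in> FB"
 shows "BB \<phi> (%x. f x + g x) k = BB \<phi> f k + BB \<phi> g k"
proof -
 note D = assms[THEN FB_FD] FB_FD[OF FB_mult[OF assms(1,2)]] FB_FD[OF FB_mult[OF assms(1,3)]]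
  FB_FD[OF FB_mult[OF assms(1,4)]] FB_FD[OF FB_mult[OF assms(2,4)]] FB_FD[OF FB_mult[OF assms(3,4)]]
 have "EE (%x. \<phi> x * (f x + g x)) k = EE (%x. \<phi> x * f x) k + EE (%x. \<phi> x * g x) k"
  using EE_add[OF D(5,6,4)] by (simp add: distrib_left)
 moreover have "EE (%x. (f x + g x) * k x) \<phi> = EE (%x. f x * k x) \<phi> + EE (%x. g x * k x) \<phi>"
  using EE_add[OF D(8,9,1)] by (simp add: distrib_right)
 moreover have "EE (%x. \<phi> x * k x) (%x. f x + g x) = EE (%x. \<phi> x * k x) f + EE (%x. \<phi> x * k x) g"
  using EE_add[OF D(2,3,7)] D by (simp add: EE_sym FD_add)
 ultimately show ?thesis unfolding BB_def by (simp add: add_divide_distrib diff_divide_distrib)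
qed

lemma BB_scale:
 assumes "\<phi> \<in> FB" "f \<in> FB" "k \<in> FB"
 shows "BB \<phi> (%x. c * f x) k = c * BB \<phi> f k"
proof -
 note D = assms[THEN FB_FD] FB_FD[OF FB_mult[OF assms(1,2)]] FB_FD[OF FB_mult[OF assms(1,3)]] FB_FD[OF FB_mult[OF assms(2,3)]]
 have "EE (%x. \<phi> x * (c * f x)) k = c * EE (%x. \<phi> x * f x) k"
  using EE_scale[OF D(4,3), of c] by (simp add: mult_ac)
 moreover have "EE (%x. c * f x * k x) \<phi> = c * EE (%x. f x * k x) \<phi>"
  using EE_scale[OF D(6,1), of c] by (simp add: mult_ac)
 moreover have "EE (%x. \<phi> x * k x) (%x. c * f x) = c * EE (%x. \<phi> x * k x) f"
  using EE_scale[OF D(2,5), of c] D by (simp add: EE_sym FD_scale)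
 ultimately show ?thesis by (simp add: BB_def algebra_simps)
qed

lemma BB_add_right: "\<phi> \<in> FB ==> f \<in> FB ==> g \<in> FB ==> k \<in> FB ==> BB \<phi> k (%x. f x + g x) = BB \<phi> k f + BB \<phi> k g"
 and BB_scale_right: "\<phi> \<in> FB ==> f \<in> FB ==> k \<in> FB ==> BB \<phi> k (%x. c * f x) = c * BB \<phi> k f"
 using BB_add[of \<phi> f g k] BB_scale[of \<phi> f k c] by (simp_all add: BB_sym[of \<phi> k])

lemma BB_diff: "\<phi> \<in> FB ==> f \<in> FB ==> g \<in> FB ==> k \<in> FB ==> BB \<phi> (%x. f x - g x) k = BB \<phi> f k - BB \<phi> g k"
 using BB_add[of \<phi> f "%x. (-1) * g x" k] BB_scale[of \<phi> g k "-1"] FB_scale[of g "-1"] by simp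

lemma GG_diff:
 assumes "\<phi> \<in> FB" "f \<in> FB" "g \<in> FB"
 shows "GG \<phi> f - GG \<phi> g = BB \<phi> (%x. f x - g x) (%x. f x + g x)"
proof -
 have "BB \<phi> (%x. f x - g x) (%x. f x + g x) = BB \<phi> f (%x. f x + g x) - BB \<phi> g (%x. f x + g x)"
  using assms by (intro BB_diff FB_add)
 also have "\<dots> = GG \<phi> f - GG \<phi> g"
  using BB_add_right[OF assms assms(2)] BB_add_right[OF assms assms(3)] by (simp add: BB_self BB_sym[of \<phi> g f])
 finally show ?thesis ..
qed

text \<open>By polarisation the difference is \<open>BB \<phi> h k\<close> with h = f - g and k = f
  + g. As h vanishes near the support of \<phi>, the first term is the energy of the zero class, and
  the other two vanish by locality.\<close>

lemma GG_local:
 assumes \<phi>: "\<phi> \<in> CD" and U: "open U" "supp \<phi> \<subseteq> U" and f: "f \<in> FB" and g: "g \<in> FB"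
  and eq: "AE x in mu0. x \<in> U \<longrightarrow> f x = g x"
 shows "GG \<phi> f = GG \<phi> g"
proof -
 define h k where "h x = f x - g x" and "k x = f x + g x" for x
 have h: "h \<in> FB" and k: "k \<in> FB" unfolding h_def k_def by (intro FB_diff FB_add f g)+
 note \<phi>B = CD_FB[OF \<phi>]
 have h0: "AE x in mu0. x \<in> U \<longrightarrow> h x = 0" using eq by eventually_elim (simp add: h_def)
 have 1: "EE (%x. \<phi> x * h x) k = 0"
 proof -
  have "AE x in mu0. \<phi> x * h x = 0"
   using h0
  proof eventually_elim
   case (elim x)
   then show ?case using U(2) supp_0[of x \<phi>] by (cases "x \<in> supp \<phi>") auto
  qed
  from EE_cong[OF FB_FD[OF FB_mult[OF \<phi>B h]] FD_0 this] show ?thesis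
   using EE_scale[OF FD_0 FB_FD[OF k], of 0] by simp
 qed
 have 2: "EE (%x. \<phi> x * k x) h = 0"
 proof -
  have "EE h (%x. \<phi> x * k x) = 0"
   by (rule locality_bounded_AE[OF FB_FD[OF FB_mult[OF \<phi>B k]] CD_compact[OF \<phi>] _ h U h0]) (auto dest!: supp_0)
  then show ?thesis using EE_sym[OF FB_FD[OF h] FB_FD[OF FB_mult[OF \<phi>B k]]] by simp
 qed
 have 3: "EE (%x. h x * k x) \<phi> = 0"
  by (rule locality_bounded_AE[OF CD_FD[OF \<phi>] CD_compact[OF \<phi>] supp_0[of _ \<phi>] FB_mult[OF h k] U])
   (use h0 in \<open>auto elim: eventually_mono\<close>)
 have "GG \<phi> f - GG \<phi> g = BB \<phi> h k" unfolding h_def k_def by (rule GG_diff[OF \<phi>B f g])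
 also have "\<dots> = 0" using 1 2 3 by (simp add: BB_def)
 finally show ?thesis by simp
qed

lemma GG_add_left: "\<phi> \<in> FB ==> \<psi> \<in> FB ==> f \<in> FB ==> GG (%x. \<phi> x + \<psi> x) f = GG \<phi> f + GG \<psi> f"
proof -
 assume a: "\<phi> \<in> FB" "\<psi> \<in> FB" "f \<in> FB"
 note D = a[THEN FB_FD] FB_FD[OF FB_mult[OF a(1,3)]] FB_FD[OF FB_mult[OF a(2,3)]] FB_FD[OF FB_square[OF a(3)]]
 have "EE (%x. (\<phi> x + \<psi> x) * f x) f = EE (%x. \<phi> x * f x) f + EE (%x. \<psi> x * f x) f"
  using EE_add[OF D(4,5,3)] by (simp add: distrib_right)
 moreover have "EE (%x. (f x)^2) (%x. \<phi> x + \<psi> x) = EE (%x. (f x)^2) \<phi> + EE (%x. (f x)^2) \<psi>"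
  using EE_add[OF D(1,2,6)] D by (simp add: EE_sym FD_add)
 ultimately show ?thesis by (simp add: GG_def add_divide_distrib)
qed

lemma GG_scale_left: "\<phi> \<in> FB ==> f \<in> FB ==> GG (%x. c * \<phi> x) f = c * GG \<phi> f"
proof -
 assume a: "\<phi> \<in> FB" "f \<in> FB"
 note D = a[THEN FB_FD] FB_FD[OF FB_mult[OF a]] FB_FD[OF FB_square[OF a(2)]]
 have "EE (%x. c * \<phi> x * f x) f = c * EE (%x. \<phi> x * f x) f"
  using EE_scale[OF D(3,2), of c] by (simp add: mult.assoc)
 moreover have "EE (%x. (f x)^2) (%x. c * \<phi> x) = c * EE (%x. (f x)^2) \<phi>"
  using EE_scale[OF D(1,4), of c] D by (simp add: EE_sym FD_scale)
 ultimately show ?thesis by (simp add: GG_def algebra_simps)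
qed

end

section \<open>Riesz representation\<close>

lemma ennreal_INF_approx:
 fixes f :: "'b => ennreal"
 assumes "(INF i\<in>I. f i) \<noteq> \<infinity>" "e > 0"
 shows "\<exists>i\<in>I. f i \<le> (INF i\<in>I. f i) + e"
proof -
 have "(INF i\<in>I. f i) + 0 < (INF i\<in>I. f i) + e" using assms by (simp add: ennreal_add_left_cancel_less)
 then show ?thesis unfolding add_0_right INF_less_iff by (auto intro: less_imp_le)
qed

context doubling_heat_space
begin

lemma clip_nonneg: "0 \<le> clip a" and clip_le_1: "clip a \<le> 1" by (simp_all add: clip_def)

text \<open>Decomposition into layers of height one, used to compare a functional with an integral
  level by level.\<close>

lemma sum_clip: "0 \<le> b ==> (\<Sum>i<n. clip (b - real i)) = min (real n) b"
 by (induction n) (auto simp: clip_def)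

lemma CD_clip: "f \<in> CD ==> s \<ge> 0 ==> (%x. clip (c * f x - s)) \<in> CD"
 using CD_contraction[OF CD_scale, of f "%a. clip (a - s)" c] abs_clip_diff[of "_ - s" "_ - s"] by (simp add: clip_cases)

lemma CD_zero: "(%x. 0) \<in> CD"
 by (rule CDI[OF FD_0, of "{}"]) auto

lemma CD_sum: "finite I ==> (!!i. i \<in> I ==> f i \<in> CD) ==> (%x. \<Sum>i\<in>I. f i x) \<in> CD"
 by (induction I rule: finite_induct) (auto intro: CD_zero CD_add)

lemma CD_borel: "f \<in> CD ==> f \<in> borel_measurable borel"
 by (rule borel_measurable_continuous_onI[OF CD_continuous])

lemma CD_integrable:
 assumes \<Gamma>: "finite_measure \<Gamma>" "sets \<Gamma> = sets borel" and f: "f \<in> CD"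
 shows "integrable \<Gamma> f"
proof -
 interpret finite_measure \<Gamma> by fact
 obtain K where K: "!!x. \<bar>f x\<bar> \<le> K" using FB_bound[OF CD_FB[OF f]] by metis
 show ?thesis
  by (rule integrable_const_bound[of _ K])
   (use K CD_borel[OF f] \<Gamma>(2) in \<open>auto simp: measurable_cong_sets[OF \<Gamma>(2) refl]\<close>)
qed

definition tests :: "'a set => ('a => real) set" where
 "tests U = {\<phi> \<in> CD. (\<forall>x. 0 \<le> \<phi> x \<and> \<phi> x \<le> 1) \<and> supp \<phi> \<subseteq> U}"

section \<open>Representing a bounded positive functional on the core by an outer measure\<close>

context
 fixes \<Lambda> :: "('a => real) => real" and M :: real
 assumes \<Lambda>_add: "!!f g. f \<in> CD ==> g \<in> CD ==> \<Lambda> (%x. f x + g x) = \<Lambda> f + \<Lambda> g"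
  and \<Lambda>_scale: "!!f c. f \<in> CD ==> \<Lambda> (%x. c * f x) = c * \<Lambda> f"
  and \<Lambda>_nonneg: "!!f. f \<in> CD ==> (!!x. 0 \<le> f x) ==> 0 \<le> \<Lambda> f"
  and \<Lambda>_le: "!!f. f \<in> CD ==> (!!x. 0 \<le> f x \<and> f x \<le> 1) ==> \<Lambda> f \<le> M"
begin

lemma \<Lambda>_diff: "f \<in> CD ==> g \<in> CD ==> \<Lambda> (%x. f x - g x) = \<Lambda> f - \<Lambda> g"
 using \<Lambda>_add[of f "%x. (-1) * g x"] \<Lambda>_scale[of g "-1"] CD_scale[of g "-1"] by simp

lemma \<Lambda>_mono: "f \<in> CD ==> g \<in> CD ==> (!!x. f x \<le> g x) ==> \<Lambda> f \<le> \<Lambda> g"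
 using \<Lambda>_nonneg[of "%x. g x - f x"] \<Lambda>_diff[of g f] CD_diff[of g f] by simp

lemma \<Lambda>_sum: "finite I ==> (!!i. i \<in> I ==> f i \<in> CD) ==> \<Lambda> (%x. \<Sum>i\<in>I. f i x) = (\<Sum>i\<in>I. \<Lambda> (f i))"
proof (induction I rule: finite_induct)
 case empty
 show ?case using \<Lambda>_scale[OF CD_zero, of 0] by simp
qed (simp add: \<Lambda>_add CD_sum)

definition content :: "'a set => ennreal" where "content U = (SUP \<phi>\<in>tests U. ennreal (\<Lambda> \<phi>))"

definition outer :: "'a set => ennreal" where "outer A = (INF U\<in>{U. open U \<and> A \<subseteq> U}. content U)"

lemma testsD: "\<phi> \<in> tests U ==> \<phi> \<in> CD \<and> (\<forall>x. 0 \<le> \<phi> x) \<and> (\<forall>x. \<phi> x \<le> 1) \<and> supp \<phi> \<subseteq> U"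
 by (auto simp: tests_def)

lemma content_upper: "\<phi> \<in> tests U ==> ennreal (\<Lambda> \<phi>) \<le> content U"
 unfolding content_def by (rule SUP_upper)

lemma content_mono: "U \<subseteq> V ==> content U \<le> content V"
 unfolding content_def by (rule SUP_subset_mono) (auto simp: tests_def)

lemma content_le_M: "content U \<le> ennreal M"
 unfolding content_def by (rule SUP_least) (auto simp: tests_def intro!: ennreal_leI \<Lambda>_le)

lemma content_empty: "content {} = 0"
proof -
 have "content {} \<le> 0" unfolding content_def
 proof (rule SUP_least)
  fix \<phi> assume "\<phi> \<in> tests {}"
  then have "\<phi> = (%x. 0)" by (auto simp: tests_def closure_eq_empty)
  then show "ennreal (\<Lambda> \<phi>) \<le> 0" using \<Lambda>_scale[OF CD_zero, of 0] by simp
 qed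
 then show ?thesis by simp
qed

text \<open>A partition of unity: \<open>h\<close> is 1 near the part of the support outside
  \<open>V\<close> and is supported in \<open>U\<close>, so \<phi> h and \<phi> - \<phi> h are tests
  for \<open>U\<close> and for \<open>V\<close>.\<close>

lemma content_Un:
 assumes U: "open U" and V: "open V"
 shows "content (U \<union> V) \<le> content U + content V"
 unfolding content_def[of "U \<union> V"]
proof (rule SUP_least)
 fix \<phi> assume "\<phi> \<in> tests (U \<union> V)"
 note \<phi> = testsD[OF this]
 have K: "compact (supp \<phi> - V)" "supp \<phi> - V \<subseteq> U" using \<phi> V by (auto intro!: compact_diff CD_compact)
 obtain h W where h: "h \<in> CD" "!!x. 0 \<le> h x" "!!x. h x \<le> 1" "supp h \<subseteq> U"
  and W: "open W" "supp \<phi> - V \<subseteq> W" "!!x. x \<in> W ==> h x = 1" by (rule urysohn_CD[OF K(1) U K(2)]) metis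
 define \<phi>1 \<phi>2 where "\<phi>1 = (%x. \<phi> x * h x)" and "\<phi>2 = (%x. \<phi> x - \<phi> x * h x)"
 have CDs: "\<phi>1 \<in> CD" "\<phi>2 \<in> CD" unfolding \<phi>1_def \<phi>2_def using \<phi> h(1) by (auto intro: CD_diff CD_mult)
 have b: "0 \<le> \<phi> x * h x" "\<phi> x * h x \<le> \<phi> x" for x
  using \<phi> h(2,3)[of x] by (auto simp: mult_left_le)
 have b1: "\<phi> x * h x \<le> 1" "\<phi> x \<le> 1 + \<phi> x * h x" for x using b[of x] \<phi> by (auto intro: order_trans add_increasing2)
 have "supp \<phi>1 \<subseteq> supp h" unfolding \<phi>1_def by (intro closure_mono) auto
 then have t1: "\<phi>1 \<in> tests U" using CDs(1) b b1 h(4) unfolding tests_def \<phi>1_def by auto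
 have "supp \<phi>2 \<subseteq> supp \<phi> - W"
 proof (rule closure_minimal)
  show "{x. \<phi>2 x \<noteq> 0} \<subseteq> supp \<phi> - W"
   using closure_subset[of "{x. \<phi> x \<noteq> 0}"] W(3) by (auto simp: \<phi>2_def)
  show "closed (supp \<phi> - W)" by (intro closed_Diff W closed_closure)
 qed
 then have "supp \<phi>2 \<subseteq> V" using W(2) by auto
 then have t2: "\<phi>2 \<in> tests V" using CDs(2) b b1 unfolding tests_def \<phi>2_def by (auto simp: diff_le_eq)
 have "\<Lambda> \<phi> = \<Lambda> \<phi>1 + \<Lambda> \<phi>2" using \<Lambda>_add[OF CDs] by (simp add: \<phi>1_def \<phi>2_def)
 also have "ennreal \<dots> = ennreal (\<Lambda> \<phi>1) + ennreal (\<Lambda> \<phi>2)"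
  using CDs b by (intro ennreal_plus \<Lambda>_nonneg) (auto simp: \<phi>1_def \<phi>2_def)
 also have "\<dots> \<le> content U + content V" by (intro add_mono content_upper t1 t2)
 finally show "ennreal (\<Lambda> \<phi>) \<le> content U + content V" .
qed

text \<open>The support of a test function is compact, so finitely many of the sets already cover
  it.\<close>

lemma content_UN:
 assumes U: "!!i::nat. open (U i)"
 shows "content (\<Union>i. U i) \<le> (\<Sum>i. content (U i))"
 unfolding content_def[of "\<Union>i. U i"]
proof (rule SUP_least)
 fix \<phi> assume \<phi>': "\<phi> \<in> tests (\<Union>i. U i)"
 note \<phi> = testsD[OF \<phi>']
 obtain C where C: "finite C" "supp \<phi> \<subseteq> (\<Union>i\<in>C. U i)"
  using compactE_image[of "supp \<phi>" UNIV U] \<phi> U CD_compact by auto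
 have "ennreal (\<Lambda> \<phi>) \<le> content (\<Union>i\<in>C. U i)"
  using \<phi> C by (intro content_upper) (simp add: tests_def)
 also have "\<dots> \<le> (\<Sum>i\<in>C. content (U i))" using C(1)
 proof (induction C rule: finite_induct)
  case (insert i C)
  have "content (\<Union>j\<in>insert i C. U j) \<le> content (U i) + content (\<Union>j\<in>C. U j)"
   using content_Un[OF U open_UN, of C U i] U by simp
  then show ?case using insert by (auto intro: order_trans add_left_mono)
 qed (simp add: content_empty)
 also have "\<dots> \<le> (\<Sum>i. content (U i))" using C(1) by (intro sum_le_suminf) auto
 finally show "ennreal (\<Lambda> \<phi>) \<le> (\<Sum>i. content (U i))" .
qed

lemma outer_open: "open U ==> outer U = content U"
 unfolding outer_def by (intro antisym INF_lower INF_greatest content_mono) auto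

lemma outer_mono: "A \<subseteq> B ==> outer A \<le> outer B"
 unfolding outer_def by (intro INF_superset_mono) auto

lemma outer_le_M: "outer A \<le> ennreal M"
 unfolding outer_def by (rule INF_lower2[of UNIV]) (auto intro: content_le_M)

lemma outer_not_top: "outer A \<noteq> \<infinity>"
 using outer_le_M[of A] by (auto simp: top_unique)

lemma outer_cover: "e > 0 ==> \<exists>U. open U \<and> A \<subseteq> U \<and> content U \<le> outer A + e"
 using ennreal_INF_approx[OF outer_not_top[of A, unfolded outer_def], of e] by (auto simp: outer_def)

lemma outer_countably_subadditive: "outer (\<Union>i. A i) \<le> (\<Sum>i::nat. outer (A i))"
proof (rule ennreal_le_epsilon)
 fix e :: real assume e: "e > 0"
 have "\<forall>i. \<exists>U. open U \<and> A i \<subseteq> U \<and> content U \<le> outer (A i) + ennreal (e * (1 / 2) ^ Suc i)"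
  using e by (intro allI outer_cover) simp
 then obtain U where U: "!!i. open (U i)" "!!i. A i \<subseteq> U i"
  "!!i. content (U i) \<le> outer (A i) + ennreal (e * (1 / 2) ^ Suc i)" by metis
 have "outer (\<Union>i. A i) \<le> content (\<Union>i. U i)"
  unfolding outer_def using U by (intro INF_lower) auto
 also have "\<dots> \<le> (\<Sum>i. content (U i))" by (rule content_UN[OF U(1)])
 also have "\<dots> \<le> (\<Sum>i. outer (A i) + ennreal (e * (1 / 2) ^ Suc i))" by (intro suminf_le U) auto
 also have "\<dots> = (\<Sum>i. outer (A i)) + (\<Sum>i. ennreal (e * (1 / 2) ^ Suc i))"
  by (rule suminf_add[symmetric]) auto
 also have "(\<Sum>i. ennreal (e * (1 / 2) ^ Suc i)) = ennreal e"
  by (rule suminf_ennreal_eq, use e in simp, use sums_mult[OF power_half_series, of e] in \<open>simp only: mult_1_right\<close>)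
 finally show "outer (\<Union>i. A i) \<le> (\<Sum>i. outer (A i)) + ennreal e" .
qed

text \<open>To a test \<phi> for the intersection of \<open>U\<close> and \<open>V\<close> one may
  add any test for \<open>V\<close> minus the support of \<phi> without exceeding 1, and that open
  set contains the part of \<open>V\<close> outside \<open>U\<close>.\<close>

lemma outer_open_split:
 assumes U: "open U"
 shows "outer (U \<inter> A) + outer (- U \<inter> A) \<le> outer A"
 unfolding outer_def[of A]
proof (rule INF_greatest)
 fix V assume "V \<in> {V. open V \<and> A \<subseteq> V}"
 then have V: "open V" "A \<subseteq> V" by auto
 have key: "ennreal (\<Lambda> \<phi>) + outer (- U \<inter> V) \<le> content V" if "\<phi> \<in> tests (U \<inter> V)" for \<phi>
 proof -
  note \<phi> = testsD[OF that]
  have o: "open (V - supp \<phi>)" using V by (intro open_Diff) auto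
  have "outer (- U \<inter> V) \<le> content (V - supp \<phi>)"
   using \<phi> outer_mono[of "- U \<inter> V" "V - supp \<phi>"] outer_open[OF o] by auto
  moreover have "ennreal (\<Lambda> \<phi>) + content (V - supp \<phi>) \<le> content V"
   unfolding content_def[of "V - supp \<phi>"]
  proof (subst ennreal_SUP_add_right)
   show "tests (V - supp \<phi>) \<noteq> {}" using CD_zero by (auto simp: tests_def intro!: exI[of _ "%x. 0"])
   show "(SUP \<psi>\<in>tests (V - supp \<phi>). ennreal (\<Lambda> \<phi>) + ennreal (\<Lambda> \<psi>)) \<le> content V"
   proof (rule SUP_least)
    fix \<psi> assume "\<psi> \<in> tests (V - supp \<phi>)"
    note \<psi> = testsD[OF this]
    have "\<phi> x + \<psi> x \<le> 1" for x
     using \<phi> \<psi> supp_0[of x \<phi>] supp_0[of x \<psi>] by (cases "x \<in> supp \<phi>") (auto simp: subset_eq)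
    moreover have "supp (%x. \<phi> x + \<psi> x) \<subseteq> supp \<phi> \<union> supp \<psi>"
     unfolding closure_Un[symmetric] by (intro closure_mono) auto
    ultimately have "(%x. \<phi> x + \<psi> x) \<in> tests V"
     using \<phi> \<psi> by (auto simp: tests_def intro: CD_add)
    from content_upper[OF this] show "ennreal (\<Lambda> \<phi>) + ennreal (\<Lambda> \<psi>) \<le> content V"
     using \<phi> \<psi> \<Lambda>_nonneg by (simp add: \<Lambda>_add)
   qed
  qed
  ultimately show ?thesis by (meson add_left_mono order_trans)
 qed
 have "outer (U \<inter> A) + outer (- U \<inter> A) \<le> content (U \<inter> V) + outer (- U \<inter> V)"
  unfolding outer_open[OF open_Int[OF U V(1)], symmetric] using V(2) by (intro add_mono outer_mono) auto
 also have "\<dots> \<le> content V"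
  unfolding content_def[of "U \<inter> V"]
 proof (subst ennreal_SUP_add_left[symmetric])
  show "tests (U \<inter> V) \<noteq> {}" using CD_zero by (auto simp: tests_def intro!: exI[of _ "%x. 0"])
 qed (auto intro!: SUP_least key simp: outer_not_top)
 finally show "outer (U \<inter> A) + outer (- U \<inter> A) \<le> content V" .
qed

text \<open>The splitting inequality puts open sets into the Caratheodory system, which is a sigma
  algebra and so contains all Borel sets.\<close>

lemma outer_measure_space_borel: "measure_space UNIV (sets (borel :: 'a measure)) outer"
proof -
 have pos: "outer {} = 0" by (simp add: outer_open content_empty)
 have oms: "outer_measure_space (Pow UNIV) outer"
  unfolding outer_measure_space_def positive_def increasing_def countably_subadditive_def
  using pos by (auto intro: outer_mono outer_countably_subadditive)
 interpret P: sigma_algebra "UNIV :: 'a set" "Pow UNIV" by (rule sigma_algebra_Pow)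
 define S where "S = lambda_system (UNIV :: 'a set) (Pow UNIV) outer"
 have ms: "measure_space UNIV S outer" unfolding S_def by (rule P.caratheodory_lemma[OF oms])
 have "U \<in> S" if "open U" for U
 proof -
  have "outer (U \<inter> A) + outer (- U \<inter> A) = outer A" for A
  proof (rule antisym[OF outer_open_split[OF that]])
   have "outer A \<le> (\<Sum>i. outer ((if i = 0 then U \<inter> A else if i = 1 then - U \<inter> A else {})))"
    using outer_countably_subadditive[of "%i. if i = 0 then U \<inter> A else if i = 1 then - U \<inter> A else {}"]
    by (rule order_trans[OF outer_mono, rotated]) (auto split: if_splits intro: exI[of _ "0::nat"] exI[of _ "1::nat"])
   also have "\<dots> = (\<Sum>i\<in>{0,1::nat}. outer (if i = 0 then U \<inter> A else if i = 1 then - U \<inter> A else {}))"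
    by (rule suminf_finite) (auto simp: pos)
   finally show "outer A \<le> outer (U \<inter> A) + outer (- U \<inter> A)" by simp
  qed
  then show ?thesis by (simp add: S_def lambda_system_def Compl_eq_Diff_UNIV)
 qed
 moreover have "sigma_algebra UNIV S" using ms by (simp add: measure_space_def)
 ultimately have "sets (borel :: 'a measure) \<subseteq> S"
  unfolding borel_def using sigma_algebra.sigma_sets_subset[of UNIV S "Collect open"] by (simp add: subset_eq)
 then show ?thesis
  using ms sets.sigma_algebra_axioms[of "borel :: 'a measure"]
  by (auto simp: measure_space_def positive_def countably_additive_def subset_eq)
qed

lemma riesz_representation: "\<exists>\<Gamma>. sets \<Gamma> = sets borel \<and> finite_measure \<Gamma> \<and> (\<forall>\<phi>\<in>CD. (LINT x|\<Gamma>. \<phi> x) = \<Lambda> \<phi>)"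
proof -
 define \<Gamma> where "\<Gamma> = measure_of UNIV (sets (borel :: 'a measure)) outer"
 have sets: "sets \<Gamma> = sets borel" unfolding \<Gamma>_def by (metis sets.sets_measure_of_eq space_borel)
 have em: "emeasure \<Gamma> A = outer A" if "A \<in> sets borel" for A
  unfolding \<Gamma>_def using outer_measure_space_borel that by (intro emeasure_measure_of_sigma) (auto simp: measure_space_def)
 have fin: "finite_measure \<Gamma>"
  by (rule finite_measureI) (use em[of UNIV] outer_not_top sets_eq_imp_space_eq[OF sets] in simp)
 interpret finite_measure \<Gamma> by fact
 note [measurable_cong] = sets
 note int = CD_integrable[OF fin sets]
 have M: "M \<ge> 0" using \<Lambda>_le[OF CD_zero] \<Lambda>_scale[OF CD_zero, of 0] by simp
 \<comment> \<open>n \<phi> is cut into layers of height one. The integral of layer i + 1 is at most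
   the measure of {n \<phi> > i + 1}, on which layer i equals 1, hence at most the functional of
   layer i. The shift costs one layer, whose integral is at most the total mass; this is negligible
   after division by n.\<close>
 have lower1: "(LINT x|\<Gamma>. \<phi> x) \<le> \<Lambda> \<phi>" if \<phi>: "\<phi> \<in> CD" "!!x. 0 \<le> \<phi> x" "!!x. \<phi> x \<le> 1" for \<phi>
 proof -
  have "real n * (LINT x|\<Gamma>. \<phi> x) - measure \<Gamma> UNIV \<le> real n * \<Lambda> \<phi>" for n :: nat
  proof -
   define \<psi> where "\<psi> i x = clip (real n * \<phi> x - real i)" for i x
   have \<psi>: "\<psi> i \<in> CD" for i unfolding \<psi>_def using \<phi>(1) by (intro CD_clip) auto
   have le: "(LINT x|\<Gamma>. \<psi> (Suc i) x) \<le> \<Lambda> (\<psi> i)" for i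
   proof -
    define G where "G = {x. real (Suc i) < real n * \<phi> x}"
    have G: "open G" unfolding G_def by (intro open_Collect_less continuous_intros CD_continuous \<phi>)
    have "\<Lambda> \<xi> \<le> \<Lambda> (\<psi> i)" if "\<xi> \<in> tests G" for \<xi>
    proof (rule \<Lambda>_mono)
     note \<xi> = testsD[OF that]
     then show "\<xi> \<in> CD" "\<psi> i \<in> CD" using \<psi> by auto
     show "\<xi> x \<le> \<psi> i x" for x
      using \<xi> supp_0[of x \<xi>] by (cases "x \<in> supp \<xi>") (auto simp: \<psi>_def G_def clip_cases clip_nonneg subset_eq)
    qed
    then have "content G \<le> ennreal (\<Lambda> (\<psi> i))" unfolding content_def by (intro SUP_least ennreal_leI)
    then have "measure \<Gamma> G \<le> \<Lambda> (\<psi> i)"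
     unfolding measure_def using G em[of G] outer_open[OF G]
     by (intro enn2real_leI \<Lambda>_nonneg[OF \<psi>]) (auto simp: \<psi>_def clip_nonneg)
    moreover have "(LINT x|\<Gamma>. \<psi> (Suc i) x) \<le> (LINT x|\<Gamma>. indicator G x)"
     using G by (intro integral_mono[OF int[OF \<psi>] integrable_real_indicator]) (auto simp: \<psi>_def G_def clip_le_1 clip_cases indicator_def sets less_top[symmetric])
    ultimately show ?thesis using G sets_eq_imp_space_eq[OF sets] by simp
   qed
   have s: "(\<Sum>i<n. \<psi> i x) = real n * \<phi> x" for x
    unfolding \<psi>_def using sum_clip[of "real n * \<phi> x" n] \<phi>(2,3)[of x] by (simp add: min_absorb2 mult_left_le)
   have "(\<Sum>i<n. \<psi> (Suc i) x) = real n * \<phi> x - \<psi> 0 x" for x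
   proof -
    have "(\<Sum>i<Suc n. \<psi> i x) = \<psi> 0 x + (\<Sum>i<n. \<psi> (Suc i) x)" by (rule sum.lessThan_Suc_shift)
    moreover have "\<psi> n x = 0" using \<phi>(3)[of x] by (simp add: \<psi>_def clip_cases mult_left_le)
    ultimately show ?thesis using s[of x] by simp
   qed
   then have "(\<Sum>i<n. \<integral>x. \<psi> (Suc i) x \<partial>\<Gamma>) = (LINT x|\<Gamma>. real n * \<phi> x - \<psi> 0 x)"
    using int[OF \<psi>] by (simp flip: Bochner_Integration.integral_sum)
   also have "\<dots> = real n * (LINT x|\<Gamma>. \<phi> x) - (LINT x|\<Gamma>. \<psi> 0 x)"
    using int[OF \<psi>] int[OF \<phi>(1)] by simp
   finally have eq: "(\<Sum>i<n. \<integral>x. \<psi> (Suc i) x \<partial>\<Gamma>) = real n * (LINT x|\<Gamma>. \<phi> x) - (LINT x|\<Gamma>. \<psi> 0 x)" .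
   have "(LINT x|\<Gamma>. \<psi> 0 x) \<le> (LINT x|\<Gamma>. 1)"
    by (rule integral_mono[OF int[OF \<psi>]]) (auto simp: \<psi>_def clip_le_1)
   then have "(LINT x|\<Gamma>. \<psi> 0 x) \<le> measure \<Gamma> UNIV" using sets_eq_imp_space_eq[OF sets] by simp
   moreover have "(\<Sum>i<n. \<integral>x. \<psi> (Suc i) x \<partial>\<Gamma>) \<le> (\<Sum>i<n. \<Lambda> (\<psi> i))" by (intro sum_mono le)
   moreover have "(\<Sum>i<n. \<Lambda> (\<psi> i)) = real n * \<Lambda> \<phi>"
    using \<Lambda>_sum[of "{..<n}" \<psi>] \<psi> \<Lambda>_scale[OF \<phi>(1), of "real n"] by (simp add: s)
   ultimately show ?thesis using eq by linarith
  qed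
  then have *: "real n * ((LINT x|\<Gamma>. \<phi> x) - \<Lambda> \<phi>) \<le> measure \<Gamma> UNIV" for n :: nat by (simp add: algebra_simps)
  show ?thesis
  proof (rule ccontr)
   assume "\<not> ?thesis"
   then obtain n :: nat where "measure \<Gamma> UNIV < real n * ((LINT x|\<Gamma>. \<phi> x) - \<Lambda> \<phi>)"
    using reals_Archimedean3 by (metis diff_gt_0_iff_gt not_le)
   then show False using *[of n] by simp
  qed
 qed
 have lower: "(LINT x|\<Gamma>. \<phi> x) \<le> \<Lambda> \<phi>" if \<phi>: "\<phi> \<in> CD" "!!x. 0 \<le> \<phi> x" for \<phi>
 proof -
  obtain K where K: "K \<ge> 0" "!!x. \<bar>\<phi> x\<bar> \<le> K" using FB_bound[OF CD_FB[OF \<phi>(1)]] by metis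
  have K': "\<phi> x \<le> K + 1" for x using K(2)[of x] by simp
  have "(LINT x|\<Gamma>. 1 / (K + 1) * \<phi> x) \<le> \<Lambda> (%x. 1 / (K + 1) * \<phi> x)"
   by (rule lower1[OF CD_scale[OF \<phi>(1)]]) (use K K' \<phi>(2) in auto)
  then show ?thesis using \<Lambda>_scale[OF \<phi>(1), of "1 / (K + 1)"] K(1) by (simp add: divide_right_mono_neg pos_divide_le_eq)
 qed
 \<comment> \<open>For \<open>h\<close> equal to 1 on the support and living on a slightly larger
   open set, the functional exceeds the integral by at most \<open>e\<close>; the lower bound
   applied to h - \<phi> becomes an upper bound for \<phi>.\<close>
 have upper1: "\<Lambda> \<phi> \<le> (LINT x|\<Gamma>. \<phi> x)" if \<phi>: "\<phi> \<in> CD" "!!x. 0 \<le> \<phi> x" "!!x. \<phi> x \<le> 1" for \<phi>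
 proof (rule field_le_epsilon)
  fix e :: real assume e: "e > 0"
  obtain U where U: "open U" "supp \<phi> \<subseteq> U" "content U \<le> outer (supp \<phi>) + ennreal e"
   using outer_cover[of "ennreal e" "supp \<phi>"] e by auto
  obtain h W where h: "h \<in> CD" "!!x. 0 \<le> h x" "!!x. h x \<le> 1" "supp h \<subseteq> U"
   and W: "open W" "supp \<phi> \<subseteq> W" "!!x. x \<in> W ==> h x = 1" by (rule urysohn_CD[OF CD_compact[OF \<phi>(1)] U(1,2)]) metis
  have h1: "h x = 1" if "x \<in> supp \<phi>" for x using W that by blast
  have "ennreal (\<Lambda> h) \<le> content U" using h by (intro content_upper) (simp add: tests_def)
  also note U(3)
  also have "outer (supp \<phi>) = ennreal (measure \<Gamma> (supp \<phi>))" using em[of "supp \<phi>"] by (simp add: emeasure_eq_measure)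
  finally have "\<Lambda> h \<le> measure \<Gamma> (supp \<phi>) + e" using e by (simp flip: ennreal_plus)
  moreover have "(LINT x|\<Gamma>. indicator (supp \<phi>) x) \<le> (LINT x|\<Gamma>. h x)"
   using h1 h(2) by (intro integral_mono[OF integrable_real_indicator int[OF h(1)]]) (auto simp: indicator_def sets less_top[symmetric])
  ultimately have 1: "\<Lambda> h \<le> (LINT x|\<Gamma>. h x) + e" using sets_eq_imp_space_eq[OF sets] by simp
  have "\<phi> x \<le> h x" for x using h1[of x] supp_0[of x \<phi>] h(2)[of x] \<phi>(3)[of x] by (cases "x \<in> supp \<phi>") auto
  then have "(LINT x|\<Gamma>. h x - \<phi> x) \<le> \<Lambda> (%x. h x - \<phi> x)" by (intro lower CD_diff h \<phi>) simp
  then show "\<Lambda> \<phi> \<le> (LINT x|\<Gamma>. \<phi> x) + e" using 1 int[OF h(1)] int[OF \<phi>(1)] \<Lambda>_diff[OF h(1) \<phi>(1)] by simp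
 qed
 have nn: "(LINT x|\<Gamma>. \<phi> x) = \<Lambda> \<phi>" if \<phi>: "\<phi> \<in> CD" "!!x. 0 \<le> \<phi> x" for \<phi>
 proof -
  obtain K where K: "K \<ge> 0" "!!x. \<bar>\<phi> x\<bar> \<le> K" using FB_bound[OF CD_FB[OF \<phi>(1)]] by metis
  have K': "\<phi> x \<le> K + 1" for x using K(2)[of x] by simp
  have "\<Lambda> (%x. 1 / (K + 1) * \<phi> x) = (LINT x|\<Gamma>. 1 / (K + 1) * \<phi> x)"
   by (intro antisym upper1 lower1 CD_scale \<phi>(1)) (use K K' \<phi>(2) in auto)
  then show ?thesis using \<Lambda>_scale[OF \<phi>(1), of "1 / (K + 1)"] K(1) by simp
 qed
 have "(LINT x|\<Gamma>. \<phi> x) = \<Lambda> \<phi>" if \<phi>: "\<phi> \<in> CD" for \<phi>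
 proof -
  have pm: "(%x. max 0 (\<phi> x)) \<in> CD" "(%x. max 0 (\<phi> x) - \<phi> x) \<in> CD"
   using CD_contraction[OF \<phi>, of "max 0"] CD_diff[OF _ \<phi>] by (auto simp: max_def)
  have "(LINT x|\<Gamma>. max 0 (\<phi> x) - (max 0 (\<phi> x) - \<phi> x)) = \<Lambda> (%x. max 0 (\<phi> x)) - \<Lambda> (%x. max 0 (\<phi> x) - \<phi> x)"
   using int[OF pm(1)] int[OF pm(2)] nn[OF pm(1)] nn[OF pm(2)] by (subst Bochner_Integration.integral_diff) auto
  then show ?thesis using \<Lambda>_diff[OF pm] by simp
 qed
 then show ?thesis using sets fin by blast
qed

end

text \<open>Inner regularity of the first measure and outer regularity of the second reduce the
  claim to a test function between a compact set and an open set.\<close>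

lemma measure_le_of_CD:
 assumes \<Gamma>: "finite_measure \<Gamma>" "sets \<Gamma> = sets borel" and \<Delta>: "finite_measure \<Delta>" "sets \<Delta> = sets borel"
  and U: "open U" and le: "!!\<phi>. \<phi> \<in> CD ==> (!!x. 0 \<le> \<phi> x) ==> supp \<phi> \<subseteq> U ==> (LINT x|\<Gamma>. \<phi> x) \<le> (LINT x|\<Delta>. \<phi> x)"
  and B: "B \<in> sets borel" "B \<subseteq> U"
 shows "emeasure \<Gamma> B \<le> emeasure \<Delta> B"
proof -
 interpret \<Gamma>: finite_measure \<Gamma> by fact
 interpret \<Delta>: finite_measure \<Delta> by fact
 have fin: "emeasure \<Gamma> (space \<Gamma>) \<noteq> \<infinity>" "emeasure \<Delta> (space \<Delta>) \<noteq> \<infinity>" by simp_all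
 have *: "emeasure \<Gamma> K \<le> emeasure \<Delta> K" if K: "compact K" "K \<subseteq> U" for K
 proof -
  have Kb: "K \<in> sets borel" using K by (simp add: compact_imp_closed)
  have "emeasure \<Gamma> K \<le> emeasure \<Delta> V" if V: "K \<subseteq> V" "open V" for V
  proof -
   obtain h W where h: "h \<in> CD" "!!x. 0 \<le> h x" "!!x. h x \<le> 1" "supp h \<subseteq> U \<inter> V"
    and W: "open W" "K \<subseteq> W" "!!x. x \<in> W ==> h x = 1"
    by (rule urysohn_CD[OF K(1), of "U \<inter> V"]) (use K V U in auto)
   have h0: "h x = 0" if "x \<notin> V" for x using that h(4) supp_0[of x h] by blast
   have "measure \<Gamma> K = (LINT x|\<Gamma>. indicator K x)" using Kb \<Gamma>(2) by simp
   also have "\<dots> \<le> (LINT x|\<Gamma>. h x)"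
    using W h(2) Kb by (intro integral_mono[OF integrable_real_indicator CD_integrable[OF \<Gamma> h(1)]]) (auto simp: indicator_def \<Gamma>(2) subset_eq less_top[symmetric])
   also have "\<dots> \<le> (LINT x|\<Delta>. h x)" using h by (intro le) auto
   also have "\<dots> \<le> (LINT x|\<Delta>. indicator V x)"
    using h(3) h0 V by (intro integral_mono[OF CD_integrable[OF \<Delta> h(1)] integrable_real_indicator]) (auto simp: indicator_def \<Delta>(2) less_top[symmetric])
   also have "\<dots> = measure \<Delta> V" using V \<Delta>(2) by simp
   finally show ?thesis by (simp add: \<Gamma>.emeasure_eq_measure \<Delta>.emeasure_eq_measure)
  qed
  then show ?thesis
   unfolding outer_regular[OF \<Delta>(2) fin(2) Kb] by (intro INF_greatest) auto
 qed
 show ?thesis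
  unfolding inner_regular[OF \<Gamma>(2) fin(1) B(1)]
 proof (rule SUP_least, clarify)
  fix K assume K: "K \<subseteq> B" "compact K"
  have "emeasure \<Gamma> K \<le> emeasure \<Delta> K" using K B by (intro *) auto
  also have "\<dots> \<le> emeasure \<Delta> B" using K B \<Delta>(2) by (intro emeasure_mono) auto
  finally show "emeasure \<Gamma> K \<le> emeasure \<Delta> B" .
 qed
qed

end

section \<open>Energy measures\<close>

context doubling_heat_space
begin

lemma truncate_FB: "f \<in> FD ==> truncate n f \<in> FB"
 using FD_truncate_max[of f "real n"] by (intro FBI[of _ "real n"]) (auto simp: truncate_def[abs_def])

lemma truncate_eq: "\<bar>f x\<bar> \<le> real n ==> truncate n f x = f x"
 by (simp add: truncate_def)

definition energy :: "('a => real) => ('a => real) => real" where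
 "energy f \<phi> = lim (%n. GG \<phi> (truncate n f))"

lemma GG_diff_left: "\<phi> \<in> FB ==> \<psi> \<in> FB ==> f \<in> FB ==> GG (%x. \<phi> x - \<psi> x) f = GG \<phi> f - GG \<psi> f"
 using GG_add_left[of \<phi> "%x. (-1) * \<psi> x" f] GG_scale_left[of \<psi> f "-1"] FB_scale[of \<psi> "-1"] by simp

lemma GG_truncate_le:
 assumes \<phi>: "\<phi> \<in> CD" "!!x. 0 \<le> \<phi> x" "!!x. \<phi> x \<le> K" "K \<ge> 0" and f: "f \<in> FD"
 shows "GG \<phi> (truncate n f) \<le> K * EE f f"
proof -
 have "GG \<phi> (truncate n f) \<le> K * EE (truncate n f) (truncate n f)"
  by (rule GG_le[OF CD_FB[OF \<phi>(1)] truncate_FB[OF f] \<phi>(2,3)])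
 also have "\<dots> \<le> K * EE f f"
  using EE_truncate_max[OF f, of "real n"] \<phi>(4) by (intro mult_left_mono) (simp_all add: truncate_def[abs_def])
 finally show ?thesis .
qed

text \<open>For nonnegative \<phi> the sequence increases, as truncations are contractions of each
  other, and is bounded by a multiple of the energy of f; a general \<phi> is a difference of two
  nonnegative core functions.\<close>

lemma energy_tendsto:
 assumes \<phi>: "\<phi> \<in> CD" and f: "f \<in> FD"
 shows "(%n. GG \<phi> (truncate n f)) \<longlonglongrightarrow> energy f \<phi>"
proof -
 have nn: "convergent (%n. GG \<phi> (truncate n f))" if \<phi>: "\<phi> \<in> CD" "!!x. 0 \<le> \<phi> x" for \<phi>
 proof (rule Bseq_mono_convergent)
  obtain K where K: "K \<ge> 0" "!!x. \<bar>\<phi> x\<bar> \<le> K" using FB_bound[OF CD_FB[OF \<phi>(1)]] by metis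
  have "\<phi> x \<le> K" for x using K(2)[of x] by simp
  then show "Bseq (%n. GG \<phi> (truncate n f))"
   using GG_truncate_le[OF \<phi>(1,2) _ K(1) f] GG_nonneg[OF CD_FB[OF \<phi>(1)] truncate_FB[OF f] \<phi>(2)]
   by (intro BseqI'[of _ "K * EE f f"]) simp
  have "GG \<phi> (truncate n f) \<le> GG \<phi> (truncate (Suc n) f)" for n
   by (rule GG_contraction[OF CD_FB[OF \<phi>(1)] truncate_FB[OF f] truncate_FB[OF f] \<phi>(2)])
    (auto simp: truncate_def max_def min_def)
  then show "\<forall>m. \<forall>n\<ge>m. GG \<phi> (truncate m f) \<le> GG \<phi> (truncate n f)" using lift_Suc_mono_le[of "%n. GG \<phi> (truncate n f)"] by blast
 qed
 define \<psi> where "\<psi> x = max 0 (\<phi> x)" for x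
 have \<psi>: "\<psi> \<in> CD" "(%x. \<psi> x - \<phi> x) \<in> CD"
  using CD_contraction[OF \<phi>, of "max 0"] CD_diff[OF _ \<phi>, of \<psi>] by (auto simp: \<psi>_def[abs_def] max_def)
 have "convergent (%n. GG \<psi> (truncate n f) - GG (%x. \<psi> x - \<phi> x) (truncate n f))"
  by (intro convergent_diff nn \<psi>) (auto simp: \<psi>_def)
 then have "convergent (%n. GG \<phi> (truncate n f))"
  using CD_FB[OF \<phi>] CD_FB[OF \<psi>(1)] truncate_FB[OF f] by (simp add: GG_diff_left)
 then show ?thesis unfolding energy_def by (simp add: convergent_LIMSEQ_iff)
qed

lemma energy_FB:
 assumes \<phi>: "\<phi> \<in> CD" and f: "f \<in> FB"
 shows "energy f \<phi> = GG \<phi> f"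
proof -
 obtain M where M: "!!x. \<bar>f x\<bar> \<le> M" using FB_bound[OF f] by metis
 obtain N :: nat where N: "M \<le> real N" using real_arch_simple by blast
 have "truncate n f = f" if "n \<ge> N" for n
  using M N that by (intro ext truncate_eq) (meson of_nat_mono order_trans)
 then have "\<forall>\<^sub>F n in sequentially. GG \<phi> (truncate n f) = GG \<phi> f" by (intro eventually_sequentiallyI[of N]) simp
 then have "(%n. GG \<phi> (truncate n f)) \<longlonglongrightarrow> GG \<phi> f" by (rule tendsto_eventually)
 then show ?thesis using energy_tendsto[OF \<phi> FB_FD[OF f]] by (rule LIMSEQ_unique[symmetric])
qed

lemma energy_local:
 assumes \<phi>: "\<phi> \<in> CD" "open U" "supp \<phi> \<subseteq> U" and f: "f \<in> FD" and g: "g \<in> FD"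
  and eq: "AE x in mu0. x \<in> U \<longrightarrow> f x = g x"
 shows "energy f \<phi> = energy g \<phi>"
proof -
 have "GG \<phi> (truncate n f) = GG \<phi> (truncate n g)" for n
  by (rule GG_local[OF \<phi> truncate_FB[OF f] truncate_FB[OF g]]) (use eq in \<open>eventually_elim, auto simp: truncate_def\<close>)
 then show ?thesis by (simp add: energy_def)
qed

abbreviation \<Gamma>\<Gamma> :: "('a => real) => 'a measure" where "\<Gamma>\<Gamma> f \<equiv> energy_measure mu0 FD EE f"

text \<open>The Riesz theorem gives existence, comparison on core functions in both directions gives
  uniqueness; so the definite description denotes.\<close>

lemma energy_measure:
 assumes f: "f \<in> FD"
 shows "sets (\<Gamma>\<Gamma> f) = sets borel \<and> finite_measure (\<Gamma>\<Gamma> f) \<and> (\<forall>\<phi>\<in>CD. (LINT x|\<Gamma>\<Gamma> f. \<phi> x) = energy f \<phi>)"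
proof -
 have ex: "\<exists>\<Gamma>. sets \<Gamma> = sets borel \<and> finite_measure \<Gamma> \<and> (\<forall>\<phi>\<in>CD. (LINT x|\<Gamma>. \<phi> x) = energy f \<phi>)"
 proof (rule riesz_representation)
  fix \<phi> \<psi> :: "'a => real" and c :: real
  assume \<phi>: "\<phi> \<in> CD"
  note lim = energy_tendsto[OF \<phi> f]
  show "energy f (%x. c * \<phi> x) = c * energy f \<phi>"
   using energy_tendsto[OF CD_scale[OF \<phi>] f, of c] tendsto_mult_left[OF lim, of c]
   by (simp add: GG_scale_left CD_FB \<phi> truncate_FB f LIMSEQ_unique)
  show "energy f (%x. \<phi> x + \<psi> x) = energy f \<phi> + energy f \<psi>" if "\<psi> \<in> CD"
   using energy_tendsto[OF CD_add[OF \<phi> that] f] tendsto_add[OF lim energy_tendsto[OF that f]]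
   by (simp add: GG_add_left CD_FB \<phi> that truncate_FB f LIMSEQ_unique)
  show "0 \<le> energy f \<phi>" if "!!x. 0 \<le> \<phi> x"
   by (rule LIMSEQ_le_const[OF lim]) (use GG_nonneg[OF CD_FB[OF \<phi>] truncate_FB[OF f] that] in auto)
  show "energy f \<phi> \<le> EE f f" if "!!x. 0 \<le> \<phi> x \<and> \<phi> x \<le> 1"
   by (rule LIMSEQ_le_const2[OF lim]) (use GG_truncate_le[OF \<phi> _ _ _ f, of 1] that in auto)
 qed
 have unique: "\<Gamma> = \<Gamma>'"
  if "sets \<Gamma> = sets borel" "finite_measure \<Gamma>" "\<forall>\<phi>\<in>CD. (LINT x|\<Gamma>. \<phi> x) = energy f \<phi>"
   "sets \<Gamma>' = sets borel" "finite_measure \<Gamma>'" "\<forall>\<phi>\<in>CD. (\<integral>x. \<phi> x \<partial>\<Gamma>') = energy f \<phi>" for \<Gamma> \<Gamma>'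
  using that by (intro measure_eqI antisym measure_le_of_CD[OF _ _ _ _ open_UNIV]) auto
 have "(%n. EE (%x. \<phi> x * truncate n f x) (truncate n f) - EE (%x. (truncate n f x)^2) \<phi> / 2) \<longlonglongrightarrow> r \<longleftrightarrow> r = energy f \<phi>"
  if "\<phi> \<in> CD" for \<phi> r
  using energy_tendsto[OF that f] LIMSEQ_unique unfolding GG_def by blast
 then have "\<Gamma>\<Gamma> f = (THE \<Gamma>. sets \<Gamma> = sets borel \<and> finite_measure \<Gamma> \<and> (\<forall>\<phi>\<in>CD. (LINT x|\<Gamma>. \<phi> x) = energy f \<phi>))"
  unfolding energy_measure_def CD_def[symmetric] by (intro arg_cong[where f = The] ext conj_cong refl ball_cong) auto
 moreover have "\<exists>!\<Gamma>. sets \<Gamma> = sets borel \<and> finite_measure \<Gamma> \<and> (\<forall>\<phi>\<in>CD. (LINT x|\<Gamma>. \<phi> x) = energy f \<phi>)"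
  using ex unique by (intro ex_ex1I) blast+
 ultimately show ?thesis using theI'[of "%\<Gamma>. sets \<Gamma> = sets borel \<and> finite_measure \<Gamma> \<and> (\<forall>\<phi>\<in>CD. (LINT x|\<Gamma>. \<phi> x) = energy f \<phi>)"] by simp
qed

lemma energy_measure_local:
 assumes U: "open U" and f: "f \<in> FD" and g: "g \<in> FD" and eq: "AE x in mu0. x \<in> U \<longrightarrow> f x = g x"
  and A: "A \<in> sets borel" "A \<subseteq> U"
 shows "emeasure (\<Gamma>\<Gamma> f) A = emeasure (\<Gamma>\<Gamma> g) A"
 using energy_measure[OF f] energy_measure[OF g] energy_local[OF _ U _ f g eq]
 by (intro antisym measure_le_of_CD[OF _ _ _ _ U _ A]) auto

lemma energy_measure_loc:
 assumes u: "u \<in> form_dom_loc mu0 FD" and U: "rel_compact_open U" and f: "f \<in> FD"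
  and eq: "AE x in mu0. x \<in> U \<longrightarrow> u x = f x" and A: "A \<in> sets borel" "A \<subseteq> U"
 shows "emeasure (energy_measure_loc mu0 FD EE u) A = emeasure (\<Gamma>\<Gamma> f) A"
proof -
 define good where "good \<Gamma> \<longleftrightarrow> sets \<Gamma> = sets borel \<and>
  (\<forall>U. \<forall>f\<in>FD. rel_compact_open U \<and> (AE x in mu0. x \<in> U \<longrightarrow> u x = f x) \<longrightarrow>
   (\<forall>A\<in>sets borel. A \<subseteq> U \<longrightarrow> emeasure \<Gamma> A = emeasure (\<Gamma>\<Gamma> f) A))" for \<Gamma>
 define V where "V n = ball (undefined :: 'a) (real (Suc n))" for n
 have V: "rel_compact_open (V n)" "open (V n)" "V n \<in> sets borel" for n
  by (auto simp: V_def intro!: rel_compact_openI)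
 have incV: "incseq V" unfolding incseq_def V_def by (auto intro: order_less_le_trans)
 have UN: "(\<Union>n. V n) = UNIV"
 proof -
  have "\<exists>n. x \<in> V n" for x
  proof -
   obtain n :: nat where "dist undefined x < real n" using reals_Archimedean2 by blast
   then have "x \<in> V n" by (simp add: V_def)
   then show ?thesis ..
  qed
  then show ?thesis by auto
 qed
 have inc: "incseq (%n. A \<inter> V n)" for A using incV by (auto simp: incseq_def)
 have SUP: "(SUP n. emeasure \<Gamma> (A \<inter> V n)) = emeasure \<Gamma> A" if "sets \<Gamma> = sets borel" "A \<in> sets borel" for \<Gamma> A
  using SUP_emeasure_incseq[of "%n. A \<inter> V n" \<Gamma>] inc that V by (simp add: UN image_subset_iff)
 have "\<forall>n. \<exists>g. g \<in> FD \<and> (AE x in mu0. x \<in> V n \<longrightarrow> u x = g x)" using u V(1) unfolding form_dom_loc_def by blast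
 from choice[OF this] obtain g where g: "!!n. g n \<in> FD" "!!n. AE x in mu0. x \<in> V n \<longrightarrow> u x = g n x" by blast
 note Gs = energy_measure[OF g(1), THEN conjunct1]
 \<comment> \<open>Energy measures of local representatives, restricted to exhausting balls. They
   agree on overlaps by locality, so they increase, and the patched measure is their
   supremum.\<close>
 define N where "N n = density (\<Gamma>\<Gamma> (g n)) (indicator (V n))" for n
 have Ns: "sets (N n) = sets borel" for n using Gs by (simp add: N_def)
 have Ne: "emeasure (N n) A = emeasure (\<Gamma>\<Gamma> (g n)) (A \<inter> V n)" if "A \<in> sets borel" for A n
  using that V Gs[of n] unfolding N_def
  by (subst emeasure_density) (auto simp: indicator_inter_arith[symmetric] Int_commute intro!: borel_measurable_indicator)
 have loc: "emeasure (N n) A = emeasure (\<Gamma>\<Gamma> f) (A \<inter> V n)"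
  if "f \<in> FD" "open U" "AE x in mu0. x \<in> U \<longrightarrow> u x = f x" "A \<in> sets borel" "A \<inter> V n \<subseteq> U" for f U A n
  unfolding Ne[OF that(4)]
 proof (rule energy_measure_local[of "U \<inter> V n"])
  show "AE x in mu0. x \<in> U \<inter> V n \<longrightarrow> g n x = f x"
   using that(3) g(2)[of n] by eventually_elim auto
 qed (use that V g in auto)
 have "N m \<le> N n" if "m \<le> n" for m n
 proof -
  have "emeasure (N m) A \<le> emeasure (N n) A" if A: "A \<in> sets borel" for A
  proof -
   have "emeasure (N m) A = emeasure (\<Gamma>\<Gamma> (g n)) (A \<inter> V m)"
    by (rule loc[OF g(1)[of n] V(2)[of n] g(2)[of n] A]) (use incV \<open>m \<le> n\<close> in \<open>auto simp: incseq_def\<close>)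
   also have "\<dots> \<le> emeasure (\<Gamma>\<Gamma> (g n)) (A \<inter> V n)"
    using incV \<open>m \<le> n\<close> A V Gs[of n] by (intro emeasure_mono) (auto simp: incseq_def)
   finally show ?thesis using Ne[OF A] by simp
  qed
  then show ?thesis using Ns by (subst le_measure) auto
 qed
 then have chain: "Complete_Partial_Order.chain (\<le>) (range N)"
  by (auto simp: Complete_Partial_Order.chain_def) (metis nat_le_linear)
 define \<Gamma> where "\<Gamma> = (SUP n. N n)"
 have \<Gamma>s: "sets \<Gamma> = sets borel" unfolding \<Gamma>_def using Ns by (intro sets_SUP) auto
 have \<Gamma>e: "emeasure \<Gamma> A = (SUP n. emeasure (N n) A)" if "A \<in> sets borel" for A
  unfolding \<Gamma>_def by (rule emeasure_SUP_chain[OF _ _ chain, of borel]) (use Ns that in auto)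
 have "good \<Gamma>"
  unfolding good_def
 proof (intro conjI allI ballI impI \<Gamma>s)
  fix U f A assume *: "f \<in> FD" "rel_compact_open U \<and> (AE x in mu0. x \<in> U \<longrightarrow> u x = f x)" "A \<in> sets borel" "A \<subseteq> U"
  then have "emeasure (N n) A = emeasure (\<Gamma>\<Gamma> f) (A \<inter> V n)" for n
   by (intro loc[of f U]) (auto simp: rel_compact_open_def)
  then show "emeasure \<Gamma> A = emeasure (\<Gamma>\<Gamma> f) A"
   using \<Gamma>e[OF *(3)] SUP[of "\<Gamma>\<Gamma> f" A] energy_measure[OF *(1)] *(3) by simp
 qed
 moreover have "\<Gamma>' = \<Gamma>" if "good \<Gamma>'" for \<Gamma>'
 proof (rule measure_eqI)
  show s: "sets \<Gamma>' = sets \<Gamma>" using that \<Gamma>s by (simp add: good_def)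
  fix A assume "A \<in> sets \<Gamma>'"
  then have A: "A \<in> sets borel" using s \<Gamma>s by simp
  have "emeasure \<Gamma>' (A \<inter> V n) = emeasure (N n) A" for n
   unfolding Ne[OF A]
   by (rule that[unfolded good_def, THEN conjunct2, rule_format, of "g n" "V n"]) (use g V A in auto)
  then show "emeasure \<Gamma>' A = emeasure \<Gamma> A" using SUP[of \<Gamma>' A] \<Gamma>e[OF A] A s \<Gamma>s by simp
 qed
 ultimately have "energy_measure_loc mu0 FD EE u = \<Gamma>"
  unfolding energy_measure_loc_def good_def[symmetric] by (rule the_equality)
 then show ?thesis using \<open>good \<Gamma>\<close> U f eq A by (auto simp: good_def)
qed

lemma CD_integrable_mu0: "\<phi> \<in> CD ==> integrable mu0 \<phi>"
proof -
 assume \<phi>: "\<phi> \<in> CD"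
 obtain K where K: "!!x. \<bar>\<phi> x\<bar> \<le> K" using FB_bound[OF CD_FB[OF \<phi>]] by metis
 have "integrable mu0 (%x. K * indicator (supp \<phi>) x)"
  using emeasure_bounded_finite[OF compact_imp_bounded[OF CD_compact[OF \<phi>]]] by (intro integrable_mult_right integrable_real_indicator) auto
 then show ?thesis
 proof (rule Bochner_Integration.integrable_bound)
  have "norm (\<phi> x) \<le> norm (K * indicator (supp \<phi>) x)" for x
   using K[of x] supp_0[of x \<phi>] by (cases "x \<in> supp \<phi>") auto
  then show "AE x in mu0. norm (\<phi> x) \<le> norm (K * indicator (supp \<phi>) x)" by simp
 qed (use CD_borel[OF \<phi>] in simp)
qed

text \<open>The hypothesis on the distance concerns the patched measure of Borel sets; inside
  \<open>U\<close> it passes to the energy measure of a global representative and is then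
  integrated.\<close>

lemma GG_le_dist:
 assumes U: "rel_compact_open U" and f: "f \<in> FB" and eq: "AE y in mu0. y \<in> U \<longrightarrow> dist x y = f y"
  and \<phi>: "\<phi> \<in> CD" "!!x. 0 \<le> \<phi> x" "supp \<phi> \<subseteq> U"
 shows "GG \<phi> f \<le> (LINT y|mu0. \<phi> y)"
proof -
 have dx: "dist x \<in> form_dom_loc mu0 FD"
  and le: "!!A. A \<in> sets mu0 ==> emeasure (energy_measure_loc mu0 FD EE (dist x)) A \<le> emeasure mu0 A"
  using H by (auto simp: hypothesis_H_def)
 note E = energy_measure[OF FB_FD[OF f]]
 have Uo: "open U" using U by (simp add: rel_compact_open_def)
 define N where "N = density (\<Gamma>\<Gamma> f) (indicator U)"
 have m: "(%y. ennreal (\<phi> y)) \<in> borel_measurable (\<Gamma>\<Gamma> f)" "indicator U \<in> borel_measurable (\<Gamma>\<Gamma> f)"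
  using CD_borel[OF \<phi>(1)] Uo E by (auto simp: measurable_cong_sets[of "\<Gamma>\<Gamma> f" borel] intro: borel_measurable_indicator)
 have "emeasure N A \<le> emeasure mu0 A" if A: "A \<in> sets borel" for A
 proof -
  have "emeasure N A = emeasure (\<Gamma>\<Gamma> f) (A \<inter> U)"
   using A Uo E m unfolding N_def by (subst emeasure_density) (auto simp: indicator_inter_arith[symmetric] Int_commute)
  also have "\<dots> = emeasure (energy_measure_loc mu0 FD EE (dist x)) (A \<inter> U)"
   using A Uo by (intro energy_measure_loc[OF dx U FB_FD[OF f] eq, symmetric]) auto
  also have "\<dots> \<le> emeasure mu0 (A \<inter> U)" using A Uo by (intro le) auto
  also have "\<dots> \<le> emeasure mu0 A" using A by (intro emeasure_mono) auto
  finally show ?thesis .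
 qed
 then have N: "N \<le> mu0" using E by (subst le_measure) (auto simp: N_def)
 have "(\<integral>\<^sup>+y. ennreal (\<phi> y) \<partial>\<Gamma>\<Gamma> f) = (\<integral>\<^sup>+y. ennreal (\<phi> y) \<partial>N)"
  unfolding N_def nn_integral_density[OF m(2,1)]
 proof (rule nn_integral_cong)
  fix y
  have "\<phi> y = 0" if "y \<notin> U" using that \<phi>(3) supp_0[of y \<phi>] by blast
  then show "ennreal (\<phi> y) = indicator U y * ennreal (\<phi> y)"
   by (cases "y \<in> U") auto
 qed
 also have "\<dots> \<le> (\<integral>\<^sup>+y. ennreal (\<phi> y) \<partial>mu0)"
  by (rule nn_integral_mono_measure) (use N E in \<open>auto simp: N_def\<close>)
 finally have "ennreal (LINT y|\<Gamma>\<Gamma> f. \<phi> y) \<le> ennreal (LINT y|mu0. \<phi> y)"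
  using E \<phi> by (simp add: nn_integral_eq_integral CD_integrable CD_integrable_mu0)
 then have "(LINT y|\<Gamma>\<Gamma> f. \<phi> y) \<le> (LINT y|mu0. \<phi> y)" using \<phi>(2) by (simp add: ennreal_le_iff)
 then show ?thesis using E \<phi>(1) energy_FB[OF \<phi>(1) f] by simp
qed

end

section \<open>Cutoff functions\<close>

context doubling_heat_space
begin

text \<open>A function carries no energy where it is constant. Since \<phi> \<zeta> = \<phi>, the
  first and third terms combine to the pairing of k - \<zeta> k with \<phi>; this and the second
  term vanish by locality.\<close>

lemma BB_const:
 assumes \<phi>: "\<phi> \<in> CD" and \<zeta>: "\<zeta> \<in> CD" and k: "k \<in> FB"
  and V: "open V" "supp \<phi> \<subseteq> V" "!!x. x \<in> V ==> \<zeta> x = 1"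
 shows "BB \<phi> \<zeta> k = 0"
proof -
 note B = CD_FB[OF \<phi>] CD_FB[OF \<zeta>] k FB_mult[OF CD_FB[OF \<phi>] k] FB_mult[OF CD_FB[OF \<zeta>] k]
 have one: "\<phi> x * \<zeta> x = \<phi> x" for x using V supp_0[of x \<phi>] by (cases "x \<in> supp \<phi>") auto
 have 1: "EE (%x. k x - \<zeta> x * k x) \<phi> = 0"
  by (rule locality_bounded[OF CD_FD[OF \<phi>] CD_compact[OF \<phi>] supp_0[of _ \<phi>] FB_diff[OF B(3,5)] V(1,2)]) (simp_all add: V(3))
 have 2: "EE (%x. \<phi> x * k x) \<zeta> = 0"
  by (rule strong_locality[OF FB_FD[OF B(4)] CD_compact[OF \<phi>] _ CD_FD[OF \<zeta>] CD_compact[OF \<zeta>] supp_0[of _ \<zeta>] V]) (auto dest!: supp_0)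
 show ?thesis
  using 1 2 EE_diff[OF B(3,5,1)[THEN FB_FD]] EE_sym[OF B(1,3)[THEN FB_FD]] by (simp add: BB_def one)
qed

lemma L2_multiplier:
 assumes "f \<in> L2 mu0" "m \<in> borel_measurable borel" "!!x. \<bar>m x\<bar> \<le> 1"
 shows "(%x. m x * f x) \<in> L2 (mu0 :: 'a measure)" "norm (cls (%x. m x * f x)) \<le> norm (cls f)"
proof -
 show L: "(%x. m x * f x) \<in> L2 mu0" by (rule L2_mult_bounded[OF assms])
 have "(LINT x|mu0. (m x * f x)^2) \<le> (LINT x|mu0. (f x)^2)"
  by (rule integral_mono[OF L2_integrable_square[OF L] L2_integrable_square[OF assms(1)]])
   (use assms(3) in \<open>auto simp: power_mult_distrib intro!: mult_left_le_one_le simp: abs_square_le_1\<close>)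
 then have "(norm (cls (%x. m x * f x)))^2 \<le> (norm (cls f))^2" by (simp only: norm_cls_square L assms(1))
 then show "norm (cls (%x. m x * f x)) \<le> norm (cls f)" by (rule power2_le_imp_le) simp
qed

lemma multiplier_tendsto:
 fixes f :: "nat => 'a => real"
 assumes f: "!!n. f n \<in> L2 mu0" and g: "g \<in> L2 mu0" and lim: "(%n. cls (f n)) \<longlonglongrightarrow> cls g"
  and m: "m \<in> borel_measurable borel" "!!x. \<bar>m x\<bar> \<le> 1"
 shows "(%n. cls (%x. m x * f n x)) \<longlonglongrightarrow> cls (%x. m x * g x)"
  and "(%n. \<integral>x. (m x * f n x)^2 \<partial>mu0) \<longlonglongrightarrow> (LINT x|mu0. (m x * g x)^2)"
proof -
 have "norm (cls (%x. m x * f n x) - cls (%x. m x * g x)) \<le> norm (cls (f n) - cls g)" for n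
  using L2_multiplier[OF L2_diff[OF f g] m, of n] by (simp add: right_diff_distrib cls_diff L2_multiplier f g m)
 then show 1: "(%n. cls (%x. m x * f n x)) \<longlonglongrightarrow> cls (%x. m x * g x)"
  using Lim_null_comparison[OF always_eventually[OF allI], of "%n. cls (%x. m x * f n x) - cls (%x. m x * g x)" "%n. norm (cls (f n) - cls g)"]
   tendsto_norm_zero[OF LIM_zero[OF lim]] by (simp add: LIM_zero_iff)
 show "(%n. \<integral>x. (m x * f n x)^2 \<partial>mu0) \<longlonglongrightarrow> (LINT x|mu0. (m x * g x)^2)"
  using tendsto_power[OF tendsto_norm[OF 1], of 2] by (simp add: norm_cls_square L2_multiplier f g m)
qed

text \<open>\<open>K\<close> bounds the density of the energy measure of \<eta> with respect to the
  underlying measure, expressed through test functions because this is how the estimates use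
  it.\<close>

definition cutoff :: "('a => real) => real => bool" where
 "cutoff \<eta> K \<longleftrightarrow> \<eta> \<in> CD \<and> (\<forall>x. 0 \<le> \<eta> x) \<and> (\<forall>x. \<eta> x \<le> 1) \<and> 0 \<le> K \<and>
  (\<forall>\<phi>\<in>CD. (\<forall>x. 0 \<le> \<phi> x) \<longrightarrow> GG \<phi> \<eta> \<le> K * (LINT x|mu0. \<phi> x))"

text \<open>\<open>a - b d\<close> is globally in the domain only after it has been cut off far away, where it is negative.\<close>

lemma cutoff_dist:
 assumes b: "0 < b"
 shows "cutoff (%y. clip (a - b * dist x0 y)) (b^2)"
proof -
 define \<eta> where "\<eta> y = clip (a - b * dist x0 y)" for y
 have loc: "\<exists>g m. g \<in> FB \<and> m \<in> FB \<and> (AE y in mu0. \<eta> y = clip (g y)) \<and>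
   (\<forall>\<phi>\<in>CD. (\<forall>x. 0 \<le> \<phi> x) \<longrightarrow> supp \<phi> \<subseteq> ball x0 R \<longrightarrow> GG \<phi> g = b^2 * GG \<phi> m \<and> GG \<phi> m \<le> (LINT x|mu0. \<phi> x))"
  if R: "0 \<le> R" "a \<le> b * R" for R
 proof -
  define U where "U = ball x0 (R + 1)"
  have U: "rel_compact_open U" "open U" by (simp_all add: U_def rel_compact_openI)
  obtain f where f: "f \<in> FD" "AE y in mu0. y \<in> U \<longrightarrow> dist x0 y = f y"
  proof -
   have "dist x0 \<in> form_dom_loc mu0 FD" using H by (simp add: hypothesis_H_def)
   then show ?thesis using U(1) that unfolding form_dom_loc_def by blast
  qed
  \<comment> \<open>Truncating the local representative of the distance at the radius of
    \<open>U\<close> makes it bounded, hence an element of the algebra.\<close>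
  define m where "m y = max 0 (min (R + 1) (f y))" for y
  have m: "m \<in> FB"
  proof (rule FBI)
   show "m \<in> FD" unfolding m_def
    by (rule FD_contraction[OF f(1)]) (use FD_measurable[OF f(1)] R in \<open>auto simp: max_def min_def\<close>)
   show "\<bar>m y\<bar> \<le> R + 1" for y using R by (simp add: m_def)
  qed
  have eqm: "AE y in mu0. y \<in> U \<longrightarrow> dist x0 y = m y"
   using f(2) by eventually_elim (auto simp: m_def U_def)
  have sub: "cball x0 R \<subseteq> U" by (auto simp: U_def)
  obtain \<zeta> V where \<zeta>: "\<zeta> \<in> CD" "!!x. 0 \<le> \<zeta> x" "!!x. \<zeta> x \<le> 1" "supp \<zeta> \<subseteq> U"
   and V: "open V" "cball x0 R \<subseteq> V" "!!x. x \<in> V ==> \<zeta> x = 1" by (rule urysohn_CD[OF compact_cball U(2) sub]) metis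
  \<comment> \<open>a \<zeta> replaces the constant a. Near the ball of radius R, where \<zeta> is
    1, it contributes no energy; beyond R both \<open>g\<close> and a - b d are nonpositive almost
    everywhere, so the clips agree.\<close>
  define g where "g y = a * \<zeta> y - b * m y" for y
  have g: "g \<in> FB" unfolding g_def by (intro FB_diff FB_scale CD_FB \<zeta> m)
  have "AE y in mu0. \<eta> y = clip (g y)"
   using eqm
  proof eventually_elim
   case (elim y)
   consider "y \<in> cball x0 R" | "y \<notin> cball x0 R" "y \<in> U" | "y \<notin> U" by blast
   then show ?case
   proof cases
    case 1
    then have "\<zeta> y = 1" "dist x0 y = m y" using V elim sub by blast+
    then show ?thesis by (simp add: \<eta>_def g_def)
   next
    case 2
    then have d: "R < dist x0 y" "dist x0 y = m y" using elim by auto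
    then have "a \<le> b * dist x0 y" using R(2) b by (meson less_imp_le mult_left_mono order_trans)
    moreover have "a * \<zeta> y \<le> b * dist x0 y"
    proof (cases "a \<ge> 0")
     case True
     then have "a * \<zeta> y \<le> a" using \<zeta>(3)[of y] by (simp add: mult_left_le)
     then show ?thesis using \<open>a \<le> b * dist x0 y\<close> by simp
    next
     case False
     then have "a * \<zeta> y \<le> 0" using \<zeta>(2)[of y] by (simp add: mult_nonpos_nonneg)
     also have "0 \<le> b * dist x0 y" using b by simp
     finally show ?thesis .
    qed
    ultimately show ?thesis using d by (simp add: \<eta>_def g_def clip_cases)
   next
    case 3
    then have "\<zeta> y = 0" using \<zeta>(4) supp_0[of y \<zeta>] by blast
    then have "g y \<le> 0" using b by (simp add: g_def m_def)
    moreover have "R \<le> dist x0 y" using 3 by (simp add: U_def)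
    then have "a \<le> b * dist x0 y" using R(2) b by (meson less_imp_le mult_left_mono order_trans)
    ultimately show ?thesis by (simp add: \<eta>_def clip_cases)
   qed
  qed
  moreover have "GG \<phi> g = b^2 * GG \<phi> m \<and> GG \<phi> m \<le> (LINT x|mu0. \<phi> x)"
   if \<phi>: "\<phi> \<in> CD" "\<forall>x. 0 \<le> \<phi> x" "supp \<phi> \<subseteq> ball x0 R" for \<phi>
  proof
   note \<phi>B = CD_FB[OF \<phi>(1)]
   define n where "n y = (- b) * m y" for y
   have n: "n \<in> FB" unfolding n_def by (rule FB_scale[OF m])
   have "GG \<phi> g - GG \<phi> n = BB \<phi> (%y. a * \<zeta> y) (%y. g y + n y)"
    using GG_diff[OF \<phi>B g n] by (simp add: g_def n_def)
   also have "\<dots> = 0"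
    using BB_scale[OF \<phi>B CD_FB[OF \<zeta>(1)] FB_add[OF g n], of a] BB_const[OF \<phi>(1) \<zeta>(1) FB_add[OF g n] V(1) _ V(3)] \<phi>(3) V(2)
    by (simp add: order_trans[OF _ order_trans[OF ball_subset_cball]])
   also have "GG \<phi> n = b^2 * GG \<phi> m"
    unfolding BB_self[symmetric] n_def BB_scale[OF \<phi>B m n[unfolded n_def]] BB_scale_right[OF \<phi>B m m] by (simp add: power2_eq_square)
   finally show "GG \<phi> g = b^2 * GG \<phi> m" by simp
   show "GG \<phi> m \<le> (LINT x|mu0. \<phi> x)"
    by (rule GG_le_dist[OF U(1) m eqm \<phi>(1)]) (use \<phi> ball_subset_cball sub in blast)+
  qed
  ultimately show ?thesis using g m by blast
 qed
 have \<eta>c: "continuous_on UNIV \<eta>" unfolding \<eta>_def clip_def by (intro continuous_intros)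
 have \<eta>CD: "\<eta> \<in> CD"
 proof (rule CDI[OF _ \<eta>c compact_cball])
  define R where "R = max 0 (a / b)"
  have R: "0 \<le> R" "a \<le> b * R" using b by (auto simp: R_def max_def field_simps)
  show "\<eta> x = 0" if "x \<notin> cball x0 R" for x
  proof -
   have "a \<le> b * dist x0 x" using that R(2) b by (intro order_trans[OF R(2)]) auto
   then show ?thesis by (simp add: \<eta>_def clip_cases)
  qed
  obtain g where g: "g \<in> FB" "AE y in mu0. \<eta> y = clip (g y)" using loc[OF R] by blast
  show "\<eta> \<in> FD"
   by (rule FD_cong[OF FD_clip[OF FB_FD[OF g(1)]] borel_measurable_continuous_onI[OF \<eta>c]]) (use g(2) in \<open>auto elim: eventually_mono\<close>)
 qed
 have "GG \<phi> \<eta> \<le> b^2 * (LINT x|mu0. \<phi> x)" if \<phi>: "\<phi> \<in> CD" "\<forall>x. 0 \<le> \<phi> x" for \<phi>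
 proof -
  obtain R0 where R0: "supp \<phi> \<subseteq> ball x0 R0" using bounded_subset_ballD[OF compact_imp_bounded[OF CD_compact[OF \<phi>(1)]]] by blast
  define R where "R = max R0 (max 0 (a / b))"
  have "0 \<le> R" "a / b \<le> R" by (simp_all add: R_def)
  then have R: "0 \<le> R" "a \<le> b * R" using b by (simp_all add: pos_divide_le_eq mult.commute)
  obtain g m where g: "g \<in> FB" "m \<in> FB" "AE y in mu0. \<eta> y = clip (g y)"
   and le: "\<forall>\<phi>\<in>CD. (\<forall>x. 0 \<le> \<phi> x) \<longrightarrow> supp \<phi> \<subseteq> ball x0 R \<longrightarrow> GG \<phi> g = b^2 * GG \<phi> m \<and> GG \<phi> m \<le> (LINT x|mu0. \<phi> x)"
   using loc[OF R] by blast
  have "supp \<phi> \<subseteq> ball x0 R" using R0 by (rule order_trans) (auto simp: R_def)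
  with le \<phi> have le': "GG \<phi> g = b^2 * GG \<phi> m" "GG \<phi> m \<le> (LINT x|mu0. \<phi> x)" by blast+
  have cg: "(%y. clip (g y)) \<in> FB" by (rule FBI[OF FD_clip[OF FB_FD[OF g(1)]], of 1]) (simp add: clip_def)
  have "GG \<phi> \<eta> = GG \<phi> (%y. clip (g y))"
   by (rule GG_local[OF \<phi>(1) open_UNIV _ CD_FB[OF \<eta>CD] cg]) (use g(3) in auto)
  also have "\<dots> \<le> GG \<phi> g"
   by (rule GG_contraction[OF CD_FB[OF \<phi>(1)] g(1) cg]) (use \<phi>(2) abs_clip_diff abs_clip_le in auto)
  also have "\<dots> \<le> b^2 * (LINT x|mu0. \<phi> x)" unfolding le'(1) by (intro mult_left_mono le'(2)) simp
  finally show ?thesis .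
 qed
 then show ?thesis using \<eta>CD unfolding cutoff_def \<eta>_def by (simp add: clip_nonneg clip_le_1)
qed

section \<open>Caccioppoli inequalities for cutoffs\<close>

context
 fixes \<eta> K
 assumes cut: "cutoff \<eta> K"
begin

lemma cutoffD: "\<eta> \<in> CD" "0 \<le> \<eta> x" "\<eta> x \<le> 1" "0 \<le> K" "\<phi> \<in> CD ==> \<forall>x. 0 \<le> \<phi> x ==> GG \<phi> \<eta> \<le> K * (LINT x|mu0. \<phi> x)"
 and cutoff_abs: "\<bar>\<eta> x\<bar> \<le> 1" "\<bar>1 - \<eta> x\<bar> \<le> 1" "\<bar>(1 - \<eta> x)^2\<bar> \<le> 1"
 and cutoff_measurable: "\<eta> \<in> borel_measurable borel"
 using cut by (auto simp: cutoff_def CD_borel abs_square_le_1 abs_le_iff)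

lemma CD_square: "w \<in> CD ==> (%x. (w x)^2) \<in> CD"
 unfolding power2_eq_square by (rule CD_mult)

lemma EE_cutoff_CD: "w \<in> CD ==> EE (%x. \<eta> x * w x) (%x. \<eta> x * w x) \<le> 2 * EE w w + 2 * K * (LINT x|mu0. (w x)^2)"
 using EE_cutoff_bounded[OF CD_FB CD_FB[OF cutoffD(1)] cutoff_abs(1), of w] cutoffD(5)[OF CD_square[of w]] by simp

lemma EE_cocutoff_CD:
 assumes w: "w \<in> CD"
 shows "EE (%x. (1 - \<eta> x) * w x) (%x. (1 - \<eta> x) * w x) \<le> 6 * EE w w + 4 * K * (LINT x|mu0. (w x)^2)"
 using EE_diff_le[OF CD_FD[OF w] CD_FD[OF CD_mult[OF cutoffD(1) w]]] EE_cutoff_CD[OF w] by (simp add: left_diff_distrib)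

lemma CD_cocutoff: "w \<in> CD ==> (%x. (1 - \<eta> x) * w x) \<in> CD"
 using CD_diff[OF _ CD_mult[OF cutoffD(1)], of w w] by (simp add: left_diff_distrib)

text \<open>Expanding (1 - \<eta>)^2 and using E(w - \<eta> w) >= 0 bounds the left side by E(\<eta>
  w) - E(w, \<eta>^2 w), hence by the energy of \<eta> with weight w^2. As \<eta> is 1 near the
  support of \<eta>', the weight may be changed to that of (1 - \<eta>') w, so only mass outside the
  inner cutoff enters.\<close>

lemma caccioppoli_CD:
 assumes w: "w \<in> CD" and \<eta>': "cutoff \<eta>' K'" and V: "open V" "supp \<eta>' \<subseteq> V" "!!x. x \<in> V ==> \<eta> x = 1"
 shows "- EE w (%x. (1 - \<eta> x)^2 * w x) \<le> K * (LINT x|mu0. ((1 - \<eta>' x) * w x)^2)"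
proof -
 note \<eta>CD = cutoffD(1) and \<eta>'CD = \<eta>'[unfolded cutoff_def, THEN conjunct1]
 define h where "h x = (1 - \<eta>' x) * w x" for x
 define \<phi> where "\<phi> x = (w x)^2 - (h x)^2" for x
 have h: "h \<in> CD" using CD_diff[OF w CD_mult[OF \<eta>'CD w]] by (simp add: h_def[abs_def] left_diff_distrib)
 have \<phi>: "\<phi> \<in> CD" unfolding \<phi>_def by (intro CD_diff CD_square w h)
 have "supp \<phi> \<subseteq> supp \<eta>'" by (intro closure_mono) (auto simp: \<phi>_def h_def)
 then have "GG \<phi> \<eta> = 0"
  using BB_const[OF \<phi> \<eta>CD CD_FB[OF \<eta>CD] V(1) _ V(3)] V(2) by (simp add: BB_self)
 then have GG: "GG (%x. (w x)^2) \<eta> = GG (%x. (h x)^2) \<eta>"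
  using GG_diff_left[OF CD_FB[OF CD_square[OF w]] CD_FB[OF CD_square[OF h]] CD_FB[OF \<eta>CD]] unfolding \<phi>_def by simp
 define p where "p x = \<eta> x * w x" for x
 define q where "q x = (\<eta> x)^2 * w x" for x
 have pq: "p \<in> CD" "q \<in> CD" unfolding p_def q_def by (intro CD_mult CD_square \<eta>CD w)+
 note D = CD_FD[OF w] CD_FD[OF pq(1)] CD_FD[OF pq(2)] CD_FD[OF CD_diff[OF w pq(1)]]
 have "(%x. (1 - \<eta> x)^2 * w x) = (%x. (w x - 2 * p x) + q x)"
  by (simp add: p_def q_def power2_eq_square algebra_simps fun_eq_iff)
 moreover have "EE w (%x. (w x - 2 * p x) + q x) = EE (%x. (w x - 2 * p x) + q x) w"
  using D by (intro EE_sym FD_add FD_diff FD_scale)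
 moreover have "EE (%x. (w x - 2 * p x) + q x) w = EE w w - 2 * EE p w + EE q w"
  using D by (simp add: FD_add FD_diff FD_scale EE_add EE_diff EE_scale)
 ultimately have "EE w (%x. (1 - \<eta> x)^2 * w x) = EE w w - 2 * EE w p + EE w q"
  using EE_sym[OF D(1,2)] EE_sym[OF D(1,3)] by simp
 moreover have "0 \<le> EE (%x. w x - p x) (%x. w x - p x)" by (rule EE_nonneg[OF D(4)])
 moreover have "EE (%x. w x - p x) (%x. w x - p x) = EE w w - 2 * EE w p + EE p p"
  using EE_diff[OF D(1,2,4)] EE_diff[OF D(1,2,1)] EE_diff[OF D(1,2,2)] EE_sym[OF D(1,2)] EE_sym[OF D(4,1)] EE_sym[OF D(4,2)] by simp
 moreover have "EE p p - EE w q \<le> GG (%x. (w x)^2) \<eta>"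
  using EE_cutoff_le[OF CD_FB[OF w] CD_FB[OF \<eta>CD]] unfolding p_def q_def .
 moreover have "GG (%x. (h x)^2) \<eta> \<le> K * (LINT x|mu0. (h x)^2)" by (rule cutoffD(5)[OF CD_square[OF h]]) simp
 ultimately show ?thesis using GG unfolding h_def by linarith
qed

lemma caccioppoli:
 assumes u: "u \<in> FD" and \<eta>': "cutoff \<eta>' K'" and V: "open V" "supp \<eta>' \<subseteq> V" "!!x. x \<in> V ==> \<eta> x = 1"
 shows "(%x. (1 - \<eta> x)^2 * u x) \<in> FD"
  and "- EE u (%x. (1 - \<eta> x)^2 * u x) \<le> K * (LINT x|mu0. ((1 - \<eta>' x) * u x)^2)"
proof -
 obtain w where w: "!!n. w n \<in> CD" "(%n. cls (w n)) \<longlonglongrightarrow> cls u"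
  "(%n. EE (%x. w n x - u x) (%x. w n x - u x)) \<longlonglongrightarrow> 0" using approx_CD[OF u] by blast
 note wD = CD_FD[OF w(1)] and wL = FD_L2[OF CD_FD[OF w(1)]] and uL = FD_L2[OF u]
 define h where "h n x = (1 - \<eta> x)^2 * w n x" for n x
 have hCD: "h n \<in> CD" for n
  using CD_cocutoff[OF CD_cocutoff[OF w(1)], of n] by (simp add: h_def[abs_def] power2_eq_square mult.assoc)
 have "Bseq (%n. EE (%x. w n x - u x) (%x. w n x - u x))"
  using w(3) by (intro convergent_imp_Bseq) (auto simp: convergent_def)
 then obtain B where B: "!!n. \<bar>EE (%x. w n x - u x) (%x. w n x - u x)\<bar> \<le> B" by (auto simp: Bseq_def)
 have "Bseq (%n. norm (cls (w n)))"
  using tendsto_norm[OF w(2)] by (intro convergent_imp_Bseq) (auto simp: convergent_def)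
 then obtain N where N: "!!n. norm (cls (w n)) \<le> N" by (auto simp: Bseq_def)
 have I: "(LINT x|mu0. (w n x)^2) \<le> N^2" for n using power_mono[OF N[of n] norm_ge_zero, of 2] wL[of n] by (simp add: norm_cls_square[symmetric])
 have Ew: "EE (w n) (w n) \<le> 2 * B + 2 * EE u u" for n
  using EE_sum_le[OF FD_diff[OF wD u] u, of n] B[of n] by simp
 \<comment> \<open>The factor (1 - \<eta>)^2 is applied in two stages, each estimated by
   \<open>EE_cocutoff_CD\<close>; a uniform energy bound is what the weak limit requires.\<close>
 have bound: "EE (h n) (h n) \<le> 6 * (6 * (2 * B + 2 * EE u u) + 4 * K * N^2) + 4 * K * N^2" for n
 proof -
  let ?w1 = "%x. (1 - \<eta> x) * w n x"
  have "EE (h n) (h n) \<le> 6 * EE ?w1 ?w1 + 4 * K * (LINT x|mu0. (?w1 x)^2)"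
   using EE_cocutoff_CD[OF CD_cocutoff[OF w(1)], of n] by (simp add: h_def[abs_def] power2_eq_square mult.assoc)
  also have "\<dots> \<le> 6 * (6 * (2 * B + 2 * EE u u) + 4 * K * N^2) + 4 * K * N^2"
  proof (intro add_mono mult_left_mono)
   show "EE ?w1 ?w1 \<le> 6 * (2 * B + 2 * EE u u) + 4 * K * N^2"
    by (rule order_trans[OF EE_cocutoff_CD[OF w(1)]])
     (intro add_mono mult_left_mono I Ew, use cutoffD(4) in auto)
   have "norm (cls ?w1) \<le> N"
    using L2_multiplier(2)[of "w n" "%x. 1 - \<eta> x", OF wL _ cutoff_abs(2)] N[of n] cutoff_measurable by (simp add: order_trans)
   then show "(LINT x|mu0. (?w1 x)^2) \<le> N^2"
    using power_mono[OF _ norm_ge_zero, of "cls ?w1" N 2] L2_multiplier(1)[of "w n" "%x. 1 - \<eta> x", OF wL _ cutoff_abs(2)] cutoff_measurable by (simp add: norm_cls_square[symmetric])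
  qed (use cutoffD(4) in auto)
  finally show ?thesis .
 qed
 have limh: "(%n. cls (h n)) \<longlonglongrightarrow> cls (%x. (1 - \<eta> x)^2 * u x)"
  unfolding h_def by (rule multiplier_tendsto(1)[where m = "%x. (1 - \<eta> x)^2", OF wL uL w(2) _ cutoff_abs(3)]) (use cutoff_measurable in simp)
 have hL: "(%x. (1 - \<eta> x)^2 * u x) \<in> L2 mu0"
  by (rule L2_multiplier(1)[where m = "%x. (1 - \<eta> x)^2", OF uL _ cutoff_abs(3)]) (use cutoff_measurable in simp)
 note weak = EE_weak_limit[OF CD_FD[OF hCD] bound limh hL]
 show hD: "(%x. (1 - \<eta> x)^2 * u x) \<in> FD" by (rule weak(1))
 have "(%n. EE (%x. w n x - u x) (h n)) \<longlonglongrightarrow> 0"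
 proof (rule Lim_null_comparison)
  define B' where "B' = sqrt (6 * (6 * (2 * B + 2 * EE u u) + 4 * K * N^2) + 4 * K * N^2)"
  show "(%n. sqrt (EE (%x. w n x - u x) (%x. w n x - u x)) * B') \<longlonglongrightarrow> 0"
   using tendsto_mult_left_zero[OF tendsto_real_sqrt[OF w(3), simplified], of B'] .
  show "\<forall>\<^sub>F n in sequentially. norm (EE (%x. w n x - u x) (h n)) \<le> sqrt (EE (%x. w n x - u x) (%x. w n x - u x)) * B'"
  proof (rule always_eventually, rule allI)
   fix n
   have D: "(%x. w n x - u x) \<in> FD" by (rule FD_diff[OF wD u])
   show "norm (EE (%x. w n x - u x) (h n)) \<le> sqrt (EE (%x. w n x - u x) (%x. w n x - u x)) * B'"
    unfolding real_norm_def B'_def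
    by (rule order_trans[OF EE_Cauchy_Schwarz[OF D CD_FD[OF hCD]]])
     (intro mult_left_mono real_sqrt_le_mono bound real_sqrt_ge_zero EE_nonneg D)
  qed
 qed
 moreover have "(%n. EE u (h n)) \<longlonglongrightarrow> EE u (%x. (1 - \<eta> x)^2 * u x)"
  using weak(3)[OF u] EE_sym[OF CD_FD[OF hCD] u] EE_sym[OF hD u] by simp
 ultimately have "(%n. EE (%x. w n x - u x) (h n) + EE u (h n)) \<longlonglongrightarrow> 0 + EE u (%x. (1 - \<eta> x)^2 * u x)" by (rule tendsto_add)
 then have lim: "(%n. EE (w n) (h n)) \<longlonglongrightarrow> EE u (%x. (1 - \<eta> x)^2 * u x)"
  using EE_diff[OF wD u CD_FD[OF hCD]] by simp
 have \<eta>'m: "\<eta>' \<in> borel_measurable borel" "\<bar>1 - \<eta>' x\<bar> \<le> 1" for x using \<eta>' by (auto simp: cutoff_def CD_borel)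
 have "(%n. \<integral>x. ((1 - \<eta>' x) * w n x)^2 \<partial>mu0) \<longlonglongrightarrow> (LINT x|mu0. ((1 - \<eta>' x) * u x)^2)"
  by (rule multiplier_tendsto(2)[where m = "%x. 1 - \<eta>' x", OF wL uL w(2) _ \<eta>'m(2)]) (use \<eta>'m(1) in simp)
 then show "- EE u (%x. (1 - \<eta> x)^2 * u x) \<le> K * (LINT x|mu0. ((1 - \<eta>' x) * u x)^2)"
  using caccioppoli_CD[OF w(1) \<eta>' V] by (intro LIMSEQ_le[OF tendsto_minus[OF lim] tendsto_mult_left]) (auto simp: h_def[abs_def])
qed

end

end

section \<open>Heat kernel bounds from Faber--Krahn inequalities\<close>

lemma mvt_le:
 fixes f :: "real => real"
 assumes c: "continuous_on {0..t} f" and t: "0 \<le> t"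
  and d: "!!s. 0 < s ==> s < t ==> \<exists>d. (f has_real_derivative d) (at s) \<and> d \<le> K"
 shows "f t \<le> f 0 + K * t"
proof (cases "t = 0")
 case False
 then have t: "0 < t" using t by simp
 have "f differentiable (at s)" if "0 < s" "s < t" for s
  using d[OF that] by (auto simp: real_differentiable_def)
 from MVT[OF t c this] obtain l s where s: "0 < s" "s < t" "DERIV f s :> l" "f t - f 0 = (t - 0) * l" by blast
 have "l \<le> K" using d[OF s(1,2)] DERIV_unique[OF s(3)] by auto
 then have "l * t \<le> K * t" using t by (intro mult_right_mono) auto
 moreover have "f t = f 0 + l * t" using s(4) by (simp add: algebra_simps)
 ultimately show ?thesis by linarith
qed simp

text \<open>\<open>y\<close> is meant as the full squared norm and \<open>z k\<close> as the part
  outside the k-th cutoff. A bootstrap: if t^q y <= Y on (0, T], then the tail is small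
  (\<open>step1\<close>), and the differential inequality improves the bound to 4 N + Y / 2
  (\<open>step2\<close>). The supremum Y is finite thanks to B, so Y <= 8 N.\<close>

lemma decay_system:
 fixes y :: "real => real" and z :: "nat => real => real"
 assumes q: "q > 0" and \<kappa>: "\<kappa> > 0" and N: "N \<ge> 0"
  and z0: "!!k t. 0 \<le> t ==> 0 \<le> z k t" and zy: "!!k t. 0 \<le> t ==> z k t \<le> y t" and yB: "!!t. 0 \<le> t ==> y t \<le> B"
  and zc: "!!k. continuous_on {0..} (z k)" and zi: "!!k. z k 0 = 0"
  and zd: "!!k t. 0 < t ==> \<exists>d. (z k has_real_derivative d) (at t) \<and> d \<le> \<kappa> * 4 ^ k * z (Suc k) t"
  and yd: "!!t. 0 < t ==> \<exists>d. (y has_real_derivative d) (at t) \<and>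
   d \<le> - (2 * q / t) * (y t - 2 * z 0 t - 2 * N * t powr (- q)) + \<kappa> * y t"
  and T: "T = 4 powr (- (q + 1)) / (32 * \<kappa>)"
 shows "T powr q * y T \<le> 8 * N"
proof -
 define D where "D = 16 * T"
 have T0: "T > 0" and D0: "D > 0" using \<kappa> by (simp_all add: T D_def)
 have y0: "0 \<le> y t" if "0 \<le> t" for t using z0[OF that, of 0] zy[OF that, of 0] by linarith
 have B0: "0 \<le> B" using y0[of 0] yB[of 0] by linarith
 have step1: "z 0 t \<le> Y * D powr (- q) / 16"
  if Y: "Y \<ge> 0" "!!t. 0 < t ==> t \<le> T ==> t powr q * y t \<le> Y" and t: "0 \<le> t" "t \<le> T" for Y t
 proof -
  define E where "E = Y * D powr (- q) / 16"
  have E0: "E \<ge> 0" using Y by (simp add: E_def)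
  \<comment> \<open>The weights combine the factor 4^k with 4^(q k), the growth of the bound Y
    s^(-q) at time s = D / 4^k. \<open>M\<close> will be the best constant in z k <= M G k, finite
    because z is bounded and G >= 1.\<close>
  define G where "G k = 4 powr ((q + 1) * real k)" for k
  have G: "G k > 0" "G k \<ge> 1" "G (Suc k) = 4 powr (q + 1) * G k" "G k = 4 ^ k * (4 ^ k) powr q" for k
  proof -
   show "G k \<ge> 1" using q by (simp add: G_def ge_one_powr_ge_zero)
   show "G (Suc k) = 4 powr (q + 1) * G k" by (simp add: G_def distrib_left powr_add mult.commute)
   show "G k = 4 ^ k * (4 ^ k) powr q"
    unfolding G_def by (simp add: powr_realpow[symmetric] powr_powr powr_add[symmetric] algebra_simps)
  qed (simp add: G_def)
  define M where "M = (SUP (k, s)\<in>UNIV \<times> {0..T}. z k s / G k)"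
  have bdd: "bdd_above ((%(k, s). z k s / G k) ` (UNIV \<times> {0..T}))"
  proof (rule bdd_aboveI2)
   fix x :: "nat \<times> real" assume "x \<in> UNIV \<times> {0..T}"
   then obtain k s where x: "x = (k, s)" "0 \<le> s" by auto
   have "z k s / G k \<le> B / 1"
    using z0[OF x(2), of k] zy[OF x(2), of k] yB[OF x(2)] G(2)[of k] by (intro frac_le) auto
   then show "(case x of (k, s) => z k s / G k) \<le> B" using x by simp
  qed
  have up: "z k s \<le> M * G k" if "0 \<le> s" "s \<le> T" for k s
  proof -
   have "z k s / G k \<le> M" unfolding M_def using cSUP_upper[OF _ bdd, of "(k, s)"] that by simp
   then show ?thesis using G(1)[of k] by (simp add: pos_divide_le_eq)
  qed
  have M0: "M \<ge> 0" using up[of 0 0] zi[of 0] G(1)[of 0] T0 by (simp add: zero_le_mult_iff)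
  have "M \<le> max (M / 2) E"
   unfolding M_def[symmetric]
  proof (subst (1) M_def, rule cSUP_least)
   fix x :: "nat \<times> real" assume "x \<in> UNIV \<times> {0..T}"
   then obtain k s where x: "x = (k, s)" "0 \<le> s" "s \<le> T" by auto
   have "z k s / G k \<le> max (M / 2) E"
   \<comment> \<open>Before time D / 4^k, integrating the inequality for z k gains a factor 1/2, by
     the choice of T. Later the assumed bound on y is used; there s <= T = D / 16 forces 4^k >= 16,
     the source of the factor 1/16 in \<open>E\<close>. Hence M <= max (M / 2) E.\<close>
   proof (cases "s * 4 ^ k \<le> D")
    case True
    have "z k s \<le> z k 0 + \<kappa> * 4 ^ k * (M * G (Suc k)) * s"
    proof (rule mvt_le[OF continuous_on_subset[OF zc] x(2)])
     fix r assume r: "0 < r" "r < s"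
     have "\<kappa> * 4 ^ k * z (Suc k) r \<le> \<kappa> * 4 ^ k * (M * G (Suc k))"
      using up[of r "Suc k"] r x \<kappa> by (intro mult_left_mono) auto
     then show "\<exists>d. (z k has_real_derivative d) (at r) \<and> d \<le> \<kappa> * 4 ^ k * (M * G (Suc k))"
      using zd[OF r(1), of k] by (meson order_trans)
    qed auto
    also have "\<dots> = \<kappa> * (s * 4 ^ k) * 4 powr (q + 1) * (M * G k)" by (simp add: zi G(3) mult_ac)
    also have "\<dots> \<le> \<kappa> * D * 4 powr (q + 1) * (M * G k)"
     using True \<kappa> M0 G(1)[of k] by (intro mult_right_mono mult_left_mono) auto
    also have "\<kappa> * D * 4 powr (q + 1) = 1 / 2" using \<kappa> powr_add[of 4 "q + 1" "- (q + 1)"] by (simp add: D_def T field_simps)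
    finally have "z k s / G k \<le> M / 2" using G(1)[of k] by (simp add: field_simps)
    then show ?thesis by (rule max.coboundedI1)
   next
    case False
    then have s: "0 < s" "D / 4 ^ k \<le> s" using x D0 by (auto simp: field_simps le_less)
    have "D \<le> s * 4 ^ k" using s(2) by (simp add: pos_divide_le_eq)
    also have "\<dots> \<le> T * 4 ^ k" using x(3) by (intro mult_right_mono) auto
    finally have "D \<le> T * 4 ^ k" .
    then have k: "(16 :: real) \<le> 4 ^ k" using T0 by (simp add: D_def)
    have "z k s \<le> y s" by (rule zy[OF x(2)])
    also have "\<dots> \<le> Y * s powr (- q)" using Y(2)[OF s(1) x(3)] s(1) by (simp add: powr_minus field_simps)
    also have "s powr (- q) \<le> (D / 4 ^ k) powr (- q)" using s D0 q by (intro powr_mono2') auto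
    also have "(D / 4 ^ k) powr (- q) = D powr (- q) * (4 ^ k) powr q" using D0 by (simp add: powr_divide powr_minus field_simps)
    finally have "z k s \<le> Y * D powr (- q) * (4 ^ k) powr q" using Y(1) by (simp add: mult_left_mono mult.assoc)
    also have "\<dots> \<le> Y * D powr (- q) * (4 ^ k * (4 ^ k) powr q / 16)"
     using k Y(1) by (intro mult_left_mono) auto
    also have "\<dots> = E * G k" by (simp add: E_def G(4))
    finally show ?thesis using G(1)[of k] by (simp add: pos_divide_le_eq le_max_iff_disj)
   qed
   then show "(case x of (k, s) => z k s / G k) \<le> max (M / 2) E" using x by simp
  qed (use T0 in auto)
  then have "M \<le> E" using M0 E0 by (auto simp: max_def split: if_splits)
  then show ?thesis using up[OF t, of 0] by (simp add: G_def E_def)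
 qed
 have step2: "t powr q * y t \<le> 4 * N + Y / 2"
  if Y: "Y \<ge> 0" "!!t. 0 < t ==> t \<le> T ==> t powr q * y t \<le> Y" and t: "0 < t" "t \<le> T" for Y t
 proof -
  define c where "c = Y / 8 + 2 * N"
  \<comment> \<open>s^(2q) is the integrating factor for -(2q/s) y, and the subtracted powers have
    derivatives that dominate the error terms. So F is nonincreasing, and its values near 0 are
    bounded by a quantity tending to 0.\<close>
  define F where "F s = s powr (2 * q) * y s - 2 * c * s powr q - \<kappa> * Y * s powr (q + 1)" for s
  have F': "\<exists>d. (F has_real_derivative d) (at s) \<and> d \<le> 0" if s: "0 < s" "s \<le> T" for s
  proof -
   obtain d where d: "(y has_real_derivative d) (at s)" "d \<le> - (2 * q / s) * (y s - 2 * z 0 s - 2 * N * s powr (- q)) + \<kappa> * y s"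
    using yd[OF s(1)] by blast
   define d' where "d' = 2 * q * s powr (2 * q - 1) * y s + s powr (2 * q) * d - 2 * c * (q * s powr (q - 1)) - \<kappa> * Y * ((q + 1) * s powr q)"
   have "(F has_real_derivative d') (at s)"
    unfolding F_def d'_def using s by (auto intro!: derivative_eq_intros d)
   moreover have "d' \<le> 0"
   proof -
    have "D powr (- q) \<le> s powr (- q)" using s T0 q by (intro powr_mono2') (auto simp: D_def)
    then have "2 * z 0 s \<le> Y / 8 * s powr (- q)"
     using step1[OF Y, of s] s mult_left_mono[of "D powr (- q)" "s powr (- q)" "Y / 8"] Y(1) by simp
    then have "y s - c * s powr (- q) \<le> y s - 2 * z 0 s - 2 * N * s powr (- q)" by (simp add: c_def algebra_simps)
    then have "(2 * q / s) * (y s - c * s powr (- q)) \<le> (2 * q / s) * (y s - 2 * z 0 s - 2 * N * s powr (- q))"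
     using s q by (intro mult_left_mono) auto
    moreover have "\<kappa> * y s \<le> \<kappa> * (Y * s powr (- q))"
     using Y(2)[OF s] s \<kappa> by (intro mult_left_mono) (auto simp: powr_minus field_simps)
    ultimately have "d \<le> - (2 * q / s) * (y s - c * s powr (- q)) + \<kappa> * (Y * s powr (- q))" using d(2) by simp
    then have "s powr (2 * q) * d \<le> s powr (2 * q) * (- (2 * q / s) * (y s - c * s powr (- q)) + \<kappa> * (Y * s powr (- q)))"
     by (intro mult_left_mono) auto
    also have "\<dots> = - (2 * q * s powr (2 * q - 1) * y s) + 2 * c * (q * s powr (q - 1)) + \<kappa> * Y * s powr q"
    proof -
     have e: "s powr (2 * q - 1) = s powr (2 * q) / s" "s powr (q - 1) = s powr q / s"
      "s powr (2 * q) = s powr q * s powr q" "s powr (- q) = 1 / s powr q"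
      using s by (simp_all add: powr_diff powr_minus_divide powr_add[symmetric])
     show ?thesis unfolding e using s by (simp add: field_simps)
    qed
    finally have "d' \<le> \<kappa> * Y * s powr q - \<kappa> * Y * ((q + 1) * s powr q)" by (simp add: d'_def)
    also have "\<dots> = - (q * (\<kappa> * Y * s powr q))" by (simp add: algebra_simps)
    also have "\<dots> \<le> 0" using q \<kappa> Y(1) by simp
    finally show ?thesis .
   qed
   ultimately show ?thesis by blast
  qed
  have dec: "F t \<le> s powr (2 * q) * B" if s: "0 < s" "s < t" for s
  proof -
   have "F t \<le> F s"
    by (rule DERIV_nonpos_imp_nonincreasing[OF less_imp_le[OF s(2)]]) (use F' s t in auto)
   also have "F s \<le> s powr (2 * q) * y s" 
   proof -
    have "0 \<le> 2 * c * s powr q" "0 \<le> \<kappa> * Y * s powr (q + 1)" using N Y(1) \<kappa> by (simp_all add: c_def)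
    then show ?thesis unfolding F_def by linarith
   qed
   also have "\<dots> \<le> s powr (2 * q) * B" using yB[of s] s by (intro mult_left_mono) auto
   finally show ?thesis .
  qed
  have "((%s. s powr (2 * q) * B) \<longlongrightarrow> 0) (at_right 0)"
  proof -
   have "((%s::real. s powr (2 * q)) \<longlongrightarrow> 0) (at_right 0)"
    using q by (intro tendsto_zero_powrI[of "%s. s" _ "%s. 2 * q" "2 * q"]) (auto intro!: tendsto_intros simp: eventually_at_filter)
   then show ?thesis by (rule tendsto_mult_left_zero)
  qed
  moreover have "\<forall>\<^sub>F s in at_right 0. F t \<le> s powr (2 * q) * B"
   using eventually_at_right_real[OF t(1)] by eventually_elim (use dec in auto)
  ultimately have "F t \<le> 0" by (intro tendsto_lowerbound[of _ 0 "at_right 0"]) auto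
  moreover have "t powr (2 * q) = t powr q * t powr q" by (simp add: powr_add[symmetric])
  ultimately have "t powr q * (t powr q * y t) \<le> t powr q * (2 * c + \<kappa> * Y * t)"
   using t by (simp add: F_def powr_add algebra_simps)
  then have "t powr q * y t \<le> 2 * c + \<kappa> * Y * t" using t by simp
  also have "\<kappa> * Y * t \<le> Y / 4"
  proof -
   have "4 powr (- (q + 1)) \<le> (1 :: real)" using q powr_mono[of "- (q + 1)" 0 "4 :: real"] by simp
   then have "\<kappa> * T \<le> 1 / 4" using \<kappa> by (simp add: T)
   moreover have "\<kappa> * t \<le> \<kappa> * T" using t \<kappa> by simp
   ultimately have "\<kappa> * t * Y \<le> 1 / 4 * Y" using Y(1) by (intro mult_right_mono) auto
   then show ?thesis by (simp add: mult_ac)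
  qed
  finally show ?thesis by (simp add: c_def)
 qed
 define Y where "Y = (SUP t\<in>{0<..T}. t powr q * y t)"
 have bdd: "bdd_above ((%t. t powr q * y t) ` {0<..T})"
 proof (rule bdd_aboveI2)
  fix t assume "t \<in> {0<..T}"
  then show "t powr q * y t \<le> T powr q * B" using yB[of t] y0[of t] q by (intro mult_mono powr_mono2) auto
 qed
 have up: "t powr q * y t \<le> Y" if "0 < t" "t \<le> T" for t
  unfolding Y_def using that by (intro cSUP_upper bdd) auto
 have Y0: "Y \<ge> 0" using up[of T] T0 y0[of T] by (meson less_imp_le mult_nonneg_nonneg order_refl order_trans powr_ge_zero)
 have "Y \<le> 4 * N + Y / 2"
  by (subst (1) Y_def, rule cSUP_least) (use step2[OF Y0 up] T0 in auto)
 then show ?thesis using up[of T] T0 by simp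
qed

context doubling_heat_space
begin

lemma EE_self_tendsto:
 assumes w: "!!n. w n \<in> FD" and u: "u \<in> FD" and lim: "(%n. EE (%x. w n x - u x) (%x. w n x - u x)) \<longlonglongrightarrow> 0"
 shows "(%n. EE (w n) (w n)) \<longlonglongrightarrow> EE u u"
proof -
 define d where "d n x = w n x - u x" for n x
 have d: "d n \<in> FD" for n unfolding d_def by (rule FD_diff[OF w u])
 have eq: "EE (w n) (w n) = EE (d n) (d n) + 2 * EE (d n) u + EE u u" for n
  using EE_diff[OF w u d, of n n] EE_diff[OF w u w, of n n] EE_diff[OF w u u, of n] EE_sym[OF d w, of n n] EE_sym[OF d u, of n] EE_sym[OF w u, of n]
  unfolding d_def by simp
 have "(%n. EE (d n) u) \<longlonglongrightarrow> 0"
 proof (rule Lim_null_comparison)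
  show "(%n. sqrt (EE (d n) (d n)) * sqrt (EE u u)) \<longlonglongrightarrow> 0"
   using tendsto_mult_left_zero[OF tendsto_real_sqrt[OF lim, simplified]] by (simp add: d_def[abs_def])
 qed (simp add: EE_Cauchy_Schwarz[OF d u])
 from tendsto_add[OF tendsto_add[OF lim[folded d_def] tendsto_mult_right_zero[OF this, of 2]] tendsto_const[of "EE u u"]]
 show ?thesis unfolding eq by simp
qed

lemma L2_abs: "f \<in> L2 (mu0 :: 'a measure) ==> (%x. \<bar>f x\<bar>) \<in> L2 mu0"
 using L2_measurable[of f mu0] by (intro L2_bound[of f mu0 "%x. \<bar>f x\<bar>"]) auto

section \<open>Weighted norms along the heat flow\<close>

definition Mop :: "('a => real) => 'a l2 => 'a l2" where "Mop m h = cls (%x. m x * rep h x)"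

context
 fixes m :: "'a => real"
 assumes m: "m \<in> borel_measurable borel" "!!x. \<bar>m x\<bar> \<le> 1"
begin

lemma Mop_L2: "(%x. m x * rep h x) \<in> L2 mu0"
 by (rule L2_multiplier(1)[OF rep_L2 m])

lemma bounded_linear_Mop: "bounded_linear (Mop m)"
proof (rule bounded_linear_intro[where K = 1])
 fix h k :: "'a l2" and c :: real
 have "Mop m (h + k) = cls (%x. m x * rep h x + m x * rep k x)"
  unfolding Mop_def by (intro cls_cong Mop_L2 L2_add) (use rep_ops_AE(1)[of h k] in \<open>eventually_elim, simp add: distrib_left\<close>)
 then show "Mop m (h + k) = Mop m h + Mop m k" by (simp add: Mop_def cls_add Mop_L2)
 have "Mop m (c *\<^sub>R h) = cls (%x. c * (m x * rep h x))"
  unfolding Mop_def by (intro cls_cong Mop_L2 L2_scale) (use rep_ops_AE(4)[of c h] in \<open>eventually_elim, simp\<close>)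
 then show "Mop m (c *\<^sub>R h) = c *\<^sub>R Mop m h" by (simp add: Mop_def cls_scale Mop_L2)
 show "norm (Mop m h) \<le> norm h * 1"
  using L2_multiplier(2)[OF rep_L2 m, of h] by (simp add: Mop_def)
qed

lemma norm_Mop: "(norm (Mop m h))^2 = (LINT x|mu0. (m x * rep h x)^2)" "norm (Mop m h) \<le> norm h"
 using norm_cls_square[OF Mop_L2] L2_multiplier(2)[OF rep_L2 m, of h] by (simp_all add: Mop_def)

text \<open>Multiplication by \<open>m\<close> is symmetric, so the derivative pairs -L P_t f with
  m^2 P_t f; if the latter is in the form domain, this pairing is a value of the form.\<close>

lemma Mop_derivative:
 assumes t: "t > 0" and D: "(%x. (m x)^2 * PP t f x) \<in> FD"
 shows "((%s. (norm (Mop m (H.P s (cls f))))^2) has_real_derivative - 2 * EE (PP t f) (%x. (m x)^2 * PP t f x)) (at t)"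
proof -
 obtain w where w: "((%s. H.P s (cls f)) has_vector_derivative - w) (at t)" "!!g. g \<in> H.D ==> inner w g = H.E (H.P t (cls f)) g"
  using H.has_derivative_P[OF t, of "cls f"] by blast
 have uD: "PP t f \<in> FD" using H.P_in_D[OF t, of "cls f"] by (simp add: FD_iff rep_L2)
 have "((%s. Mop m (H.P s (cls f))) has_vector_derivative Mop m (- w)) (at t)"
  by (rule bounded_linear.has_vector_derivative[OF bounded_linear_Mop w(1)])
 from bounded_bilinear.has_vector_derivative[OF bounded_bilinear_inner this this]
 have "((%s. (norm (Mop m (H.P s (cls f))))^2) has_vector_derivative - 2 * inner (Mop m w) (Mop m (H.P t (cls f)))) (at t)"
  using linear_neg[OF bounded_linear.linear[OF bounded_linear_Mop], of w] by (simp add: power2_norm_eq_inner inner_commute)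
 moreover have "inner (Mop m w) (Mop m (H.P t (cls f))) = inner w (cls (%x. (m x)^2 * PP t f x))"
  using inner_cls[OF Mop_L2 Mop_L2, of w "H.P t (cls f)"] inner_cls[OF rep_L2 FD_L2[OF D], of w]
  by (simp add: Mop_def l2_inner_def power2_eq_square mult_ac)
 moreover have "\<dots> = EE (PP t f) (%x. (m x)^2 * PP t f x)" using w(2)[OF FD_D[OF D]] uD D by (simp add: EE_eq)
 ultimately show ?thesis by (simp add: has_real_derivative_iff_has_vector_derivative)
qed

lemma continuous_on_Mop_P: "continuous_on {0..} (%s. (norm (Mop m (H.P s (cls f))))^2)"
 by (intro continuous_intros bounded_linear.continuous_on[OF bounded_linear_Mop] H.P.continuous_on_T)

end

section \<open>Local Nash inequality and heat bounds under Faber-Krahn\<close>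

context
 fixes v :: "'a => real => real" and \<alpha> c :: real
 assumes \<alpha>: "\<alpha> > 0" and c: "c > 0" and v_pos: "!!x r. r > 0 ==> 0 < v x r"
  and fk: "!!x r U f. r > 0 ==> rel_compact_open U ==> U \<noteq> {} ==> U \<subseteq> ball x r ==> f \<in> FD ==>
   compact (ess_support mu0 f) ==> ess_support mu0 f \<subseteq> U ==>
   c / r^2 * (v x r / measure mu0 U) powr \<alpha> * (LINT x|mu0. (f x)^2) \<le> EE f f"
begin

text \<open>The Faber--Krahn inequality on the superlevel set \<open>{f > s}\<close> controls the part of \<open>f\<close> above \<open>2 s\<close>,
 and Chebyshev's inequality bounds the measure of that set.\<close>

lemma nash_CD:
 assumes f: "f \<in> CD" "!!x. 0 \<le> f x" "supp f \<subseteq> ball x r" and A: "A > 0" "(LINT x|mu0. f x) \<le> A" and s: "s > 0" and r: "r > 0"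
 shows "(LINT x|mu0. (f x)^2) \<le> 4 * s * A + r^2 / c * (A / (s * v x r)) powr \<alpha> * EE f f"
proof -
 define g where "g x = max 0 (f x - 2 * s)" for x
 define U where "U = {x. s < f x}"
 note fc = CD_continuous[OF f(1)] and fi = CD_integrable_mu0[OF f(1)]
 have g: "g \<in> CD" unfolding g_def by (rule CD_contraction[OF f(1), of "%a. max 0 (a - 2 * s)"]) (use s in \<open>auto simp: max_def\<close>)
 have gE: "EE g g \<le> EE f f" unfolding g_def
  by (rule EE_contraction[OF CD_FD[OF f(1)]]) (use s f(2) CD_borel[OF f(1)] in \<open>auto simp: max_def\<close>)
 have U: "open U" unfolding U_def by (intro open_Collect_less continuous_intros fc)
 have sub: "U \<subseteq> ball x r"
 proof
  fix y assume "y \<in> U"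
  then have "f y \<noteq> 0" using s by (simp add: U_def)
  then show "y \<in> ball x r" using f(3) supp_0[of y f] by blast
 qed
 have rco: "rel_compact_open U" using U bounded_subset[OF bounded_ball sub] by (rule rel_compact_openI)
 have "supp g \<subseteq> {x. 2 * s \<le> f x}"
  by (intro closure_minimal closed_Collect_le continuous_intros fc) (auto simp: g_def)
 also have "\<dots> \<subseteq> U" using s by (auto simp: U_def)
 finally have gU: "supp g \<subseteq> U" .
 define X where "X = r^2 / c * (A / (s * v x r)) powr \<alpha> * EE f f"
 note v0 = v_pos[OF r, of x]
 have key: "(LINT x|mu0. (g x)^2) \<le> X"
 proof (cases "U = {}")
  case True
  then have "g x = 0" for x using gU supp_0[of x g] by auto
  then show ?thesis using c EE_nonneg[OF CD_FD[OF f(1)]] by (simp add: X_def)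
 next
  case False
  define \<mu> where "\<mu> = measure mu0 U"
  have fin: "emeasure mu0 U < \<infinity>" using emeasure_bounded_finite[OF bounded_subset[OF bounded_ball sub]] .
  have "0 < emeasure mu0 U" using H U False by (auto simp: hypothesis_H_def)
  then have \<mu>0: "\<mu> > 0" using fin unfolding \<mu>_def by (simp add: measure_def enn2real_positive_iff)
  have "s * \<mu> = (LINT x|mu0. s * indicator U x)" using U by (simp add: \<mu>_def)
  also have "\<dots> \<le> (LINT x|mu0. f x)"
   using fin U f(2) by (intro integral_mono[OF integrable_mult_right[OF integrable_real_indicator] fi]) (auto simp: indicator_def U_def)
  finally have \<mu>: "s * \<mu> \<le> A" using A(2) by simp
  from ess_support_compact[of "supp g" g, OF CD_compact[OF g] supp_0[of _ g]]
  have "c / r^2 * (v x r / \<mu>) powr \<alpha> * (LINT x|mu0. (g x)^2) \<le> EE g g"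
   unfolding \<mu>_def using gU by (intro fk r rco False sub CD_FD[OF g]) auto
  then have "c / r^2 * (v x r / \<mu>) powr \<alpha> * (LINT x|mu0. (g x)^2) \<le> EE f f" using gE by simp
  define P where "P = (s * v x r / A) powr \<alpha>"
  have P: "P > 0" "(A / (s * v x r)) powr \<alpha> = 1 / P" using A(1) s v0 by (simp_all add: P_def powr_divide)
  have "P \<le> (v x r / \<mu>) powr \<alpha>"
   unfolding P_def using \<mu> \<mu>0 A v0 s \<alpha> by (intro powr_mono2) (auto simp: field_simps)
  then have "c / r^2 * P * (LINT x|mu0. (g x)^2) \<le> c / r^2 * (v x r / \<mu>) powr \<alpha> * (LINT x|mu0. (g x)^2)"
   using c by (intro mult_right_mono mult_left_mono) auto
  also note \<open>\<dots> \<le> EE f f\<close>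
  finally show ?thesis unfolding X_def P(2) using c r P(1) by (simp add: field_simps)
 qed
 have le: "(f x)^2 \<le> (g x)^2 + 4 * s * f x" for x
 proof (cases "f x \<le> 2 * s")
  case True
  then have "f x * f x \<le> 2 * s * f x" using f(2)[of x] by (intro mult_right_mono) auto
  moreover have "g x = 0" "0 \<le> s * f x" using True f(2)[of x] s by (simp_all add: g_def)
  ultimately show ?thesis by (simp add: power2_eq_square)
 next
  case False
  then have "(f x)^2 = (g x)^2 + 4 * s * f x - 4 * s^2" by (simp add: g_def max_def power2_eq_square algebra_simps)
  then show ?thesis by simp
 qed
 have "(LINT x|mu0. (f x)^2) \<le> (LINT x|mu0. (g x)^2 + 4 * s * f x)"
  using le FD_L2[OF CD_FD[OF f(1)]] FD_L2[OF CD_FD[OF g]] fi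
  by (intro integral_mono Bochner_Integration.integrable_add integrable_mult_right L2_integrable_square)
 also have "\<dots> = (LINT x|mu0. (g x)^2) + 4 * s * (LINT x|mu0. f x)"
  using FD_L2[OF CD_FD[OF g]] fi by (simp add: L2_integrable_square)
 also have "\<dots> \<le> X + 4 * s * A" using key A(2) s by (intro add_mono mult_left_mono) auto
 finally show ?thesis by (simp add: X_def)
qed

text \<open>Passage from the core to the whole domain. The approximants need not satisfy the L1
  bound, but with the square integrable weight \<eta> the excess is at most |\<eta>| |w_n - u|,
  which tends to 0.\<close>

lemma nash:
 assumes \<eta>: "cutoff \<eta> K" "supp \<eta> \<subseteq> ball x r" and u: "u \<in> FD" and A: "A > 0" "(LINT x|mu0. \<eta> x * \<bar>u x\<bar>) \<le> A" and s: "s > 0" and r: "r > 0"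
 shows "(LINT x|mu0. (\<eta> x * u x)^2) \<le> 4 * s * A + r^2 / c * (A / (s * v x r)) powr \<alpha> * (2 * EE u u + 2 * K * (LINT x|mu0. (u x)^2))"
proof -
 obtain w where w: "!!n. w n \<in> CD" "(%n. cls (w n)) \<longlonglongrightarrow> cls u"
  "(%n. EE (%x. w n x - u x) (%x. w n x - u x)) \<longlonglongrightarrow> 0" using approx_CD[OF u] by blast
 note \<eta>D = cutoffD[OF \<eta>(1)] and wL = FD_L2[OF CD_FD[OF w(1)]] and uL = FD_L2[OF u]
 have \<eta>L: "\<eta> \<in> L2 mu0" by (rule FD_L2[OF CD_FD[OF \<eta>D(1)]])
 define B where "B a = (A + a) / (s * v x r)" for a :: real
 define a where "a n = norm (cls \<eta>) * norm (cls (w n) - cls u)" for n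
 note v0 = v_pos[OF r, of x]
 have L1: "(LINT x|mu0. \<eta> x * \<bar>w n x\<bar>) \<le> A + a n" for n
 proof -
  note dL = L2_diff[OF wL uL, of n]
  have "(LINT x|mu0. \<eta> x * \<bar>w n x\<bar>) \<le> (LINT x|mu0. \<eta> x * \<bar>u x\<bar> + \<eta> x * \<bar>w n x - u x\<bar>)"
   using \<eta>D(2) \<eta>L wL[of n] uL dL
   by (intro integral_mono Bochner_Integration.integrable_add L2_integrable_mult L2_abs)
    (auto simp: distrib_left[symmetric] intro!: mult_left_mono)
  also have "\<dots> = (LINT x|mu0. \<eta> x * \<bar>u x\<bar>) + (LINT x|mu0. \<eta> x * \<bar>w n x - u x\<bar>)"
   using \<eta>L uL dL by (intro Bochner_Integration.integral_add L2_integrable_mult L2_abs)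
  also have "(LINT x|mu0. \<eta> x * \<bar>w n x - u x\<bar>) = inner (cls \<eta>) (cls (%x. \<bar>w n x - u x\<bar>))"
   using inner_cls[OF \<eta>L L2_abs[OF dL]] by (simp add: l2_inner_def)
  also have "\<dots> \<le> norm (cls \<eta>) * norm (cls (%x. \<bar>w n x - u x\<bar>))" by (rule norm_cauchy_schwarz)
  also have "norm (cls (%x. \<bar>w n x - u x\<bar>)) = norm (cls (w n) - cls u)"
   using dL wL uL by (simp add: cls_diff[symmetric] norm_cls L2_abs l2_norm_def)
  finally show ?thesis using A(2) by (simp add: a_def)
 qed
 have ineq: "(LINT x|mu0. (\<eta> x * w n x)^2) \<le> 4 * s * (A + a n) + r^2 / c * B (a n) powr \<alpha> * (2 * EE (w n) (w n) + 2 * K * (LINT x|mu0. (w n x)^2))" for n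
 proof -
  define f where "f x = \<bar>\<eta> x * w n x\<bar>" for x
  note pCD = CD_mult[OF \<eta>D(1) w(1), of n]
  have f: "f \<in> CD" unfolding f_def by (rule CD_contraction[OF pCD]) auto
  have "EE f f \<le> EE (%x. \<eta> x * w n x) (%x. \<eta> x * w n x)"
   by (rule EE_contraction[OF CD_FD[OF pCD]]) (use CD_borel[OF f] in \<open>auto simp: f_def\<close>)
  also have "\<dots> \<le> 2 * EE (w n) (w n) + 2 * K * (LINT x|mu0. (w n x)^2)" by (rule EE_cutoff_CD[OF \<eta>(1) w(1)])
  finally have E: "EE f f \<le> 2 * EE (w n) (w n) + 2 * K * (LINT x|mu0. (w n x)^2)" .
  have "supp f \<subseteq> supp \<eta>" by (intro closure_mono) (auto simp: f_def)
  then have "(LINT x|mu0. (f x)^2) \<le> 4 * s * (A + a n) + r^2 / c * B (a n) powr \<alpha> * EE f f"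
   unfolding B_def using \<eta>(2) L1[of n] A(1) \<eta>D(2) s r by (intro nash_CD f) (auto simp: f_def a_def abs_mult add_pos_nonneg)
  also have "\<dots> \<le> 4 * s * (A + a n) + r^2 / c * B (a n) powr \<alpha> * (2 * EE (w n) (w n) + 2 * K * (LINT x|mu0. (w n x)^2))"
   using c E by (intro add_left_mono mult_left_mono) auto
  finally show ?thesis by (simp add: f_def)
 qed
 have a: "a \<longlonglongrightarrow> 0" unfolding a_def using tendsto_mult_right_zero[OF tendsto_norm_zero[OF LIM_zero[OF w(2)]]] .
 have "(%n. 4 * s * (A + a n) + r^2 / c * B (a n) powr \<alpha> * (2 * EE (w n) (w n) + 2 * K * (LINT x|mu0. (w n x)^2)))
  \<longlonglongrightarrow> 4 * s * (A + 0) + r^2 / c * B 0 powr \<alpha> * (2 * EE u u + 2 * K * (LINT x|mu0. (u x)^2))"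
  unfolding B_def
 proof (intro tendsto_intros a EE_self_tendsto CD_FD[OF w(1)] w(3) u)
  show "(%n. \<integral>x. (w n x)^2 \<partial>mu0) \<longlonglongrightarrow> (LINT x|mu0. (u x)^2)"
   using tendsto_power[OF tendsto_norm[OF w(2)], of 2] by (simp add: norm_cls_square wL uL)
 qed (use s v0 A(1) in auto)
 moreover have "(%n. \<integral>x. (\<eta> x * w n x)^2 \<partial>mu0) \<longlonglongrightarrow> (LINT x|mu0. (\<eta> x * u x)^2)"
  by (rule multiplier_tendsto(2)[OF wL uL w(2) cutoff_measurable[OF \<eta>(1)] cutoff_abs(1)[OF \<eta>(1)]])
 ultimately show ?thesis using ineq unfolding B_def by (auto intro: LIMSEQ_le)
qed

text \<open>The cutoffs fall from 1 to 0 between the radii r (1 + 3/4 2^(-k)) and r (1 + 2^(-k)), so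
  the support of the next one lies where the previous one is 1. Slope 4 2^k / r gives the density
  bound 16 4^k / r^2, and the derivative of a squared norm doubles it. This yields \<kappa> = 32 /
  r^2 in \<open>decay_system\<close>, hence the 1024 = 32^2 in T.\<close>

lemma heat_L1_L2:
 fixes q T :: real
 assumes q: "q = 1 / \<alpha>" and r: "r > 0" and T: "T = 4 powr (- (q + 1)) / 1024 * r^2"
  and g: "g \<in> L2 mu0" "!!x. 0 \<le> g x" "!!x. x \<notin> ball x0 r ==> g x = 0" "integrable mu0 g" "(LINT x|mu0. g x) \<le> a" and a: "a > 0"
 shows "(norm (H.P T (cls g)))^2 \<le> 32 * (36 * q * 1024 * 4 powr (q + 1) / c) powr q * a^2 / v x0 (3 * r)"
proof -
 define \<eta> where "\<eta> k y = clip (4 * 2 ^ k + 4 - 4 * 2 ^ k / r * dist x0 y)" for k :: nat and y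
 have cut: "cutoff (\<eta> k) (16 * 4 ^ k / r^2)" for k
 proof -
  have "(4 * 2 ^ k / r)^2 = 16 * 4 ^ k / r^2" by (simp add: power_divide power_mult_distrib power_mult[symmetric] mult.commute[of k] power_mult)
  then show ?thesis using cutoff_dist[of "4 * 2 ^ k / r" "4 * 2 ^ k + 4" x0] r by (simp add: \<eta>_def[abs_def])
 qed
 have \<eta>1: "\<eta> k y = 1" if "dist x0 y \<le> r * (1 + 3 / 4 / 2 ^ k)" for k y
 proof -
  have "4 * 2 ^ k / r * dist x0 y \<le> 4 * 2 ^ k / r * (r * (1 + 3 / 4 / 2 ^ k))" using that r by (intro mult_left_mono) auto
  also have "\<dots> = 4 * 2 ^ k + 3" using r by (simp add: field_simps)
  finally show ?thesis unfolding \<eta>_def by (intro clip_cases) simp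
 qed
 have \<eta>0: "\<eta> k y = 0" if "r * (1 + 1 / 2 ^ k) \<le> dist x0 y" for k y
 proof -
  have "4 * 2 ^ k / r * (r * (1 + 1 / 2 ^ k)) \<le> 4 * 2 ^ k / r * dist x0 y" using that r by (intro mult_left_mono) auto
  also have "4 * 2 ^ k / r * (r * (1 + 1 / 2 ^ k)) = 4 * 2 ^ k + 4" using r by (simp add: field_simps)
  finally show ?thesis unfolding \<eta>_def by (intro clip_cases) simp
 qed
 have supp_\<eta>: "supp (\<eta> k) \<subseteq> cball x0 (r * (1 + 1 / 2 ^ k))" for k
 proof (intro closure_minimal closed_cball subsetI)
  fix y assume "y \<in> {y. \<eta> k y \<noteq> 0}"
  then show "y \<in> cball x0 (r * (1 + 1 / 2 ^ k))" using \<eta>0[of k y] by (meson linear mem_Collect_eq mem_cball)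
 qed
 define m where "m k y = 1 - \<eta> k y" for k y
 have m: "m k \<in> borel_measurable borel" "!!x. \<bar>m k x\<bar> \<le> 1" for k
  using cutoff_measurable[OF cut[of k]] cutoff_abs(2)[OF cut[of k]] by (auto simp: m_def[abs_def])
 have m1: "(%x::'a. 1::real) \<in> borel_measurable borel" "!!x::'a. \<bar>1::real\<bar> \<le> 1" by auto
 define z where "z k t = (norm (Mop (m k) (H.P t (cls g))))^2" for k t
 define y where "y t = (norm (H.P t (cls g)))^2" for t
 have M1: "Mop (%x. 1) h = h" for h by (simp add: Mop_def)
 define N where "N = 4 * (a^2 / v x0 (3 * r)) * (36 * q * r^2 / c) powr q"
 have q0: "q > 0" using \<alpha> q by simp
 have v0: "v x0 (3 * r) > 0" using r by (intro v_pos) simp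
 have uD: "PP t g \<in> FD" if "t > 0" for t using H.P_in_D[OF that, of "cls g"] by (simp add: FD_iff rep_L2)
 have "T powr q * y T \<le> 8 * N"
 proof (rule decay_system[where z = z and B = "(norm (cls g))^2" and \<kappa> = "32 / r^2", OF q0])
  show "0 < 32 / r^2" "0 \<le> N" using r v0 by (simp_all add: N_def)
  show "0 \<le> z k t" "z k t \<le> y t" "y t \<le> (norm (cls g))^2" for k t
   using norm_Mop(2)[OF m, of k "H.P t (cls g)"] H.norm_P_le[of t "cls g"] by (simp_all add: z_def y_def power_mono)
  show "continuous_on {0..} (z k)" for k unfolding z_def by (rule continuous_on_Mop_P[OF m])
  show "T = 4 powr (- (q + 1)) / (32 * (32 / r^2))" by (simp add: T)
  \<comment> \<open>The initial function lives in the ball of radius r, where every cutoff is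
    1.\<close>
  show "z k 0 = 0" for k
  proof -
   have "AE x in mu0. m k x * rep (cls g) x = 0"
    using rep_cls[OF g(1)]
   proof eventually_elim
    case (elim x)
    have "dist x0 x < r ==> dist x0 x \<le> r * (1 + 3 / 4 / 2 ^ k)" using r by (simp add: distrib_left) (smt (verit) divide_nonneg_nonneg mult_nonneg_nonneg zero_le_power)
    then show ?case using elim g(3)[of x] \<eta>1[of x k] by (cases "x \<in> ball x0 r") (auto simp: m_def)
   qed
   then have "cls (%x. m k x * rep (cls g) x) = cls (%x. 0)"
    by (intro cls_cong Mop_L2[OF m] L2_0)
   then show ?thesis by (simp add: z_def Mop_def cls_0 H.P_def)
  qed
  show "\<exists>d. (z k has_real_derivative d) (at t) \<and> d \<le> 32 / r^2 * 4 ^ k * z (Suc k) t" if t: "0 < t" for k t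
  proof -
   have V: "open (ball x0 (r * (1 + 3 / 4 / 2 ^ k)))" "supp (\<eta> (Suc k)) \<subseteq> ball x0 (r * (1 + 3 / 4 / 2 ^ k))"
    "!!x. x \<in> ball x0 (r * (1 + 3 / 4 / 2 ^ k)) ==> \<eta> k x = 1"
   proof -
    have lt: "r * (1 + 1 / 2 ^ Suc k) < r * (1 + 3 / 4 / 2 ^ k)" using r by (simp add: field_simps)
    show "supp (\<eta> (Suc k)) \<subseteq> ball x0 (r * (1 + 3 / 4 / 2 ^ k))"
     by (rule order_trans[OF supp_\<eta>]) (use lt in auto)
    show "\<eta> k x = 1" if "x \<in> ball x0 (r * (1 + 3 / 4 / 2 ^ k))" for x using that by (intro \<eta>1) simp
   qed simp
   note cc = caccioppoli[OF cut[of k] uD[OF t] cut[of "Suc k"] V]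
   have "(z k has_real_derivative - 2 * EE (PP t g) (%x. (m k x)^2 * PP t g x)) (at t)"
    unfolding z_def by (rule Mop_derivative[OF m t]) (use cc(1) in \<open>simp add: m_def\<close>)
   moreover have "- 2 * EE (PP t g) (%x. (m k x)^2 * PP t g x) \<le> 32 / r^2 * 4 ^ k * z (Suc k) t"
   proof -
    have "32 / r^2 * 4 ^ k * z (Suc k) t = 2 * (16 * 4 ^ k / r^2 * (LINT x|mu0. ((1 - \<eta> (Suc k) x) * PP t g x)^2))"
     by (simp add: z_def norm_Mop(1)[OF m] m_def)
    then show ?thesis using cc(2) unfolding m_def by linarith
   qed
   ultimately show ?thesis by blast
  qed
  show "\<exists>d. (y has_real_derivative d) (at t) \<and>
    d \<le> - (2 * q / t) * (y t - 2 * z 0 t - 2 * N * t powr (- q)) + 32 / r^2 * y t" if t: "0 < t" for t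
  proof -
   define u where "u = PP t g"
   have u: "u \<in> FD" "u \<in> L2 mu0" using uD[OF t] by (simp_all add: u_def FD_L2)
   have "(y has_real_derivative - 2 * EE u u) (at t)"
    using Mop_derivative[OF m1 t, of g] uD[OF t] by (simp add: M1 y_def[abs_def] u_def)
   moreover have "- 2 * EE u u \<le> - (2 * q / t) * (y t - 2 * z 0 t - 2 * N * t powr (- q)) + 32 / r^2 * y t"
   proof -
    \<comment> \<open>\<open>X\<close> and \<open>s\<close> make the factor in front of the energy
      in the Nash inequality on the ball of radius 3 r equal to t / (4 q); the additive term 4 s a
      then is N t^(-q), which dictates \<open>N\<close>.\<close>
    define X where "X = 36 * q * r^2 / (c * t)"
    define s where "s = a / v x0 (3 * r) * X powr q"
    have X: "X > 0" using q0 r c t by (simp add: X_def)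
    have s: "s > 0" using a v0 X by (simp add: s_def)
    have u_nn: "AE x in mu0. 0 \<le> u x" unfolding u_def by (rule P_nonneg[OF g(1)]) (use g(2) t in auto)
    note I = P_integral_le[OF g(1) AE_I2[OF g(2)] g(4) less_imp_le[OF t]]
    note \<eta>D = cutoffD[OF cut[of 0]]
    have "(LINT x|mu0. \<eta> 0 x * \<bar>u x\<bar>) \<le> (LINT x|mu0. u x)"
    proof (rule integral_mono_AE)
     show "integrable mu0 (%x. \<eta> 0 x * \<bar>u x\<bar>)" by (intro L2_integrable_mult L2_abs u FD_L2 CD_FD \<eta>D(1))
     show "integrable mu0 u" unfolding u_def by (rule I(1))
     show "AE x in mu0. \<eta> 0 x * \<bar>u x\<bar> \<le> u x"
      using u_nn by eventually_elim (use \<eta>D(2,3) in \<open>auto intro: mult_left_le_one_le\<close>)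
    qed
    also have "\<dots> \<le> a" unfolding u_def using I(2) g(5) by simp
    finally have L1: "(LINT x|mu0. \<eta> 0 x * \<bar>u x\<bar>) \<le> a" .
    have "supp (\<eta> 0) \<subseteq> ball x0 (3 * r)"
     using supp_\<eta>[of 0] by (rule order_trans) (use r in \<open>auto simp: cball_subset_ball_iff\<close>)
    from nash[OF cut this u(1) a L1 s] have "(LINT x|mu0. (\<eta> 0 x * u x)^2) \<le> 4 * s * a + (3 * r)^2 / c * (a / (s * v x0 (3 * r))) powr \<alpha> *
     (2 * EE u u + 2 * (16 / r^2) * (LINT x|mu0. (u x)^2))" using r by simp
    also have "4 * s * a = N * t powr (- q)"
     using q0 r c t v0 by (simp add: s_def N_def X_def powr_divide powr_mult powr_minus_divide power2_eq_square field_simps)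
    also have "(3 * r)^2 / c * (a / (s * v x0 (3 * r))) powr \<alpha> = t / (4 * q)"
    proof -
     have "a / (s * v x0 (3 * r)) = X powr (- q)" using a v0 X by (simp add: s_def powr_minus field_simps)
     moreover have "(X powr (- q)) powr \<alpha> = 1 / X" unfolding powr_powr using \<alpha> X by (simp add: q powr_minus_divide)
     ultimately have "(a / (s * v x0 (3 * r))) powr \<alpha> = 1 / X" by simp
     then show ?thesis using q0 r c t by (simp add: X_def field_simps power2_eq_square)
    qed
    also have "(LINT x|mu0. (u x)^2) = y t" using norm_cls_square[OF u(2)] by (simp add: y_def u_def)
    finally have *: "(LINT x|mu0. (\<eta> 0 x * u x)^2) \<le> N * t powr (- q) + t / (4 * q) * (2 * EE u u + 32 / r^2 * y t)" by simp
    have zt: "z 0 t = (LINT x|mu0. (m 0 x * u x)^2)" by (simp add: z_def norm_Mop(1)[OF m] u_def)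
    have "y t \<le> 2 * (LINT x|mu0. (\<eta> 0 x * u x)^2) + 2 * z 0 t"
    proof -
     have L: "(%x. \<eta> 0 x * u x) \<in> L2 mu0" "(%x. m 0 x * u x) \<in> L2 mu0"
      using L2_multiplier(1)[OF u(2) cutoff_measurable[OF cut] cutoff_abs(1)[OF cut]] L2_multiplier(1)[OF u(2) m] by blast+
     have "(u x)^2 \<le> 2 * (\<eta> 0 x * u x)^2 + 2 * (m 0 x * u x)^2" for x
      using sum_squares_bound[of "\<eta> 0 x * u x" "m 0 x * u x"] by (simp add: m_def power2_eq_square algebra_simps)
     then have "(LINT x|mu0. (u x)^2) \<le> (LINT x|mu0. 2 * (\<eta> 0 x * u x)^2 + 2 * (m 0 x * u x)^2)"
      using u(2) L by (intro integral_mono Bochner_Integration.integrable_add integrable_mult_right L2_integrable_square)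
     then show ?thesis using norm_cls_square[OF u(2)] L by (simp add: L2_integrable_square zt y_def u_def)
    qed
    moreover have "t / (2 * q) * X = 2 * (t / (4 * q) * X)" for X by simp
    ultimately have "y t - 2 * z 0 t - 2 * N * t powr (- q) \<le> t / (2 * q) * (2 * EE u u + 32 / r^2 * y t)" using * by linarith
    then have "(2 * q / t) * (y t - 2 * z 0 t - 2 * N * t powr (- q)) \<le> (2 * q / t) * (t / (2 * q) * (2 * EE u u + 32 / r^2 * y t))"
     using q0 t by (intro mult_left_mono) auto
    also have "\<dots> = 2 * EE u u + 32 / r^2 * y t" using q0 t by simp
    finally show ?thesis by simp
   qed
   ultimately show ?thesis by blast
  qed
 qed
 moreover have "T powr q > 0" using r by (simp add: T)
 ultimately have "y T \<le> 8 * N / T powr q" by (simp add: pos_le_divide_eq mult.commute)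
 also have "\<dots> = 32 * (a^2 / v x0 (3 * r)) * ((36 * q * r^2 / c) / T) powr q"
 proof -
  have "((36 * q * r^2 / c) / T) powr q = (36 * q * r^2 / c) powr q / T powr q"
   by (rule powr_divide)
  then show ?thesis by (simp add: N_def)
 qed
 also have "(36 * q * r^2 / c) / T = 36 * q * 1024 * 4 powr (q + 1) / c"
  using r unfolding T powr_minus by (simp add: field_simps)
 finally show ?thesis by (simp add: y_def mult_ac)
qed

text \<open>Duality with the L1 to L2 bound for the indicator of the set where the upper bound
  fails: the integral of P_T h over it is at most b |h| times its measure although the integrand
  exceeds b |h|, so the set is null. The lower bound follows by passing to -h.\<close>

lemma heat_L2_Linf:
 fixes q T :: real
 assumes q: "q = 1 / \<alpha>" and r: "r > 0" and T: "T = 4 powr (- (q + 1)) / 1024 * r^2"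
 shows "AE x in mu0. x \<in> ball x0 r \<longrightarrow> \<bar>rep (H.P T h) x\<bar> \<le> sqrt (32 * (36 * q * 1024 * 4 powr (q + 1) / c) powr q / v x0 (3 * r)) * norm h"
proof -
 define b where "b = sqrt (32 * (36 * q * 1024 * 4 powr (q + 1) / c) powr q / v x0 (3 * r))"
 have v0: "v x0 (3 * r) > 0" using r by (intro v_pos) simp
 have upper: "AE x in mu0. x \<in> ball x0 r \<longrightarrow> rep (H.P T h) x \<le> b * norm h" for h
 proof -
  define u where "u = rep (H.P T h)"
  have u: "u \<in> L2 mu0" by (simp add: u_def rep_L2)
  define A where "A = {x \<in> ball x0 r. b * norm h < u x}"
  have A: "A \<in> sets borel" using L2_measurable[OF u] unfolding A_def by simp
  have "A \<subseteq> ball x0 r" by (auto simp: A_def)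
  then have fin: "emeasure mu0 A < \<infinity>" by (intro emeasure_bounded_finite bounded_subset[OF bounded_ball])
  note gL = L2_indicator[OF A fin]
  have gi: "integrable mu0 (indicator A :: 'a => real)" using A fin by (intro integrable_real_indicator) auto
  have "AE x in mu0. x \<notin> A"
  proof (cases "measure mu0 A = 0")
   case True
   then have "A \<in> null_sets mu0" using A fin by (intro null_setsI) (auto simp: measure_def enn2real_eq_0_iff)
   then show ?thesis by (rule AE_not_in)
  next
   case False
   then have a: "measure mu0 A > 0" by (simp add: less_le)
   have "(norm (H.P T (cls (indicator A))))^2 \<le> 32 * (36 * q * 1024 * 4 powr (q + 1) / c) powr q * (measure mu0 A)^2 / v x0 (3 * r)"
    by (rule heat_L1_L2[OF q r T gL _ _ gi _ a]) (auto simp: A_def A)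
   also have "\<dots> = (b * measure mu0 A)^2" using v0 by (simp add: b_def power_mult_distrib)
   finally have P: "norm (H.P T (cls (indicator A))) \<le> b * measure mu0 A"
    using v0 by (intro power2_le_imp_le[of "norm _"]) (auto simp: b_def)
   have "(LINT x|mu0. u x * indicator A x) = inner (H.P T h) (cls (indicator A))"
    using inner_cls[OF u gL] by (simp add: u_def l2_inner_def)
   also have "\<dots> = inner h (H.P T (cls (indicator A)))" by (rule H.P_sym)
   also have "\<dots> \<le> norm h * norm (H.P T (cls (indicator A)))" by (rule norm_cauchy_schwarz)
   also have "\<dots> \<le> norm h * (b * measure mu0 A)" using P by (intro mult_left_mono) auto
   finally have le: "(LINT x|mu0. u x * indicator A x) \<le> norm h * (b * measure mu0 A)" .
   have int: "integrable mu0 (%x. (u x - b * norm h) * indicator A x)"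
    unfolding left_diff_distrib by (intro Bochner_Integration.integrable_diff[OF L2_integrable_mult[OF u gL] integrable_mult_right[OF gi]])
   have nn: "0 \<le> (u x - b * norm h) * indicator A x" for x by (auto simp: A_def indicator_def)
   have "(LINT x|mu0. (u x - b * norm h) * indicator A x) = (LINT x|mu0. u x * indicator A x) - b * norm h * measure mu0 A"
    unfolding left_diff_distrib using gi A by (subst Bochner_Integration.integral_diff[OF L2_integrable_mult[OF u gL] integrable_mult_right[OF gi]]) simp
   then have "(LINT x|mu0. (u x - b * norm h) * indicator A x) \<le> 0" using le by (simp add: mult_ac)
   moreover have "0 \<le> (LINT x|mu0. (u x - b * norm h) * indicator A x)" by (rule Bochner_Integration.integral_nonneg) (use nn in simp)
   ultimately have "AE x in mu0. (u x - b * norm h) * indicator A x = 0"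
    using integral_nonneg_eq_0_iff_AE[OF int] nn by simp
   then show ?thesis by eventually_elim (auto simp: A_def indicator_def split: if_splits)
  qed
  then show ?thesis by eventually_elim (auto simp: A_def u_def)
 qed
 have "H.P T (- h) = - H.P T h" using linear_neg[OF H.linear_P] .
 then have "AE x in mu0. x \<in> ball x0 r \<longrightarrow> rep (- H.P T h) x \<le> b * norm h" using upper[of "- h"] by simp
 then show ?thesis
  using upper[of h] rep_ops_AE(3)[of "H.P T h"] unfolding b_def[symmetric] by eventually_elim auto
qed

end

end

section \<open>Existence of the kernel\<close>

text \<open>\<open>sgn\<close> normalises and sends 0 to 0, so linearly dependent vectors leave zero
  entries in the sequence; accordingly \<open>orthonormal_total\<close> admits zero vectors.\<close>

fun gram_schmidt :: "(nat => 'h::real_inner) => nat => 'h" where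
 "gram_schmidt g n = sgn (g n - (\<Sum>i<n. inner (g n) (gram_schmidt g i) *\<^sub>R gram_schmidt g i))"

declare gram_schmidt.simps [simp del]

lemma gram_schmidt_norm: "norm (gram_schmidt g n) = 1 \<or> gram_schmidt g n = 0"
 by (subst (1 2) gram_schmidt.simps) (auto simp: norm_sgn)

lemma gram_schmidt_ortho: "i < n ==> inner (gram_schmidt g n) (gram_schmidt g i) = 0"
proof (induction n arbitrary: i rule: less_induct)
 case (less n)
 let ?e = "gram_schmidt g"
 have ortho: "inner (?e j) (?e i) = 0" if "j < n" "j \<noteq> i" for j
  using less.IH[of j i] less.IH[of i j] less.prems that by (cases "i < j") (auto simp: inner_commute)
 have "(\<Sum>j<n. inner (g n) (?e j) * inner (?e j) (?e i)) = (\<Sum>j<n. if j = i then inner (g n) (?e j) * inner (?e j) (?e i) else 0)"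
  by (intro sum.cong) (auto simp: ortho)
 also have "\<dots> = inner (g n) (?e i) * inner (?e i) (?e i)" using less.prems by (simp add: sum.delta)
 also have "\<dots> = inner (g n) (?e i)" using gram_schmidt_norm[of g i] by (auto simp: norm_eq_1)
 finally have "inner (g n - (\<Sum>j<n. inner (g n) (?e j) *\<^sub>R ?e j)) (?e i) = 0"
  by (simp add: inner_diff_left inner_sum_left)
 then show ?case by (subst gram_schmidt.simps) (simp add: sgn_div_norm)
qed

lemma gram_schmidt_total:
 assumes "!!n. inner h (gram_schmidt g n) = 0"
 shows "inner h (g n) = 0"
proof -
 define d where "d = g n - (\<Sum>i<n. inner (g n) (gram_schmidt g i) *\<^sub>R gram_schmidt g i)"
 have "d = norm d *\<^sub>R gram_schmidt g n" unfolding gram_schmidt.simps[of g n] d_def[symmetric] by (cases "d = 0") (simp_all add: sgn_div_norm)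
 then have "inner h d = 0" using assms[of n] by (metis inner_scaleR_right mult_zero_right)
 then show ?thesis by (simp add: d_def inner_diff_right inner_sum_right assms)
qed

locale orthonormal_total =
 fixes e :: "nat => 'h::{real_inner, banach}"
 assumes norm_e: "norm (e n) = 1 \<or> e n = 0" and ortho_e: "i \<noteq> j ==> inner (e i) (e j) = 0"
  and total_e: "(!!n. inner h (e n) = 0) ==> h = 0"
begin

lemma norm_sum_e: "finite I ==> (norm (\<Sum>i\<in>I. a i *\<^sub>R e i))\<^sup>2 \<le> (\<Sum>i\<in>I. (a i)^2)"
proof -
 assume I: "finite I"
 have "(norm (\<Sum>i\<in>I. a i *\<^sub>R e i))^2 = (\<Sum>i\<in>I. (norm (a i *\<^sub>R e i))^2)"
  by (rule norm_sum_Pythagorean[OF I]) (auto simp: pairwise_def orthogonal_def ortho_e)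
 also have "\<dots> \<le> (\<Sum>i\<in>I. (a i)^2)"
 proof (rule sum_mono)
  fix i show "(norm (a i *\<^sub>R e i))^2 \<le> (a i)^2" using norm_e[of i] by auto
 qed
 finally show ?thesis .
qed

lemma summable_e:
 assumes "summable (%i. (a i)^2)"
 shows "summable (%i. a i *\<^sub>R e i)"
 unfolding summable_Cauchy
proof (intro allI impI)
 fix d :: real assume d: "d > 0"
 then have "d^2 > 0" by simp
 then obtain N where N: "!!m n. m \<ge> N ==> norm (\<Sum>i\<in>{m..<n}. (a i)^2) < d^2"
  using assms unfolding summable_Cauchy by blast
 have "norm (\<Sum>i\<in>{m..<n}. a i *\<^sub>R e i) < d" if "m \<ge> N" for m n
 proof -
  have "(norm (\<Sum>i\<in>{m..<n}. a i *\<^sub>R e i))^2 < d^2"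
   using norm_sum_e[of "{m..<n}" a] N[OF that, of n] by simp
  then show ?thesis using d by (meson less_imp_le power2_less_imp_less)
 qed
 then show "\<exists>N. \<forall>m\<ge>N. \<forall>n. norm (\<Sum>i\<in>{m..<n}. a i *\<^sub>R e i) < d" by blast
qed

lemma expansion_e: "(%n. \<Sum>i<n. inner h (e i) *\<^sub>R e i) \<longlonglongrightarrow> h"
proof -
 have sq: "inner (e i) (e i) * inner h (e i) = inner h (e i)" for i using norm_e[of i] by (auto simp: norm_eq_1)
 have "summable (%i. (inner h (e i))^2)"
 proof (rule summableI_nonneg_bounded[where x = "(norm h)^2"])
  fix n
  define S where "S = (\<Sum>i<n. inner h (e i) *\<^sub>R e i)"
  define s where "s = (\<Sum>i<n. (inner h (e i))^2)"
  have "inner h S = s" by (simp add: S_def s_def inner_sum_right power2_eq_square)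
  moreover have "(norm S)^2 \<le> s" unfolding S_def s_def by (rule norm_sum_e) simp
  moreover have "0 \<le> (norm (h - S))^2" by simp
  moreover have "(norm (h - S))^2 = (norm h)^2 - 2 * inner h S + (norm S)^2"
   by (simp add: power2_norm_eq_inner inner_diff inner_commute)
  ultimately show "(\<Sum>i<n. (inner h (e i))^2) \<le> (norm h)^2" by (simp add: s_def)
 qed simp
 from summable_e[OF this] obtain k where k: "(%n. \<Sum>i<n. inner h (e i) *\<^sub>R e i) \<longlonglongrightarrow> k"
  by (auto simp: summable_def sums_def)
 have "inner (h - k) (e j) = 0" for j
 proof -
  have "inner (\<Sum>i<n. inner h (e i) *\<^sub>R e i) (e j) = inner h (e j)" if "n > j" for n
  proof -
   have "inner (\<Sum>i<n. inner h (e i) *\<^sub>R e i) (e j) = (\<Sum>i<n. if i = j then inner h (e i) else 0)"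
    unfolding inner_sum_left
   proof (intro sum.cong refl)
    fix i show "inner (inner h (e i) *\<^sub>R e i) (e j) = (if i = j then inner h (e i) else 0)"
     using ortho_e[of i j] sq[of j] by (cases "i = j") (simp_all add: mult.commute)
   qed
   then show ?thesis using that by (simp add: sum.delta)
  qed
  then have "\<forall>\<^sub>F n in sequentially. inner (\<Sum>i<n. inner h (e i) *\<^sub>R e i) (e j) = inner h (e j)"
   by (intro eventually_sequentiallyI[of "Suc j"]) simp
  then have "(%n. inner (\<Sum>i<n. inner h (e i) *\<^sub>R e i) (e j)) \<longlonglongrightarrow> inner h (e j)" by (rule tendsto_eventually)
  moreover have "(%n. inner (\<Sum>i<n. inner h (e i) *\<^sub>R e i) (e j)) \<longlonglongrightarrow> inner k (e j)" by (intro tendsto_intros k)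
  ultimately show ?thesis using LIMSEQ_unique by (fastforce simp: inner_diff_left)
 qed
 then have "h = k" using total_e[of "h - k"] by simp
 then show ?thesis using k by simp
qed

end

context doubling_heat_space
begin

text \<open>Finite intersections of bounded members of a countable base form a countable
  intersection-stable generator of the Borel sets. If the integrals of h over all of them vanish,
  its positive and negative parts define the same measure.\<close>

lemma countable_total_sets:
 "\<exists>A :: nat => 'a set. (\<forall>n. A n \<in> sets borel \<and> emeasure mu0 (A n) < \<infinity>) \<and>
  (\<forall>h. (\<forall>n. inner h (cls (indicator (A n))) = 0) \<longrightarrow> h = 0)"
proof -
 obtain B :: "'a set set" where B: "countable B" "topological_basis B" using ex_countable_basis by blast
 define B0 where "B0 = {b \<in> B. bounded b}"
 have B0o: "open b" if "b \<in> B0" for b using that B(2) by (simp add: B0_def topological_basis_open)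
 have B0: "topological_basis B0"
 proof (rule topological_basisI[OF B0o])
  fix O' and x :: 'a assume O: "open O'" "x \<in> O'"
  then obtain b where b: "b \<in> B" "x \<in> b" "b \<subseteq> O' \<inter> ball x 1"
   using topological_basisE[OF B(2), of "O' \<inter> ball x 1" x] by auto
  then have "bounded b" by (intro bounded_subset[OF bounded_ball]) auto
  with b show "\<exists>b\<in>B0. x \<in> b \<and> b \<subseteq> O'" by (auto simp: B0_def)
 qed
 have B0c: "countable B0" using B(1) by (simp add: B0_def)
 define G where "G = Inter ` {F. finite F \<and> F \<subseteq> B0 \<and> F \<noteq> {}}"
 have Gc: "countable G" unfolding G_def
  by (intro countable_image countable_subset[OF _ countable_Collect_finite_subset[OF B0c]]) auto
 have cover: "\<Union>B0 = UNIV" using topological_basisE[OF B0, of UNIV] by blast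
 have B0G: "B0 \<subseteq> G" unfolding G_def by (auto intro!: image_eqI[of _ Inter "{_}"])
 have G: "X \<in> sets borel \<and> bounded X" if X: "X \<in> G" for X
 proof -
  obtain F where F: "X = \<Inter>F" "finite F" "F \<subseteq> B0" "F \<noteq> {}" using X by (auto simp: G_def)
  then obtain b where "b \<in> F" by auto
  then have "bounded X" using F bounded_subset[of b X] by (auto simp: B0_def)
  moreover have "open X" unfolding F(1) using F B0o by (intro open_Inter) auto
  ultimately show ?thesis by simp
 qed
 have Gne: "G \<noteq> {}" using B0G cover by auto
 define A where "A = from_nat_into G"
 have AG: "range A = G" unfolding A_def by (rule range_from_nat_into[OF Gne Gc])
 have fin: "emeasure mu0 X < \<infinity>" if "X \<in> G" for X using G[OF that] emeasure_bounded_finite by blast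
 have total: "h = 0" if h: "!!X. X \<in> G ==> inner h (cls (indicator X)) = 0" for h
 proof -
  note [measurable] = L2_measurable[OF rep_L2[of h], simplified]
  \<comment> \<open>\<open>ennreal\<close> cuts negative values to 0, so \<open>N 1\<close> and
    \<open>N (-1)\<close> have the positive and the negative part of h as densities.\<close>
  define N where "N s = density mu0 (%x. ennreal (s * rep h x))" for s :: real
  have Ne: "emeasure (N s) X = (\<integral>\<^sup>+x. ennreal (s * (rep h x * indicator X x)) \<partial>mu0)" if "X \<in> sets borel" for X s
   unfolding N_def using that by (subst emeasure_density) (auto intro!: nn_integral_cong simp: indicator_def)
  have NX: "emeasure (N 1) X = emeasure (N (-1)) X \<and> emeasure (N 1) X \<noteq> \<infinity>" if X: "X \<in> G" for X
  proof -
   have int: "integrable mu0 (%x. rep h x * indicator X x)"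
    using G[OF X] fin[OF X] by (intro L2_integrable_mult rep_L2 L2_indicator) auto
   have f: "emeasure (N s) X \<noteq> \<infinity>" for s
    using real_integrable_def[THEN iffD1, THEN conjunct2, THEN conjunct1, OF integrable_mult_right[OF int, of s]] G[OF X]
    by (subst Ne) auto
   have "inner h (cls (indicator X)) = (LINT x|mu0. rep h x * indicator X x)"
    using inner_cls[OF rep_L2 L2_indicator, of X h] G[OF X] fin[OF X] by (simp add: l2_inner_def)
   then have "enn2real (emeasure (N 1) X) = enn2real (emeasure (N (-1)) X)"
    using h[OF X] real_lebesgue_integral_def[OF int] G[OF X] by (simp add: Ne)
   then show ?thesis using f by (metis ennreal_enn2real infinity_ennreal_def less_top)
  qed
  have "sets (borel :: 'a measure) = sigma_sets UNIV B0"
   by (subst borel_eq_countable_basis[OF B0c B0]) simp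
  then have sG: "sigma_sets UNIV G = sets (borel :: 'a measure)"
   using sigma_sets_mono'[OF B0G, of UNIV] sets.sigma_sets_subset[of G "borel :: 'a measure"] G by auto
  have "N 1 = N (-1)"
  proof (rule measure_eqI_generator_eq_countable[of G UNIV _ _ B0])
   show "Int_stable G"
   proof (rule Int_stableI)
    fix X Y assume "X \<in> G" "Y \<in> G"
    then obtain F F' where "X = \<Inter>F" "finite F" "F \<subseteq> B0" "F \<noteq> {}" "Y = \<Inter>F'" "finite F'" "F' \<subseteq> B0" "F' \<noteq> {}"
     by (auto simp: G_def)
    then show "X \<inter> Y \<in> G" unfolding G_def by (intro image_eqI[of _ _ "F \<union> F'"]) auto
   qed
  qed (use NX B0G cover B0c in \<open>auto simp: N_def sG\<close>)
  then have eq: "emeasure (N 1) X = emeasure (N (-1)) X" for X by simp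
  have "AE x in mu0. s * rep h x \<le> 0" if s: "s = 1 \<or> s = -1" for s
  proof -
   define X where "X = {x. 0 < s * rep h x}"
   have X: "X \<in> sets borel" unfolding X_def by measurable
   have "emeasure (N s) X = emeasure (N (- s)) X" using eq s by auto
   also have "\<dots> = (\<integral>\<^sup>+x. 0 \<partial>(mu0 :: 'a measure))"
    unfolding Ne[OF X] by (intro nn_integral_cong) (auto simp: X_def indicator_def ennreal_neg)
   finally have "(\<integral>\<^sup>+x. ennreal (s * (rep h x * indicator X x)) \<partial>mu0) = 0" by (simp add: Ne[OF X])
   then have "AE x in mu0. ennreal (s * (rep h x * indicator X x)) = 0"
    using X by (subst (asm) nn_integral_0_iff_AE) auto
   then show ?thesis
   proof eventually_elim
    case (elim x)
    then show ?case by (cases "x \<in> X") (auto simp: ennreal_eq_0_iff X_def)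
   qed
  qed
  from this[of 1] this[of "-1"] have "AE x in mu0. rep h x \<le> 0" "AE x in mu0. 0 \<le> rep h x" by simp_all
  then have "AE x in mu0. rep h x = rep 0 x" using rep_ops_AE(5) by eventually_elim simp
  then show ?thesis by (rule rep_eqI)
 qed
 show ?thesis
 proof (intro exI[of _ A] conjI allI impI)
  show "A n \<in> sets borel" "emeasure mu0 (A n) < \<infinity>" for n using G fin AG by blast+
  show "h = 0" if "\<forall>n. inner h (cls (indicator (A n))) = 0" for h
   using that AG by (intro total) (metis rangeE)
 qed
qed

lemma l2_orthonormal_total: "\<exists>e :: nat => 'a l2. orthonormal_total e"
proof -
 obtain A :: "nat => 'a set" where A: "!!h. (\<forall>n. inner h (cls (indicator (A n))) = 0) \<longrightarrow> h = 0"
  using countable_total_sets by blast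
 define e where "e = gram_schmidt (%n. cls (indicator (A n)))"
 have "orthonormal_total e"
 proof
  show "norm (e n) = 1 \<or> e n = 0" for n unfolding e_def by (rule gram_schmidt_norm)
  show "inner (e i) (e j) = 0" if "i \<noteq> j" for i j
   using gram_schmidt_ortho[of i j] gram_schmidt_ortho[of j i] that by (cases "i < j") (auto simp: e_def inner_commute)
  show "h = 0" if "!!n. inner h (e n) = 0" for h
   using that A[of h] gram_schmidt_total[of h "%n. cls (indicator (A n))"] by (simp add: e_def)
 qed
 then show ?thesis by blast
qed

lemma rep_sum_AE: fixes n :: nat shows "AE x in mu0. rep (\<Sum>i<n. a i *\<^sub>R k i) x = (\<Sum>i<n. a i * rep (k i) x)"
proof (induction n)
 case 0
 show ?case using rep_ops_AE(5) by simp
next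
 case (Suc n)
 show ?case
  using Suc rep_ops_AE(1)[of "\<Sum>i<n. a i *\<^sub>R k i" "a n *\<^sub>R k n"] rep_ops_AE(4)[of "a n" "k n"]
  by eventually_elim simp
qed

text \<open>For almost every x the functional h -> (P_t h)(x) is represented by q, the sum of (P_t
  e_i)(x) e_i, of norm at most W x. Then (P_2t f)(x) = <q, P_t f> = <P_t q, f>, and p x is a version
  of P_t q. The series of products makes p jointly measurable, and using the bound in both variables
  gives W x W y.\<close>

lemma heat_kernel_exists:
 assumes W: "!!x. 0 \<le> W x" and bound: "!!h. AE x in mu0. \<bar>rep (H.P t h) x\<bar> \<le> W x * norm h" and t: "t > 0"
 shows "\<exists>p. (%(x, y). p x y) \<in> borel_measurable (mu0 \<Otimes>\<^sub>M (mu0 :: 'a measure)) \<and>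
  (\<forall>f\<in>L2 mu0. AE x in mu0. integrable mu0 (%y. p x y * f y) \<and> PP (2 * t) f x = (LINT y|mu0. p x y * f y)) \<and>
  (AE x in mu0. AE y in mu0. \<bar>p x y\<bar> \<le> W x * W y)"
proof -
 obtain e :: "nat => 'a l2" where "orthonormal_total e" using l2_orthonormal_total by blast
 then interpret orthonormal_total e .
 define E where "E i = rep (H.P t (e i))" for i
 have E [measurable]: "E i \<in> borel_measurable borel" for i
  unfolding E_def using L2_measurable[OF rep_L2[of "H.P t (e i)"]] by simp
 define p where "p x y = (\<Sum>i. E i x * E i y)" for x y
 define P where "P = H.P t"
 have Plin: "P (\<Sum>i<n. a i *\<^sub>R e i) = (\<Sum>i<n. a i *\<^sub>R P (e i))" for a n
  unfolding P_def by (simp add: linear_sum[OF H.linear_P] linear_scale[OF H.linear_P])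
 have approx: "AE y in mu0. (%n. \<Sum>i<n. a i * E i y) \<longlonglongrightarrow> rep (P k) y"
  if "(%n. \<Sum>i<n. a i *\<^sub>R e i) \<longlonglongrightarrow> k" for a k
 proof -
  define s where "s n = (\<Sum>i<n. a i *\<^sub>R e i)" for n
  have "AE y in mu0. \<forall>n. \<bar>rep (H.P t (k - s n)) y\<bar> \<le> W y * norm (k - s n)"
   unfolding AE_all_countable using bound by blast
  moreover have "AE y in mu0. \<forall>n. rep (P k - P (s n)) y = rep (P k) y - rep (P (s n)) y"
   unfolding AE_all_countable using rep_ops_AE(2) by blast
  moreover have "AE y in mu0. \<forall>n. rep (P (s n)) y = (\<Sum>i<n. a i * E i y)"
   unfolding AE_all_countable s_def Plin E_def P_def[symmetric] by (intro allI rep_sum_AE)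
  ultimately show ?thesis
  proof eventually_elim
   case (elim y)
   have "P (k - s n) = P k - P (s n)" for n unfolding P_def by (rule linear_diff[OF H.linear_P])
   then have le: "norm (rep (P k) y - (\<Sum>i<n. a i * E i y)) \<le> W y * norm (k - s n)" for n using elim by (metis P_def real_norm_def)
   have "(%n. W y * norm (k - s n)) \<longlonglongrightarrow> W y * norm (k - k)"
    using that unfolding s_def by (intro tendsto_intros)
   then have "(%n. rep (P k) y - (\<Sum>i<n. a i * E i y)) \<longlonglongrightarrow> 0"
    by (intro Lim_null_comparison[OF always_eventually[OF allI[OF le]]]) simp
   from tendsto_diff[OF tendsto_const[of "rep (P k) y"] this] show ?case by simp
  qed
 qed
 have bessel: "AE x in mu0. \<forall>n. (\<Sum>i<n. (E i x)^2) \<le> (W x)^2"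
 proof -
  \<comment> \<open>The exceptional null set depends on h, so the bound is taken for the countably
    many rational combinations of the basis; rational approximation then admits the coefficients E_i
    x, which depend on the point itself.\<close>
  have "AE x in mu0. \<forall>l::rat list. \<bar>\<Sum>i<length l. of_rat (l ! i) * E i x\<bar> \<le> W x * sqrt (\<Sum>i<length l. (of_rat (l ! i))^2)"
   unfolding AE_all_countable
  proof
   fix l :: "rat list"
   define s where "s = (\<Sum>i<length l. (of_rat (l ! i) :: real) *\<^sub>R e i)"
   have ns: "norm s \<le> sqrt (\<Sum>i<length l. (of_rat (l ! i))^2)"
    unfolding s_def by (intro real_le_rsqrt norm_sum_e) simp
   show "AE x in mu0. \<bar>\<Sum>i<length l. of_rat (l ! i) * E i x\<bar> \<le> W x * sqrt (\<Sum>i<length l. (of_rat (l ! i))^2)"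
    using bound[of s] rep_sum_AE[where n = "length l" and a = "%i. of_rat (l ! i)" and k = "%i. P (e i)"]
   proof eventually_elim
    case (elim x)
    have "H.P t s = (\<Sum>i<length l. of_rat (l ! i) *\<^sub>R P (e i))" unfolding s_def using Plin by (simp add: P_def)
    then have "\<bar>\<Sum>i<length l. of_rat (l ! i) * E i x\<bar> \<le> W x * norm s" using elim by (simp add: E_def P_def)
    also have "\<dots> \<le> W x * sqrt (\<Sum>i<length l. (of_rat (l ! i))^2)" using ns W by (intro mult_left_mono)
    finally show ?case .
   qed
  qed
  then show ?thesis
  proof eventually_elim
   case (elim x)
   show ?case
   proof
    fix n
    have "\<exists>r. \<bar>of_rat r - E i x\<bar> < 1 / real (Suc k)" for i k
    proof -
     obtain r where "E i x < of_rat r" "of_rat r < E i x + 1 / real (Suc k)"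
      using of_rat_dense[of "E i x" "E i x + 1 / real (Suc k)"] by auto
     then show ?thesis by (intro exI[of _ r]) simp
    qed
    then have "\<forall>i k. \<exists>r. \<bar>of_rat r - E i x\<bar> < 1 / real (Suc k)" by blast
    then obtain r where r: "!!i k. \<bar>of_rat (r i k) - E i x\<bar> < 1 / real (Suc k)" by metis
    have lim: "(%k. of_rat (r i k) :: real) \<longlonglongrightarrow> E i x" for i
    proof (rule LIM_zero_cancel, rule Lim_null_comparison)
     show "(%k. 1 / real (Suc k)) \<longlonglongrightarrow> 0" using LIMSEQ_inverse_real_of_nat by (simp add: inverse_eq_divide)
    qed (use r in \<open>auto intro!: always_eventually less_imp_le\<close>)
    define S where "S = (\<Sum>i<n. (E i x)^2)"
    have "\<bar>\<Sum>i<n. E i x * E i x\<bar> \<le> W x * sqrt (\<Sum>i<n. (E i x)^2)"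
    proof (rule LIMSEQ_le)
     show "(%k. \<bar>\<Sum>i<n. of_rat (r i k) * E i x\<bar>) \<longlonglongrightarrow> \<bar>\<Sum>i<n. E i x * E i x\<bar>" by (intro tendsto_intros lim)
     show "(%k. W x * sqrt (\<Sum>i<n. (of_rat (r i k))^2)) \<longlonglongrightarrow> W x * sqrt (\<Sum>i<n. (E i x)^2)" by (intro tendsto_intros lim)
     show "\<exists>N. \<forall>k\<ge>N. \<bar>\<Sum>i<n. of_rat (r i k) * E i x\<bar> \<le> W x * sqrt (\<Sum>i<n. (of_rat (r i k))^2)"
      using elim[rule_format, of "map (%i. r i _) [0..<n]"] by simp
    qed
    moreover have S0: "S \<ge> 0" by (simp add: S_def sum_nonneg)
    ultimately have le: "sqrt S * sqrt S \<le> W x * sqrt S" by (simp add: S_def power2_eq_square)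
    have "sqrt S \<le> W x"
    proof (cases "S = 0")
     case False
     then show ?thesis using S0 by (intro mult_right_le_imp_le[OF le]) simp
    qed (simp add: W)
    then have "(sqrt S)^2 \<le> (W x)^2" using S0 by (intro power_mono) auto
    then show "(\<Sum>i<n. (E i x)^2) \<le> (W x)^2" using S0 by (simp add: S_def)
   qed
  qed
 qed
 have row: "\<exists>q. (%n. \<Sum>i<n. E i x *\<^sub>R e i) \<longlonglongrightarrow> q \<and> norm q \<le> W x \<and> (AE y in mu0. p x y = rep (P q) y)"
  if x: "\<forall>n. (\<Sum>i<n. (E i x)^2) \<le> (W x)^2" for x
 proof -
  have "summable (%i. (E i x)^2)" using x by (intro summableI_nonneg_bounded[where x = "(W x)^2"]) auto
  from summable_e[OF this] obtain q where q: "(%n. \<Sum>i<n. E i x *\<^sub>R e i) \<longlonglongrightarrow> q" by (auto simp: summable_def sums_def)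
  have "norm (\<Sum>i<n. E i x *\<^sub>R e i) \<le> W x" for n
   by (rule power2_le_imp_le[OF order_trans[OF norm_sum_e] W]) (use x in auto)
  then have "norm q \<le> W x" by (intro LIMSEQ_le_const2[OF tendsto_norm[OF q]]) blast
  moreover have "AE y in mu0. p x y = rep (P q) y"
   using approx[OF q] by eventually_elim (simp add: p_def sums_def[symmetric] sums_unique[symmetric])
  ultimately show ?thesis using q by blast
 qed
 show ?thesis
 proof (intro exI[of _ p] conjI ballI)
  show "(%(x, y). p x y) \<in> borel_measurable (mu0 \<Otimes>\<^sub>M (mu0 :: 'a measure))"
   unfolding p_def case_prod_beta by measurable
  show "AE x in mu0. AE y in mu0. \<bar>p x y\<bar> \<le> W x * W y"
   using bessel
  proof eventually_elim
   case (elim x)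
   from row[OF this] obtain q where q: "norm q \<le> W x" "AE y in mu0. p x y = rep (P q) y" by blast
   from q(2) bound[of q] show ?case
   proof eventually_elim
    case (elim y)
    then have "\<bar>p x y\<bar> \<le> W y * norm q" by (simp add: P_def)
    also have "\<dots> \<le> W y * W x" using q(1) W by (intro mult_left_mono)
    finally show ?case by (simp add: mult.commute)
   qed
  qed
 next
  fix f :: "'a => real" assume f: "f \<in> L2 mu0"
  define k where "k = P (cls f)"
  have PPk: "H.P (2 * t) (cls f) = P k" using H.P_add[of t t "cls f"] t by (simp add: k_def P_def)
  show "AE x in mu0. integrable mu0 (%y. p x y * f y) \<and> PP (2 * t) f x = (LINT y|mu0. p x y * f y)"
   using bessel approx[OF expansion_e[of k]]
  proof eventually_elim
   case (elim x)
   from row[OF elim(1)] obtain q where q: "(%n. \<Sum>i<n. E i x *\<^sub>R e i) \<longlonglongrightarrow> q" "AE y in mu0. p x y = rep (P q) y" by blast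
   note [measurable] = L2_measurable[OF f, simplified] L2_measurable[OF rep_L2, simplified]
   have pm: "p x \<in> borel_measurable borel" unfolding p_def by measurable
   have eq: "AE y in mu0. p x y * f y = rep (P q) y * f y" using q(2) by eventually_elim simp
   have int: "integrable mu0 (%y. rep (P q) y * f y)" by (rule L2_integrable_mult[OF rep_L2 f])
   have "integrable mu0 (%y. p x y * f y)"
    by (rule integrable_cong_AE_imp[OF int]) (use pm eq in \<open>auto elim: eventually_mono\<close>)
   moreover have "(LINT y|mu0. p x y * f y) = inner (P q) (cls f)"
    using integral_cong_AE[OF _ _ eq] pm inner_cls[OF rep_L2 f, of "P q"] by (simp add: l2_inner_def)
   moreover have "inner (P q) (cls f) = inner q k" unfolding k_def P_def by (rule H.P_sym)
   moreover have "inner q k = rep (P k) x"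
   proof (rule LIMSEQ_unique)
    show "(%n. inner (\<Sum>i<n. E i x *\<^sub>R e i) k) \<longlonglongrightarrow> inner q k" by (intro tendsto_intros q)
    have "inner (\<Sum>i<n. E i x *\<^sub>R e i) k = (\<Sum>i<n. inner k (e i) * E i x)" for n
     unfolding inner_sum_left by (intro sum.cong) (simp_all add: inner_commute)
    then show "(%n. inner (\<Sum>i<n. E i x *\<^sub>R e i) k) \<longlonglongrightarrow> rep (P k) x" using elim(2) by (simp only:)
   qed
   ultimately show ?case by (simp add: PPk)
  qed
 qed
qed

end

section \<open>The equivalence\<close>

context doubling_heat_space
begin

lemma heat_AE: "t \<ge> 0 ==> f \<in> L2 mu0 ==> AE x in mu0. heat_semigroup mu0 L t f x = PP t f x"
 using rep_cls[OF heat_L2, of t f] heat_cls[of t f] by (auto elim: eventually_mono)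

lemma l2_norm_square: "f \<in> L2 mu0 ==> (l2_norm mu0 f)\<^sup>2 = (LINT x|(mu0 :: 'a measure). (f x)^2)"
 by (simp add: l2_norm_def)

lemma integral_square_0:
 fixes f :: "'a => real"
 shows "f \<in> L2 mu0 ==> (LINT x|mu0. (f x)^2) = 0 \<longleftrightarrow> (AE x in mu0. f x = 0)"
 using integral_nonneg_eq_0_iff_AE[OF L2_integrable_square, of f mu0] by simp

text \<open>The complement of the support is a union of possibly uncountably many open sets; by
  Lindelof's theorem countably many have the same union.\<close>

lemma AE_outside_ess_support:
 fixes f :: "'a => real"
 shows "AE x in mu0. x \<notin> ess_support mu0 f \<longrightarrow> f x = 0"
proof -
 define \<U> where "\<U> = {U. open U \<and> (AE x in mu0. x \<in> U \<longrightarrow> f x = 0)}"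
 obtain \<V> where V: "\<V> \<subseteq> \<U>" "countable \<V>" "\<Union>\<V> = \<Union>\<U>"
  using Lindelof[of \<U>] by (auto simp: \<U>_def)
 have "AE x in mu0. \<forall>U\<in>\<V>. x \<in> U \<longrightarrow> f x = 0"
  using V(1) by (subst AE_ball_countable[OF V(2)]) (auto simp: \<U>_def)
 then show ?thesis
 proof eventually_elim
  case (elim x)
  then show ?case using V(3) by (auto simp: ess_support_def \<U>_def[symmetric])
 qed
qed

context
 fixes v :: "'a => real => real" and \<kappa> b :: real
 assumes v_nonneg: "!!x r. r > 0 ==> 0 \<le> v x r" and \<kappa>: "\<kappa> > 0" and b: "b > 0"
  and RD: "!!r s x y. 0 < s ==> s \<le> r ==> dist x y < r + s ==> b * (r / s) powr \<kappa> \<le> v y r / v x s"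
begin

text \<open>If \<open>v x r = 0\<close> then the quotient in the reverse doubling condition would be \<open>0\<close>.\<close>

lemma v_pos: "r > 0 ==> 0 < v x r"
 using RD[of r r x x] v_nonneg[of r x] b by (cases "v x r = 0") auto

lemma RD_le: "0 < s ==> s \<le> r ==> dist x y < r + s ==> b * (r / s) powr \<kappa> * v x s \<le> v y r"
 using RD[of s r x y] v_pos[of s x] by (simp add: pos_le_divide_eq)

text \<open>Local bounds around a countable dense set of centres hold simultaneously almost
  everywhere. Reverse doubling with radius ratio 3 then replaces the value of \<open>v\<close> at a
  nearby centre by its value at the point.\<close>

lemma FK_imp_DUE:
 assumes FK: "FK mu0 L v"
 shows "DUE mu0 L v"
proof -
 obtain \<alpha> c where \<alpha>: "\<alpha> > 0" and c: "c > 0"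
  and F: "!!x r U. r > 0 ==> rel_compact_open U ==> U \<noteq> {} ==> U \<subseteq> ball x r ==>
   ereal (c / r^2 * (v x r / measure mu0 U) powr \<alpha>) \<le> lambda1 mu0 L U"
  using FK unfolding FK_def by blast
 have fk: "c / r^2 * (v x r / measure mu0 U) powr \<alpha> * (LINT x|mu0. (f x)^2) \<le> EE f f"
  if r: "r > 0" and U: "rel_compact_open U" "U \<noteq> {}" "U \<subseteq> ball x r"
   and f: "f \<in> FD" "compact (ess_support mu0 f)" "ess_support mu0 f \<subseteq> U" for x r U f
 proof (cases "AE x in mu0. f x = 0")
  case True
  then show ?thesis using integral_square_0[OF FD_L2[OF f(1)]] EE_nonneg[OF f(1)] by simp
 next
  case False
  then have pos: "(LINT x|mu0. (f x)^2) > 0"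
   using integral_square_0[OF FD_L2[OF f(1)]] Bochner_Integration.integral_nonneg[of mu0 "%x. (f x)^2"] by (simp add: less_le)
  have "ereal (c / r^2 * (v x r / measure mu0 U) powr \<alpha>) \<le> lambda1 mu0 L U" by (rule F[OF r U])
  also have "\<dots> \<le> ereal (quad_form mu0 L f / (l2_norm mu0 f)^2)"
   unfolding lambda1_def by (rule INF_lower) (use f False in \<open>simp add: form_dom_c_def\<close>)
  finally show ?thesis using pos FD_L2[OF f(1)] by (simp add: quad_form_eq[OF f(1)] l2_norm_square pos_le_divide_eq)
 qed
 define q where "q = 1 / \<alpha>"
 define \<theta> where "\<theta> = 4 powr (- (q + 1)) / 1024"
 define C where "C = 32 * (36 * q * 1024 * 4 powr (q + 1) / c) powr q"
 define \<gamma> where "\<gamma> = b * 3 powr \<kappa>"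
 define W where "W r x = sqrt (C / \<gamma>) * v x r powr (- 1 / 2)" for r x
 have pos: "\<theta> > 0" "C > 0" "\<gamma> > 0" using \<alpha> c b by (simp_all add: \<theta>_def C_def \<gamma>_def q_def)
 have bound: "AE x in mu0. \<bar>rep (H.P (\<theta> * r^2) h) x\<bar> \<le> W r x * norm h" if r: "r > 0" for r h
 proof -
  obtain D :: "'a set" where D: "countable D" "!!X. open X ==> X \<noteq> {} ==> \<exists>d\<in>D. d \<in> X"
   by (rule countable_dense_setE) blast
  have "AE x in mu0. x \<in> ball d r \<longrightarrow> \<bar>rep (H.P (\<theta> * r^2) h) x\<bar> \<le> sqrt (C / v d (3 * r)) * norm h" for d
   unfolding C_def \<theta>_def by (rule heat_L2_Linf[where v = v, OF \<alpha> c v_pos _ q_def r refl]) (assumption, rule fk)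
  then have "AE x in mu0. \<forall>d\<in>D. x \<in> ball d r \<longrightarrow> \<bar>rep (H.P (\<theta> * r^2) h) x\<bar> \<le> sqrt (C / v d (3 * r)) * norm h"
   unfolding AE_ball_countable[OF D(1)] by blast
  then show ?thesis
  proof eventually_elim
   case (elim x)
   obtain d where d: "d \<in> D" "dist x d < r" using D(2)[of "ball x r"] r by auto
   have "\<gamma> * v x r \<le> v d (3 * r)" using RD_le[of r "3 * r" x d] d r by (simp add: \<gamma>_def)
   then have "C / v d (3 * r) \<le> C / (\<gamma> * v x r)" using pos v_pos[OF r, of x] v_pos[of "3 * r" d] r by (intro divide_left_mono) simp_all
   then have "sqrt (C / v d (3 * r)) \<le> sqrt (C / (\<gamma> * v x r))" by simp
   also have "\<dots> = W r x"
    using v_pos[OF r, of x] by (simp add: W_def real_sqrt_divide real_sqrt_mult powr_minus_divide powr_half_sqrt)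
   finally have "sqrt (C / v d (3 * r)) * norm h \<le> W r x * norm h" by (intro mult_right_mono) auto
   moreover have "\<bar>rep (H.P (\<theta> * r^2) h) x\<bar> \<le> sqrt (C / v d (3 * r)) * norm h"
    using elim d by (auto simp: dist_commute)
   ultimately show ?case by linarith
  qed
 qed
 \<comment> \<open>For r = c' sqrt t the time \<theta> r^2 equals t / 2; the kernel at time t is
   composed of two operators at half the time.\<close>
 define c' where "c' = sqrt (1 / (2 * \<theta>))"
 have c': "c' > 0" using pos by (simp add: c'_def)
 define Q where "Q t p \<longleftrightarrow> (%(x, y). p x y) \<in> borel_measurable (mu0 \<Otimes>\<^sub>M (mu0 :: 'a measure)) \<and>
  (\<forall>f\<in>L2 mu0. AE x in mu0. integrable mu0 (%y. p x y * f y) \<and> PP t f x = (LINT y|mu0. p x y * f y)) \<and>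
  (AE x in mu0. AE y in mu0. \<bar>p x y\<bar> \<le> W (c' * sqrt t) x * W (c' * sqrt t) y)" for t p
 have "\<exists>p. t > 0 \<longrightarrow> Q t p" for t
 proof (cases "t > 0")
  case True
  have e: "\<theta> * (c' * sqrt t)^2 = t / 2" "2 * (t / 2) = t" using True pos by (simp_all add: c'_def power_mult_distrib field_simps)
  have r: "c' * sqrt t > 0" using True c' by simp
  have W0: "0 \<le> W (c' * sqrt t) x" for x using pos by (simp add: W_def)
  have "t / 2 > 0" using True by simp
  from heat_kernel_exists[OF W0 bound[OF r, unfolded e(1)] this, unfolded e(2)] show ?thesis by (simp only: Q_def) blast
 qed simp
 then have "\<forall>t. \<exists>p. t > 0 \<longrightarrow> Q t p" ..
 from choice[OF this] obtain p where Q: "!!t. t > 0 ==> Q t (p t)" by blast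
 have
  p: "!!t. t > 0 ==> (%(x, y). p t x y) \<in> borel_measurable (mu0 \<Otimes>\<^sub>M (mu0 :: 'a measure))"
   "!!t f. t > 0 ==> f \<in> L2 mu0 ==> AE x in mu0. integrable mu0 (%y. p t x y * f y) \<and> PP t f x = (LINT y|mu0. p t x y * f y)"
   "!!t. t > 0 ==> AE x in mu0. AE y in mu0. \<bar>p t x y\<bar> \<le> W (c' * sqrt t) x * W (c' * sqrt t) y"
  using Q unfolding Q_def by blast+
 have "heat_kernel mu0 L p"
  unfolding heat_kernel_def
 proof (intro allI impI conjI ballI p(1))
  fix t :: real and f :: "'a => real" assume t: "t > 0" and f: "f \<in> L2 mu0"
  show "AE x in mu0. integrable mu0 (%y. p t x y * f y) \<and> heat_semigroup mu0 L t f x = (LINT y|mu0. p t x y * f y)"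
   using p(2)[OF t f] heat_AE[OF less_imp_le[OF t] f] by eventually_elim simp
 qed
 moreover have "AE x in mu0. AE y in mu0. \<bar>p t x y\<bar> \<le> C / \<gamma> * (v x (c' * sqrt t) * v y (c' * sqrt t)) powr (- 1 / 2)" if t: "t > 0" for t
 proof -
  have "W (c' * sqrt t) x * W (c' * sqrt t) y = C / \<gamma> * (v x (c' * sqrt t) * v y (c' * sqrt t)) powr (- 1 / 2)" for x y
  proof -
   have "W r x * W r y = (sqrt (C / \<gamma>) * sqrt (C / \<gamma>)) * (v x r powr (- 1 / 2) * v y r powr (- 1 / 2))" for r
    unfolding W_def by (simp only: mult_ac)
   then show ?thesis using pos by (simp add: powr_mult)
  qed
  then show ?thesis using p(3)[OF t] by simp
 qed
 moreover have "C / \<gamma> > 0" using pos by simp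
 ultimately show ?thesis unfolding DUE_def using c' by blast
qed

lemma DUE_imp_FK:
 assumes DUE: "DUE mu0 L v" and D: "cond_D mu0 v" and \<epsilon>: "\<epsilon> > 0" "!!x r. r > 0 ==> \<epsilon> * vol mu0 x r \<le> v x r"
 shows "FK mu0 L v"
proof -
 obtain p C c where p: "heat_kernel mu0 L p" and C: "C > 0" and c: "c > 0"
  and pb: "!!t. t > 0 ==> AE x in mu0. AE y in mu0. \<bar>p t x y\<bar> \<le> C * (v x (c * sqrt t) * v y (c * sqrt t)) powr (- 1 / 2)"
  using DUE unfolding DUE_def by blast
 \<comment> \<open>\<open>m\<close> bounds v at scale \<rho> from below on U. At the time with c
   sqrt t = \<rho> the condition 2 C mu(U) <= m makes <P_t f, f> at most half of |f|^2.\<close>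
 have key: "c^2 / (2 * \<rho>^2) * (LINT x|mu0. (f x)^2) \<le> EE f f"
  if f: "f \<in> FD" "AE x in mu0. x \<notin> U \<longrightarrow> f x = 0" and U: "U \<in> sets borel" "emeasure mu0 U < \<infinity>"
   and \<rho>: "\<rho> > 0" and m: "m > 0" "AE y in mu0. y \<in> U \<longrightarrow> m \<le> v y \<rho>" "2 * C * measure mu0 U \<le> m" for f U \<rho> m
 proof -
  define t where "t = (\<rho> / c)^2"
  have t: "t > 0" "c * sqrt t = \<rho>" using \<rho> c by (simp_all add: t_def)
  note fL = FD_L2[OF f(1)] and gL = L2_indicator[OF U]
  define J where "J = (LINT x|mu0. \<bar>f x\<bar>)"
  have fU: "AE x in mu0. \<bar>f x\<bar> * indicator U x = \<bar>f x\<bar>" using f(2) by eventually_elim (auto simp: indicator_def)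
  have fm: "f \<in> borel_measurable borel" by (rule FD_measurable[OF f(1)])
  have fi: "integrable mu0 (%x. \<bar>f x\<bar>)"
   by (rule integrable_cong_AE_imp[OF L2_integrable_mult[OF L2_abs[OF fL] gL]]) (use fm fU in \<open>auto elim: eventually_mono\<close>)
  have J2: "J^2 \<le> measure mu0 U * (LINT x|mu0. (f x)^2)"
  proof -
   have "J = (LINT x|mu0. \<bar>f x\<bar> * indicator U x)" unfolding J_def
    using fU fm U by (intro integral_cong_AE) (auto elim: eventually_mono)
   also have "\<dots> = inner (cls (%x. \<bar>f x\<bar>)) (cls (indicator U))" using inner_cls[OF L2_abs[OF fL] gL] by (simp add: l2_inner_def)
   finally have "J^2 \<le> (norm (cls (%x. \<bar>f x\<bar>)))^2 * (norm (cls (indicator U)))^2"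
    using Cauchy_Schwarz_ineq[of "cls (%x. \<bar>f x\<bar>)" "cls (indicator U)"] by (simp add: power2_norm_eq_inner)
   moreover have "(%x. (indicator U x :: real)^2) = indicator U" by (auto simp: indicator_def)
   then have "(norm (cls (indicator U)))^2 = measure mu0 U" using norm_cls_square[OF gL] U by simp
   moreover have "(norm (cls (%x. \<bar>f x\<bar>)))^2 = (LINT x|mu0. (f x)^2)" using norm_cls_square[OF L2_abs[OF fL]] by simp
   ultimately show ?thesis by (simp add: mult.commute)
  qed
  have hk: "AE x in mu0. integrable mu0 (%y. p t x y * f y) \<and> heat_semigroup mu0 L t f x = (LINT y|mu0. p t x y * f y)"
   using p t(1) fL by (simp add: heat_kernel_def)
  have "AE x in mu0. PP t f x * f x \<le> C / m * J * \<bar>f x\<bar>"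
   using hk heat_AE[OF less_imp_le[OF t(1)] fL] pb[OF t(1)] m(2) f(2)
  proof eventually_elim
   case (elim x)
   show ?case
   proof (cases "x \<in> U")
    case True
    have "\<bar>PP t f x\<bar> \<le> (LINT y|mu0. \<bar>p t x y * f y\<bar>)" using elim(1,2) integral_abs_bound[of mu0 "%y. p t x y * f y"] by simp
    also have "\<dots> \<le> (LINT y|mu0. C / m * \<bar>f y\<bar>)"
    proof (rule integral_mono_AE)
     show "AE y in mu0. \<bar>p t x y * f y\<bar> \<le> C / m * \<bar>f y\<bar>"
      using elim(3) m(2) f(2)
     proof eventually_elim
      case y: (elim y)
      show ?case
      proof (cases "y \<in> U")
       case yU: True
       have "m * m \<le> v x \<rho> * v y \<rho>" using elim(4) True y(2) yU m(1) by (intro mult_mono) auto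
       then have "(v x \<rho> * v y \<rho>) powr (- 1 / 2) \<le> (m * m) powr (- 1 / 2)" using m(1) by (intro powr_mono2') auto
       also have "\<dots> = 1 / m" using m(1) by (simp add: powr_mult powr_add[symmetric] powr_minus_divide)
       finally have "\<bar>p t x y\<bar> \<le> C * (1 / m)" using y(1) C by (simp only: t(2)) (meson less_imp_le mult_left_mono order_trans)
       then show ?thesis unfolding abs_mult by (intro mult_right_mono) auto
      qed (use y(3) in simp)
     qed
    qed (use elim(1) fi in auto)
    also have "\<dots> = C / m * J" by (simp add: J_def)
    finally have "\<bar>PP t f x\<bar> * \<bar>f x\<bar> \<le> C / m * J * \<bar>f x\<bar>" by (rule mult_right_mono) simp
    then show ?thesis using abs_ge_self[of "PP t f x * f x"] by (simp add: abs_mult)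
   qed (use elim(5) in simp)
  qed
  then have "(LINT x|mu0. PP t f x * f x) \<le> (LINT x|mu0. C / m * J * \<bar>f x\<bar>)"
   using fi by (intro integral_mono_AE L2_integrable_mult rep_L2 fL integrable_mult_right)
  also have "\<dots> = C / m * J^2" by (simp add: J_def power2_eq_square)
  also have "\<dots> \<le> C / m * (measure mu0 U * (LINT x|mu0. (f x)^2))" using J2 C m(1) by (intro mult_left_mono) auto
  also have "\<dots> = (C * measure mu0 U / m) * (LINT x|mu0. (f x)^2)" by simp
  also have "\<dots> \<le> 1 / 2 * (LINT x|mu0. (f x)^2)"
   using m(1,3) by (intro mult_right_mono) (auto simp: pos_divide_le_eq)
  finally have half: "inner (H.P t (cls f)) (cls f) \<le> 1 / 2 * (norm (cls f))^2"
   using inner_cls[OF rep_L2 fL, of "H.P t (cls f)"] norm_cls_square[OF fL] by (simp add: l2_inner_def)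
  have "(norm (cls f))^2 / 2 / t \<le> ((norm (cls f))^2 - inner (H.P t (cls f)) (cls f)) / t"
   using half t(1) by (intro divide_right_mono) auto
  also have "\<dots> \<le> EE f f"
   using H.Et_le_E[OF t(1) FD_D[OF f(1)]] f(1) by (simp add: EE_eq H.Et_def inner_diff_left power2_norm_eq_inner)
  finally show ?thesis using \<rho> c norm_cls_square[OF fL] by (simp add: t_def power_divide mult_ac)
 qed
 obtain D0 where D0: "D0 > 0" "!!r. r > 0 ==> AE x in mu0. v x (2 * r) \<le> D0 * v x r" using D by (auto simp: cond_D_def)
 \<comment> \<open>A base of at least 2 makes its logarithm positive and its powers
   unbounded.\<close>
 define D where "D = max 2 D0"
 have D2: "D \<ge> 2" by (simp add: D_def)
 have Dr: "AE x in mu0. v x (2 * r) \<le> D * v x r" if r: "r > 0" for r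
  using D0(2)[OF r]
 proof eventually_elim
  case (elim x)
  have "D0 * v x r \<le> D * v x r" using v_pos[OF r, of x] by (intro mult_right_mono) (auto simp: D_def)
  with elim show ?case by linarith
 qed
 have Dk: "AE x in mu0. v x r \<le> D ^ k * v x (r / 2 ^ k)" if r: "r > 0" for r k
 proof (induction k)
  case (Suc k)
  have "AE x in mu0. v x (r / 2 ^ k) \<le> D * v x (r / 2 ^ Suc k)" using Dr[of "r / 2 ^ Suc k"] r by simp
  with Suc show ?case
  proof eventually_elim
   case (elim x)
   have "D ^ k * v x (r / 2 ^ k) \<le> D ^ k * (D * v x (r / 2 ^ Suc k))" using elim(2) D2 by (intro mult_left_mono) auto
   then show ?case using elim(1) by (simp add: mult_ac)
  qed
 qed simp
 \<comment> \<open>D^\<alpha> = 4: each halving of the radius may divide v by D, and it multiplies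
   the lower bound 1 / \<rho>^2 by 4.\<close>
 define \<alpha> where "\<alpha> = log D 4"
 have \<alpha>: "\<alpha> > 0" "(D ^ n) powr \<alpha> = 4 ^ n" for n
 proof -
  show "\<alpha> > 0" using D2 by (simp add: \<alpha>_def)
  have "(D ^ n) powr \<alpha> = (D powr \<alpha>) ^ n" using D2 by (simp add: powr_realpow[symmetric] powr_powr mult.commute)
  then show "(D ^ n) powr \<alpha> = 4 ^ n" using D2 by (simp add: \<alpha>_def)
 qed
 \<comment> \<open>For sets U too large for the radius r itself: since \<epsilon> mu(U) <= v x r,
   reverse doubling lifts v to the required size at radius \<Lambda> r.\<close>
 obtain \<Lambda> where \<Lambda>: "\<Lambda> \<ge> 1" "2 * C / \<epsilon> \<le> b * \<Lambda> powr \<kappa>"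
 proof
  define B where "B = 2 * C / (\<epsilon> * b)"
  have "B \<le> max 1 (B powr (1 / \<kappa>)) powr \<kappa>"
  proof -
   have "B = (B powr (1 / \<kappa>)) powr \<kappa>" using C \<epsilon>(1) b \<kappa> by (simp add: B_def powr_powr)
   also have "\<dots> \<le> max 1 (B powr (1 / \<kappa>)) powr \<kappa>" using \<kappa> by (intro powr_mono2) auto
   finally show ?thesis .
  qed
  then show "2 * C / \<epsilon> \<le> b * max 1 (B powr (1 / \<kappa>)) powr \<kappa>"
   using b \<epsilon>(1) by (simp add: B_def field_simps)
 qed simp
 \<comment> \<open>The entries of the minimum serve the two cases below: 1/8 for \<rho> = r / 2^k,
   where 4^(k+1) / 8 = 4^k / 2, and 1 / (2 \<Lambda>^2) for \<rho> = \<Lambda> r.\<close>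
 define c1 where "c1 = c^2 * (b / (2 * C)) powr \<alpha> * min (1 / 8) (1 / (2 * \<Lambda>^2))"
 have c1: "c1 > 0" "c1 \<le> c^2 * (b / (2 * C)) powr \<alpha> / 8" "c1 \<le> c^2 * (b / (2 * C)) powr \<alpha> / (2 * \<Lambda>^2)"
 proof -
  have K: "c^2 * (b / (2 * C)) powr \<alpha> > 0" using c b C by simp
  then show "c1 > 0" unfolding c1_def using \<Lambda>(1) by (intro mult_pos_pos) auto
  have "c1 \<le> c^2 * (b / (2 * C)) powr \<alpha> * (1 / 8)" "c1 \<le> c^2 * (b / (2 * C)) powr \<alpha> * (1 / (2 * \<Lambda>^2))"
   unfolding c1_def using K by (intro mult_left_mono; simp)+
  then show "c1 \<le> c^2 * (b / (2 * C)) powr \<alpha> / 8" "c1 \<le> c^2 * (b / (2 * C)) powr \<alpha> / (2 * \<Lambda>^2)" by simp_all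
 qed
 have main: "c1 / r^2 * (v x r / measure mu0 U) powr \<alpha> * (LINT x|mu0. (f x)^2) \<le> EE f f"
  if r: "r > 0" and U: "open U" "U \<noteq> {}" "U \<subseteq> ball x r" and f: "f \<in> FD" "AE x in mu0. x \<notin> U \<longrightarrow> f x = 0" for x r U f
 proof -
  have fin: "emeasure mu0 U < \<infinity>" by (rule emeasure_bounded_finite[OF bounded_subset[OF bounded_ball U(3)]])
  define M where "M = measure mu0 U"
  have "0 < emeasure mu0 U" using H U by (auto simp: hypothesis_H_def)
  then have M0: "M > 0" using fin by (simp add: M_def measure_def enn2real_positive_iff)
  have "M \<le> vol mu0 x r"
   unfolding M_def vol_def using emeasure_bounded_finite[of "ball x r"] U
   by (intro measure_mono_fmeasurable) (auto simp: fmeasurable_def)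
  then have "\<epsilon> * M \<le> v x r" using \<epsilon>(2)[OF r, of x] \<epsilon>(1) by (meson less_imp_le mult_left_mono order_trans)
  then have M: "M \<le> v x r / \<epsilon>" using \<epsilon>(1) by (simp add: field_simps)
  note v0 = v_pos[OF r, of x]
  have I0: "0 \<le> (LINT x|mu0. (f x)^2)" by (rule integral_nonneg_AE) simp
  have red: "c1 / r^2 * (v x r / M) powr \<alpha> * (LINT x|mu0. (f x)^2) \<le> EE f f"
   if le: "c1 / r^2 * (v x r / M) powr \<alpha> \<le> c^2 / (2 * \<rho>^2)" and k: "c^2 / (2 * \<rho>^2) * (LINT x|mu0. (f x)^2) \<le> EE f f" for \<rho>
   using mult_right_mono[OF le I0] k by linarith
  \<comment> \<open>X >= 1 says that radius r already meets the condition of \<open>key\<close>;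
    then D^k <= X < D^(k+1) determines how often it may be halved. For X < 1 the radius is enlarged
    instead.\<close>
  define X where "X = b * v x r / (2 * C * M)"
  have X0: "X > 0" using b v0 C M0 by (simp add: X_def)
  have XM: "(v x r / M) powr \<alpha> * (b / (2 * C)) powr \<alpha> = X powr \<alpha>"
   using v0 M0 b C by (simp add: X_def powr_mult[symmetric] field_simps)
  have le: "c1 / r^2 * (v x r / M) powr \<alpha> \<le> c^2 / a * X powr \<alpha> / r^2"
   if "c1 \<le> c^2 * (b / (2 * C)) powr \<alpha> / a" for a
  proof -
   have "c1 / r^2 * (v x r / M) powr \<alpha> \<le> c^2 * (b / (2 * C)) powr \<alpha> / a / r^2 * (v x r / M) powr \<alpha>"
    using that by (intro mult_right_mono divide_right_mono) auto
   then show ?thesis by (simp add: XM[symmetric] mult_ac)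
  qed
  show ?thesis
   unfolding M_def[symmetric]
  proof (cases "X < 1")
   case True
   have "X powr \<alpha> \<le> 1" using True X0 \<alpha>(1) powr_mono2[of \<alpha> X 1] by simp
   then have "c^2 / (2 * \<Lambda>^2) * X powr \<alpha> / r^2 \<le> c^2 / (2 * \<Lambda>^2) * 1 / r^2" by (intro divide_right_mono mult_left_mono) auto
   with le[OF c1(3)] have "c1 / r^2 * (v x r / M) powr \<alpha> \<le> c^2 / (2 * (\<Lambda> * r)^2)" by (simp add: power_mult_distrib)
   then show "c1 / r^2 * (v x r / M) powr \<alpha> * (LINT x|mu0. (f x)^2) \<le> EE f f"
   proof (rule red)
    show "c^2 / (2 * (\<Lambda> * r)^2) * (LINT x|mu0. (f x)^2) \<le> EE f f"
    proof (rule key[OF f _ fin])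
     show "AE y in mu0. y \<in> U \<longrightarrow> b * \<Lambda> powr \<kappa> * v x r \<le> v y (\<Lambda> * r)"
     proof (intro AE_I2 impI)
      fix y assume "y \<in> U"
      then have "dist x y < r" using U(3) by auto
      moreover have le: "r \<le> \<Lambda> * r" using r \<Lambda>(1) by simp
      ultimately have "dist x y < \<Lambda> * r + r" using r by linarith
      then show "b * \<Lambda> powr \<kappa> * v x r \<le> v y (\<Lambda> * r)"
       using RD_le[OF r le, of x y] r by simp
     qed
     have "2 * C * M \<le> 2 * C * (v x r / \<epsilon>)" using M C by (intro mult_left_mono) auto
     also have "\<dots> = 2 * C / \<epsilon> * v x r" by simp
     also have "\<dots> \<le> b * \<Lambda> powr \<kappa> * v x r" using \<Lambda>(2) v0 by (intro mult_right_mono) auto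
     finally show "2 * C * measure mu0 U \<le> b * \<Lambda> powr \<kappa> * v x r" by (simp add: M_def)
    qed (use U \<Lambda>(1) r v0 b in auto)
   qed
  next
   case False
   define k where "k = (LEAST n. X < D ^ Suc n)"
   have "\<exists>n. X < D ^ Suc n"
   proof -
    obtain n where "X < D ^ n" using real_arch_pow[of D X] D2 by auto
    then show ?thesis using D2 by (intro exI[of _ n]) (auto intro: less_le_trans power_increasing)
   qed
   then have k1: "X < D ^ Suc k" unfolding k_def by (rule LeastI_ex)
   have k2: "D ^ k \<le> X"
   proof (cases k)
    case (Suc j)
    then have "j < (LEAST n. X < D ^ Suc n)" unfolding k_def by simp
    then show ?thesis using not_less_Least[of j "%n. X < D ^ Suc n"] Suc by (simp only: not_less)
   qed (use False in simp)
   have "X powr \<alpha> \<le> 4 ^ Suc k" using powr_mono2[of \<alpha> X "D ^ Suc k"] k1 X0 \<alpha>(1) unfolding \<alpha>(2) by simp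
   then have "c^2 / 8 * X powr \<alpha> / r^2 \<le> c^2 / 8 * 4 ^ Suc k / r^2" by (intro divide_right_mono mult_left_mono) auto
   also have "\<dots> = c^2 / (2 * (r / 2 ^ k)^2)"
    by (simp add: power_divide power_mult[symmetric] mult.commute[of k] power_mult)
   finally have "c1 / r^2 * (v x r / M) powr \<alpha> \<le> c^2 / (2 * (r / 2 ^ k)^2)" using le[OF c1(2)] by simp
   then show "c1 / r^2 * (v x r / M) powr \<alpha> * (LINT x|mu0. (f x)^2) \<le> EE f f"
   proof (rule red)
    show "c^2 / (2 * (r / 2 ^ k)^2) * (LINT x|mu0. (f x)^2) \<le> EE f f"
    proof (rule key[OF f _ fin])
     show "AE y in mu0. y \<in> U \<longrightarrow> b * v x r / D ^ k \<le> v y (r / 2 ^ k)"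
      using Dk[OF r, of k]
     proof eventually_elim
      case (elim y)
      show ?case
      proof
       assume "y \<in> U"
       then have "b * v x r \<le> v y r" using RD_le[of r r x y] U(3) r by auto
       with elim show "b * v x r / D ^ k \<le> v y (r / 2 ^ k)" using D2 by (simp add: pos_divide_le_eq mult.commute)
      qed
     qed
     have "D ^ k * (2 * C * M) \<le> X * (2 * C * M)" using k2 C M0 by (intro mult_right_mono) auto
     also have "\<dots> = b * v x r" using C M0 by (simp add: X_def)
     finally show "2 * C * measure mu0 U \<le> b * v x r / D ^ k"
      using D2 by (simp add: M_def pos_le_divide_eq mult.commute)
    qed (use U r v0 b D2 in auto)
   qed
  qed
 qed
 show ?thesis
  unfolding FK_def
 proof (rule exI[of _ \<alpha>], intro exI[of _ c1] conjI allI impI \<alpha>(1) c1(1))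
  fix x :: 'a and r U assume r: "r > 0" and U: "rel_compact_open U \<and> U \<noteq> {} \<and> U \<subseteq> ball x r"
  show "ereal (c1 / r^2 * (v x r / measure mu0 U) powr \<alpha>) \<le> lambda1 mu0 L U"
   unfolding lambda1_def
  proof (rule INF_greatest)
   fix f assume "f \<in> {f \<in> form_dom_c mu0 L U. \<not> (AE x in mu0. f x = 0)}"
   then have f: "f \<in> FD" "ess_support mu0 f \<subseteq> U" "\<not> (AE x in mu0. f x = 0)" by (auto simp: form_dom_c_def)
   have pos: "(LINT x|mu0. (f x)^2) > 0"
    using f(3) integral_square_0[OF FD_L2[OF f(1)]] Bochner_Integration.integral_nonneg[of mu0 "%x. (f x)^2"] by (simp add: less_le)
   have "AE x in mu0. x \<notin> U \<longrightarrow> f x = 0" using AE_outside_ess_support[of f] by eventually_elim (use f(2) in auto)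
   from main[OF r _ _ _ f(1) this] U pos
   show "ereal (c1 / r^2 * (v x r / measure mu0 U) powr \<alpha>) \<le> ereal (quad_form mu0 L f / (l2_norm mu0 f)^2)"
    by (simp add: rel_compact_open_def quad_form_eq[OF f(1)] l2_norm_square[OF FD_L2[OF f(1)]] pos_le_divide_eq)
  qed
 qed
qed

end

end

theorem theorem3p4p2:
  fixes \<mu> :: "'a::polish_space measure"
    and L :: "('a \<Rightarrow> real) rel"
    and v :: "'a \<Rightarrow> real \<Rightarrow> real"
  assumes "hypothesis_H \<mu> L"
    and "\<forall>x. \<forall>r>0. 0 < emeasure \<mu> (ball x r) \<and> emeasure \<mu> (ball x r) < \<infinity>"
    and "volume_doubling \<mu>"
    and "\<forall>x. \<forall>r>0. 0 \<le> v x r"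
    and "cond_A \<mu> v"
    and "cond_D \<mu> v"
    and "cond_RD v"
    and "\<exists>\<epsilon>>0. \<forall>x. \<forall>r>0. \<epsilon> * vol \<mu> x r \<le> v x r"
  shows "DUE \<mu> L v \<longleftrightarrow> FK \<mu> L v"
proof (rule ccontr)
 assume "\<not> ?thesis"
 with assms have "\<exists>L v. standing_hypotheses \<mu> L v \<and> \<not> (DUE \<mu> L v \<longleftrightarrow> FK \<mu> L v)"
  unfolding standing_hypotheses_def by blast
 \<comment> \<open>By choice, if any measure on this type admits a counterexample then
   \<open>mu0\<close> does, possibly with another operator and another v.\<close>
 then have "\<exists>L v. standing_hypotheses (mu0 :: 'a measure) L v \<and> \<not> (DUE mu0 L v \<longleftrightarrow> FK mu0 L v)"
  unfolding mu0_def by (rule someI[of "%\<mu>. \<exists>L v. standing_hypotheses \<mu> L v \<and> \<not> (DUE \<mu> L v \<longleftrightarrow> FK \<mu> L v)"])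
 then obtain L' v' where st: "standing_hypotheses (mu0 :: 'a measure) L' v'" and neq: "\<not> (DUE mu0 L' v' \<longleftrightarrow> FK mu0 L' v')"
  by (elim exE conjE) (rule that)
 from st have H: "hypothesis_H mu0 L'" and ball: "\<forall>x. \<forall>r>0. 0 < emeasure mu0 (ball (x::'a) r) \<and> emeasure mu0 (ball x r) < \<infinity>"
  and dbl: "volume_doubling (mu0 :: 'a measure)" and D: "cond_D mu0 v'" and RD: "cond_RD v'"
  and v': "\<forall>x. \<forall>r>0. 0 \<le> v' x r" and \<epsilon>: "\<exists>\<epsilon>>0. \<forall>x. \<forall>r>0. \<epsilon> * vol mu0 x r \<le> v' x r"
  unfolding standing_hypotheses_def by - (elim conjE, assumption)+
 interpret doubling_heat_space L'
  by (intro doubling_heat_space.intro heat_space.intro doubling_heat_space_axioms.intro H dbl ball[rule_format])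
 obtain \<kappa> b where \<kappa>: "\<kappa> > 0" "b > 0" "!!r s x y. 0 < s ==> s \<le> r ==> dist x y < r + s ==> b * (r / s) powr \<kappa> \<le> v' y r / v' x s"
  using RD unfolding cond_RD_def by metis
 obtain \<epsilon> where \<epsilon>: "\<epsilon> > 0" "!!x r. r > 0 ==> \<epsilon> * vol mu0 x r \<le> v' x r" using \<epsilon> by metis
 have "FK mu0 L' v' ==> DUE mu0 L' v'" by (rule FK_imp_DUE[OF v'[rule_format] \<kappa>])
 moreover have "DUE mu0 L' v' ==> FK mu0 L' v'" by (rule DUE_imp_FK[OF v'[rule_format] \<kappa> _ D \<epsilon>])
 ultimately show False using neq by argo
qed

end
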